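(* Let $\alpha\in(\tfrac12,\infty)$ and $\sigma\in[0,1]$, and let $u:\mathbf{R}^2\to\mathbf{R}$ be an entire convex solution of $L_\sigma(u)=1$. For $h>0$ let $u_h(x)=h^{-1}u(h^{\frac{1}{1+\alpha}}x)$. Then $u_h$ converges locally uniformly on $\mathbf{R}^2$ to $\frac{1}{1+\alpha}|x|^{1+\alpha}$ as $h\to\infty$.
   Context: For $\alpha\in(\frac12,\infty)$, $\sigma\in[0,1]$ and a function $u$ on a domain in $\mathbf{R}^2$, $$L_\sigma(u)=\left(\sqrt{\sigma+|Du|^2}\right)^{\frac1\alpha}\operatorname{div}\left(\frac{Du}{\sqrt{\sigma+|Du|^2}}\right)=(\sigma+|Du|^2)^{\frac{1}{2\alpha}-\frac12}\sum_{i,j=1}^{2}\left(\delta_{ij}-\frac{u_iu_j}{\sigma+|Du|^2}\right)u_{ij}.$$ "Entire" means defined on all of $\mathbf{R}^2$. When $\sigma=0$ the equation is singular or degenerate where $Du=0$, and solutions are understood in the viscosity sense. *)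

theory Defs
  imports "HOL-Analysis.Analysis"
begin

definition partial :: "2 \<Rightarrow> (real^2 \<Rightarrow> real) \<Rightarrow> real^2 \<Rightarrow> real" where
  "partial i u x = frechet_derivative u (at x) (axis i 1)"

definition grad :: "(real^2 \<Rightarrow> real) \<Rightarrow> real^2 \<Rightarrow> real^2" where
  "grad u x = (\<chi> i. partial i u x)"

definition divergence :: "(real^2 \<Rightarrow> real^2) \<Rightarrow> real^2 \<Rightarrow> real" where
  "divergence V x = (\<Sum>i\<in>UNIV. partial i (\<lambda>y. V y $ i) x)"

definition C2 :: "(real^2 \<Rightarrow> real) \<Rightarrow> bool" where
  "C2 u \<longleftrightarrow>
     (\<forall>x. u differentiable (at x)) \<and>
     (\<forall>i x. partial i u differentiable (at x)) \<and>
     (\<forall>i j. continuous_on UNIV (partial j (partial i u)))"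

definition L :: "real \<Rightarrow> real \<Rightarrow> (real^2 \<Rightarrow> real) \<Rightarrow> real^2 \<Rightarrow> real" where
  "L \<alpha> \<sigma> u x =
     sqrt (\<sigma> + (norm (grad u x))\<^sup>2) powr (1 / \<alpha>) *
     divergence (\<lambda>y. (1 / sqrt (\<sigma> + (norm (grad u y))\<^sup>2)) *\<^sub>R grad u y) x"

lemma L_expanded:
  assumes "C2 u" and "\<sigma> \<ge> 0" and "\<sigma> \<noteq> 0 \<or> grad u x \<noteq> 0"
  shows "L \<alpha> \<sigma> u x =
     (\<sigma> + (norm (grad u x))\<^sup>2) powr (1 / (2 * \<alpha>) - 1 / 2) *
     (\<Sum>i\<in>UNIV. \<Sum>j\<in>UNIV.
        ((if i = j then 1 else 0) -
          partial i u x * partial j u x / (\<sigma> + (norm (grad u x))\<^sup>2)) *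
        partial j (partial i u) x)"
proof -
  define S where "S = (\<lambda>y. \<sigma> + (norm (grad u y))\<^sup>2)"
  have Seq: "S y = \<sigma> + (\<Sum>k\<in>UNIV. (partial k u y)\<^sup>2)" for y
    by (simp add: S_def grad_def norm_vec_def L2_set_def sum_nonneg)
  have pos: "S x > 0"
    using assms(2,3) unfolding S_def
    by (smt (verit) zero_less_norm_iff zero_less_power zero_le_power2)
  define D where "D = (\<lambda>k. frechet_derivative (partial k u) (at x))"
  have D: "(partial k u has_derivative D k) (at x)" for k
    using assms(1) frechet_derivative_works unfolding C2_def D_def by blast
  have dS: "(S has_derivative (\<lambda>h. \<Sum>k\<in>UNIV. 2 * partial k u x * D k h)) (at x)"
    unfolding Seq[abs_def]
    by (auto intro!: derivative_eq_intros D simp: mult_ac sum_distrib_left fun_eq_iff)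
  have dq: "((\<lambda>y. sqrt (S y)) has_derivative
      (\<lambda>h. (\<Sum>k\<in>UNIV. 2 * partial k u x * D k h) * (inverse (sqrt (S x)) / 2))) (at x)"
    using has_derivative_real_sqrt[OF pos dS]
    by (simp add: mult.commute field_simps)
  have dV: "((\<lambda>y. partial i u y / sqrt (S y)) has_derivative
      (\<lambda>h. (D i h - partial i u x * (\<Sum>k\<in>UNIV. partial k u x * D k h) / S x) / sqrt (S x))) (at x)"
    for i
  proof -
    have s: "sqrt (S x) \<noteq> 0" "sqrt (S x) * sqrt (S x) = S x" using pos by auto
    define r where "r = sqrt (S x)"
    have r: "r \<noteq> 0" "S x = r * r" using s r_def by auto
    show ?thesis
      apply (rule has_derivative_eq_rhs[OF has_derivative_divide'[OF D dq s(1)]])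
      apply (rule ext)
      apply (unfold r_def[symmetric])
      using r apply (simp add: field_simps)
      apply (simp add: sum_distrib_left mult_ac)
      done
  qed
  have pd: "partial i (\<lambda>y. partial i u y / sqrt (S y)) x =
      (\<Sum>j\<in>UNIV. ((if i = j then 1 else 0) - partial i u x * partial j u x / S x) *
        D j (axis i 1)) / sqrt (S x)" for i
    unfolding partial_def[of i "\<lambda>y. partial i u y / sqrt (S y)"]
      frechet_derivative_at[OF dV, symmetric]
    using exhaust_2[of i] pos by (auto simp: sum_2 field_simps)
  have pw: "sqrt (S x) powr (1 / \<alpha>) / sqrt (S x) = S x powr (1 / (2 * \<alpha>) - 1 / 2)"
    using pos by (simp add: powr_half_sqrt[symmetric] powr_powr powr_diff)
  have "L \<alpha> \<sigma> u x = sqrt (S x) powr (1 / \<alpha>) *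
      (\<Sum>i\<in>UNIV. partial i (\<lambda>y. partial i u y / sqrt (S y)) x)"
    unfolding L_def divergence_def S_def by (simp add: grad_def)
  also have "\<dots> = S x powr (1 / (2 * \<alpha>) - 1 / 2) *
      (\<Sum>i\<in>UNIV. \<Sum>j\<in>UNIV. ((if i = j then 1 else 0) - partial i u x * partial j u x / S x) *
        D j (axis i 1))"
    unfolding pd pw[symmetric] by (simp add: sum_divide_distrib[symmetric])
  also have "(\<Sum>i\<in>UNIV. \<Sum>j\<in>UNIV. ((if i = j then 1 else 0) - partial i u x * partial j u x / S x) *
        D j (axis i 1)) =
     (\<Sum>i\<in>UNIV. \<Sum>j\<in>UNIV. ((if i = j then 1 else 0) - partial i u x * partial j u x / S x) *
        partial j (partial i u) x)"
    by (simp add: sum_2 D_def partial_def mult.commute)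
  finally show ?thesis by (simp add: S_def)
qed

definition classical_solution :: "real \<Rightarrow> real \<Rightarrow> (real^2 \<Rightarrow> real) \<Rightarrow> bool" where
  "classical_solution \<alpha> \<sigma> u \<longleftrightarrow> C2 u \<and> (\<forall>x. L \<alpha> \<sigma> u x = 1)"

text \<open>
  Viscosity solutions of the singular equation L_0(u) = 1 are taken in the sense of
  Ishii and Souganidis (generalized motion of hypersurfaces whose velocity grows arbitrarily in
  the curvature), written for the stationary equation; the set {u = -t} is the moving front.
  A test function with a critical point at the contact point must be so flat there that the
  operator tends to 0, and the operator is given the value 0 at such a point.  The definition
  with semicontinuous envelopes of the operator at Du = 0 cannot be used
  for \<open>\<alpha> > 1\<close>: there the envelopes
  are infinite and every constant would be a solution.
\<close>

definition flat_profile :: "real \<Rightarrow> (real \<Rightarrow> real) \<Rightarrow> bool" where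
  "flat_profile \<alpha> f \<longleftrightarrow>
     (\<exists>f' f''.
        (\<forall>r\<ge>0. (f has_real_derivative f' r) (at r within {0..})) \<and>
        (\<forall>r\<ge>0. (f' has_real_derivative f'' r) (at r within {0..})) \<and>
        continuous_on {0..} f'' \<and>
        f 0 = 0 \<and> f' 0 = 0 \<and> f'' 0 = 0 \<and> (\<forall>r>0. f'' r > 0)) \<and>
     ((\<lambda>x. L \<alpha> 0 (\<lambda>y. f (norm y)) x) \<longlongrightarrow> 0) (at 0)"

definition admissible :: "real \<Rightarrow> (real^2 \<Rightarrow> real) \<Rightarrow> real^2 \<Rightarrow> bool" where
  "admissible \<alpha> \<phi> x0 \<longleftrightarrow>
     C2 \<phi> \<and>
     (grad \<phi> x0 = 0 \<longrightarrow>
        (\<exists>f. flat_profile \<alpha> f \<and>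
             (\<forall>\<^sub>F x in nhds x0. \<bar>\<phi> x - \<phi> x0\<bar> \<le> f (norm (x - x0)))))"

definition L0_test :: "real \<Rightarrow> (real^2 \<Rightarrow> real) \<Rightarrow> real^2 \<Rightarrow> real" where
  "L0_test \<alpha> \<phi> x0 = (if grad \<phi> x0 = 0 then 0 else L \<alpha> 0 \<phi> x0)"

definition viscosity_subsolution :: "real \<Rightarrow> (real^2 \<Rightarrow> real) \<Rightarrow> bool" where
  "viscosity_subsolution \<alpha> u \<longleftrightarrow>
     (\<forall>\<phi> x0. admissible \<alpha> \<phi> x0 \<and>
        (\<forall>\<^sub>F x in nhds x0. u x - \<phi> x \<le> u x0 - \<phi> x0) \<longrightarrow>
        L0_test \<alpha> \<phi> x0 \<ge> 1)"

definition viscosity_supersolution :: "real \<Rightarrow> (real^2 \<Rightarrow> real) \<Rightarrow> bool" where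
  "viscosity_supersolution \<alpha> u \<longleftrightarrow>
     (\<forall>\<phi> x0. admissible \<alpha> \<phi> x0 \<and>
        (\<forall>\<^sub>F x in nhds x0. u x - \<phi> x \<ge> u x0 - \<phi> x0) \<longrightarrow>
        L0_test \<alpha> \<phi> x0 \<le> 1)"

definition viscosity_solution :: "real \<Rightarrow> (real^2 \<Rightarrow> real) \<Rightarrow> bool" where
  "viscosity_solution \<alpha> u \<longleftrightarrow>
     continuous_on UNIV u \<and> viscosity_subsolution \<alpha> u \<and> viscosity_supersolution \<alpha> u"

definition entire_solution :: "real \<Rightarrow> real \<Rightarrow> (real^2 \<Rightarrow> real) \<Rightarrow> bool" where
  "entire_solution \<alpha> \<sigma> u \<longleftrightarrow>
     (if \<sigma> = 0 then viscosity_solution \<alpha> u else classical_solution \<alpha> \<sigma> u)"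

definition blow_down :: "real \<Rightarrow> (real^2 \<Rightarrow> real) \<Rightarrow> real \<Rightarrow> real^2 \<Rightarrow> real" where
  "blow_down \<alpha> u h x = u (h powr (1 / (1 + \<alpha>)) *\<^sub>R x) / h"

end

theory Submission
  imports Defs "HOL-Complex_Analysis.Great_Picard" "HOL-Real_Asymp.Real_Asymp" "HOL-Library.Diagonal_Subsequence"
begin

text \<open>
  Reading \<open>h\<close> as time, the level lines \<open>{u = h}\<close> expand with a speed \<open>v\<close> that is tied to the radius of curvature \<open>\<rho>\<close> by
  \<open>\<rho> = v powr (- 1 / \<alpha>)\<close>, up to terms in \<open>\<sigma>\<close> that disappear in the blow-down. Comparison with touching circles expresses
  this in terms of the support function \<open>s(\<theta>, h)\<close> of \<open>{u <= h}\<close> and passes to limits. A sublevel set with a very long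
  chord would have a nearly flat, almost immobile boundary and could never exhaust the plane, because \<open>\<alpha> > 1 / 2\<close>; hence
  diameters grow like \<open>h powr (1 / (1 + \<alpha>))\<close> and the blow-downs are precompact. Limits are fronts for all \<open>h > 0\<close>
  with \<open>\<sigma> = 0\<close>; a reflection argument keeps the origin away from their boundary, which makes them regular.
  On the compact class of these fronts the energy \<open>\<integral> (s \<rho> / 2 - F(s)) d\<theta>\<close>, \<open>F'(s) = s powr (- 1 / \<alpha>)\<close>, taken at
  \<open>h = 1 / (1 + \<alpha>)\<close>, attains its maximum and minimum. Rescaling varies it by a multiple of
  \<open>\<integral> (v - s) (v powr (- 1 / \<alpha>) - s powr (- 1 / \<alpha>)) d\<theta>\<close>, so \<open>v = s\<close> at an extremum, where then
  \<open>s'' + s = s powr (- 1 / \<alpha>)\<close> and therefore \<open>s = 1\<close>. So the energy is constant on the class, all its members are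
  extrema, and the expanding circle is the only possible limit.

  In the proofs \<open>aa\<close>, \<open>ss\<close> and \<open>tt\<close> stand for \<open>\<alpha>\<close>, \<open>\<sigma>\<close> and the angle \<open>\<theta>\<close>.
\<close>

section \<open>Trigonometric convexity\<close>

text \<open>For ss = 0 a solution is only known to be convex, so the equation reaches the support
  functions through touching circles alone. All smoothness of limit fronts is won afterwards, from
  concavity in h (the convexity of u) and from trigonometric convexity in the angle. The bound aa >
  1 / 2 comes from the long chord: above a chord of length l the level line moves with speed of
  order l powr (- 2 * aa), the levels that have to be crossed are of order l, and l powr (1 - 2 *
  aa) must be summable over dyadic l. The energy is not followed along the flow, and no limits for h
  near 0 or infinity enter. The fronts with one fixed growth constant \<open>D\<close> form a class
  that is compact and invariant under all scalings. Factors above and below 1 are both available, so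
  the derivative in the scale vanishes at a maximum as well as at a minimum. A limit front shrinks
  to the origin as h tends to 0, but this does not yet place the origin inside its sets. Without a
  positive lower bound for s the speed might vanish, the radius of curvature might be infinite, and
  the energy would make no sense. The reflection argument supplies this bound.\<close>

definition trig_convex :: "(real => real) => bool" where
 "trig_convex f \<longleftrightarrow>
  (\<forall>a t b. a < t --> t < b --> b - a < pi -->
    f t * sin (b - a) <= f a * sin (b - t) + f b * sin (t - a))"

text \<open>Pointwise form of f'' + f >= 0, the inequality that \<open>trig_convex\<close> expresses
  by comparison with combinations of sine and cosine. Only symmetric second differences occur
  because these are what comparison with circles controls; cos r accounts for the term of order
  zero.\<close>

definition trig_sub :: "(real => real) => real => bool" where
 "trig_sub f x \<longleftrightarrow>
  (\<forall>ep>0. \<forall>\<^sub>F r in at_right 0. - ep * r^2 <= f (x + r) + f (x - r) - 2 * cos r * f x)"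

lemma trig_convexD:
 "trig_convex f ==> a < t ==> t < b ==> b - a < pi ==>
  f t * sin (b - a) <= f a * sin (b - t) + f b * sin (t - a)" by (auto simp: trig_convex_def)

lemma sin_three_point: "cos (t - c) * sin (b - a) = cos (a - c) * sin (b - t) + cos (b - c) * sin (t - a)"
 for a b c t :: real
proof -
 have *: "cos A * sin (B + C) = cos (A - B) * sin C + cos (A + C) * sin B" for A B C :: real by (simp add: sin_add cos_add cos_diff algebra_simps)
 show ?thesis using *[of "t - c" "t - a" "b - t"] by simp
qed

text \<open>For \<open>k > 1\<close> the function cos (k * x) is the strict supersolution of y'' + y
  = 0 behind the maximum principle below; this is its gain in the second difference.\<close>

lemma cos_minus_cos_mult_ge:
 assumes "k > (1::real)"
 shows "\<forall>\<^sub>F r in at_right 0. (k^2 - 1) / 4 * r^2 <= cos r - cos (k * r)"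
proof -
 have "((%r. (cos r - cos (k * r)) / r^2) \<longlongrightarrow> (k^2 - 1) / 2) (at_right 0)"
  using assms by (real_asymp simp: field_simps power2_eq_square)
 moreover have "(k^2 - 1) / 4 < (k^2 - 1) / 2" using assms by (simp add: power2_eq_square less_1_mult)
 ultimately have "\<forall>\<^sub>F r in at_right 0. (k^2 - 1) / 4 < (cos r - cos (k * r)) / r^2" by (rule order_tendstoD)
 moreover have "\<forall>\<^sub>F r in at_right (0::real). 0 < r" by (intro eventually_at_rightI[of 0 1]) auto
 ultimately show ?thesis by eventually_elim (simp add: field_simps)
qed

text \<open>Maximum principle. If f exceeded the trigonometric interpolant \<open>T\<close> of its
  end values, the quotient of f - T by the positive strict supersolution \<open>S\<close> would have
  a positive maximum M at some x1. There the second difference of f is at most the one belonging to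
  M * S, which falls below - ep * r^2 for small r and violates \<open>trig_sub\<close>.\<close>

lemma trig_convex_ineqI:
 fixes f :: "real => real"
 assumes ab: "a < t" "t < b" "b - a < pi"
  and cont: "continuous_on {a..b} f"
  and sub: "!!x. a < x ==> x < b ==> trig_sub f x"
 shows "f t * sin (b - a) <= f a * sin (b - t) + f b * sin (t - a)"
proof (rule ccontr)
 assume neg: "\<not> ?thesis"
 have sab: "sin (b - a) > 0" using ab by (intro sin_gt_zero) auto
 define T where "T x = (f a * sin (b - x) + f b * sin (x - a)) / sin (b - a)" for x
 define m where "m = (a + b) / 2"
 \<comment> \<open>Midway between 1 and pi / (b - a): above 1, so that \<open>S\<close> is a strict
   supersolution, and small enough for \<open>S\<close> to stay positive on the closed
   interval.\<close>
 define k where "k = (1 + pi / (b - a)) / 2"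
 have k1: "k > 1" using ab by (simp add: k_def field_simps)
 have kb: "k * ((b - a) / 2) < pi / 2"
 proof -
  have "k * ((b - a) / 2) = ((b - a) + pi) / 4" using ab by (simp add: k_def field_simps)
  then show ?thesis using ab by simp
 qed
 define S where "S x = cos (k * (x - m))" for x
 have Spos: "S x > 0" if "a <= x" "x <= b" for x
 proof -
  have "\<bar>x - m\<bar> <= (b - a) / 2" using that by (auto simp: m_def abs_if field_simps)
  then have "\<bar>k * (x - m)\<bar> <= k * ((b - a) / 2)" using k1 by (simp add: abs_mult)
  then have "\<bar>k * (x - m)\<bar> < pi / 2" using kb by linarith
  then show ?thesis unfolding S_def by (intro cos_gt_zero_pi) (auto simp: abs_less_iff)
 qed
 define g where "g x = f x - T x" for x
 have ga: "g a = 0" "g b = 0" using sab by (auto simp: g_def T_def)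
 have gt: "g t > 0" using neg sab by (simp add: g_def T_def field_simps)
 have "continuous_on {a..b} (%x. g x / S x)" unfolding g_def T_def S_def
  using Spos sab by (intro continuous_intros cont) (auto simp: S_def less_imp_neq[symmetric])
 then obtain x1 where x1: "x1 \<in> {a..b}" and mx: "!!x. x \<in> {a..b} ==> g x / S x <= g x1 / S x1"
  using continuous_attains_sup[of "{a..b}" "%x. g x / S x"] ab by auto
 define M where "M = g x1 / S x1"
 have "M >= g t / S t" using mx[of t] ab by (simp add: M_def)
 moreover have "g t / S t > 0" using gt Spos[of t] ab by simp
 ultimately have M0: "M > 0" by linarith
 then have x1ne: "x1 ~= a" "x1 ~= b" using ga by (auto simp: M_def)
 then have x1i: "a < x1" "x1 < b" using x1 by auto
 have S1: "S x1 > 0" using Spos x1 by auto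
 have gle: "g x <= M * S x" if "a <= x" "x <= b" for x using mx[of x] Spos[of x] that by (simp add: M_def divide_le_eq)
 have g1: "g x1 = M * S x1" using S1 by (simp add: M_def)
 have Ttrig: "T (x + r) + T (x - r) = 2 * cos r * T x" for x r unfolding T_def add_divide_distrib[symmetric]
  by (simp add: field_simps) (simp add: sin_add sin_diff cos_add cos_diff algebra_simps)
 have Strig: "S (x + r) + S (x - r) = 2 * cos (k * r) * S x" for x r
 proof -
  have 1: "k * (x + r - m) = k * (x - m) + k * r" and 2: "k * (x - r - m) = k * (x - m) - k * r" by (auto simp: algebra_simps)
  show ?thesis unfolding S_def 1 2 by (simp add: cos_add cos_diff)
 qed
 define ep where "ep = M * S x1 * ((k^2 - 1) / 4)"
 have ks: "k^2 - 1 > 0" using k1 by (simp add: power2_eq_square less_1_mult)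
 have e0: "ep > 0" unfolding ep_def using M0 S1 ks by simp
 have "\<forall>\<^sub>F r in at_right 0. - ep * r^2 <= f (x1 + r) + f (x1 - r) - 2 * cos r * f x1"
  using sub[OF x1i] e0 unfolding trig_sub_def by blast
 moreover have "\<forall>\<^sub>F r in at_right 0. (k^2 - 1) / 4 * r^2 <= cos r - cos (k * r)" by (rule cos_minus_cos_mult_ge[OF k1])
 moreover have "\<forall>\<^sub>F r in at_right (0::real). 0 < r & r < min (x1 - a) (b - x1)"
  using x1i by (intro eventually_at_rightI[of 0 "min (x1 - a) (b - x1)"]) auto
 ultimately have "\<forall>\<^sub>F r in at_right (0::real). False"
 proof eventually_elim
  case (elim r)
  have "f (x1 + r) + f (x1 - r) - 2 * cos r * f x1
    = g (x1 + r) + g (x1 - r) - 2 * cos r * g x1" using Ttrig[of x1 r] by (simp add: g_def algebra_simps)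
  also have "\<dots> <= M * S (x1 + r) + M * S (x1 - r) - 2 * cos r * (M * S x1)" using gle[of "x1 + r"] gle[of "x1 - r"] elim g1 by auto
  also have "\<dots> = M * (S (x1 + r) + S (x1 - r)) - 2 * cos r * (M * S x1)" by (simp add: algebra_simps)
  also have "\<dots> = - 2 * (M * S x1) * (cos r - cos (k * r))" unfolding Strig by (simp add: algebra_simps)
  also have "\<dots> <= - 2 * (M * S x1) * ((k^2 - 1) / 4 * r^2)" using elim M0 S1 by (intro mult_left_mono_neg) auto
  also have "\<dots> = - 2 * ep * r^2" by (simp add: ep_def)
  finally have "- ep * r^2 <= - 2 * ep * r^2" using elim by linarith
  moreover have "ep * r^2 > 0" using e0 elim by simp
  ultimately show False by simp
 qed
 then show False by (simp add: eventually_False)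
qed

lemma trig_convexI:
 assumes "!!x. isCont f x" "!!x. trig_sub f x"
 shows "trig_convex f" unfolding trig_convex_def using assms by (auto intro!: trig_convex_ineqI continuous_at_imp_continuous_on)

text \<open>To the right of x the three-point inequality bounds f from above, with the points x and
  x + 1, and from below, with x - 1 and x; both bounds tend to f x. The left side follows by
  reflection.\<close>

lemma trig_convex_isCont:
 assumes f: "trig_convex f"
 shows "isCont f x"
proof -
 have pi1: "(1::real) < pi" using pi_gt3 by linarith
 have s1: "sin (1::real) > 0" by (intro sin_gt_zero) (use pi_gt3 in auto)
 have right: "(g \<longlongrightarrow> g x) (at_right x)" if g: "trig_convex g" for g x
 proof (rule tendsto_sandwich)
  let ?up = "%y. (g x * sin (x + 1 - y) + g (x + 1) * sin (y - x)) / sin 1"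
  let ?lo = "%y. (g x * sin (y - (x - 1)) - g (x - 1) * sin (y - x)) / sin 1"
  have ev: "\<forall>\<^sub>F y in at_right x. x < y & y < x + 1" by (intro eventually_at_rightI[of x "x + 1"]) auto
  show "\<forall>\<^sub>F y in at_right x. g y <= ?up y" using ev
  proof eventually_elim
   case (elim y)
   show ?case using trig_convexD[OF g, of x y "x + 1"] elim pi1 s1 by (simp add: field_simps)
  qed
  show "\<forall>\<^sub>F y in at_right x. ?lo y <= g y" using ev
  proof eventually_elim
   case (elim y)
   show ?case using trig_convexD[OF g, of "x - 1" x y] elim pi_gt3 s1 by (simp add: field_simps)
  qed
  have "(?up \<longlongrightarrow> (g x * sin (x + 1 - x) + g (x + 1) * sin (x - x)) / sin 1) (at_right x)" by (intro tendsto_intros) (use s1 in auto)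
  then show "(?up \<longlongrightarrow> g x) (at_right x)" using s1 by simp
  have "(?lo \<longlongrightarrow> (g x * sin (x - (x - 1)) - g (x - 1) * sin (x - x)) / sin 1) (at_right x)"
   by (intro tendsto_intros) (use s1 in auto)
  then show "(?lo \<longlongrightarrow> g x) (at_right x)" using s1 by simp
 qed
 have "trig_convex (%y. f (- y))" unfolding trig_convex_def
 proof (intro allI impI)
  fix a t b :: real assume "a < t" "t < b" "b - a < pi"
  then show "f (- t) * sin (b - a) <= f (- a) * sin (b - t) + f (- b) * sin (t - a)"
   using trig_convexD[OF f, of "- b" "- t" "- a"] by (simp add: algebra_simps)
 qed
 from right[OF this, of "- x"] have "((%y. f (- y)) \<longlongrightarrow> f x) (at_right (- x))" by simp
 then have "(f \<longlongrightarrow> f x) (at_left x)" by (simp add: at_left_minus filterlim_filtermap)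
 with right[OF f, of x] show ?thesis by (simp add: isCont_def filterlim_at_split)
qed

section \<open>Second differences and the equation G'' + G = rh\<close>

lemma symmetric_second_difference:
 fixes g g' :: "real => real"
 assumes ab: "a < x" "x < b" and g1: "!!y. a < y ==> y < b ==> DERIV g y :> g' y"
  and g2: "DERIV g' x :> c"
 shows "((%r. (g (x + r) + g (x - r) - 2 * g x) / r^2) \<longlongrightarrow> c) (at_right 0)"
proof (rule lhopital_right_0[where f' = "%r. g' (x + r) - g' (x - r)" and g' = "%r. 2 * r"])
 have "isCont g x" using g1[OF ab] DERIV_isCont by blast
 then have "((%r. g (x + r) + g (x - r) - 2 * g x) \<longlongrightarrow> g (x + 0) + g (x - 0) - 2 * g x) (at_right 0)"
  by (intro tendsto_intros) (auto intro!: isCont_tendsto_compose[of _ g] tendsto_eq_intros)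
 then show "((%r. g (x + r) + g (x - r) - 2 * g x) \<longlongrightarrow> 0) (at_right 0)" by simp
 show "((%r::real. r\<^sup>2) \<longlongrightarrow> 0) (at_right 0)" by (auto intro!: tendsto_eq_intros)
 show "\<forall>\<^sub>F r in at_right (0::real). r\<^sup>2 ~= 0" by (auto intro!: eventually_at_rightI[of 0 1])
 show "\<forall>\<^sub>F r in at_right (0::real). 2 * r ~= 0" by (auto intro!: eventually_at_rightI[of 0 1])
 show "\<forall>\<^sub>F r in at_right 0.
  DERIV (%r. g (x + r) + g (x - r) - 2 * g x) r :> g' (x + r) - g' (x - r)"
 proof (rule eventually_at_rightI[of 0 "min (x - a) (b - x)"])
  fix r assume "r \<in> {0<..<min (x - a) (b - x)}"
  then have "DERIV g (x + r) :> g' (x + r)" "DERIV g (x - r) :> g' (x - r)" using ab by (auto intro!: g1)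
  then show "DERIV (%r. g (x + r) + g (x - r) - 2 * g x) r :> g' (x + r) - g' (x - r)" by (auto intro!: derivative_eq_intros DERIV_chain2[of g])
 qed (use ab in auto)
 show "\<forall>\<^sub>F r in at_right (0::real). DERIV (%r. r\<^sup>2) r :> 2 * r"
  by (intro always_eventually allI) (auto intro!: derivative_eq_intros)
 have "((%r. (g' (x + r) - g' x) / r) \<longlongrightarrow> c) (at 0)" using g2 by (simp add: DERIV_def)
 then have r1: "((%r. (g' (x + r) - g' x) / r) \<longlongrightarrow> c) (at_right 0)"
  and l1: "((%r. (g' (x + r) - g' x) / r) \<longlongrightarrow> c) (at_left 0)" by (auto simp: filterlim_at_split)
 have "((%r. (g' (x - r) - g' x) / (- r)) \<longlongrightarrow> c) (at_right 0)" using l1 by (simp add: at_left_minus filterlim_filtermap)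
 with r1 have "((%r. ((g' (x + r) - g' x) / r + (g' (x - r) - g' x) / (- r)) / 2) \<longlongrightarrow> (c + c) / 2) (at_right 0)"
  by (intro tendsto_intros) auto
 then have "((%r. ((g' (x + r) - g' x) / r + (g' (x - r) - g' x) / (- r)) / 2) \<longlongrightarrow> c) (at_right 0)" by simp
 then show "((%r. (g' (x + r) - g' (x - r)) / (2 * r)) \<longlongrightarrow> c) (at_right 0)" by (rule Lim_transform_eventually)
   (intro eventually_at_rightI[of 0 1], auto simp: field_simps)
qed

lemma trig_sub_of_limit:
 assumes "((%r. (f (x + r) + f (x - r) - 2 * cos r * f x) / r^2) \<longlongrightarrow> c) (at_right 0)" "c >= 0"
 shows "trig_sub f x" unfolding trig_sub_def
proof (intro allI impI)
 fix ep :: real assume "ep > 0"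
 then have "- ep < c" using assms(2) by simp
 from order_tendstoD(1)[OF assms(1) this]
 have "\<forall>\<^sub>F r in at_right 0. - ep < (f (x + r) + f (x - r) - 2 * cos r * f x) / r^2" .
 moreover have "\<forall>\<^sub>F r in at_right (0::real). 0 < r" by (intro eventually_at_rightI[of 0 1]) auto
 ultimately show "\<forall>\<^sub>F r in at_right 0. - ep * r^2 <= f (x + r) + f (x - r) - 2 * cos r * f x" by eventually_elim (simp add: field_simps)
qed

lemma trig_second_difference:
 fixes g g' :: "real => real"
 assumes "((%r. (g (x + r) + g (x - r) - 2 * g x) / r^2) \<longlongrightarrow> c) (at_right 0)"
 shows "((%r. (g (x + r) + g (x - r) - 2 * cos r * g x) / r^2) \<longlongrightarrow> c + g x) (at_right 0)"
proof -
 have "((%r::real. (1 - cos r) / r^2) \<longlongrightarrow> 1 / 2) (at_right 0)" by real_asymp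
 then have "((%r. (g (x + r) + g (x - r) - 2 * g x) / r^2 + 2 * g x * ((1 - cos r) / r^2))
   \<longlongrightarrow> c + 2 * g x * (1 / 2)) (at_right 0)" by (intro tendsto_add tendsto_mult tendsto_const assms)
 moreover have "(%r. (g (x + r) + g (x - r) - 2 * g x) / r^2 + 2 * g x * ((1 - cos r) / r^2)) =
   (%r. (g (x + r) + g (x - r) - 2 * cos r * g x) / r^2)"
  by (rule ext, simp only: add_divide_distrib[symmetric] times_divide_eq_right) (simp add: algebra_simps)
 ultimately show ?thesis by simp
qed

text \<open>
 Variation of constants provides a solution \<open>G\<close> of \<open>G'' + G = rh\<close>; the maximum principle applied
 to \<open>s - G\<close> and to \<open>G - s\<close> shows that \<open>s - G\<close> is a combination of sine and cosine.
\<close>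

lemma trig_second_difference_imp_deriv:
 fixes s rh :: "real => real"
 assumes cs: "!!x. isCont s x" and cr: "!!x. isCont rh x"
  and lim: "!!x. ((%r. (s (x + r) + s (x - r) - 2 * cos r * s x) / r^2) \<longlongrightarrow> rh x) (at_right 0)"
 shows "\<exists>s'. (\<forall>x. DERIV s x :> s' x) & (\<forall>x. DERIV s' x :> rh x - s x)"
proof -
 \<comment> \<open>Intervals of length 2 < pi are within reach of the maximum principle.\<close>
 have local: "\<exists>g. (\<forall>x\<in>{x0 - 1<..<x0 + 1}. DERIV s x :> g x & DERIV g x :> rh x - s x)" for x0
 proof -
  define a where "a = x0 - 1"
  define b where "b = x0 + 1"
  define P where "P x = integral {a..x} (%t. cos t * rh t)" for x
  define Q where "Q x = integral {a..x} (%t. sin t * rh t)" for x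
  define G where "G x = sin x * P x - cos x * Q x" for x
  define G' where "G' x = cos x * P x + sin x * Q x" for x
  have cP: "continuous_on {a..b} (%t. cos t * rh t)" "continuous_on {a..b} (%t. sin t * rh t)"
   by (auto intro!: continuous_intros continuous_at_imp_continuous_on cr)
  have dP: "(P has_real_derivative cos x * rh x) (at x)"
    and dQ: "(Q has_real_derivative sin x * rh x) (at x)" if "a < x" "x < b" for x
  proof -
   have "(P has_real_derivative cos x * rh x) (at x within {a..b})"
    unfolding P_def by (rule integral_has_real_derivative[OF cP(1)]) (use that in auto)
   then show "(P has_real_derivative cos x * rh x) (at x)" using that by (simp add: at_within_Icc_at)
   have "(Q has_real_derivative sin x * rh x) (at x within {a..b})"
    unfolding Q_def by (rule integral_has_real_derivative[OF cP(2)]) (use that in auto)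
   then show "(Q has_real_derivative sin x * rh x) (at x)" using that by (simp add: at_within_Icc_at)
  qed
  have dG: "DERIV G x :> G' x" if "a < x" "x < b" for x unfolding G_def G'_def using dP[OF that] dQ[OF that]
   by (auto intro!: derivative_eq_intros simp: algebra_simps)
  have dG': "DERIV G' x :> rh x - G x" if "a < x" "x < b" for x
  proof -
   have "DERIV G' x :> - sin x * P x + cos x * (cos x * rh x) + (cos x * Q x + sin x * (sin x * rh x))"
    unfolding G'_def using dP[OF that] dQ[OF that] by (auto intro!: derivative_eq_intros)
   moreover have "- sin x * P x + cos x * (cos x * rh x) + (cos x * Q x + sin x * (sin x * rh x))
     = ((sin x)^2 + (cos x)^2) * rh x - G x" unfolding G_def by algebra
   ultimately show ?thesis by simp
  qed
  have limG: "((%r. (G (x + r) + G (x - r) - 2 * cos r * G x) / r^2) \<longlongrightarrow> rh x) (at_right 0)"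
   if "a < x" "x < b" for x
  proof -
   have "((%r. (G (x + r) + G (x - r) - 2 * G x) / r^2) \<longlongrightarrow> rh x - G x) (at_right 0)"
    using that by (intro symmetric_second_difference[where a = a and b = b and g' = G'] dG dG') auto
   from trig_second_difference[OF this] show ?thesis by simp
  qed
  define f where "f x = s x - G x" for x
  have limf: "((%r. (f (x + r) + f (x - r) - 2 * cos r * f x) / r^2) \<longlongrightarrow> 0) (at_right 0)"
   if "a < x" "x < b" for x
  proof -
   have "((%r. (s (x + r) + s (x - r) - 2 * cos r * s x) / r^2
     - (G (x + r) + G (x - r) - 2 * cos r * G x) / r^2) \<longlongrightarrow> rh x - rh x) (at_right 0)" by (intro tendsto_diff lim limG that)
   moreover have "(%r. (s (x + r) + s (x - r) - 2 * cos r * s x) / r^2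
     - (G (x + r) + G (x - r) - 2 * cos r * G x) / r^2)
     = (%r. (f (x + r) + f (x - r) - 2 * cos r * f x) / r^2)" unfolding f_def diff_divide_distrib[symmetric] by (simp add: algebra_simps)
   ultimately show ?thesis by simp
  qed
  have limnf: "((%r. (- f (x + r) + - f (x - r) - 2 * cos r * - f x) / r^2) \<longlongrightarrow> 0) (at_right 0)"
   if "a < x" "x < b" for x using tendsto_minus[OF limf[OF that]] by (simp add: minus_divide_left del: minus_divide_divide) (simp add: algebra_simps)
  have "\<exists>A B. \<forall>x\<in>{a<..<b}. f x = A * cos x + B * sin x"
  proof -
   have cf: "continuous_on {a'..b'} f" if "a < a'" "b' < b" for a' b'
   proof -
    have "isCont G x" if "x \<in> {a'..b'}" for x using dG[of x] that \<open>a < a'\<close> \<open>b' < b\<close> DERIV_isCont by fastforce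
    then show ?thesis unfolding f_def by (intro continuous_at_imp_continuous_on ballI continuous_intros cs) auto
   qed
   have eq: "f t * sin (b' - a') = f a' * sin (b' - t) + f b' * sin (t - a')"
    if "a < a'" "a' < t" "t < b'" "b' < b" for a' t b'
   proof (rule antisym)
    have pi: "b' - a' < pi" using that pi_gt3 by (simp add: a_def b_def)
    show "f t * sin (b' - a') <= f a' * sin (b' - t) + f b' * sin (t - a')"
     using that pi by (intro trig_convex_ineqI cf trig_sub_of_limit[OF limf]) auto
    have "- f t * sin (b' - a') <= - f a' * sin (b' - t) + - f b' * sin (t - a')" using that pi
     by (intro trig_convex_ineqI[where f = "%x. - f x"] continuous_on_minus cf
       trig_sub_of_limit[OF limnf]) auto
    then show "f a' * sin (b' - t) + f b' * sin (t - a') <= f t * sin (b' - a')" by simp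
   qed
   define y where "y = x0 + 1 / 4"
   have s14: "sin (1/4::real) > 0" by (intro sin_gt_zero) (use pi_gt3 in auto)
   have yx: "y - x0 = 1/4" "a < x0" "x0 < y" "y < b" by (auto simp: y_def a_def b_def)
   \<comment> \<open>The three-point identity lets the values at x0 and y determine f on the whole
     interval, whatever the order of the three points.\<close>
   have fx: "f x * sin (1/4) = f x0 * sin (y - x) + f y * sin (x - x0)" if "a < x" "x < b" for x
   proof -
    have yx': "sin (y - x0) = sin (1 / 4)" by (simp only: yx(1))
    consider "x < x0" | "x = x0" | "x0 < x" "x < y" | "x = y" | "y < x" by linarith
    then show ?thesis
    proof cases
     case 1
     have "sin (x0 - x) = - sin (x - x0)" by (metis minus_diff_eq sin_minus)
     then show ?thesis using eq[of x x0 y] 1 yx that by (simp add: algebra_simps)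
    next
     case 3 then show ?thesis using eq[of x0 x y] yx that by (simp add: algebra_simps)
    next
     case 5
     have "sin (x - y) = - sin (y - x)" by (metis minus_diff_eq sin_minus)
     then show ?thesis using eq[of x0 y x] 5 yx that by (simp add: algebra_simps)
    qed (use yx' in auto)
   qed
   have "f x = ((f x0 * sin y - f y * sin x0) / sin (1/4)) * cos x
     + ((f y * cos x0 - f x0 * cos y) / sin (1/4)) * sin x" if "x \<in> {a<..<b}" for x
   proof -
    have "f x = (f x0 * sin (y - x) + f y * sin (x - x0)) / sin (1/4)" using fx[of x] that s14 by (simp add: field_simps)
    also have "\<dots> = ((f x0 * sin y - f y * sin x0) * cos x + (f y * cos x0 - f x0 * cos y) * sin x) / sin (1/4)"
     by (simp add: sin_diff algebra_simps)
    finally show ?thesis by (simp add: add_divide_distrib)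
   qed
   then show ?thesis by blast
  qed
  then obtain A B where "\<forall>x\<in>{a<..<b}. f x = A * cos x + B * sin x" by blast
  then have AB: "s x = A * cos x + B * sin x + G x" if "a < x" "x < b" for x using that by (force simp: f_def)
  define g where "g x = - A * sin x + B * cos x + G' x" for x
  have "DERIV s x :> g x & DERIV g x :> rh x - s x" if "x \<in> {x0 - 1<..<x0 + 1}" for x
  proof
   have x: "a < x" "x < b" using that by (auto simp: a_def b_def)
   have "DERIV (%x. A * cos x + B * sin x + G x) x :> g x" unfolding g_def using dG[OF x] by (auto intro!: derivative_eq_intros)
   moreover have "\<forall>\<^sub>F y in nhds x. A * cos y + B * sin y + G y = s y"
    using eventually_nhds_in_open[of "{a<..<b}" x] x by (auto elim!: eventually_mono simp: AB)
   ultimately show "DERIV s x :> g x" by (simp add: DERIV_cong_ev[OF refl _ refl])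
   have "DERIV g x :> - A * cos x - B * sin x + (rh x - G x)" unfolding g_def using dG'[OF x] by (auto intro!: derivative_eq_intros)
   then show "DERIV g x :> rh x - s x" using AB[OF x] by (simp add: algebra_simps)
  qed
  then show ?thesis by blast
 qed
 have d1: "DERIV s x :> deriv s x" for x
 proof -
  obtain g where g: "\<forall>y\<in>{x - 1<..<x + 1}. DERIV s y :> g y & DERIV g y :> rh y - s y" using local by blast
  then have "DERIV s x :> g x" by simp
  then show ?thesis using DERIV_imp_deriv by metis
 qed
 have d2: "DERIV (deriv s) x :> rh x - s x" for x
 proof -
  obtain g where g: "\<forall>y\<in>{x - 1<..<x + 1}. DERIV s y :> g y & DERIV g y :> rh y - s y" using local by blast
  have "\<forall>\<^sub>F y in nhds x. g y = deriv s y"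
  proof (rule eventually_mono[OF eventually_nhds_in_open[of "{x - 1<..<x + 1}" x]])
   fix y assume "y \<in> {x - 1<..<x + 1}"
   then have "DERIV s y :> g y" using g by blast
   then show "g y = deriv s y" by (simp add: DERIV_imp_deriv)
  qed auto
  moreover have "DERIV g x :> rh x - s x" using g by simp
  ultimately show ?thesis by (simp add: DERIV_cong_ev[OF refl _ refl])
 qed
 show ?thesis using d1 d2 by blast
qed

section \<open>Self-similar shrinking curves are circles\<close>

definition powr_primitive :: "real => real => real" where
 "powr_primitive q t = (if q = 1 then ln t else t powr (1 - q) / (1 - q))"

lemma powr_primitive_deriv:
 "t > 0 ==> DERIV (powr_primitive q) t :> t powr (- q)"
proof (cases "q = 1")
 case True
 assume "t > 0"
 then have "DERIV ln t :> t powr (- q)" using True by (auto intro!: derivative_eq_intros simp: powr_minus_divide)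
 then show ?thesis by (simp add: powr_primitive_def[abs_def] True)
next
 case False
 assume t: "t > 0"
 have "((%t. t powr (1 - q) / (1 - q)) has_real_derivative t powr (- q)) (at t)" using t False by (auto intro!: derivative_eq_intros)
 then show ?thesis by (simp add: powr_primitive_def[abs_def] False)
qed

text \<open>t^2 / 2 - F(t) is the potential of S'' = S powr (- q) - S, and 1 is its strict minimum.
  In the phase plane (1, 0) is therefore the only point on its energy level.\<close>

lemma powr_potential_min:
 assumes q: "0 < q" and t: "t > 0" "t ~= 1"
 shows "1 / 2 - powr_primitive q 1 < t^2 / 2 - powr_primitive q t"
proof -
 define Ph where "Ph t = t^2 / 2 - powr_primitive q t" for t
 have d: "DERIV Ph t :> t - t powr (- q)" if "t > 0" for t unfolding Ph_def using that by (auto intro!: derivative_eq_intros powr_primitive_deriv)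
 have "Ph 1 < Ph t"
 proof (cases "t > 1")
  case True
  have dd: "DERIV Ph y :> y - y powr (- q)" "y - y powr (- q) > 0" if "1 < y" "y < t" for y
  proof -
   show "DERIV Ph y :> y - y powr (- q)" using that by (intro d) auto
   have "y powr (- q) < 1 powr (- q)" using that q by (intro powr_less_mono2_neg) auto
   then show "y - y powr (- q) > 0" using that by simp
  qed
  have "continuous_on {1..t} Ph" by (intro continuous_at_imp_continuous_on ballI DERIV_isCont[OF d]) auto
  then show ?thesis using DERIV_pos_imp_increasing_open[of 1 t Ph] True dd by blast
 next
  case False
  then have t1: "t < 1" using t by simp
  have dd: "DERIV Ph y :> y - y powr (- q)" "y - y powr (- q) < 0" if "t < y" "y < 1" for y
  proof -
   show "DERIV Ph y :> y - y powr (- q)" using that t by (intro d) auto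
   have "y powr (- q) > 1 powr (- q)" using that q t by (intro powr_less_mono2_neg) auto
   then show "y - y powr (- q) < 0" using that by simp
  qed
  have "continuous_on {t..1} Ph" using t by (intro continuous_at_imp_continuous_on ballI DERIV_isCont[OF d]) auto
  then show ?thesis using DERIV_neg_imp_decreasing_open[of t 1 Ph] t1 dd by blast
 qed
 then show ?thesis by (simp add: Ph_def)
qed

text \<open>Applied to S' and to - S', this cuts the circle into arcs on which S' has a constant
  sign. The sign of the derivative at b tells how the next arc starts.\<close>

lemma next_zero:
 fixes f f' :: "real => real"
 assumes d: "!!x. DERIV f x :> f' x" and a: "f a = 0" "f' a > 0" and c: "a < c" "f c = 0"
 shows "\<exists>b. a < b & b <= c & f b = 0 & (\<forall>x. a < x & x < b --> f x > 0) & f' b <= 0"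
proof -
 have cont: "continuous_on A f" for A by (intro continuous_at_imp_continuous_on ballI DERIV_isCont[OF d])
 obtain e where e: "e > 0" "!!h. 0 < h ==> h < e ==> 0 < f (a + h)" using DERIV_pos_inc_right[OF d a(2)] a(1) by auto
 have ec: "a + e / 2 < c" using e(2)[of "c - a"] c e(1) by (cases "c - a < e") auto
 define Z where "Z = {x \<in> {a + e / 2..c}. f x = 0}"
 have "Z = {a + e / 2..c} \<inter> {x. f x = 0}" by (auto simp: Z_def)
 moreover have "closed {x. f x = 0}" using cont by (intro closed_Collect_eq) auto
 ultimately have "compact Z" by (simp add: compact_Int_closed)
 moreover have "Z ~= {}" using c ec by (auto simp: Z_def)
 ultimately obtain b where b: "b \<in> Z" "!!x. x \<in> Z ==> b <= x" using compact_attains_inf[of Z] by blast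
 have fb: "f b = 0" "a + e / 2 <= b" "b <= c" using b by (auto simp: Z_def)
 have pos: "f x > 0" if x: "a < x" "x < b" for x
 proof (rule ccontr)
  assume n: "\<not> f x > 0"
  have xe: "x >= a + e / 2"
  proof (rule ccontr)
   assume "\<not> ?thesis"
   then have "f (a + (x - a)) > 0" using x e by (intro e(2)) auto
   then show False using n by simp
  qed
  have "f (a + e / 2) > 0" using e by simp
  moreover have "f x <= 0" using n by simp
  ultimately obtain y where "a + e / 2 <= y" "y <= x" "f y = 0" using IVT2'[of f x 0 "a + e / 2", OF _ _ xe cont] by auto
  then have "y \<in> Z" using x fb by (auto simp: Z_def)
  then show False using b(2) \<open>y <= x\<close> x by force
 qed
 have "f' b <= 0"
 proof (rule ccontr)
  assume "\<not> ?thesis"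
  then obtain d0 where d0: "d0 > 0" "!!h. 0 < h ==> h < d0 ==> f (b - h) < f b" using DERIV_pos_inc_left[OF d, of b] by auto
  define h where "h = min (d0 / 2) ((b - a) / 2)"
  have "0 < h" "h < d0" "a < b - h" using d0 fb e by (auto simp: h_def min_def field_simps)
  then show False using d0(2)[of h] pos[of "b - h"] fb by auto
 qed
 then show ?thesis using fb pos e by (intro exI[of _ b]) auto
qed

text \<open>
 Sturm comparison. On an arc between consecutive zeros of \<open>S'\<close> one has \<open>(S')'' + (1 + q S powr (-q-1)) S' = 0\<close>, so its
 length is less than \<open>pi\<close>; \<open>p = (S^2)'\<close> satisfies \<open>p'' + (4 - (3 - q) S powr (-q-1)) p = 0\<close>, so for \<open>q < 3\<close> the length exceeds \<open>pi / 2\<close>.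
 Arcs of length in \<open>(pi / 2, pi)\<close> with alternating signs cannot fill a circle of length \<open>2 * pi\<close>.
\<close>

lemma shrinker_unique:
 fixes S S' :: "real => real"
 assumes q: "0 < q" "q < 3"
  and pos: "!!x. S x > 0" and per: "!!x. S (x + 2 * pi) = S x"
  and d1: "!!x. DERIV S x :> S' x"
  and d2: "!!x. DERIV S' x :> S x powr (- q) - S x"
 shows "S x = 1"
proof -
 define R where "R x = S x powr (- q) - S x" for x
 define w where "w x = q * S x powr (- q - 1)" for x
 have d2': "DERIV S' x :> R x" for x using d2 by (simp add: R_def)
 have wpos: "w x > 0" for x using pos[of x] q by (simp add: w_def)
 have d3: "DERIV R x :> - w x * S' x - S' x" for x unfolding R_def w_def using pos[of x] by (auto intro!: derivative_eq_intros d1 simp: algebra_simps)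
 have Rzero: "R x = 0 \<longleftrightarrow> S x = 1" for x
 proof
  assume "R x = 0"
  then have "ln (S x powr (- q)) = ln (S x)" by (simp add: R_def)
  then have "(1 + q) * ln (S x) = 0" using pos[of x] by (simp add: ln_powr algebra_simps)
  then show "S x = 1" using pos[of x] q by simp
 qed (simp add: R_def)
 \<comment> \<open>At such a point the first integral \<open>H\<close> takes the least value that it
   can have, which forces S = 1 everywhere.\<close>
 have crit: "S x = 1" if x0: "S x0 = 1" "S' x0 = 0" for x x0
 proof -
  define H where "H x = (S' x)^2 / 2 + ((S x)^2 / 2 - powr_primitive q (S x))" for x
  have "DERIV H x :> 0" for x
  proof -
   have "DERIV H x :> S' x * R x + (S x * S' x - S x powr (- q) * S' x)" unfolding H_def using pos[of x]
    by (auto intro!: derivative_eq_intros d1 d2' DERIV_chain2[OF powr_primitive_deriv])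
   then show ?thesis by (simp add: R_def algebra_simps)
  qed
  then have "H x = H x0" by (metis DERIV_isconst_all)
  then have "(S' x)^2 / 2 + ((S x)^2 / 2 - powr_primitive q (S x)) = 1 / 2 - powr_primitive q 1" using x0 by (simp add: H_def)
  moreover have "(S' x)^2 / 2 >= 0" by simp
  ultimately show ?thesis using powr_potential_min[OF q(1) pos[of x]] by linarith
 qed
 have long: "b - a > pi / 2"
  if ab: "a < b" "S' a = 0" "S' b = 0" "!!x. a < x ==> x < b ==> ep * S' x > 0" "ep * R b <= 0"
  for a b ep
 proof (rule ccontr)
  assume n: "\<not> ?thesis"
  define p where "p x = 2 * S x * S' x" for x
  define p' where "p' x = 2 * (S' x)^2 + 2 * S x * R x" for x
  \<comment> \<open>Wronskian of p and sin (2 * (x - a)); its derivative is (p'' + 4 * p) times this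
    sine, of one sign on the arc.\<close>
  define W where "W x = ep * (p' x * sin (2 * (x - a)) - 2 * p x * cos (2 * (x - a)))" for x
  have dp: "DERIV p x :> p' x" for x unfolding p_def p'_def by (auto intro!: derivative_eq_intros d1 d2' simp: power2_eq_square)
  have dp': "DERIV p' x :> (6 - 2 * q) * S x powr (- q) * S' x - 4 * p x" for x
  proof -
   have "DERIV p' x :> 4 * S' x * R x + 2 * S' x * R x + 2 * S x * (- w x * S' x - S' x)"
    unfolding p'_def by (auto intro!: derivative_eq_intros d1 d2' d3)
   moreover have Sw: "S x * w x = q * S x powr (- q)"
   proof -
    have "S x * S x powr (- q - 1) = S x powr (1 + (- q - 1))" using pos[of x] by (subst powr_add) auto
    then show ?thesis by (simp add: w_def)
   qed
   have "4 * S' x * R x + 2 * S' x * R x + 2 * S x * (- w x * S' x - S' x)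
    = 6 * S' x * R x - 2 * (S x * w x) * S' x - 2 * S x * S' x" by (simp add: algebra_simps)
   also have "\<dots> = (6 - 2 * q) * S x powr (- q) * S' x - 4 * p x" unfolding Sw by (simp add: R_def p_def algebra_simps)
   ultimately show ?thesis by simp
  qed
  have dW: "DERIV W x :> ep * ((6 - 2 * q) * S x powr (- q) * S' x) * sin (2 * (x - a))" for x
   unfolding W_def by (auto intro!: derivative_eq_intros dp dp' simp: algebra_simps)
  have "W a < W b"
  proof (rule DERIV_pos_imp_increasing_open[OF ab(1)])
   fix x assume x: "a < x" "x < b"
   then have "sin (2 * (x - a)) > 0" using n by (intro sin_gt_zero) auto
   moreover have "(6 - 2 * q) * S x powr (- q) * (ep * S' x) > 0" using ab(4)[OF x] pos[of x] q by (intro mult_pos_pos[OF mult_pos_pos]) auto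
   ultimately have "(6 - 2 * q) * S x powr (- q) * (ep * S' x) * sin (2 * (x - a)) > 0" by (rule mult_pos_pos[rotated])
   then have "ep * ((6 - 2 * q) * S x powr (- q) * S' x) * sin (2 * (x - a)) > 0" by (simp add: mult_ac)
   then show "\<exists>y. DERIV W x :> y & y > 0" using dW by blast
  qed (intro continuous_at_imp_continuous_on ballI DERIV_isCont[OF dW])
  moreover have "W a = 0" using ab by (simp add: W_def p_def)
  moreover have "W b = 2 * S b * (ep * R b) * sin (2 * (b - a))" using ab by (simp add: W_def p_def p'_def)
  moreover have "sin (2 * (b - a)) >= 0" using n ab(1) by (intro sin_ge_zero) auto
  moreover have "2 * S b * (ep * R b) <= 0" using ab(5) pos[of b] by (simp add: mult_nonneg_nonpos)
  ultimately show False using mult_nonpos_nonneg[of "2 * S b * (ep * R b)" "sin (2 * (b - a))"] by simp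
 qed
 have short: "b - a < pi"
  if ab: "a < b" "S' a = 0" "S' b = 0" "!!x. a < x ==> x < b ==> ep * S' x > 0" for a b ep
 proof (rule ccontr)
  assume n: "\<not> ?thesis"
  \<comment> \<open>Wronskian of S' and sin (x - a), decreasing as long as ep * S' is
    positive.\<close>
  define W where "W x = ep * (R x * sin (x - a) - S' x * cos (x - a))" for x
  have dW: "DERIV W x :> - (w x * (ep * S' x) * sin (x - a))" for x unfolding W_def by (auto intro!: derivative_eq_intros d2' d3 simp: algebra_simps)
  have "W (a + pi) < W a"
  proof (rule DERIV_neg_imp_decreasing_open[where f = W and a = a and b = "a + pi"])
   fix x assume x: "a < x" "x < a + pi"
   then have "sin (x - a) > 0" by (intro sin_gt_zero) auto
   then have "- (w x * (ep * S' x) * sin (x - a)) < 0" using ab(4)[of x] x n wpos[of x] by simp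
   then show "\<exists>y. DERIV W x :> y & y < 0" using dW by blast
  qed (auto intro!: continuous_at_imp_continuous_on ballI DERIV_isCont[OF dW])
  moreover have "W a = 0" using ab by (simp add: W_def)
  moreover have "W (a + pi) = ep * S' (a + pi)" by (simp add: W_def)
  moreover have "ep * S' (a + pi) >= 0" using n ab(3) ab(4)[of "a + pi"] by (cases "a + pi = b") auto
  ultimately show False by simp
 qed
 show ?thesis
 proof (rule ccontr)
  assume n: "S x ~= 1"
  have nz: "R y ~= 0" if "S' y = 0" for y using crit[of y x] n that Rzero by blast
  have contS: "continuous_on A S" for A by (intro continuous_at_imp_continuous_on ballI DERIV_isCont[OF d1])
  obtain a where a: "a \<in> {0..2*pi}" "!!y. y \<in> {0..2*pi} ==> S a <= S y" using continuous_attains_inf[of "{0..2*pi}" S] contS by auto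
  have amin: "S a <= S y" for y
  proof -
   have pern: "S (z + 2 * pi * of_int k) = S z" for z k
   proof (induction k rule: int_induct[of _ 0])
    case (step1 i)
    then show ?case using per[of "z + 2 * pi * of_int i"] by (simp add: algebra_simps)
   next
    case (step2 i)
    then show ?case using per[of "z + 2 * pi * of_int (i - 1)"] by (simp add: algebra_simps)
   qed simp
   define k where "k = \<lfloor>y / (2 * pi)\<rfloor>"
   have "of_int k <= y / (2 * pi)" "y / (2 * pi) < of_int k + 1" by (auto simp: k_def)
   then have "y + 2 * pi * of_int (- k) \<in> {0..2*pi}" by (auto simp: field_simps)
   from a(2)[OF this] show ?thesis unfolding pern .
  qed
  have Sa: "S' a = 0" using DERIV_local_min[OF d1, of 1 a] amin by auto
  have per': "S' (y + 2 * pi) = S' y" for y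
  proof -
   have "DERIV (%y. S (y + 2 * pi)) y :> S' (y + 2 * pi)" using DERIV_shift[of S "S' (y + 2 * pi)" y "2 * pi"] d1 by simp
   then show ?thesis using per d1[of y] DERIV_unique by fastforce
  qed
  have Ra: "R a > 0"
  proof (rule ccontr)
   assume "\<not> ?thesis"
   then have "R a < 0" using nz[OF Sa] by simp
   then obtain e where e: "e > 0" "!!h. 0 < h ==> h < e ==> S' (a + h) < 0" using DERIV_neg_dec_right[OF d2', of a] Sa by auto
   have "S (a + e / 2) < S a"
   proof (rule DERIV_neg_imp_decreasing_open[where f = S and a = a and b = "a + e / 2"])
    fix y assume "a < y" "y < a + e / 2"
    then have "S' (a + (y - a)) < 0" using e by (intro e(2)) auto
    then show "\<exists>z. DERIV S y :> z & z < 0" using d1 by auto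
   qed (use e contS in auto)
   then show False using amin[of "a + e / 2"] by simp
  qed
  define c where "c = a + 2 * pi"
  have Sc: "S' c = 0" using Sa per' by (simp add: c_def)
  have Rc: "R c > 0" using Ra per by (simp add: c_def R_def)
  have nd: "DERIV (%x. - S' x) x :> - R x" for x by (auto intro!: derivative_eq_intros d2')
  \<comment> \<open>Starting from a global minimum of S, two arcs shorter than pi do not reach c; a
    third one ends where R <= 0, hence not at c, where R > 0. So there are at least four arcs, each
    longer than pi / 2.\<close>
  obtain b1 where b1: "a < b1" "b1 <= c" "S' b1 = 0" "!!x. a < x ==> x < b1 ==> S' x > 0" "R b1 <= 0"
   using next_zero[of S' R, OF d2' Sa Ra _ Sc] by (auto simp: c_def)
  have l1: "b1 - a > pi / 2" "b1 - a < pi" using long[of a b1 1] short[of a b1 1] b1 Sa by auto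
  have "- R b1 > 0" using nz[OF b1(3)] b1(5) by simp
  then obtain b2 where b2: "b1 < b2" "b2 <= c" "S' b2 = 0" "!!x. b1 < x ==> x < b2 ==> S' x < 0" "R b2 >= 0"
   using next_zero[of "%x. - S' x" "%x. - R x", OF nd _ _ _, of b1 c] b1 Sc l1 by (auto simp: c_def)
  have l2: "b2 - b1 > pi / 2" "b2 - b1 < pi" using long[of b1 b2 "-1"] short[of b1 b2 "-1"] b2 b1 by auto
  have "R b2 > 0" using nz[OF b2(3)] b2(5) by simp
  then obtain b3 where b3: "b2 < b3" "b3 <= c" "S' b3 = 0" "!!x. b2 < x ==> x < b3 ==> S' x > 0" "R b3 <= 0"
   using next_zero[of S' R, OF d2' b2(3) _ _ Sc] l1 l2 by (auto simp: c_def)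
  have l3: "b3 - b2 > pi / 2" using long[of b2 b3 1] b3 b2 by auto
  have "b3 ~= c" using Rc b3(5) by auto
  moreover have "- R b3 > 0" using nz[OF b3(3)] b3(5) by simp
  ultimately obtain b4 where b4: "b3 < b4" "b4 <= c" "S' b4 = 0" "!!x. b3 < x ==> x < b4 ==> S' x < 0" "R b4 >= 0"
   using next_zero[of "%x. - S' x" "%x. - R x", OF nd _ _ _, of b3 c] b3 Sc by auto
  have "b4 - b3 > pi / 2" using long[of b3 b4 "-1"] b4 b3 by auto
  then show False using l1 l2 l3 b4(2) by (simp add: c_def)
 qed
qed

section \<open>Radial test functions\<close>

text \<open>
 Tests by radial functions \<open>ps(|x - z|^2)\<close> suffice. In \<open>super_test\<close> the term with \<open>ps''\<close> is dropped: it is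
 the second derivative along the gradient, which is nonnegative when a convex function is touched from below.
\<close>

definition sub_test :: "real => real => (real^2 => real) => bool" where
 "sub_test aa ss u \<longleftrightarrow>
  (\<forall>ps ps' ps'' z x1.
    (\<forall>t. DERIV ps t :> ps' t) & (\<forall>t. DERIV ps' t :> ps'' t) & continuous_on UNIV ps'' &
    x1 ~= z & ps' ((norm (x1 - z))^2) > 0 &
    (\<forall>\<^sub>F x in nhds x1. u x - ps ((norm (x - z))^2) <= u x1 - ps ((norm (x1 - z))^2)) -->
    (let q = (norm (x1 - z))^2; P = 4 * (ps' q)^2 * q in
    1 <= (ss + P) powr (1 / (2 * aa) - 1 / 2) *
     (2 * ps' q + (2 * ps' q + 4 * q * ps'' q) * (ss / (ss + P)))))"

definition super_test :: "real => real => (real^2 => real) => bool" where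
 "super_test aa ss u \<longleftrightarrow>
  (\<forall>ps ps' ps'' z x1.
    (\<forall>t. DERIV ps t :> ps' t) & (\<forall>t. DERIV ps' t :> ps'' t) & continuous_on UNIV ps'' &
    x1 ~= z & ps' ((norm (x1 - z))^2) > 0 &
    (\<forall>\<^sub>F x in nhds x1. u x - ps ((norm (x - z))^2) >= u x1 - ps ((norm (x1 - z))^2)) -->
    (let q = (norm (x1 - z))^2; P = 4 * (ps' q)^2 * q in
    (ss + P) powr (1 / (2 * aa) - 1 / 2) * (2 * ps' q) <= 1))"

text \<open>Exponent m of |x - z|^2 in the flat test functions. On them L_0 behaves like |x - z|
  powr ((2 * m - 1) / aa - 1), which tends to 0 because m >= aa + 2; m >= 2 makes the Hessian vanish
  at z.\<close>

definition flat_order :: "real => nat" where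
 "flat_order aa = nat \<lceil>aa\<rceil> + 2"

text \<open>At a contact point with vanishing gradient the test for subsolutions would read 0 >= 1,
  so a flat contact from above cannot occur.\<close>

definition nonflat :: "real => (real^2 => real) => bool" where
 "nonflat aa u \<longleftrightarrow>
  (\<forall>z B. B >= 0 --> \<not> (\<forall>\<^sub>F x in nhds z. u x <= u z + B * ((norm (x - z))^2) ^ flat_order aa))"

text \<open>The common consequence of both notions of solution, and all that the later arguments
  take from the equation.\<close>

definition convex_solution :: "real => real => (real^2 => real) => bool" where
 "convex_solution aa ss u \<longleftrightarrow>
  convex_on UNIV u & sub_test aa ss u & super_test aa ss u & nonflat aa u"

lemma partial_eqI: "(f has_derivative f') (at x) ==> partial i f x = f' (axis i 1)" unfolding partial_def by (metis frechet_derivative_at)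

lemma has_derivative_partial:
 fixes f :: "real^2 => real"
 assumes "f differentiable (at x)"
 shows "(f has_derivative (%h. \<Sum>i\<in>UNIV. h $ i * partial i f x)) (at x)"
proof -
 have d: "(f has_derivative frechet_derivative f (at x)) (at x)" using assms frechet_derivative_works by blast
 then have lin: "linear (frechet_derivative f (at x))" by (rule has_derivative_linear)
 have "frechet_derivative f (at x) h = (\<Sum>i\<in>UNIV. h $ i * partial i f x)" for h
 proof -
  have "h = (\<Sum>i\<in>UNIV. h $ i *\<^sub>R axis i 1)" using basis_expansion[of h] by (simp add: scalar_mult_eq_scaleR)
  then have "frechet_derivative f (at x) h = frechet_derivative f (at x) (\<Sum>i\<in>UNIV. h $ i *\<^sub>R axis i 1)" by simp
  also have "\<dots> = (\<Sum>i\<in>UNIV. h $ i * partial i f x)" by (simp add: linear_sum[OF lin] linear_cmul[OF lin] partial_def)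
  finally show ?thesis .
 qed
 then have "frechet_derivative f (at x) = (%h. \<Sum>i\<in>UNIV. h $ i * partial i f x)" by (rule ext)
 then show ?thesis using d by simp
qed

lemma norm_diff_sq_has_derivative:
 fixes z :: "real^2"
 shows "((%x. (norm (x - z))\<^sup>2) has_derivative (%h. 2 * ((x - z) \<bullet> h))) (at x)" unfolding power2_norm_eq_inner
 by (auto intro!: derivative_eq_intros simp: inner_commute)

lemma radial_derivatives:
 fixes z :: "real^2"
 assumes d1: "!!t. DERIV ps t :> ps' t" and d2: "!!t. DERIV ps' t :> ps'' t"
  and c: "continuous_on UNIV ps''"
 defines "ph \<equiv> %x. ps ((norm (x - z))^2)"
 shows "partial i ph x = 2 * ps' ((norm (x - z))^2) * (x - z) $ i"
  and "partial j (partial i ph) x =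
   2 * ps' ((norm (x - z))^2) * (if i = j then 1 else 0) +
   4 * ps'' ((norm (x - z))^2) * (x - z) $ i * (x - z) $ j"
  and "C2 ph"
proof -
 have D1: "(ph has_derivative (%h. ps' ((norm (x - z))^2) * (2 * ((x - z) \<bullet> h)))) (at x)" for x
 proof -
  have "(ps has_derivative (*) (ps' ((norm (x - z))^2))) (at ((norm (x - z))^2))" using d1 by (simp add: has_field_derivative_def)
  from has_derivative_compose[OF norm_diff_sq_has_derivative this] show ?thesis by (simp add: ph_def)
 qed
 show p1: "partial i ph x = 2 * ps' ((norm (x - z))^2) * (x - z) $ i" for x i using partial_eqI[OF D1] by (simp add: inner_axis)
 have D2: "(partial i ph has_derivative (%h. 2 * ps' ((norm (x - z))^2) * h $ i
   + 2 * (ps'' ((norm (x - z))^2) * (2 * ((x - z) \<bullet> h))) * (x - z) $ i)) (at x)" for x i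
 proof -
  have "(ps' has_derivative (*) (ps'' ((norm (x - z))^2))) (at ((norm (x - z))^2))" using d2 by (simp add: has_field_derivative_def)
  note e = has_derivative_compose[OF norm_diff_sq_has_derivative this]
  have "((%x. 2 * ps' ((norm (x - z))^2) * (x - z) $ i) has_derivative
   (%h. 2 * ps' ((norm (x - z))^2) * h $ i
   + 2 * (ps'' ((norm (x - z))^2) * (2 * ((x - z) \<bullet> h))) * (x - z) $ i)) (at x)"
   by (auto intro!: derivative_eq_intros e bounded_linear_imp_has_derivative bounded_linear_vec_nth
     has_derivative_compose[of "%x. x - z" _ _ _ "%x. x $ i", unfolded o_def])
  then show ?thesis using p1 by presburger
 qed
 show p2: "partial j (partial i ph) x =
   2 * ps' ((norm (x - z))^2) * (if i = j then 1 else 0) +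
   4 * ps'' ((norm (x - z))^2) * (x - z) $ i * (x - z) $ j" for x i j
  using partial_eqI[OF D2[where x = x and i = i], of j] by (simp add: inner_axis) (simp add: axis_def)
 have cd: "continuous_on UNIV ps'" using d2 by (intro continuous_at_imp_continuous_on ballI DERIV_isCont)
 show "C2 ph" unfolding C2_def
 proof (intro conjI allI)
  fix x show "ph differentiable (at x)" using D1 differentiableI by blast
  fix i show "partial i ph differentiable (at x)" using D2 differentiableI by blast
  fix j
  show "continuous_on UNIV (partial j (partial i ph))" unfolding p2
   by (intro continuous_intros continuous_on_compose2[OF cd] continuous_on_compose2[OF c]) auto
 qed
qed

section \<open>Second-order conditions at a contact point\<close>

lemma second_derivative_test:
 fixes g :: "real => real"
 assumes ev: "\<forall>\<^sub>F t in nhds 0. g t <= g 0" and d1: "!!t. DERIV g t :> g' t" and d2: "DERIV g' 0 :> c"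
 shows "g' 0 = 0" "c <= 0"
proof -
 obtain d where d: "d > 0" "!!t. \<bar>t\<bar> < d ==> g t <= g 0" using ev by (auto simp: eventually_nhds_metric dist_real_def)
 show g0: "g' 0 = 0" using DERIV_local_max[OF d1 d(1)] d(2) by auto
 show "c <= 0"
 proof (rule ccontr)
  assume "\<not> ?thesis"
  then obtain e where e: "e > 0" "!!h. 0 < h ==> h < e ==> 0 < g' h" using DERIV_pos_inc_right[OF d2] g0 by auto
  define t where "t = min d e / 2"
  have t: "0 < t" "t < d" "t < e" using d e by (auto simp: t_def)
  have "g 0 < g t"
  proof (rule DERIV_pos_imp_increasing_open[where f = g and a = 0 and b = t])
   show "\<exists>y. DERIV g x :> y & 0 < y" if "0 < x" "x < t" for x using d1 e(2)[of x] that t by fastforce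
  qed (use t d1 in \<open>auto intro!: continuous_at_imp_continuous_on DERIV_isCont\<close>)
  then show False using d(2)[of t] t by auto
 qed
qed

definition hess :: "(real^2 => real) => real^2 => real^2 => real" where
 "hess w x v = (\<Sum>i\<in>UNIV. \<Sum>j\<in>UNIV. v $ i * v $ j * partial j (partial i w) x)"

lemma C2_line_derivs:
 assumes "C2 w"
 shows "DERIV (%t. w (x + t *\<^sub>R v)) t :> (\<Sum>i\<in>UNIV. v $ i * partial i w (x + t *\<^sub>R v))"
  and "DERIV (%t. \<Sum>i\<in>UNIV. v $ i * partial i w (x + t *\<^sub>R v)) t :> hess w (x + t *\<^sub>R v) v"
proof -
 have line: "((%t. x + t *\<^sub>R v) has_derivative (%s. s *\<^sub>R v)) (at t)" for t by (auto intro!: derivative_eq_intros)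
 have gen: "DERIV (%t. f (x + t *\<^sub>R v)) t :> (\<Sum>i\<in>UNIV. v $ i * partial i f (x + t *\<^sub>R v))"
  if "f differentiable (at (x + t *\<^sub>R v))" for f t unfolding has_field_derivative_def
  by (rule has_derivative_eq_rhs[OF has_derivative_compose[OF line has_derivative_partial[OF that]]])
   (simp add: fun_eq_iff sum_distrib_left mult_ac)
 show "DERIV (%t. w (x + t *\<^sub>R v)) t :> (\<Sum>i\<in>UNIV. v $ i * partial i w (x + t *\<^sub>R v))"
  using assms by (intro gen) (auto simp: C2_def)
 have "DERIV (%t. \<Sum>i\<in>UNIV. v $ i * partial i w (x + t *\<^sub>R v)) t :>
  (\<Sum>i\<in>UNIV. v $ i * (\<Sum>j\<in>UNIV. v $ j * partial j (partial i w) (x + t *\<^sub>R v)))"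
  using assms by (intro DERIV_sum DERIV_cmult gen) (auto simp: C2_def)
 then show "DERIV (%t. \<Sum>i\<in>UNIV. v $ i * partial i w (x + t *\<^sub>R v)) t :> hess w (x + t *\<^sub>R v) v"
  by (simp add: hess_def sum_distrib_left mult_ac)
qed

lemma C2_local_max:
 assumes "C2 u" "C2 ph" and ev: "\<forall>\<^sub>F x in nhds x1. u x - ph x <= u x1 - ph x1"
 shows "partial i u x1 = partial i ph x1" "hess u x1 v <= hess ph x1 v"
proof -
 have *: "(\<Sum>i\<in>UNIV. v $ i * partial i u x1) = (\<Sum>i\<in>UNIV. v $ i * partial i ph x1) &
  hess u x1 v <= hess ph x1 v" for v
 proof -
  define g where "g t = u (x1 + t *\<^sub>R v) - ph (x1 + t *\<^sub>R v)" for t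
  define g' where "g' t = (\<Sum>i\<in>UNIV. v $ i * partial i u (x1 + t *\<^sub>R v))
   - (\<Sum>i\<in>UNIV. v $ i * partial i ph (x1 + t *\<^sub>R v))" for t
  have "((%t. x1 + t *\<^sub>R v) \<longlongrightarrow> x1 + 0 *\<^sub>R v) (nhds 0)" by (intro tendsto_intros filterlim_ident)
  then have lim: "filterlim (%t. x1 + t *\<^sub>R v) (nhds x1) (nhds 0)" by simp
  have "\<forall>\<^sub>F t in nhds 0. g t <= g 0" using filterlim_iff[THEN iffD1, OF lim, rule_format, OF ev] by (simp add: g_def)
  moreover have "DERIV g t :> g' t" for t unfolding g_def g'_def by (intro DERIV_diff C2_line_derivs assms)
  moreover have "DERIV g' 0 :> hess u (x1 + 0 *\<^sub>R v) v - hess ph (x1 + 0 *\<^sub>R v) v"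
   unfolding g'_def by (intro DERIV_diff C2_line_derivs assms)
  ultimately have "g' 0 = 0" "hess u (x1 + 0 *\<^sub>R v) v - hess ph (x1 + 0 *\<^sub>R v) v <= 0" using second_derivative_test by blast+
  then show ?thesis by (simp add: g'_def)
 qed
 show "hess u x1 v <= hess ph x1 v" using * by blast
 show "partial i u x1 = partial i ph x1" using *[of "axis i 1"] by (simp add: axis_def if_distrib[of "%x. x * _"] cong: if_cong)
qed

lemma C2_convex_hess_nonneg:
 assumes "C2 u" "convex_on UNIV u"
 shows "hess u x v >= 0"
proof -
 define g where "g t = u (x + t *\<^sub>R v)" for t
 define g' where "g' t = (\<Sum>i\<in>UNIV. v $ i * partial i u (x + t *\<^sub>R v))" for t
 have d: "DERIV g t :> g' t" for t unfolding g_def g'_def by (intro C2_line_derivs assms)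
 have cg: "convex_on UNIV g"
 proof (rule convex_onI)
  fix s a b :: real assume s: "0 < s" "s < 1"
  have "x + ((1 - s) *\<^sub>R a + s *\<^sub>R b) *\<^sub>R v = (1 - s) *\<^sub>R (x + a *\<^sub>R v) + s *\<^sub>R (x + b *\<^sub>R v)"
   by (simp add: algebra_simps)
  then show "g ((1 - s) *\<^sub>R a + s *\<^sub>R b) <= (1 - s) * g a + s * g b"
   unfolding g_def using convex_onD[OF assms(2), of s "x + a *\<^sub>R v" "x + b *\<^sub>R v"] s by simp
 qed auto
 have "- (g t - g 0 - g' 0 * t) <= 0" for t using convex_on_imp_above_tangent[OF cg, of 0 t "g' 0"] d[of 0] by simp
 then have "\<forall>\<^sub>F t in nhds 0. - (g t - g 0 - g' 0 * t) <= - (g 0 - g 0 - g' 0 * 0)" by (intro always_eventually) simp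
 moreover have "DERIV (%t. - (g t - g 0 - g' 0 * t)) t :> - (g' t - g' 0)" for t by (auto intro!: derivative_eq_intros d)
 moreover have "DERIV (%t. - (g' t - g' 0)) 0 :> - hess u (x + 0 *\<^sub>R v) v"
 proof -
  have "DERIV g' 0 :> hess u (x + 0 *\<^sub>R v) v" unfolding g'_def by (intro C2_line_derivs assms)
  then show ?thesis by (auto intro!: derivative_eq_intros)
 qed
 ultimately have "- hess u (x + 0 *\<^sub>R v) v <= 0" by (rule second_derivative_test(2)[where g = "%t. - (g t - g 0 - g' 0 * t)"])
 then show ?thesis by simp
qed

text \<open>
 The coefficient matrix splits into the tangential and the normal direction of the level line.
\<close>

lemma coefficient_split:
 fixes p :: "real^2"
 assumes "P = (p $ 1)^2 + (p $ 2)^2" "P > 0" "ss >= 0"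
 shows "(\<Sum>i\<in>UNIV. \<Sum>j\<in>UNIV. ((if i = j then 1 else 0) - p $ i * p $ j / (ss + P)) * partial j (partial i u) x)
  = (hess u x (vector [- p $ 2, p $ 1]) + ss / (ss + P) * hess u x p) / P"
proof -
 have sP: "ss + P ~= 0" "P ~= 0" using assms by auto
 define S where "S = ss + P"
 have S: "S ~= 0" "ss = S - P" using sP by (auto simp: S_def)
 define a b where "a = p $ 1" and "b = p $ 2"
 have P: "P = a^2 + b^2" using assms by (simp add: a_def b_def)
 define A B C D where "A = partial 1 (partial 1 u) x" and "B = partial 2 (partial 1 u) x"
  and "C = partial 1 (partial 2 u) x" and "D = partial 2 (partial 2 u) x"
 define l where "l = (1 - a * a / S) * A + (0 - a * b / S) * B + ((0 - b * a / S) * C + (1 - b * b / S) * D)"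
 define M where "M = b^2 * A - a * b * B - a * b * C + a^2 * D"
 define N where "N = a^2 * A + a * b * B + a * b * C + b^2 * D"
 have "S * l = (S - a * a) * A + (- a * b) * B + ((- b * a) * C + (S - b * b) * D)" using S(1) by (simp add: l_def field_simps)
 then have "P * (S * l) = S * M + (S - P) * N" unfolding P M_def N_def by algebra
 then have "l = (S * M + (S - P) * N) / (P * S)" using S(1) sP(2) by (simp add: nonzero_eq_divide_eq mult_ac)
 also have "\<dots> = (M + (S - P) / S * N) / P" using S(1) sP(2) by (simp add: add_divide_distrib)
 finally show ?thesis unfolding S(2) hess_def sum_2 A_def B_def C_def D_def a_def b_def l_def M_def N_def
  by (simp add: S_def power2_eq_square algebra_simps)
qed

lemma norm_vec2_sq: "(norm (p::real^2))^2 = (p $ 1)^2 + (p $ 2)^2" unfolding power2_norm_eq_inner by (simp add: inner_vec_def sum_2 power2_eq_square)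

lemma L_split:
 assumes "C2 u" "ss >= 0" "grad u x ~= 0"
 defines "p \<equiv> grad u x"
 shows "L aa ss u x = (ss + (norm p)^2) powr (1 / (2 * aa) - 1 / 2) *
  ((hess u x (vector [- p $ 2, p $ 1]) + ss / (ss + (norm p)^2) * hess u x p) / (norm p)^2)"
proof -
 have "L aa ss u x = (ss + (norm p)^2) powr (1 / (2 * aa) - 1 / 2) *
  (\<Sum>i\<in>UNIV. \<Sum>j\<in>UNIV. ((if i = j then 1 else 0) - p $ i * p $ j / (ss + (norm p)^2)) *
    partial j (partial i u) x)" using L_expanded[of u ss x aa] assms by (simp add: grad_def)
 also have "(\<Sum>i\<in>UNIV. \<Sum>j\<in>UNIV. ((if i = j then 1 else 0) - p $ i * p $ j / (ss + (norm p)^2)) *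
    partial j (partial i u) x) =
  (hess u x (vector [- p $ 2, p $ 1]) + ss / (ss + (norm p)^2) * hess u x p) / (norm p)^2"
  by (rule coefficient_split) (use assms in \<open>auto simp: norm_vec2_sq[symmetric]\<close>)
 finally show ?thesis .
qed

lemma radial_hess:
 fixes z :: "real^2"
 assumes "!!t. DERIV ps t :> ps' t" and "!!t. DERIV ps' t :> ps'' t"
  and "continuous_on UNIV ps''"
 shows "hess (%x. ps ((norm (x - z))^2)) x v =
  2 * ps' ((norm (x - z))^2) * (norm v)^2 + 4 * ps'' ((norm (x - z))^2) * ((x - z) \<bullet> v)^2"
 unfolding hess_def radial_derivatives[OF assms] norm_vec2_sq[of v] inner_vec_def sum_2 by (simp add: power2_eq_square algebra_simps)

lemma radial_grad:
 fixes z :: "real^2"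
 assumes "!!t. DERIV ps t :> ps' t" and "!!t. DERIV ps' t :> ps'' t"
  and "continuous_on UNIV ps''"
 shows "grad (%x. ps ((norm (x - z))^2)) x = (2 * ps' ((norm (x - z))^2)) *\<^sub>R (x - z)"
 by (simp add: vec_eq_iff grad_def radial_derivatives[OF assms])

lemma rot_vec2: "norm (vector [- p $ 2, p $ 1] :: real^2) = norm (p::real^2)"
 "p \<bullet> (vector [- p $ 2, p $ 1] :: real^2) = 0"
proof -
 have "(norm (vector [- p $ 2, p $ 1] :: real^2))^2 = (norm p)^2" by (simp add: norm_vec2_sq)
 then show "norm (vector [- p $ 2, p $ 1] :: real^2) = norm (p::real^2)" by (simp add: power2_eq_iff_nonneg)
qed (simp add: inner_vec_def sum_2)

text \<open>The Hessian of a radial function has the eigenvalue 2 * ps' along the circle and 2 * ps'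
  + 4 * q * ps'' along the radius; \<open>P\<close> is the squared length of the gradient.\<close>

lemma radial_L:
 fixes z :: "real^2"
 assumes d: "!!t. DERIV ps t :> ps' t" "!!t. DERIV ps' t :> ps'' t" "continuous_on UNIV ps''"
  and x: "x ~= z" "ps' ((norm (x - z))^2) ~= 0" and ss: "ss >= 0"
 defines "q \<equiv> (norm (x - z))\<^sup>2"
 defines "P \<equiv> 4 * (ps' q)^2 * q"
 shows "L aa ss (%x. ps ((norm (x - z))^2)) x = (ss + P) powr (1 / (2 * aa) - 1 / 2) *
  (2 * ps' q + (2 * ps' q + 4 * q * ps'' q) * (ss / (ss + P)))"
proof -
 define ph where "ph x = ps ((norm (x - z))^2)" for x
 define p where "p = grad ph x"
 have p: "p = (2 * ps' q) *\<^sub>R (x - z)" unfolding p_def ph_def q_def by (rule radial_grad[OF d])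
 have q0: "q > 0" using x by (simp add: q_def)
 have P: "(norm p)^2 = P" "P > 0" using x q0 by (auto simp: p P_def q_def power_mult_distrib)
 have perp: "(x - z) \<bullet> (vector [- p $ 2, p $ 1] :: real^2) = 0"
 proof -
  have "(2 * ps' q) *\<^sub>R ((x - z) \<bullet> (vector [- p $ 2, p $ 1] :: real^2)) = 0"
   using rot_vec2(2)[of p] p by (metis inner_scaleR_left real_scaleR_def)
  then show ?thesis using x by (simp add: q_def)
 qed
 have par: "((x - z) \<bullet> p)^2 = P * q" by (simp add: p P_def q_def power2_norm_eq_inner[symmetric] power_mult_distrib power2_eq_square)
 have h: "hess ph x v = 2 * ps' q * (norm v)^2 + 4 * ps'' q * ((x - z) \<bullet> v)^2" for v unfolding ph_def q_def by (rule radial_hess[OF d])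
 have "grad ph x ~= 0" using P by (auto simp: p_def)
 from L_split[OF _ ss this, of aa]
 have "L aa ss ph x = (ss + P) powr (1 / (2 * aa) - 1 / 2) *
  ((hess ph x (vector [- p $ 2, p $ 1]) + ss / (ss + P) * hess ph x p) / P)"
  using radial_derivatives(3)[OF d, of z] P by (simp add: p_def ph_def[abs_def])
 also have "(hess ph x (vector [- p $ 2, p $ 1]) + ss / (ss + P) * hess ph x p) / P
  = 2 * ps' q + (2 * ps' q + 4 * q * ps'' q) * (ss / (ss + P))"
 proof -
  define s where "s = ss / (ss + P)"
  show ?thesis unfolding h perp par rot_vec2(1) P(1) s_def[symmetric] using P(2) by (simp add: field_simps)
 qed
 finally show ?thesis by (simp add: ph_def[abs_def])
qed

lemma flat_power_derivs:
 assumes "m >= (2::nat)"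
 shows "DERIV (%t. B * t ^ m) t :> B * m * t ^ (m - 1)"
  and "DERIV (%t. B * m * t ^ (m - 1)) t :> B * m * real (m - 1) * t ^ (m - 2)"
  and "continuous_on UNIV (%t::real. B * m * real (m - 1) * t ^ (m - 2))"
proof -
 show "DERIV (%t. B * t ^ m) t :> B * m * t ^ (m - 1)" by (auto intro!: derivative_eq_intros)
 have "m - 1 - 1 = m - 2" by simp
 then show "DERIV (%t. B * m * t ^ (m - 1)) t :> B * m * real (m - 1) * t ^ (m - 2)"
  using assms by (auto intro!: derivative_eq_intros simp: of_nat_diff)
qed (intro continuous_intros)

text \<open>At a contact point the gradients agree and the Hessians are ordered. Contact from above
  compares both terms of \<open>L_split\<close>; contact from below compares the tangential one and
  discards the normal one of u, which is nonnegative by convexity. A flat contact from above leaves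
  a zero gradient and a nonpositive Hessian, hence L <= 0.\<close>

lemma classical_imp_convex_solution:
 assumes cl: "classical_solution aa ss u" and ss: "ss > 0" and cv: "convex_on UNIV u"
 shows "convex_solution aa ss u"
proof -
 have C: "C2 u" and Lu: "!!x. L aa ss u x = 1" using cl by (auto simp: classical_solution_def)
 have sub: "sub_test aa ss u" unfolding sub_test_def Let_def
 proof (intro allI impI, elim conjE)
  fix ps ps' ps'' :: "real => real" and z x1 :: "real^2"
  assume d: "\<forall>t. DERIV ps t :> ps' t" "\<forall>t. DERIV ps' t :> ps'' t" "continuous_on UNIV ps''"
   and x: "x1 ~= z" "ps' ((norm (x1 - z))^2) > 0"
   and ev: "\<forall>\<^sub>F x in nhds x1. u x - ps ((norm (x - z))^2) <= u x1 - ps ((norm (x1 - z))^2)"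
  define ph where "ph x = ps ((norm (x - z))^2)" for x
  have Cph: "C2 ph" unfolding ph_def[abs_def] using d by (intro radial_derivatives(3)) auto
  note mx = C2_local_max[OF C Cph, of x1, unfolded ph_def, OF ev, folded ph_def]
  have g: "grad u x1 = grad ph x1" by (simp add: grad_def mx)
  have gp: "grad ph x1 = (2 * ps' ((norm (x1 - z))^2)) *\<^sub>R (x1 - z)" unfolding ph_def[abs_def] using d by (intro radial_grad) auto
  then have g0: "grad ph x1 ~= 0" using x by auto
  have "1 <= L aa ss ph x1" unfolding Lu[of x1, symmetric]
   using C Cph ss g0 mx(2) by (auto simp: L_split g intro!: mult_left_mono divide_right_mono add_mono)
  also have "L aa ss ph x1 = (ss + 4 * (ps' ((norm (x1 - z))^2))^2 * (norm (x1 - z))^2) powr (1 / (2 * aa) - 1 / 2) *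
     (2 * ps' ((norm (x1 - z))^2) +
     (2 * ps' ((norm (x1 - z))^2) + 4 * (norm (x1 - z))^2 * ps'' ((norm (x1 - z))^2)) *
     (ss / (ss + 4 * (ps' ((norm (x1 - z))^2))^2 * (norm (x1 - z))^2)))" unfolding ph_def[abs_def] using d x ss by (intro radial_L) auto
  finally show "1 <= (ss + 4 * (ps' ((norm (x1 - z))^2))^2 * (norm (x1 - z))^2) powr (1 / (2 * aa) - 1 / 2) *
     (2 * ps' ((norm (x1 - z))^2) +
     (2 * ps' ((norm (x1 - z))^2) + 4 * (norm (x1 - z))^2 * ps'' ((norm (x1 - z))^2)) *
     (ss / (ss + 4 * (ps' ((norm (x1 - z))^2))^2 * (norm (x1 - z))^2)))" .
 qed
 have super: "super_test aa ss u" unfolding super_test_def Let_def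
 proof (intro allI impI, elim conjE)
  fix ps ps' ps'' :: "real => real" and z x1 :: "real^2"
  assume d: "\<forall>t. DERIV ps t :> ps' t" "\<forall>t. DERIV ps' t :> ps'' t" "continuous_on UNIV ps''"
   and x: "x1 ~= z" "ps' ((norm (x1 - z))^2) > 0"
   and ev: "\<forall>\<^sub>F x in nhds x1. u x - ps ((norm (x - z))^2) >= u x1 - ps ((norm (x1 - z))^2)"
  define ph where "ph x = ps ((norm (x - z))^2)" for x
  have Cph: "C2 ph" unfolding ph_def[abs_def] using d by (intro radial_derivatives(3)) auto
  have "\<forall>\<^sub>F x in nhds x1. ph x - u x <= ph x1 - u x1" using ev by eventually_elim (simp add: ph_def)
  note mx = C2_local_max[OF Cph C, OF this]
  define q where "q = (norm (x1 - z))^2"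
  define p where "p = grad u x1"
  have "grad ph x1 = (2 * ps' q) *\<^sub>R (x1 - z)" unfolding ph_def[abs_def] q_def using d by (intro radial_grad) auto
  then have p: "p = (2 * ps' q) *\<^sub>R (x1 - z)" by (simp add: p_def grad_def mx)
  have P: "(norm p)^2 = 4 * (ps' q)^2 * q" "(norm p)^2 > 0" using x by (auto simp: p q_def power_mult_distrib)
  have "grad u x1 ~= 0" using P by (auto simp: p_def)
  from L_split[OF C _ this, of ss aa] Lu[of x1] ss
  have 1: "1 = (ss + (norm p)^2) powr (1 / (2 * aa) - 1 / 2) *
   ((hess u x1 (vector [- p $ 2, p $ 1]) + ss / (ss + (norm p)^2) * hess u x1 p) / (norm p)^2)" by (simp add: p_def)
  have "2 * ps' q * (norm p)^2 <= hess ph x1 (vector [- p $ 2, p $ 1])"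
  proof -
   have "(x1 - z) \<bullet> (vector [- p $ 2, p $ 1] :: real^2) = 0"
   proof -
    have "(2 * ps' q) *\<^sub>R ((x1 - z) \<bullet> (vector [- p $ 2, p $ 1] :: real^2)) = 0"
     using rot_vec2(2)[of p] p by (metis inner_scaleR_left real_scaleR_def)
    then show ?thesis using x by (simp add: q_def)
   qed
   moreover have "hess ph x1 (vector [- p $ 2, p $ 1]) =
    2 * ps' q * (norm (vector [- p $ 2, p $ 1] :: real^2))^2
     + 4 * ps'' q * ((x1 - z) \<bullet> (vector [- p $ 2, p $ 1]))^2" unfolding ph_def[abs_def] q_def using d by (intro radial_hess) auto
   ultimately show ?thesis by (simp add: rot_vec2)
  qed
  also have "\<dots> <= hess u x1 (vector [- p $ 2, p $ 1])" by (rule mx(2))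
  also have "\<dots> <= hess u x1 (vector [- p $ 2, p $ 1]) + ss / (ss + (norm p)^2) * hess u x1 p" using C2_convex_hess_nonneg[OF C cv] ss by simp
  finally have "2 * ps' q <= (hess u x1 (vector [- p $ 2, p $ 1]) + ss / (ss + (norm p)^2) * hess u x1 p) / (norm p)^2"
   using P(2) by (simp add: pos_le_divide_eq)
  then have "(ss + (norm p)^2) powr (1 / (2 * aa) - 1 / 2) * (2 * ps' q) <= 1" by (subst 1) (intro mult_left_mono, auto)
  then show "(ss + 4 * (ps' ((norm (x1 - z))^2))^2 * (norm (x1 - z))^2) powr (1 / (2 * aa) - 1 / 2) *
   (2 * ps' ((norm (x1 - z))^2)) <= 1" unfolding P by (simp add: q_def)
 qed
 have flat: "nonflat aa u" unfolding nonflat_def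
 proof (intro allI impI notI)
  fix z :: "real^2" and B :: real
  assume B: "B >= 0" and ev: "\<forall>\<^sub>F x in nhds z. u x <= u z + B * ((norm (x - z))^2) ^ flat_order aa"
  define m where "m = flat_order aa"
  have m: "m >= 2" by (simp add: m_def flat_order_def)
  define ph where "ph x = B * ((norm (x - z))^2) ^ m" for x
  have phz: "ph z = 0" using m by (simp add: ph_def power_0_left)
  note d = flat_power_derivs[OF m, of B]
  have Cph: "C2 ph" unfolding ph_def[abs_def] by (rule radial_derivatives(3)[OF d])
  have "\<forall>\<^sub>F x in nhds z. u x - ph x <= u z - ph z" unfolding phz using ev by (auto simp: ph_def m_def elim!: eventually_mono)
  note mx = C2_local_max[OF C Cph, OF this]
  have "grad ph z = 0" unfolding ph_def[abs_def] by (subst radial_grad[OF d]) simp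
  then have "partial i ph z = 0" for i by (metis grad_def vec_lambda_beta zero_index)
  then have g: "partial i u z = 0" for i using mx by simp
  then have g0: "grad u z = 0" by (simp add: grad_def vec_eq_iff)
  have h: "hess u z v <= 0" for v
  proof -
   have "hess ph z v = 0" unfolding ph_def[abs_def] using m by (subst radial_hess[OF d]) simp
   then show ?thesis using mx(2)[of v] by simp
  qed
  have "(\<Sum>i\<in>UNIV. \<Sum>j\<in>UNIV. ((if i = j then 1 else 0) - partial i u z * partial j u z / (ss + (norm (grad u z))^2)) *
    partial j (partial i u) z) = hess u z (axis 1 1) + hess u z (axis 2 1)" by (simp add: g hess_def sum_2 axis_def)
  also have "\<dots> <= 0" using h[of "axis 1 1"] h[of "axis 2 1"] by simp
  finally have "L aa ss u z <= 0" using L_expanded[OF C, of ss z aa] ss by (simp add: mult_nonneg_nonpos)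
  then show False using Lu[of z] by simp
 qed
 show ?thesis using sub super flat cv by (simp add: convex_solution_def)
qed

lemma flat_profile_power:
 assumes aa: "aa > 0" and B: "B > 0"
 shows "flat_profile aa (%r. B * (r^2) ^ flat_order aa)"
proof -
 define m where "m = flat_order aa"
 have m: "m >= 2" by (simp add: m_def flat_order_def)
 have maa: "real m >= aa + 2" using aa by (simp add: m_def flat_order_def)
 define f where "f r = B * r ^ (2 * m)" for r :: real
 define f' where "f' r = B * (2 * m) * r ^ (2 * m - 1)" for r :: real
 define f'' where "f'' r = B * (2 * m) * (2 * m - 1) * r ^ (2 * m - 2)" for r :: real
 have "2 * m >= 2" using m by simp
 note e = flat_power_derivs[OF this, of B]
 have 1: "DERIV f r :> f' r" "DERIV f' r :> f'' r" "continuous_on UNIV f''" for r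
  using e by (simp_all add: f_def[abs_def] f'_def[abs_def] f''_def[abs_def])
 have "(\<forall>r\<ge>0. (f has_real_derivative f' r) (at r within {0..})) &
    (\<forall>r\<ge>0. (f' has_real_derivative f'' r) (at r within {0..})) &
    continuous_on {0..} f'' & f 0 = 0 & f' 0 = 0 & f'' 0 = 0 & (\<forall>r>0. f'' r > 0)"
 proof (intro conjI allI impI)
  show "(f has_real_derivative f' r) (at r within {0..})" "(f' has_real_derivative f'' r) (at r within {0..})" for r using 1 DERIV_subset by blast+
  show "continuous_on {0..} f''" using 1(3) continuous_on_subset by blast
  show "f'' r > 0" if "r > 0" for r using that B m by (simp add: f''_def)
 qed (use m in \<open>auto simp: f_def f'_def f''_def\<close>)
 moreover have "((%x. L aa 0 (%y::real^2. B * ((norm y)^2) ^ m) x) \<longlongrightarrow> 0) (at 0)"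
 proof -
  define gm where "gm = 1 / (2 * aa) - 1 / 2"
  define C where "C = (4 * (B * m)^2) powr gm * (2 * (B * m))"
  define k where "k = (2 * real m - 1) / aa - 1"
  have "k > 0" using maa aa by (simp add: k_def field_simps)
  have "((%x. C * norm (x::real^2) powr k) \<longlongrightarrow> C * 0) (at 0)" using \<open>k > 0\<close>
   by (intro tendsto_mult tendsto_const tendsto_zero_powrI[where b = k] tendsto_norm_zero tendsto_ident_at) auto
  moreover have "\<forall>\<^sub>F x in at (0::real^2). C * norm x powr k = L aa 0 (%y::real^2. B * ((norm y)^2) ^ m) x"
   unfolding eventually_at_filter
  proof (intro always_eventually allI impI)
   fix x :: "real^2" assume x: "x ~= 0"
   define r where "r = norm x"
   have r: "r > 0" using x by (simp add: r_def)
   define b where "b = B * m * (r^2) ^ (m - 1)"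
   have b: "b > 0" using B m r by (simp add: b_def)
   have "L aa 0 (%y::real^2. B * ((norm (y - 0))^2) ^ m) x =
    (0 + 4 * b^2 * r^2) powr (1 / (2 * aa) - 1 / 2) * (2 * b + (2 * b + 4 * r^2 * (B * m * real (m - 1) * (r^2) ^ (m - 2))) * (0 / (0 + 4 * b^2 * r^2)))"
    using radial_L[OF flat_power_derivs[OF m, of B], of x 0 0 aa] x b B m by (simp add: r_def b_def)
   also have "\<dots> = (4 * b^2 * r^2) powr gm * (2 * b)" by (simp add: gm_def)
   also have "\<dots> = C * norm x powr k"
   proof -
    have br: "b = (B * m) * r powr (2 * (real m - 1))"
    proof -
     have "(r^2) ^ (m - 1) = r ^ (2 * (m - 1))" by (simp only: power_mult)
     also have "\<dots> = r powr (real (2 * (m - 1)))" using r by (rule powr_realpow[symmetric])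
     finally show ?thesis using m by (simp add: b_def of_nat_diff)
    qed
    have "4 * b^2 * r^2 = 4 * (B * m)^2 * r powr (2 * (2 * real m - 1))"
    proof -
     have "(r powr (2 * (real m - 1)))^2 * r^2 = r powr (2 * (2 * real m - 1))"
     proof -
      have "2 * (2 * real m - 1) = 2 * (real m - 1) + (2 * (real m - 1) + 2)" by simp
      then have "r powr (2 * (2 * real m - 1)) = r powr (2 * (real m - 1)) * (r powr (2 * (real m - 1)) * r powr 2)" by (simp only: powr_add)
      then show ?thesis using r by (simp add: power2_eq_square)
     qed
     then show ?thesis by (simp add: br power_mult_distrib)
    qed
    then have "(4 * b^2 * r^2) powr gm = (4 * (B * m)^2) powr gm * r powr (2 * (2 * real m - 1) * gm)"
     using B m r by (simp only: powr_mult powr_powr mult_nonneg_nonneg zero_le_power2 powr_ge_zero) 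
    then have "(4 * b^2 * r^2) powr gm * (2 * b) = C * (r powr (2 * (2 * real m - 1) * gm) * r powr (2 * (real m - 1)))" by (simp add: br C_def)
    also have "r powr (2 * (2 * real m - 1) * gm) * r powr (2 * (real m - 1)) = r powr k"
    proof -
     have "2 * (2 * real m - 1) * gm + 2 * (real m - 1) = k" using aa by (simp add: gm_def k_def field_simps)
     then show ?thesis by (simp add: powr_add[symmetric])
    qed
    finally show ?thesis by (simp add: r_def)
   qed
   finally show "C * norm x powr k = L aa 0 (%y::real^2. B * ((norm y)^2) ^ m) x" by simp
  qed
  ultimately show ?thesis using Lim_transform_eventually by fastforce
 qed
 ultimately show ?thesis unfolding flat_profile_def f_def[abs_def] m_def by (auto simp: power_mult)
qed

text \<open>The radial tests have a nonzero gradient at the contact point and are admissible for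
  that reason; the flat powers are admissible through \<open>flat_profile_power\<close>, and the
  operator has the value 0 on them.\<close>

lemma viscosity_imp_convex_solution:
 assumes vs: "viscosity_solution aa u" and aa: "aa > 0" and cv: "convex_on UNIV u"
 shows "convex_solution aa 0 u"
proof -
 have gen: "admissible aa (%x. ps ((norm (x - z))^2)) x1 &
  L0_test aa (%x. ps ((norm (x - z))^2)) x1 =
   (0 + 4 * (ps' ((norm (x1 - z))^2))^2 * (norm (x1 - z))^2) powr (1 / (2 * aa) - 1 / 2) * (2 * ps' ((norm (x1 - z))^2))"
  if d: "\<forall>t. DERIV ps t :> ps' t" "\<forall>t. DERIV ps' t :> ps'' t" "continuous_on UNIV ps''"
   and x: "x1 ~= z" "ps' ((norm (x1 - z))^2) > 0"
  for ps ps' ps'' :: "real => real" and z x1 :: "real^2"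
 proof -
  have Cph: "C2 (%x. ps ((norm (x - z))^2))" using d by (intro radial_derivatives(3)) auto
  have "grad (%x. ps ((norm (x - z))^2)) x1 = (2 * ps' ((norm (x1 - z))^2)) *\<^sub>R (x1 - z)" using d by (intro radial_grad) auto
  then have g0: "grad (%x. ps ((norm (x - z))^2)) x1 ~= 0" using x by auto
  show ?thesis using Cph g0 radial_L[of ps ps' ps'' x1 z 0 aa] d x by (simp add: admissible_def L0_test_def)
 qed
 have sub: "sub_test aa 0 u" unfolding sub_test_def Let_def
 proof (intro allI impI, elim conjE)
  fix ps ps' ps'' :: "real => real" and z x1 :: "real^2"
  assume a: "\<forall>t. DERIV ps t :> ps' t" "\<forall>t. DERIV ps' t :> ps'' t" "continuous_on UNIV ps''"
   "x1 ~= z" "ps' ((norm (x1 - z))^2) > 0"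
   and ev: "\<forall>\<^sub>F x in nhds x1. u x - ps ((norm (x - z))^2) <= u x1 - ps ((norm (x1 - z))^2)"
  have "L0_test aa (%x. ps ((norm (x - z))^2)) x1 >= 1" using vs gen[OF a] ev unfolding viscosity_solution_def viscosity_subsolution_def by blast
  then show "1 <= (0 + 4 * (ps' ((norm (x1 - z))^2))^2 * (norm (x1 - z))^2) powr (1 / (2 * aa) - 1 / 2) *
     (2 * ps' ((norm (x1 - z))^2) +
     (2 * ps' ((norm (x1 - z))^2) + 4 * (norm (x1 - z))^2 * ps'' ((norm (x1 - z))^2)) *
     (0 / (0 + 4 * (ps' ((norm (x1 - z))^2))^2 * (norm (x1 - z))^2)))" using gen[OF a] by simp
 qed
 have super: "super_test aa 0 u" unfolding super_test_def Let_def
 proof (intro allI impI, elim conjE)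
  fix ps ps' ps'' :: "real => real" and z x1 :: "real^2"
  assume a: "\<forall>t. DERIV ps t :> ps' t" "\<forall>t. DERIV ps' t :> ps'' t" "continuous_on UNIV ps''"
   "x1 ~= z" "ps' ((norm (x1 - z))^2) > 0"
   and ev: "\<forall>\<^sub>F x in nhds x1. u x - ps ((norm (x - z))^2) >= u x1 - ps ((norm (x1 - z))^2)"
  have "L0_test aa (%x. ps ((norm (x - z))^2)) x1 <= 1" using vs gen[OF a] ev unfolding viscosity_solution_def viscosity_supersolution_def by blast
  then show "(0 + 4 * (ps' ((norm (x1 - z))^2))^2 * (norm (x1 - z))^2) powr (1 / (2 * aa) - 1 / 2) *
   (2 * ps' ((norm (x1 - z))^2)) <= 1" using gen[OF a] by simp
 qed
 have flat: "nonflat aa u" unfolding nonflat_def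
 proof (intro allI impI notI)
  fix z :: "real^2" and B :: real
  assume B: "B >= 0" and ev: "\<forall>\<^sub>F x in nhds z. u x <= u z + B * ((norm (x - z))^2) ^ flat_order aa"
  define m where "m = flat_order aa"
  have m: "m >= 2" by (simp add: m_def flat_order_def)
  define ph where "ph x = B * ((norm (x - z))^2) ^ m" for x
  have phz: "ph z = 0" using m by (simp add: ph_def power_0_left)
  note d = flat_power_derivs[OF m, of B]
  have Cph: "C2 ph" unfolding ph_def[abs_def] by (rule radial_derivatives(3)[OF d])
  have g0: "grad ph z = 0" unfolding ph_def[abs_def] by (subst radial_grad[OF d]) simp
  \<comment> \<open>B + 1 instead of B, since a profile is strictly convex and B may be 0.\<close>
  have "flat_profile aa (%r. (B + 1) * (r^2) ^ m)" unfolding m_def using flat_profile_power[OF aa, of "B + 1"] B by simp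
  moreover have "\<forall>\<^sub>F x in nhds z. \<bar>ph x - ph z\<bar> <= (B + 1) * ((norm (x - z))^2) ^ m"
   unfolding phz using B by (intro always_eventually allI) (simp add: ph_def abs_mult mult_right_mono)
  ultimately have "admissible aa ph z" unfolding admissible_def using Cph by blast
  moreover have "\<forall>\<^sub>F x in nhds z. u x - ph x <= u z - ph z" unfolding phz using ev by (auto simp: ph_def m_def elim!: eventually_mono)
  ultimately have "L0_test aa ph z >= 1" using vs unfolding viscosity_solution_def viscosity_subsolution_def by blast
  then show False using g0 by (simp add: L0_test_def)
 qed
 show ?thesis using sub super flat cv by (simp add: convex_solution_def)
qed

subsection \<open>Similarity invariance\<close>

definition rot2 :: "real => real^2 => real^2" where
 "rot2 om x = vector [cos om * x $ 1 - sin om * x $ 2, sin om * x $ 1 + cos om * x $ 2]"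

lemma rot2_linear: "rot2 om (x - y) = rot2 om x - rot2 om y" "rot2 om (x + y) = rot2 om x + rot2 om y"
 "rot2 om (c *\<^sub>R x) = c *\<^sub>R rot2 om x" by (simp_all add: rot2_def vec_eq_iff forall_2 algebra_simps)

lemma rot2_inverse [simp]: "rot2 (- om) (rot2 om x) = x" "rot2 om (rot2 (- om) x) = x"
proof -
 have *: "cos om * (cos om * t) + sin om * (sin om * t) = t" for t
 proof -
  have "cos om * (cos om * t) + sin om * (sin om * t) = ((sin om)^2 + (cos om)^2) * t" by algebra
  then show ?thesis by simp
 qed
 show "rot2 (- om) (rot2 om x) = x" "rot2 om (rot2 (- om) x) = x"
  using *[of "x $ 1"] *[of "x $ 2"] by (simp_all add: rot2_def vec_eq_iff forall_2 algebra_simps)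
qed

lemma norm_rot2 [simp]: "norm (rot2 om x) = norm x"
proof -
 have *: "(c * a - s * b)^2 + (s * a + c * b)^2 = (s^2 + c^2) * (a^2 + b^2)" for a b c s :: real by algebra
 have "(norm (rot2 om x))^2 = ((sin om)^2 + (cos om)^2) * ((x $ 1)^2 + (x $ 2)^2)" unfolding norm_vec2_sq *[symmetric] by (simp add: rot2_def)
 then have "(norm (rot2 om x))^2 = (norm x)^2" by (simp add: norm_vec2_sq)
 then show ?thesis by (simp add: power2_eq_iff_nonneg)
qed

lemma continuous_rot2: "continuous_on UNIV (rot2 om)"
proof -
 have "rot2 om = (%x. x $ 1 *\<^sub>R vector [cos om, sin om] + x $ 2 *\<^sub>R vector [- sin om, cos om])"
  by (simp add: rot2_def fun_eq_iff vec_eq_iff forall_2)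
 moreover have "continuous_on UNIV (%x. x $ 1 *\<^sub>R vector [cos om, sin om] + x $ 2 *\<^sub>R (vector [- sin om, cos om] :: real^2))"
  by (intro continuous_intros)
 ultimately show ?thesis by simp
qed

definition similar :: "real^2 => real => real => real^2 => real^2" where
 "similar x0 mu om x = x0 + mu *\<^sub>R rot2 om x"

lemma similar_dist: "mu > 0 ==> norm (similar x0 mu om x - similar x0 mu om z) = mu * norm (x - z)"
 by (simp add: similar_def scaleR_diff_right[symmetric] rot2_linear(1)[symmetric])

lemma eventually_similar:
 assumes "mu > 0" and ev: "\<forall>\<^sub>F x in nhds x1. Q (similar x0 mu om x)"
 shows "\<forall>\<^sub>F y in nhds (similar x0 mu om x1). Q y"
proof -
 define S where "S y = (1 / mu) *\<^sub>R rot2 (- om) (y - x0)" for y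
 have TS: "similar x0 mu om (S y) = y" "S (similar x0 mu om x) = x" for x y using assms(1) by (simp_all add: similar_def S_def rot2_linear)
 have "continuous_on UNIV S" unfolding S_def by (intro continuous_intros continuous_on_compose2[OF continuous_rot2]) auto
 then have "isCont S (similar x0 mu om x1)" by (simp add: continuous_on_eq_continuous_at)
 then have "filterlim S (nhds (S (similar x0 mu om x1))) (nhds (similar x0 mu om x1))"
  by (metis continuous_at_imp_continuous_on isCont_def tendsto_at_iff_tendsto_nhds)
 then have "filterlim S (nhds x1) (nhds (similar x0 mu om x1))" by (simp add: TS)
 from filterlim_iff[THEN iffD1, OF this, rule_format, OF ev] show ?thesis by (simp add: TS)
qed

text \<open>The rescaling divides gradients by mu powr aa, hence ss by the square of this. The
  degree 1 + aa is the one for which all powers of mu cancel in the operator (\<open>fac\<close>),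
  so that the right-hand side 1 is kept.\<close>

lemma convex_solution_similar:
 assumes u: "convex_solution aa ss u" and mu: "mu > 0" and aa: "aa > 0" and sg: "ss >= 0"
 shows "convex_solution aa (ss / (mu powr aa)^2) (%x. (u (similar x0 mu om x) - k) / mu powr (1 + aa))"
proof -
 define l where "l = mu powr (1 + aa)"
 define T where "T = similar x0 mu om"
 define v where "v x = (u (T x) - k) / l" for x
 define ss' where "ss' = ss / (mu powr aa)^2"
 define gm where "gm = 1 / (2 * aa) - 1 / 2"
 have l: "l > 0" using mu by (simp add: l_def)
 have lmu: "l / mu = mu powr aa" using mu by (simp add: l_def powr_add)
 have ss: "ss = (l / mu)^2 * ss'" using mu by (simp add: ss'_def lmu)
 have uv: "u (T x) = l * v x + k" for x using l by (simp add: v_def)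
 have dist: "(norm (T x - T z))^2 / mu^2 = (norm (x - z))^2" for x z using mu by (simp add: T_def similar_dist power_mult_distrib)
 have dist': "(norm (T x - T z))^2 = mu^2 * (norm (x - z))^2" for x z using mu by (simp add: T_def similar_dist power_mult_distrib)
 have cancel: "mu^2 * t / mu^2 = t" for t using mu by simp
 have fac: "((l / mu)^2) powr gm * (l / mu^2) = 1"
 proof -
  have "((l / mu)^2) powr gm = mu powr (1 - aa)"
  proof -
   have "(mu powr aa)^2 = mu powr (2 * aa)" using mu by (simp add: power2_eq_square powr_add[symmetric])
   moreover have "2 * aa * gm = 1 - aa" using aa by (simp add: gm_def field_simps)
   ultimately show ?thesis by (simp add: lmu powr_powr)
  qed
  moreover have "l / mu^2 = mu powr (aa - 1)" using mu by (simp add: l_def powr_add powr_diff power2_eq_square)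
  ultimately show ?thesis using mu by (simp add: powr_add[symmetric])
 qed
 have scaleP: "(ss + (l / mu)^2 * P) powr gm * (l / mu^2 * y) = (ss' + P) powr gm * y"
  "ss / (ss + (l / mu)^2 * P) = ss' / (ss' + P)" if "ss' + P >= 0" for P y
 proof -
  have e: "ss + (l / mu)^2 * P = (l / mu)^2 * (ss' + P)" by (simp add: ss algebra_simps)
  have "(ss + (l / mu)^2 * P) powr gm = ((l / mu)^2) powr gm * (ss' + P) powr gm" unfolding e by (rule powr_mult)
  then have "(ss + (l / mu)^2 * P) powr gm * (l / mu^2 * y)
   = (((l / mu)^2) powr gm * (l / mu^2)) * ((ss' + P) powr gm * y)" by (simp only: mult_ac)
  then show "(ss + (l / mu)^2 * P) powr gm * (l / mu^2 * y) = (ss' + P) powr gm * y" by (simp only: fac mult_1)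
  show "ss / (ss + (l / mu)^2 * P) = ss' / (ss' + P)" unfolding e using l mu by (subst ss) simp
 qed
 have derivs: "(\<forall>t. DERIV (%t. l * ps (t / mu^2)) t :> l / mu^2 * ps' (t / mu^2)) &
   (\<forall>t. DERIV (%t. l / mu^2 * ps' (t / mu^2)) t :> l / mu^2 * (ps'' (t / mu^2) / mu^2)) &
   continuous_on UNIV (%t. l / mu^2 * (ps'' (t / mu^2) / mu^2))"
  if "\<forall>t. DERIV ps t :> ps' t" "\<forall>t. DERIV ps' t :> ps'' t" "continuous_on UNIV ps''" for ps ps' ps''
 proof (intro conjI allI)
  have c: "((%t. g (t / mu^2)) has_real_derivative g' (t / mu^2) * (1 / mu^2)) (at t)"
   if "\<forall>t. DERIV g t :> g' t" for g g' and t
  proof -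
   have "((%t. t / mu^2) has_real_derivative 1 / mu^2) (at t)" using DERIV_cdivide[OF DERIV_ident, of "mu^2"] by simp
   then show ?thesis using that by (intro DERIV_chain2[of g]) auto
  qed
  show "DERIV (%t. l * ps (t / mu^2)) t :> l / mu^2 * ps' (t / mu^2)" for t using DERIV_cmult[OF c[OF that(1)], of l] by (simp add: mult_ac)
  show "DERIV (%t. l / mu^2 * ps' (t / mu^2)) t :> l / mu^2 * (ps'' (t / mu^2) / mu^2)" for t
   using DERIV_cmult[OF c[OF that(2)], of "l / mu^2"] by (simp add: mult_ac)
  show "continuous_on UNIV (%t. l / mu^2 * (ps'' (t / mu^2) / mu^2))" using mu by (intro continuous_intros continuous_on_compose2[OF that(3)]) auto
 qed
 have ss0: "ss' + 4 * (a::real)^2 * (norm (x::real^2))^2 >= 0" for a x using sg by (simp add: ss'_def)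
 have Peq: "4 * (l / mu^2 * a)^2 * (mu^2 * q) = (l / mu)^2 * (4 * a^2 * q)" for a q using mu by (simp add: power2_eq_square field_simps)
 have ne: "T x1 ~= T z" if "x1 ~= z" for x1 z using dist'[of x1 z] that mu by auto
 have cT: "T ((1 - t) *\<^sub>R x + t *\<^sub>R y) = (1 - t) *\<^sub>R T x + t *\<^sub>R T y" for t x y
  by (simp add: T_def similar_def rot2_linear algebra_simps)
 have "convex_on UNIV v"
 proof (rule convex_onI)
  fix t :: real and x y :: "real^2" assume t: "0 < t" "t < 1"
  have "convex_on UNIV u" using u by (simp add: convex_solution_def)
  from convex_onD[OF this, of t "T x" "T y"] t
  have "u (T ((1 - t) *\<^sub>R x + t *\<^sub>R y)) <= (1 - t) * u (T x) + t * u (T y)" by (simp add: cT)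
  then have "l * v ((1 - t) *\<^sub>R x + t *\<^sub>R y) <= l * ((1 - t) * v x + t * v y)" unfolding uv by (simp add: algebra_simps)
  then show "v ((1 - t) *\<^sub>R x + t *\<^sub>R y) <= (1 - t) * v x + t * v y" using l by simp
 qed auto
 moreover have "sub_test aa ss' v" unfolding sub_test_def Let_def
 proof (intro allI impI, elim conjE)
  fix ps ps' ps'' :: "real => real" and z x1 :: "real^2"
  assume d: "\<forall>t. DERIV ps t :> ps' t" "\<forall>t. DERIV ps' t :> ps'' t" "continuous_on UNIV ps''"
   and x: "x1 ~= z" "ps' ((norm (x1 - z))^2) > 0"
   and ev: "\<forall>\<^sub>F x in nhds x1. v x - ps ((norm (x - z))^2) <= v x1 - ps ((norm (x1 - z))^2)"
  have "\<forall>\<^sub>F y in nhds (T x1). u y - l * ps ((norm (y - T z))^2 / mu^2) <= u (T x1) - l * ps ((norm (T x1 - T z))^2 / mu^2)"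
   unfolding T_def
  proof (rule eventually_similar[OF mu], fold T_def, rule eventually_mono[OF ev])
   fix x assume "v x - ps ((norm (x - z))^2) <= v x1 - ps ((norm (x1 - z))^2)"
   then have "l * (v x - ps ((norm (x - z))^2)) <= l * (v x1 - ps ((norm (x1 - z))^2))" using l by simp
   then show "u (T x) - l * ps ((norm (T x - T z))^2 / mu^2) <= u (T x1) - l * ps ((norm (T x1 - T z))^2 / mu^2)"
    unfolding dist uv by (simp add: algebra_simps)
  qed
  with u[unfolded convex_solution_def sub_test_def Let_def, THEN conjunct2, THEN conjunct1, rule_format,
    of "%t. l * ps (t / mu^2)" "%t. l / mu^2 * ps' (t / mu^2)" "%t. l / mu^2 * (ps'' (t / mu^2) / mu^2)" "T x1" "T z"]
   derivs[OF d] ne[OF x(1)] x(2) l mu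
  have *: "1 <= (ss + 4 * (l / mu^2 * ps' ((norm (x1 - z))^2))^2 * (mu^2 * (norm (x1 - z))^2)) powr (1 / (2 * aa) - 1 / 2) *
   (2 * (l / mu^2 * ps' ((norm (x1 - z))^2)) +
   (2 * (l / mu^2 * ps' ((norm (x1 - z))^2)) + 4 * (mu^2 * (norm (x1 - z))^2) * (l / mu^2 * (ps'' ((norm (x1 - z))^2) / mu^2))) *
   (ss / (ss + 4 * (l / mu^2 * ps' ((norm (x1 - z))^2))^2 * (mu^2 * (norm (x1 - z))^2))))"
   unfolding dist' cancel by (simp only: mult_pos_pos divide_pos_pos zero_less_power simp_thms)
  define q where "q = (norm (x1 - z))^2"
  define a b where "a = ps' q" and "b = ps'' q"
  have e1: "4 * (mu^2 * q) * (l / mu^2 * (b / mu^2)) = l / mu^2 * (4 * q * b)"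
  proof -
   have gen: "4 * (m * q) * (l / m * (b / m)) = l / m * (4 * q * b)" if "m ~= 0" for m using that by (simp add: field_simps)
   show ?thesis by (rule gen) (use mu in simp)
  qed
  have e2: "2 * (m * a) + (2 * (m * a) + m * (4 * q * b)) * s = m * (2 * a + (2 * a + 4 * q * b) * s)" for s m by algebra
  from * have "1 <= (ss + (l / mu)^2 * (4 * a^2 * q)) powr gm *
   (l / mu^2 * (2 * a + (2 * a + 4 * q * b) * (ss / (ss + (l / mu)^2 * (4 * a^2 * q)))))"
   unfolding q_def[symmetric] a_def[symmetric] b_def[symmetric] Peq gm_def[symmetric] e1 e2 .
  then have "1 <= (ss' + 4 * a^2 * q) powr gm * (2 * a + (2 * a + 4 * q * b) * (ss' / (ss' + 4 * a^2 * q)))"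
   using scaleP[OF ss0[of a "x1 - z"], folded q_def] by simp
  then show "1 <= (ss' + 4 * (ps' ((norm (x1 - z))^2))^2 * (norm (x1 - z))^2) powr (1 / (2 * aa) - 1 / 2) *
     (2 * ps' ((norm (x1 - z))^2) +
     (2 * ps' ((norm (x1 - z))^2) + 4 * (norm (x1 - z))^2 * ps'' ((norm (x1 - z))^2)) *
     (ss' / (ss' + 4 * (ps' ((norm (x1 - z))^2))^2 * (norm (x1 - z))^2)))" by (simp add: a_def b_def q_def gm_def)
 qed
 moreover have "super_test aa ss' v" unfolding super_test_def Let_def
 proof (intro allI impI, elim conjE)
  fix ps ps' ps'' :: "real => real" and z x1 :: "real^2"
  assume d: "\<forall>t. DERIV ps t :> ps' t" "\<forall>t. DERIV ps' t :> ps'' t" "continuous_on UNIV ps''"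
   and x: "x1 ~= z" "ps' ((norm (x1 - z))^2) > 0"
   and ev: "\<forall>\<^sub>F x in nhds x1. v x - ps ((norm (x - z))^2) >= v x1 - ps ((norm (x1 - z))^2)"
  have "\<forall>\<^sub>F y in nhds (T x1). u y - l * ps ((norm (y - T z))^2 / mu^2) >= u (T x1) - l * ps ((norm (T x1 - T z))^2 / mu^2)"
   unfolding T_def
  proof (rule eventually_similar[OF mu], fold T_def, rule eventually_mono[OF ev])
   fix x assume "v x - ps ((norm (x - z))^2) >= v x1 - ps ((norm (x1 - z))^2)"
   then have "l * (v x - ps ((norm (x - z))^2)) >= l * (v x1 - ps ((norm (x1 - z))^2))" using l by simp
   then show "u (T x) - l * ps ((norm (T x - T z))^2 / mu^2) >= u (T x1) - l * ps ((norm (T x1 - T z))^2 / mu^2)"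
    unfolding dist uv by (simp add: algebra_simps)
  qed
  with u[unfolded convex_solution_def super_test_def Let_def, THEN conjunct2, THEN conjunct2, THEN conjunct1, rule_format,
    of "%t. l * ps (t / mu^2)" "%t. l / mu^2 * ps' (t / mu^2)" "%t. l / mu^2 * (ps'' (t / mu^2) / mu^2)" "T x1" "T z"]
   derivs[OF d] ne[OF x(1)] x(2) l mu
  have *: "(ss + 4 * (l / mu^2 * ps' ((norm (x1 - z))^2))^2 * (mu^2 * (norm (x1 - z))^2)) powr (1 / (2 * aa) - 1 / 2) *
   (2 * (l / mu^2 * ps' ((norm (x1 - z))^2))) <= 1" unfolding dist' cancel by (simp only: mult_pos_pos divide_pos_pos zero_less_power simp_thms)
  define q where "q = (norm (x1 - z))^2"
  define a where "a = ps' q"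
  from * have "(ss + (l / mu)^2 * (4 * a^2 * q)) powr gm * (l / mu^2 * (2 * a)) <= 1"
   unfolding q_def[symmetric] a_def[symmetric] Peq gm_def[symmetric] by (simp add: mult_ac)
  then have "(ss' + 4 * a^2 * q) powr gm * (2 * a) <= 1" using scaleP(1)[OF ss0[of a "x1 - z"], folded q_def] by simp
  then show "(ss' + 4 * (ps' ((norm (x1 - z))^2))^2 * (norm (x1 - z))^2) powr (1 / (2 * aa) - 1 / 2) *
     (2 * ps' ((norm (x1 - z))^2)) <= 1" by (simp add: a_def q_def gm_def)
 qed
 moreover have "nonflat aa v" unfolding nonflat_def
 proof (intro allI impI notI)
  fix z :: "real^2" and B :: real
  assume B: "B >= 0" and ev: "\<forall>\<^sub>F x in nhds z. v x <= v z + B * ((norm (x - z))^2) ^ flat_order aa"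
  have "\<forall>\<^sub>F y in nhds (T z). u y <= u (T z) + (l * B / (mu^2) ^ flat_order aa) * ((norm (y - T z))^2) ^ flat_order aa" unfolding T_def
  proof (rule eventually_similar[OF mu], fold T_def, rule eventually_mono[OF ev])
   fix x assume "v x <= v z + B * ((norm (x - z))^2) ^ flat_order aa"
   then have "l * v x <= l * (v z + B * ((norm (x - z))^2) ^ flat_order aa)" using l by simp
   then show "u (T x) <= u (T z) + (l * B / (mu^2) ^ flat_order aa) * ((norm (T x - T z))^2) ^ flat_order aa"
    unfolding dist' uv power_mult_distrib using mu by (simp add: algebra_simps)
  qed
  moreover have "l * B / (mu^2) ^ flat_order aa >= 0" using l B mu by simp
  ultimately show False using u unfolding convex_solution_def nonflat_def by blast
 qed
 ultimately have "convex_solution aa ss' v" by (simp add: convex_solution_def)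
 then show ?thesis by (simp add: v_def[abs_def] ss'_def T_def l_def)
qed

subsection \<open>Balls contained in sublevel sets\<close>

lemma powr_sum_bounds:
 fixes ss P g :: real
 assumes "0 <= ss" "ss <= P" "0 < P"
 shows "(ss + P) powr g <= 2 powr \<bar>g\<bar> * P powr g" "2 powr (- \<bar>g\<bar>) * P powr g <= (ss + P) powr g"
proof -
 define t where "t = (ss + P) / P"
 have t: "1 <= t" "t <= 2" using assms by (auto simp: t_def field_simps)
 have tP: "ss + P = t * P" using assms by (simp add: t_def)
 have a: "t powr g <= t powr \<bar>g\<bar>" "t powr (- \<bar>g\<bar>) <= t powr g" using t by (auto intro!: powr_mono)
 have b: "t powr \<bar>g\<bar> <= 2 powr \<bar>g\<bar>" using t by (intro powr_mono2) auto
 have c: "2 powr (- \<bar>g\<bar>) <= t powr (- \<bar>g\<bar>)" using t by (intro powr_mono2') auto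
 have "(ss + P) powr g = t powr g * P powr g" unfolding tP by (rule powr_mult)
 moreover have "t powr g * P powr g <= 2 powr \<bar>g\<bar> * P powr g" using a b by (intro mult_right_mono) auto
 moreover have "2 powr (- \<bar>g\<bar>) * P powr g <= t powr g * P powr g" using a c by (intro mult_right_mono) auto
 ultimately show "(ss + P) powr g <= 2 powr \<bar>g\<bar> * P powr g" "2 powr (- \<bar>g\<bar>) * P powr g <= (ss + P) powr g" by auto
qed

text \<open>Sum of the constants from the two regimes of \<open>ball_bound\<close>.\<close>

definition ball_const :: "real => real" where
 "ball_const aa = (let K = 2 powr \<bar>1 / (2 * aa) - 1 / 2\<bar>; m = real (flat_order aa)
  in (2 * m * K) powr aa * (2 * m) + 4 * m^2 * K)"

text \<open>A solution must rise by at least a multiple of R powr (1 + aa) on a disc of radius R.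
  The power B * |x - z|^(2 * m), scaled to rise slightly more than h - u z up to the boundary,
  touches u from above inside the disc; \<open>nonflat\<close> keeps the contact away from z, and
  the test there bounds B from below.\<close>

lemma ball_bound:
 assumes u: "convex_solution aa ss u" and aa: "aa > 0" and ss: "0 <= ss" "ss <= 1"
  and R: "R >= 1" and ball: "!!x. x \<in> cball z R ==> u x <= h"
 shows "R powr (1 + aa) <= ball_const aa * (h - u z)"
proof -
 define m where "m = flat_order aa"
 define K where "K = 2 powr \<bar>1 / (2 * aa) - 1 / 2\<bar>"
 define gm where "gm = 1 / (2 * aa) - 1 / 2"
 have m: "m >= 2" by (simp add: m_def flat_order_def)
 have maa: "real m >= aa + 2" using aa by (simp add: m_def flat_order_def)
 have K1: "K >= 1" by (simp add: K_def ge_one_powr_ge_zero)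
 have bc: "ball_const aa = (2 * m * K) powr aa * (2 * m) + 4 * (real m)^2 * K"
  unfolding ball_const_def m_def K_def Let_def by (simp only: of_nat_mult of_nat_numeral)
 have cu: "continuous_on UNIV u" using u convex_on_continuous[of UNIV u] by (simp add: convex_solution_def)
 \<comment> \<open>The surplus \<iota> excludes a contact on the boundary circle; it tends to 0 at
   the end.\<close>
 have key: "R powr (1 + aa) <= ball_const aa * (h - u z + \<iota>)" if "\<iota> > 0" for \<iota>
 proof -
  define a where "a = h - u z + \<iota>"
  have a: "a > 0" using ball[of z] R that by (simp add: a_def)
  define B where "B = a / (R^2) ^ m"
  have B: "B > 0" using a R by (simp add: B_def)
  have BR: "B * (R^2) ^ m = a" using R by (simp add: B_def)
  define w where "w x = u x - B * ((norm (x - z))^2) ^ m" for x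
  have "continuous_on (cball z R) w" unfolding w_def by (intro continuous_intros continuous_on_subset[OF cu]) auto
  then obtain x1 where x1: "x1 \<in> cball z R" "!!x. x \<in> cball z R ==> w x <= w x1" using continuous_attains_sup[of "cball z R" w] R by auto
  have wz: "w z = u z" using m by (simp add: w_def power_0_left)
  have "norm (x1 - z) ~= R"
  proof
   assume e: "norm (x1 - z) = R"
   have "w x1 <= h - a" using ball[OF x1(1)] BR by (simp add: w_def e)
   then show False using x1(2)[of z] wz R that by (simp add: a_def)
  qed
  then have x1b: "x1 \<in> ball z R" using x1 by (simp add: dist_norm norm_minus_commute)
  define c where "c = norm (x1 - z)"
  have cR: "c < R" using x1b by (simp add: c_def dist_norm norm_minus_commute)
  have ev: "\<forall>\<^sub>F x in nhds x1. w x <= w x1" using eventually_nhds_in_open[OF open_ball x1b] x1(2) by (auto elim!: eventually_mono)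
  have x1z: "x1 ~= z"
  proof
   assume e: "x1 = z"
   have "\<forall>\<^sub>F x in nhds z. u x <= u z + B * ((norm (x - z))^2) ^ flat_order aa"
    using ev unfolding e wz by (auto simp: w_def m_def elim!: eventually_mono)
   moreover have "B >= 0" using B by simp
   ultimately show False using u unfolding convex_solution_def nonflat_def by blast
  qed
  have c0: "c > 0" using x1z by (simp add: c_def)
  define b where "b = B * m * (c^2) ^ (m - 1)"
  have b: "b > 0" using B m c0 by (simp add: b_def)
  define P where "P = 4 * b^2 * c^2"
  define p where "p = 2 * b * c"
  have p: "p > 0" "P = p^2" using b c0 by (auto simp: p_def P_def power_mult_distrib)
  then have P: "P > 0" by simp
  have "1 <= (ss + P) powr gm * (2 * b + (2 * b + 4 * c^2 * (B * m * real (m - 1) * (c^2) ^ (m - 2))) * (ss / (ss + P)))"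
   using u[unfolded convex_solution_def sub_test_def Let_def, THEN conjunct2, THEN conjunct1, rule_format,
    of "%t. B * t ^ m" "%t. B * m * t ^ (m - 1)" "%t. B * m * real (m - 1) * t ^ (m - 2)" x1 z]
    flat_power_derivs[OF m, of B] x1z b ev unfolding c_def[symmetric] b_def[symmetric] P_def[symmetric] gm_def[symmetric] w_def by blast
  also have "4 * c^2 * (B * m * real (m - 1) * (c^2) ^ (m - 2)) = 4 * (real m - 1) * b"
  proof -
   have "(c^2) ^ (m - 1) = c^2 * (c^2) ^ (m - 2)" using m by (metis Suc_diff_le diff_Suc_Suc numeral_2_eq_2 One_nat_def power_Suc)
   then show ?thesis using m by (simp add: b_def of_nat_diff mult_ac)
  qed
  also have "(ss + P) powr gm * (2 * b + (2 * b + 4 * (real m - 1) * b) * (ss / (ss + P)))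
   <= (ss + P) powr gm * (2 * b + (2 * b + 4 * (real m - 1) * b) * 1)" using ss P b m by (intro mult_left_mono add_left_mono) auto
  also have "\<dots> = 2 * m * ((ss + P) powr gm * p / c)" using c0 by (simp add: p_def algebra_simps)
  finally have one: "1 <= 2 * m * ((ss + P) powr gm * p / c)" .
  have pB: "p = 2 * B * m * c powr (2 * real m - 1)"
  proof -
   have "(c^2) ^ (m - 1) * c = c ^ (2 * (m - 1) + 1)" by (simp add: power_mult power_add)
   also have "\<dots> = c powr (real (2 * (m - 1) + 1))" using c0 by (rule powr_realpow[symmetric])
   also have "real (2 * (m - 1) + 1) = 2 * real m - 1" using m by (simp add: of_nat_diff)
   finally show ?thesis by (simp add: p_def b_def)
  qed
  have BR': "B = a / R powr (2 * real m)"
  proof -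
   have "(R^2) ^ m = R ^ (2 * m)" by (simp add: power_mult)
   also have "\<dots> = R powr (real (2 * m))" using R by (intro powr_realpow[symmetric]) auto
   finally show ?thesis by (simp add: B_def)
  qed
  show "R powr (1 + aa) <= ball_const aa * (h - u z + \<iota>)"
  \<comment> \<open>Either ss + P may be replaced by P up to the factor K, or P < ss with a positive
    exponent. In the second case ss + P <= 2, and aa < 1 makes R powr 2 the larger power because R
    >= 1.\<close>
  proof (cases "gm <= 0 \<or> ss <= P")
   case True
   have "(ss + P) powr gm <= K * P powr gm"
   proof (cases "ss <= P")
    case True then show ?thesis using powr_sum_bounds(1)[OF ss(1) True P, of gm] by (simp add: K_def gm_def)
   next
    case False
    then have "(ss + P) powr gm <= 1 * P powr gm" using True ss P by (simp add: powr_mono2')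
    also have "\<dots> <= K * P powr gm" using K1 by (intro mult_right_mono) auto
    finally show ?thesis .
   qed
   then have "2 * m * ((ss + P) powr gm * p / c) <= 2 * m * (K * P powr gm * p / c)"
    using p c0 by (intro mult_left_mono divide_right_mono mult_right_mono) auto
   with one have "1 <= 2 * m * (K * P powr gm * p / c)" by linarith
   also have "P powr gm * p = p powr (1 / aa)"
   proof -
    have "P powr gm = p powr (2 * gm)" unfolding p(2) using p(1) by (simp add: powr_powr powr_numeral[symmetric] del: powr_numeral)
    moreover have "p = p powr 1" using p by simp
    moreover have "2 * gm + 1 = 1 / aa" by (simp add: gm_def)
    ultimately show ?thesis by (metis powr_add)
   qed
   then have "2 * m * (K * P powr gm * p / c) = 2 * m * K * p powr (1 / aa) / c" by (simp add: mult_ac)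
   finally have "c <= 2 * m * K * p powr (1 / aa)" using c0 by (simp add: field_simps)
   then have "c powr aa <= (2 * m * K * p powr (1 / aa)) powr aa" using c0 aa by (intro powr_mono2) auto
   also have "\<dots> = (2 * m * K) powr aa * p" using aa p by (simp add: powr_mult powr_powr)
   finally have "c powr aa <= (2 * m * K) powr aa * (2 * B * m) * c powr (2 * real m - 1)" unfolding pB by (simp add: mult_ac)
   also have "c powr (2 * real m - 1) = c powr aa * c powr (2 * real m - 1 - aa)" using c0 by (simp add: powr_add[symmetric])
   finally have "c powr aa * 1 <= c powr aa * ((2 * m * K) powr aa * (2 * B * m) * c powr (2 * real m - 1 - aa))" by (simp add: mult_ac)
   then have "1 <= (2 * m * K) powr aa * (2 * B * m) * c powr (2 * real m - 1 - aa)" using c0 by (subst (asm) mult_le_cancel_left_pos) auto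
   also have "\<dots> <= (2 * m * K) powr aa * (2 * B * m) * R powr (2 * real m - 1 - aa)"
    using c0 cR maa B aa by (intro mult_left_mono powr_mono2) auto
   also have "\<dots> = (2 * m * K) powr aa * (2 * m) * a * (R powr (2 * real m - 1 - aa) / R powr (2 * real m))" unfolding BR' by simp
   also have "R powr (2 * real m - 1 - aa) / R powr (2 * real m) = 1 / R powr (1 + aa)"
   proof -
    have "2 * real m - 1 - aa - 2 * real m = - (1 + aa)" by simp
    then show ?thesis using R by (metis powr_diff powr_minus_divide)
   qed
   finally have "R powr (1 + aa) <= (2 * m * K) powr aa * (2 * m) * a" using R by (simp add: field_simps)
   also have "\<dots> <= ball_const aa * a" unfolding bc using a K1 by (intro mult_right_mono) auto
   finally show ?thesis by (simp add: a_def)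
  next
   case False
   then have g: "gm > 0" "P < ss" by auto
   have "aa < 1" using g(1) aa by (simp add: gm_def field_simps)
   have "(ss + P) powr gm <= 2 powr gm" using g ss P by (intro powr_mono2) auto
   also have "\<dots> = K" using g by (simp add: K_def gm_def)
   finally have "2 * m * ((ss + P) powr gm * p / c) <= 2 * m * (K * p / c)"
    using p c0 by (intro mult_left_mono divide_right_mono mult_right_mono) auto
   with one have o2: "1 <= 2 * m * (K * p / c)" by linarith
   have pc: "p / c = 2 * B * m * c powr (2 * real m - 2)" using c0 powr_diff[of c "2 * real m - 1" 1] by (simp add: pB)
   have "2 * m * (K * p / c) = 2 * m * K * (p / c)" by simp
   also have "\<dots> = 4 * (real m)^2 * K * B * c powr (2 * real m - 2)" unfolding pc by (simp add: power2_eq_square)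
   also have "\<dots> <= 4 * (real m)^2 * K * B * R powr (2 * real m - 2)" using c0 cR m B K1 by (intro mult_left_mono powr_mono2) auto
   also have "\<dots> = 4 * (real m)^2 * K * a * (R powr (2 * real m - 2) / R powr (2 * real m))" unfolding BR' by simp
   also have "R powr (2 * real m - 2) / R powr (2 * real m) = 1 / R powr 2"
   proof -
    have "2 * real m - 2 - 2 * real m = - 2" by simp
    then show ?thesis using R by (metis powr_diff powr_minus_divide)
   qed
   finally have "1 <= 4 * (real m)^2 * K * a * (1 / R powr 2)" using o2 by linarith
   then have "R powr 2 <= 4 * (real m)^2 * K * a" using R by (simp add: field_simps)
   moreover have "R powr (1 + aa) <= R powr 2" using R \<open>aa < 1\<close> by (intro powr_mono) auto
   moreover have "4 * (real m)^2 * K * a <= ball_const aa * a" unfolding bc using a by (intro mult_right_mono) auto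
   ultimately show ?thesis by (simp add: a_def)
  qed
 qed
 have bcp: "ball_const aa >= 0" unfolding bc using K1 by simp
 show ?thesis
 proof (rule field_le_epsilon)
  fix e :: real assume e: "e > 0"
  have "R powr (1 + aa) <= ball_const aa * (h - u z + e / (ball_const aa + 1))" using e bcp by (intro key) auto
  also have "\<dots> = ball_const aa * (h - u z) + e * (ball_const aa / (ball_const aa + 1))" by (simp add: algebra_simps)
  also have "\<dots> <= ball_const aa * (h - u z) + e * 1" using e bcp by (intro add_left_mono mult_left_mono) auto
  finally show "R powr (1 + aa) <= ball_const aa * (h - u z) + e" by simp
 qed
qed

section \<open>Support functions of sublevel sets\<close>

definition edir :: "real => real^2" where
 "edir t = vector [cos t, sin t]"

lemma edir_nth [simp]: "edir t $ 1 = cos t" "edir t $ 2 = sin t" by (simp_all add: edir_def)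

lemma inner_vec2: "x \<bullet> (y::real^2) = x $ 1 * y $ 1 + x $ 2 * y $ 2" by (simp add: inner_vec_def sum_2)

lemma inner_edir: "x \<bullet> edir t = x $ 1 * cos t + x $ 2 * sin t" by (simp add: inner_vec2)

lemma edir_inner_edir: "edir s \<bullet> edir t = cos (t - s)" by (simp add: inner_edir cos_diff)

lemma norm_edir [simp]: "norm (edir t) = 1" by (simp add: norm_eq_sqrt_inner edir_inner_edir)

lemma edir_periodic [simp]: "edir (t + 2 * pi) = edir t" "edir (t + pi) = - edir t" "edir (t - pi) = - edir t" by (simp_all add: vec_eq_iff forall_2)

lemma inner_edir_le: "x \<bullet> edir t <= norm x" using norm_cauchy_schwarz[of x "edir t"] by simp

lemma edir_lipschitz: "norm (edir s - edir t) <= \<bar>s - t\<bar>"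
proof -
 have "(norm (edir s - edir t))^2 = 2 - 2 * cos (s - t)" by (simp add: power2_norm_eq_inner inner_diff_left inner_diff_right edir_inner_edir cos_diff)
 also have "\<dots> <= (s - t)^2"
 proof -
  have "2 * ((s - t) / 2) = s - t" by simp
  then have "cos (s - t) = 1 - 2 * (sin ((s - t) / 2))^2" using cos_double_sin[of "(s - t) / 2"] by (simp only:)
  moreover have "(sin ((s - t) / 2))^2 <= ((s - t) / 2)^2" using abs_sin_x_le_abs_x[of "(s - t) / 2"] abs_le_square_iff by blast
  ultimately show ?thesis by (simp add: power_divide)
 qed
 finally show ?thesis using power2_le_iff_abs_le[of "\<bar>s - t\<bar>" "norm (edir s - edir t)"] by simp
qed

lemma continuous_edir: "continuous_on A edir"
proof -
 have eq: "edir = (%t. cos t *\<^sub>R vector [1, 0] + sin t *\<^sub>R vector [0, 1])" by (simp add: fun_eq_iff vec_eq_iff forall_2)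
 show ?thesis unfolding eq by (intro continuous_intros)
qed

lemma edir_three_point:
 "(x \<bullet> edir t) * sin (b - a) = (x \<bullet> edir a) * sin (b - t) + (x \<bullet> edir b) * sin (t - a)"
proof -
 have "cos t * sin (b - a) = cos a * sin (b - t) + cos b * sin (t - a)" using sin_three_point[of t 0 b a] by simp
 moreover have "sin t * sin (b - a) = sin a * sin (b - t) + sin b * sin (t - a)" using sin_three_point[of t "pi / 2" b a] by (simp add: cos_diff)
 ultimately show ?thesis unfolding inner_edir by algebra
qed

lemma polar_decomposition: obtains t where "x = norm x *\<^sub>R edir t"
proof (cases "x = 0")
 case False
 define y where "y = (1 / norm x) *\<^sub>R x"
 have "(norm y)^2 = 1" using False by (simp add: y_def)
 then have "(y $ 1)^2 + (y $ 2)^2 = 1" by (simp add: norm_vec2_sq)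
 then obtain t where "y $ 1 = cos t" "y $ 2 = sin t" using sincos_total_2pi by metis
 then have "y = edir t" by (simp add: vec_eq_iff forall_2)
 moreover have "x = norm x *\<^sub>R y" using False by (simp add: y_def)
 ultimately have "x = norm x *\<^sub>R edir t" by simp
 then show ?thesis using that by blast
qed (use that in auto)

text \<open>A formula for the polar angle that is visibly continuous near the direction tt, for use
  with points close to a contact point.\<close>

lemma polar_arctan:
 fixes y :: "real^2"
 assumes a: "y \<bullet> edir tt > 0"
 shows "y = norm y *\<^sub>R edir (tt + arctan ((y \<bullet> edir (tt + pi / 2)) / (y \<bullet> edir tt)))"
proof -
 define a b where "a = y \<bullet> edir tt" and "b = y \<bullet> edir (tt + pi / 2)"
 have b': "b = - y $ 1 * sin tt + y $ 2 * cos tt" by (simp add: b_def inner_edir cos_add sin_add)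
 have a': "a = y $ 1 * cos tt + y $ 2 * sin tt" by (simp add: a_def inner_edir)
 have y: "y $ 1 = a * cos tt - b * sin tt" "y $ 2 = a * sin tt + b * cos tt" using sin_cos_squared_add[of tt] unfolding a' b' by algebra+
 have "(norm y)^2 = a^2 + b^2" using sin_cos_squared_add[of tt] unfolding norm_vec2_sq y by algebra
 then have ny: "norm y = sqrt (a^2 + b^2)" by (metis norm_ge_zero real_sqrt_unique)
 have a0: "a > 0" using a by (simp add: a_def)
 have "sqrt (1 + (b / a)^2) = sqrt (a^2 + b^2) / a"
 proof -
  have "1 + (b / a)^2 = (a^2 + b^2) / a^2" using a0 by (simp add: field_simps)
  then show ?thesis using a0 by (simp add: real_sqrt_divide)
 qed
 moreover have "sqrt (a^2 + b^2) > 0" using a0 by (simp add: sum_power2_gt_zero_iff)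
 ultimately have cs: "norm y * cos (arctan (b / a)) = a" "norm y * sin (arctan (b / a)) = b" using a0 by (simp_all add: ny cos_arctan sin_arctan)
 define C D where "C = cos (arctan (b / a))" and "D = sin (arctan (b / a))"
 note cs' = cs[folded C_def D_def]
 have "norm y * cos (tt + arctan (b / a)) = (norm y * C) * cos tt - (norm y * D) * sin tt"
  "norm y * sin (tt + arctan (b / a)) = (norm y * C) * sin tt + (norm y * D) * cos tt" by (simp_all add: cos_add sin_add C_def D_def algebra_simps)
 then have "norm y * cos (tt + arctan (b / a)) = y $ 1" "norm y * sin (tt + arctan (b / a)) = y $ 2" unfolding cs' y by simp_all
 then show ?thesis by (simp add: vec_eq_iff forall_2 a_def b_def)
qed

text \<open>z \<bullet> edir tt + c is the support function of the disc with centre z and radius c.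
  Near (tt1, h1) the sets are thus compared with a disc whose radius grows with speed v; the
  quadratic term in h leaves room for penalised extrema.\<close>

definition touch_below :: "(real => real => real) => real^2 => real => real => real => real => real => bool" where
 "touch_below s z c v M tt1 h1 \<longleftrightarrow> s tt1 h1 = z \<bullet> edir tt1 + c &
  (\<exists>dl>0. \<forall>tt h. \<bar>tt - tt1\<bar> < dl --> \<bar>h - h1\<bar> < dl -->
    z \<bullet> edir tt + c + v * (h - h1) - M * (h - h1)^2 <= s tt h)"

definition touch_above :: "(real => real => real) => real^2 => real => real => real => real => real => bool" where
 "touch_above s z c v M tt1 h1 \<longleftrightarrow> s tt1 h1 = z \<bullet> edir tt1 + c &
  (\<exists>dl>0. \<forall>tt h. \<bar>tt - tt1\<bar> < dl --> \<bar>h - h1\<bar> < dl -->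
    s tt h <= z \<bullet> edir tt + c + v * (h - h1) + M * (h - h1)^2)"

text \<open>
 Bounds at a circle of radius \<open>c\<close> expanding with speed \<open>v\<close> that touches the level lines; \<open>1 / v\<close> is the length
 of the gradient. For \<open>ss = 0\<close> they read \<open>c <= v powr (- 1 / aa)\<close> and \<open>v powr (- 1 / aa) <= c\<close>.
\<close>

definition inner_bound :: "real => real => real => real => real => bool" where
 "inner_bound aa ss c v M \<longleftrightarrow>
  1 <= (ss + 1 / v^2) powr (1 / (2 * aa) - 1 / 2) * (1 / v) * (1 / c + ss / (c * (ss + 1 / v^2)) + 4 * ss * M)"

definition outer_bound :: "real => real => real => real => bool" where
 "outer_bound aa ss c v \<longleftrightarrow> v > 0 & (ss + 1 / v^2) powr (1 / (2 * aa) - 1 / 2) * (1 / v) <= c"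

text \<open>The window \<open>B\<close> provides compact sets before sublevel sets are known to be
  bounded: a box in \<open>long_chord_speed\<close>, a disc in \<open>tip_advance\<close>, and the
  whole plane once \<open>sublevel_growth\<close> is available.\<close>

locale sublevels =
 fixes u :: "real^2 => real" and B :: "(real^2) set"
 assumes cvx: "convex_on UNIV u" and B: "convex B"
  and cmp: "!!h. compact {x \<in> B. u x <= h}"
begin

definition K :: "real => (real^2) set" where "K h = {x \<in> B. u x <= h}"

definition S :: "real => real => real" where "S tt h = Sup ((%x. x \<bullet> edir tt) ` K h)"

lemma cont_u: "continuous_on A u" using convex_on_continuous[OF open_UNIV cvx] continuous_on_subset by blast

lemma K_compact: "compact (K h)" using cmp by (simp add: K_def)

lemma K_mono: "h <= k ==> K h \<subseteq> K k" by (auto simp: K_def)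

lemma K_combine:
 assumes "x \<in> K h" "y \<in> K k" "0 <= t" "t <= 1"
 shows "(1 - t) *\<^sub>R x + t *\<^sub>R y \<in> K ((1 - t) * h + t * k)"
proof -
 have "(1 - t) *\<^sub>R x + t *\<^sub>R y \<in> B" using assms B by (auto simp: K_def convex_alt)
 moreover have "u ((1 - t) *\<^sub>R x + t *\<^sub>R y) <= (1 - t) * u x + t * u y" using convex_onD[OF cvx, of t x y] assms by simp
 moreover have "\<dots> <= (1 - t) * h + t * k" using assms by (intro add_mono mult_left_mono) (auto simp: K_def)
 ultimately show ?thesis by (auto simp: K_def)
qed

lemma S_upper: "x \<in> K h ==> x \<bullet> edir tt <= S tt h" unfolding S_def
 by (intro cSup_upper imageI bounded_imp_bdd_above compact_imp_bounded compact_continuous_image K_compact)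
  (auto intro!: continuous_intros)

lemma S_attained: "K h ~= {} ==> \<exists>x\<in>K h. x \<bullet> edir tt = S tt h"
proof -
 assume ne: "K h ~= {}"
 have "\<exists>x\<in>K h. \<forall>y\<in>K h. y \<bullet> edir tt <= x \<bullet> edir tt"
  by (intro continuous_attains_sup K_compact ne continuous_intros)
 then obtain x where x: "x \<in> K h" "!!y. y \<in> K h ==> y \<bullet> edir tt <= x \<bullet> edir tt" by blast
 have "S tt h = x \<bullet> edir tt" unfolding S_def using x by (intro cSup_eq_maximum) auto
 then show ?thesis using x by auto
qed

lemma S_least: "K h ~= {} ==> (!!x. x \<in> K h ==> x \<bullet> edir tt <= c) ==> S tt h <= c" by (metis S_attained)

lemma S_mono: "K h ~= {} ==> h <= k ==> S tt h <= S tt k" by (rule S_least) (use K_mono S_upper in blast)+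

text \<open>Convexity of u makes its sublevel sets a concave family in the sense of Minkowski sums:
  the level lines never accelerate.\<close>

lemma S_concave:
 assumes "K h ~= {}" "K k ~= {}" "0 <= t" "t <= 1"
 shows "(1 - t) * S tt h + t * S tt k <= S tt ((1 - t) * h + t * k)"
proof -
 obtain x y where "x \<in> K h" "y \<in> K k" "x \<bullet> edir tt = S tt h" "y \<bullet> edir tt = S tt k" using S_attained assms by meson
 then show ?thesis using S_upper[OF K_combine[of x h y k t], of tt] assms by (simp add: inner_add_left)
qed

lemma S_periodic: "S (tt + 2 * pi) h = S tt h" by (simp add: S_def)

lemma S_lipschitz:
 assumes "K h \<subseteq> cball 0 r" "K h ~= {}"
 shows "\<bar>S tt h - S ph h\<bar> <= r * \<bar>tt - ph\<bar>"
proof -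
 have *: "S tt h - S ph h <= r * \<bar>tt - ph\<bar>" for tt ph
 proof -
  obtain x where x: "x \<in> K h" "x \<bullet> edir tt = S tt h" using S_attained assms by blast
  have "x \<bullet> (edir tt - edir ph) <= norm x * norm (edir tt - edir ph)" by (rule norm_cauchy_schwarz)
  also have "\<dots> <= r * \<bar>tt - ph\<bar>"
   using x assms edir_lipschitz[of tt ph] by (intro mult_mono) (auto intro: order_trans[OF norm_ge_zero])
  finally show ?thesis using S_upper[OF x(1), of ph] x by (simp add: inner_diff_right)
 qed
 show ?thesis using *[of tt ph] *[of ph tt] by (simp add: abs_le_iff abs_minus_commute)
qed

lemma S_trig_convex: "K h ~= {} ==> trig_convex (%tt. S tt h)" unfolding trig_convex_def
proof (intro allI impI)
 fix a t b :: real assume ne: "K h ~= {}" and ab: "a < t" "t < b" "b - a < pi"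
 obtain x where x: "x \<in> K h" "x \<bullet> edir t = S t h" using S_attained ne by blast
 have s: "sin (b - t) >= 0" "sin (t - a) >= 0" using ab by (auto intro!: sin_ge_zero)
 have "S t h * sin (b - a) = (x \<bullet> edir a) * sin (b - t) + (x \<bullet> edir b) * sin (t - a)" using edir_three_point[of x t b a] x by simp
 also have "\<dots> <= S a h * sin (b - t) + S b h * sin (t - a)" using s S_upper[OF x(1)] by (intro add_mono mult_right_mono) auto
 finally show "S t h * sin (b - a) <= S a h * sin (b - t) + S b h * sin (t - a)" .
qed

lemma S_membership:
 assumes ne: "K h ~= {}" and le: "!!tt. x \<bullet> edir tt <= S tt h"
 shows "x \<in> K h"
proof (rule ccontr)
 assume "x \<notin> K h"
 moreover have "convex (K h)" unfolding convex_alt using K_combine[of _ h _ h] by (auto simp: algebra_simps)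
 moreover have "closed (K h)" using K_compact compact_imp_closed by blast
 ultimately obtain a b where ab: "a \<bullet> x < b" "!!y. y \<in> K h ==> a \<bullet> y > b" using separating_hyperplane_closed_point by meson
 obtain t where t: "- a = norm (- a) *\<^sub>R edir t" by (rule polar_decomposition)
 obtain y where y: "y \<in> K h" "y \<bullet> edir t = S t h" using S_attained ne by blast
 have "norm a * (y \<bullet> edir t) = - (a \<bullet> y)" "norm a * (x \<bullet> edir t) = - (a \<bullet> x)"
  using arg_cong[OF t, of "%w. w \<bullet> y"] arg_cong[OF t, of "%w. w \<bullet> x"] by (simp_all add: inner_commute)
 moreover have "norm a * (x \<bullet> edir t) <= norm a * (y \<bullet> edir t)" using le[of t] y by (intro mult_left_mono) auto
 ultimately show False using ab(1) ab(2)[OF y(1)] by simp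
qed

lemma S_support_point:
 assumes "x \<in> K h" "x \<bullet> edir tt = S tt h" "x \<in> interior B"
 shows "u x = h"
proof (rule ccontr)
 assume "u x ~= h"
 then have lt: "u x < h" using assms by (auto simp: K_def)
 have "isCont (%t. u (x + t *\<^sub>R edir tt)) 0"
  by (rule continuous_on_interior[of UNIV]) (auto intro!: continuous_on_compose2[OF cont_u] continuous_intros)
 then have lim: "((%t. u (x + t *\<^sub>R edir tt)) \<longlongrightarrow> u x) (at_right 0)" by (simp add: isCont_def filterlim_at_split)
 have ev1: "\<forall>\<^sub>F t in at_right 0. u (x + t *\<^sub>R edir tt) < h" using order_tendstoD(2)[OF lim lt] .
 have lim2: "((%t. x + t *\<^sub>R edir tt) \<longlongrightarrow> x + 0 *\<^sub>R edir tt) (at_right 0)" by (intro tendsto_intros)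
 have "\<forall>\<^sub>F t in at_right 0. x + t *\<^sub>R edir tt \<in> interior B"
  using topological_tendstoD[OF lim2 open_interior, of B] assms by simp
 then have "\<forall>\<^sub>F t in at_right (0::real). False" using ev1 eventually_at_right_less[of 0]
 proof eventually_elim
  case (elim t)
  then have "x + t *\<^sub>R edir tt \<in> K h" using interior_subset[of B] by (auto simp: K_def)
  from S_upper[OF this, of tt] show ?case using assms elim by (simp add: inner_add_left edir_inner_edir)
 qed
 then show False by (simp add: eventually_False)
qed

end

lemma isCont_tendsto_nhds: "isCont f x ==> f x = y ==> (f \<longlongrightarrow> y) (nhds x)" by (auto simp: isCont_def tendsto_at_iff_tendsto_nhds)

lemma edir_representative:
 obtains t where "a <= t" "t < a + 2 * pi" "edir t = edir tt"
proof
 define n where "n = \<lfloor>(tt - a) / (2 * pi)\<rfloor>"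
 have "of_int n <= (tt - a) / (2 * pi)" "(tt - a) / (2 * pi) < of_int n + 1" unfolding n_def by linarith+
 then show "a <= tt - 2 * pi * of_int n" "tt - 2 * pi * of_int n < a + 2 * pi" by (simp_all add: field_simps)
 show "edir (tt - 2 * pi * of_int n) = edir tt" by (simp add: vec_eq_iff forall_2 cos_diff sin_diff)
qed

context sublevels
begin

lemma K_interior_width:
 assumes "x0 \<in> interior B" "u x0 < h"
 shows "S tt h + S (tt + pi) h > 0" "K h ~= {}"
proof -
 have x0: "x0 \<in> K h" using assms interior_subset by (auto simp: K_def)
 then show "K h ~= {}" by auto
 show "S tt h + S (tt + pi) h > 0"
 proof (rule ccontr)
  assume n: "\<not> ?thesis"
  have "x0 \<bullet> edir tt <= S tt h" "x0 \<bullet> edir (tt + pi) <= S (tt + pi) h" using S_upper x0 by blast+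
  then have "x0 \<bullet> edir tt = S tt h" using n by simp
  from S_support_point[OF x0 this assms(1)] assms(2) show False by simp
 qed
qed

section \<open>Contact of level lines with expanding circles\<close>

lemma test_polynomial:
 fixes k0 a N c2 :: real
 shows "\<forall>t. DERIV (%t. k0 + a * (t - c2) + N * (t - c2)^2) t :> a + 2 * N * (t - c2)"
  "\<forall>t. DERIV (%t. a + 2 * N * (t - c2)) t :> 2 * N" "continuous_on UNIV (%t::real. 2 * N)"
 by (auto intro!: derivative_eq_intros simp: power2_eq_square algebra_simps)

text \<open>\<open>t\<close> is the test function as a polynomial in w = |x - z|^2 - c^2. Its linear
  part puts the circle of radius c + d at a level of about d / v; the term with N absorbs the
  quadratic defect of this relation and the error M * t^2. It is positive in
  \<open>contact_below\<close> and negative in \<open>contact_above\<close>. The bound 2 / 5 is used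
  through (7 / 5)^2 <= 2.\<close>

lemma quadratic_inverse_estimate:
 fixes c v M N d w t :: real
 assumes "c > 0" "v > 0" "M >= 0"
 assumes w_def: "w = 2 * c * d + d^2" and t_def: "t = w / (2 * c * v) + N * w^2"
 assumes small: "\<bar>N * w\<bar> <= 2 / 5 / (2 * c * v)"
 shows "M * t^2 <= M / (2 * c^2 * v^2) * w^2" "v * t = d + d^2 / (2 * c) + v * N * w^2"
proof -
 define k where "k = 1 / (2 * c * v)"
 have k: "k > 0" using assms by (simp add: k_def)
 have t: "t = w * (k + N * w)" by (simp add: t_def k_def algebra_simps power2_eq_square)
 have "\<bar>N * w\<bar> <= 2 / 5 * k" using small by (simp add: k_def)
 then have "\<bar>k + N * w\<bar> <= 7 / 5 * k" using k by linarith
 then have "\<bar>k + N * w\<bar> <= \<bar>7 / 5 * k\<bar>" using k by linarith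
 then have "(k + N * w)^2 <= (7 / 5 * k)^2" by (simp only: abs_le_square_iff)
 also have "\<dots> <= 2 * k^2" by (simp add: power_mult_distrib power_divide)
 finally have "t^2 <= w^2 * (2 * k^2)" unfolding t power_mult_distrib by (intro mult_left_mono) auto
 then have "M * t^2 <= M * (w^2 * (2 * k^2))" using assms by (intro mult_left_mono)
 also have "\<dots> = M / (2 * c^2 * v^2) * w^2" by (simp add: k_def power_divide power_mult_distrib)
 finally show "M * t^2 <= M / (2 * c^2 * v^2) * w^2" .
 show "v * t = d + d^2 / (2 * c) + v * N * w^2" using assms(1,2) by (simp add: t_def w_def field_simps power2_eq_square)
qed

text \<open>The normal cone of the sublevel set at a lower contact point is a single ray.\<close>

lemma touch_below_strict:
 assumes x0: "x0 \<in> interior B" "u x0 < h1" and c: "c > 0"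
  and touch: "touch_below S z c v M tt1 h1"
  and th: "tt ~= tt1" "\<bar>tt - tt1\<bar> <= pi"
 shows "(z + c *\<^sub>R edir tt1) \<bullet> edir tt < S tt h1"
proof -
 define x1 where "x1 = z + c *\<^sub>R edir tt1"
 define h0 where "h0 = u x0"
 have Kne: "K k ~= {}" if "k >= h0" for k using x0 interior_subset that by (auto simp: K_def h0_def)
 have h01: "h0 < h1" using x0 by (simp add: h0_def)
 obtain dl where dl: "dl > 0" "S tt1 h1 = z \<bullet> edir tt1 + c"
  "!!tt h. \<bar>tt - tt1\<bar> < dl ==> \<bar>h - h1\<bar> < dl ==>
    z \<bullet> edir tt + c + v * (h - h1) - M * (h - h1)^2 <= S tt h" using touch unfolding touch_below_def by metis
 have x1e: "x1 \<bullet> edir tt = z \<bullet> edir tt + c * cos (tt - tt1)" for tt by (simp add: x1_def inner_add_left edir_inner_edir)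
 have x1S: "x1 \<bullet> edir tt1 = S tt1 h1" using dl(2) by (simp add: x1e)
 have "x1 \<bullet> edir tt < S tt h1"
 proof (rule ccontr)
  assume n: "\<not> ?thesis"
  show False
  proof (cases "\<bar>tt - tt1\<bar> = pi")
   case True
   then have "edir tt = - edir tt1"
   proof -
    have "tt = tt1 + pi \<or> tt = tt1 - pi" using True by linarith
    then show ?thesis by auto
   qed
   then have "S tt h1 = S (tt1 + pi) h1" "x1 \<bullet> edir tt = - S tt1 h1" using x1S by (auto simp: S_def)
   then show False using n K_interior_width(1)[OF x0, of tt1] by simp
  next
   case False
   then have lt: "\<bar>tt - tt1\<bar> < pi" using th by simp
   \<comment> \<open>If the contact point also supported the set in direction tt, trigonometric
     convexity would make it do so in all directions between; but close to tt1 the touching disc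
     reaches strictly farther.\<close>
   define r where "r = min (dl / 2) (\<bar>tt - tt1\<bar> / 2)"
   have r: "0 < r" "r < dl" "r < \<bar>tt - tt1\<bar>" using dl(1) th by (auto simp: r_def min_less_iff_disj)
   define tt3 where "tt3 = (if tt > tt1 then tt1 + r else tt1 - r)"
   define a b where "a = min tt tt1" and "b = max tt tt1"
   have ab: "a < tt3" "tt3 < b" "b - a < pi" using r th lt by (auto simp: a_def b_def tt3_def min_def max_def)
   have le: "S a h1 <= x1 \<bullet> edir a" "S b h1 <= x1 \<bullet> edir b" using n x1S by (auto simp: a_def b_def min_def max_def)
   have s: "sin (b - tt3) >= 0" "sin (tt3 - a) >= 0" "sin (b - a) > 0" using ab by (auto intro!: sin_ge_zero sin_gt_zero)
   have "S tt3 h1 * sin (b - a) <= S a h1 * sin (b - tt3) + S b h1 * sin (tt3 - a)"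
    using trig_convexD[OF S_trig_convex[OF Kne[of h1]], of a tt3 b] ab h01 by simp
   also have "\<dots> <= (x1 \<bullet> edir a) * sin (b - tt3) + (x1 \<bullet> edir b) * sin (tt3 - a)"
    using le s by (intro add_mono mult_right_mono) auto
   also have "\<dots> = (x1 \<bullet> edir tt3) * sin (b - a)" by (rule edir_three_point[symmetric])
   finally have "S tt3 h1 <= x1 \<bullet> edir tt3" using s(3) by (simp add: mult_le_cancel_right)
   also have "\<dots> = z \<bullet> edir tt3 + c * cos r" by (simp add: x1e tt3_def)
   also have "\<dots> < z \<bullet> edir tt3 + c"
   proof -
    have "cos r < cos 0" using r lt by (intro cos_monotone_0_pi) auto
    then show ?thesis using c by simp
   qed
   also have "\<dots> <= S tt3 h1" using dl(3)[of tt3 h1] r dl(1) by (simp add: tt3_def)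
   finally show False by simp
  qed
 qed
 then show ?thesis by (simp add: x1_def)
qed

lemma touch_below_member:
 assumes x0: "x0 \<in> interior B" "u x0 < h1" and c: "c > 0"
  and touch: "touch_below S z c v M tt1 h1"
 shows "z + c *\<^sub>R edir tt1 \<in> K h1"
proof (rule S_membership)
 show "K h1 ~= {}" using K_interior_width(2)[OF x0] .
 fix tt
 obtain t where t: "tt1 - pi <= t" "t < tt1 - pi + 2 * pi" "edir t = edir tt" using edir_representative by blast
 have "(z + c *\<^sub>R edir tt1) \<bullet> edir t <= S t h1"
 proof (cases "t = tt1")
  case True
  then show ?thesis using touch by (simp add: touch_below_def inner_add_left edir_inner_edir)
 next
  case False
  then show ?thesis using touch_below_strict[OF x0 c touch, of t] t by (simp add: abs_le_iff)
 qed
 then show "(z + c *\<^sub>R edir tt1) \<bullet> edir tt <= S tt h1" using t(3) by (simp add: S_def)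
qed

text \<open>Near the contact point u stays below h1 + ta, a function of |x - z| to which
  \<open>sub_test\<close> applies. To see that x belongs to the sublevel set of this level, x is
  tested against all support lines: near tt1 by the touching disc, elsewhere by the strict gap of
  \<open>touch_below_strict\<close>, which survives small changes of x and of the level.\<close>

lemma contact_below:
 assumes sub: "sub_test aa ss u" and ss: "ss >= 0"
  and x0: "x0 \<in> interior B" "u x0 < h1"
  and pos: "c > 0" "v > 0" "M > 0"
  and touch: "touch_below S z c v M tt1 h1"
  and int: "z + c *\<^sub>R edir tt1 \<in> interior B"
 shows "inner_bound aa ss c v M" "z + c *\<^sub>R edir tt1 \<in> K h1"
proof -
 define x1 where "x1 = z + c *\<^sub>R edir tt1"
 define h0 where "h0 = u x0"
 have Kne: "K k ~= {}" if "k >= h0" for k using x0 interior_subset that by (auto simp: K_def h0_def)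
 have h01: "h0 < h1" using x0 by (simp add: h0_def)
 obtain dl where dl: "dl > 0" "S tt1 h1 = z \<bullet> edir tt1 + c"
  "!!tt h. \<bar>tt - tt1\<bar> < dl ==> \<bar>h - h1\<bar> < dl ==>
    z \<bullet> edir tt + c + v * (h - h1) - M * (h - h1)^2 <= S tt h" using touch unfolding touch_below_def by metis
 have x1e: "x1 \<bullet> edir tt = z \<bullet> edir tt + c * cos (tt - tt1)" for tt by (simp add: x1_def inner_add_left edir_inner_edir)
 have x1S: "x1 \<bullet> edir tt1 = S tt1 h1" using dl(2) by (simp add: x1e)
 have strict: "x1 \<bullet> edir tt < S tt h1" if "tt ~= tt1" "\<bar>tt - tt1\<bar> <= pi" for tt
  using touch_below_strict[OF x0 pos(1) touch that] by (simp add: x1_def)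
 obtain rh where "rh > 0" "\<forall>x\<in>K h1. norm x <= rh" using compact_imp_bounded[OF K_compact[of h1]] unfolding bounded_pos by blast
 then have rh: "K h1 \<subseteq> cball 0 rh" "rh > 0" by auto
 \<comment> \<open>The directions that the touching condition does not reach; on this compact set
   the gap has a positive minimum.\<close>
 define G where "G = {tt. dl / 2 <= \<bar>tt - tt1\<bar> & \<bar>tt - tt1\<bar> <= pi}"
 have cS: "continuous_on A (%tt. S tt h1)" for A
  using trig_convex_isCont[OF S_trig_convex[OF Kne[of h1]]] h01 by (intro continuous_at_imp_continuous_on) auto
 have "compact G"
 proof -
  have "G = {tt1 - pi..tt1 + pi} \<inter> {tt. dl / 2 <= \<bar>tt - tt1\<bar>}" by (auto simp: G_def)
  moreover have "closed {tt. dl / 2 <= \<bar>tt - tt1\<bar>}" by (intro closed_Collect_le continuous_intros)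
  ultimately show ?thesis by (simp add: compact_Int_closed)
 qed
 moreover have "continuous_on G (%tt. S tt h1 - x1 \<bullet> edir tt)" by (intro continuous_intros cS continuous_edir)
 ultimately obtain et where et: "et > 0" "!!tt. tt \<in> G ==> et <= S tt h1 - x1 \<bullet> edir tt"
 proof (cases "G = {}")
  case False
  assume "compact G" "continuous_on G (%tt. S tt h1 - x1 \<bullet> edir tt)"
  then obtain ttm where "ttm \<in> G" "!!tt. tt \<in> G ==> S ttm h1 - x1 \<bullet> edir ttm <= S tt h1 - x1 \<bullet> edir tt"
   using continuous_attains_inf[OF _ False] by blast
  moreover from this(1) have "\<bar>ttm - tt1\<bar> >= dl / 2" "\<bar>ttm - tt1\<bar> <= pi" by (simp_all add: G_def)
  then have "S ttm h1 - x1 \<bullet> edir ttm > 0" using strict[of ttm] dl(1) by force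
  ultimately show ?thesis using that by blast
 qed (use that[of 1] in auto)
 \<comment> \<open>Concavity in the level limits how fast the support function can drop, uniformly
   in the angle.\<close>
 have Slow: "S tt h1 - 2 * rh / (h1 - h0) * \<bar>k - h1\<bar> <= S tt k" if "h0 < k" for k tt
 proof (cases "k >= h1")
  case True
  then show ?thesis using S_mono[OF Kne[of h1] True, of tt] h01 rh by (auto intro: order_trans[rotated])
 next
  case False
  define t where "t = (k - h0) / (h1 - h0)"
  have "t * (h1 - h0) = k - h0" using h01 by (simp add: t_def)
  then have "(1 - t) * h0 + t * h1 = k" by (simp add: algebra_simps)
  moreover have "0 <= t" "t <= 1" using False that by (auto simp: t_def)
  ultimately have t: "0 <= t" "t <= 1" "(1 - t) * h0 + t * h1 = k" by blast+
  have sz: "\<bar>S tt h\<bar> <= rh" if hh: "h0 <= h" "h <= h1" for h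
  proof -
   obtain x where x: "x \<in> K h" "x \<bullet> edir tt = S tt h" using S_attained[OF Kne[OF hh(1)]] by blast
   then have "norm x <= rh" using K_mono[OF hh(2)] rh by auto
   moreover have "\<bar>x \<bullet> edir tt\<bar> <= norm x * norm (edir tt)" by (rule Cauchy_Schwarz_ineq2)
   ultimately show ?thesis using x by simp
  qed
  have "(1 - t) * S tt h0 + t * S tt h1 <= S tt k" using S_concave[of h0 h1 t tt] Kne[of h0] Kne[of h1] t h01 by simp
  moreover have "(1 - t) * (S tt h1 - S tt h0) <= (1 - t) * (2 * rh)" using t sz[of h0] sz[of h1] h01 by (intro mult_left_mono) auto
  moreover define X where "X = 2 * rh / (h1 - h0) * \<bar>k - h1\<bar>"
  have "(1 - t) * (2 * rh) = X"
  proof -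
   have "1 - t = \<bar>k - h1\<bar> / (h1 - h0)" using False h01 by (simp add: t_def field_simps)
   then show ?thesis by (simp add: X_def)
  qed
  ultimately have "S tt h1 - X <= S tt k" by (simp add: algebra_simps)
  then show ?thesis by (simp add: X_def)
 qed
 \<comment> \<open>Chosen so that v * N is the coefficient M / (2 * c^2 * v^2) of the preceding
   estimate.\<close>
 define N where "N = M / (2 * v ^ 3 * c^2)"
 have N0: "N > 0" using pos by (simp add: N_def)
 define w where "w x = (norm (x - z))^2 - c^2" for x :: "real^2"
 define ta where "ta x = w x / (2 * c * v) + N * (w x)^2" for x
 have nx1: "norm (x1 - z) = c" using pos by (simp add: x1_def)
 have w1: "w x1 = 0" "ta x1 = 0" by (simp_all add: w_def ta_def nx1)
 have lim: "filterlim (%x. w x) (nhds 0) (nhds x1)" "filterlim (%x. ta x) (nhds 0) (nhds x1)"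
 proof -
  have "continuous_on UNIV w" "continuous_on UNIV ta" using pos by (auto simp: w_def ta_def intro!: continuous_intros)
  then have "filterlim w (nhds (w x1)) (nhds x1)" "filterlim ta (nhds (ta x1)) (nhds x1)"
   by (auto simp: continuous_on_eq_continuous_at isCont_def tendsto_at_iff_tendsto_nhds)
  then show "filterlim (%x. w x) (nhds 0) (nhds x1)" "filterlim (%x. ta x) (nhds 0) (nhds x1)" by (simp_all add: w1)
 qed
 define ep where "ep = min dl (min ((h1 - h0) / 2) (et / 4 / (2 * rh / (h1 - h0))))"
 have ep: "ep > 0" using dl h01 et rh by (simp add: ep_def)
 have e1: "\<forall>\<^sub>F x in nhds x1. \<bar>ta x\<bar> < ep" using lim(2) ep by (auto simp: tendsto_iff dist_real_def)
 have e2: "\<forall>\<^sub>F x in nhds x1. \<bar>w x\<bar> < 2 / 5 / (2 * c * v) / N" using lim(1) pos N0 by (auto simp: tendsto_iff dist_real_def)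
 have e3: "\<forall>\<^sub>F x in nhds x1. x \<in> interior B" using eventually_nhds_in_open[OF open_interior int] by (simp add: x1_def)
 have e4: "\<forall>\<^sub>F x in nhds x1. dist x x1 < et / 4" using et(1) unfolding eventually_nhds_metric by (intro exI[of _ "et / 4"]) auto
 have main: "\<forall>\<^sub>F x in nhds x1. u x <= h1 + ta x" using e1 e2 e3 e4
 proof eventually_elim
  case (elim x)
  define k where "k = h1 + ta x"
  have k: "\<bar>k - h1\<bar> < dl" "h0 < k" "2 * rh / (h1 - h0) * \<bar>k - h1\<bar> < et / 4"
   using elim(1) h01 rh by (auto simp: k_def ep_def field_simps)
  define d where "d = norm (x - z) - c"
  have wd: "w x = 2 * c * d + d^2" by (simp add: w_def d_def power2_eq_square algebra_simps)
  have "\<bar>w x\<bar> * N < 2 / 5 / (2 * c * v)" using elim(2) N0 by (simp only: pos_less_divide_eq)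
  moreover have "\<bar>N * w x\<bar> = \<bar>w x\<bar> * N" using N0 by (simp add: abs_mult)
  ultimately have "\<bar>N * w x\<bar> <= 2 / 5 / (2 * c * v)" by linarith
  note est = quadratic_inverse_estimate[OF pos(1,2) less_imp_le[OF pos(3)] wd ta_def this]
  have "v * N = M / (2 * c^2 * v^2)" using pos by (simp add: N_def power2_eq_square power3_eq_cube)
  then have "M * (ta x)^2 <= v * N * (w x)^2" using est(1) by (simp only:)
  moreover have "0 <= d^2 / (2 * c)" using pos by simp
  ultimately have dle: "d <= v * ta x - M * (ta x)^2" using est(2) by linarith
  have "x \<in> K k"
  proof (rule S_membership[OF Kne])
   fix tt
   obtain j :: int where j: "\<bar>tt + 2 * pi * j - tt1\<bar> <= pi"
   proof -
    define j where "j = - \<lfloor>(tt - tt1 + pi) / (2 * pi)\<rfloor>"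
    have "of_int (- j) <= (tt - tt1 + pi) / (2 * pi)" "(tt - tt1 + pi) / (2 * pi) < of_int (- j) + 1" unfolding j_def by simp_all
    then have "\<bar>tt + 2 * pi * j - tt1\<bar> <= pi" by (auto simp: field_simps abs_le_iff)
    then show ?thesis using that by blast
   qed
   define ph where "ph = tt + 2 * pi * j"
   have ed: "edir tt = edir ph" by (simp add: ph_def vec_eq_iff forall_2 cos_add sin_add)
   have "x \<bullet> edir ph <= S ph k"
   proof (cases "\<bar>ph - tt1\<bar> < dl")
    case True
    have "x \<bullet> edir ph = z \<bullet> edir ph + (x - z) \<bullet> edir ph" by (simp add: inner_diff_left)
    also have "\<dots> <= z \<bullet> edir ph + (c + d)" using inner_edir_le[of "x - z" ph] by (simp add: d_def)
    also have "\<dots> <= z \<bullet> edir ph + c + v * (k - h1) - M * (k - h1)^2" using dle by (simp add: k_def)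
    also have "\<dots> <= S ph k" using dl(3)[OF True k(1)] .
    finally show ?thesis .
   next
    case False
    then have "ph \<in> G" using j dl by (auto simp: G_def ph_def)
    then have "et <= S ph h1 - x1 \<bullet> edir ph" by (rule et)
    moreover have "(x - x1) \<bullet> edir ph <= et / 4" using inner_edir_le[of "x - x1" ph] elim(4) by (simp add: dist_norm)
    moreover have "S ph h1 - et / 4 <= S ph k" using Slow[OF k(2), of ph] k(3) by simp
    ultimately show ?thesis using et(1) by (simp add: inner_diff_left)
   qed
   then show "x \<bullet> edir tt <= S tt k" by (simp add: ed S_def)
  qed (use k in auto)
  then show ?case by (simp add: K_def k_def)
 qed
 have "u x1 <= h1" using eventually_nhds_x_imp_x[OF main] w1 by simp
 then have x1K: "x1 \<in> K h1" using int interior_subset by (auto simp: K_def x1_def)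
 then show "z + c *\<^sub>R edir tt1 \<in> K h1" by (simp add: x1_def)
 from x1K have ux1: "u x1 = h1" using S_support_point[OF _ x1S] int by (simp add: x1_def)
 define a where "a = 1 / (2 * c * v)"
 have "\<forall>\<^sub>F x in nhds x1. u x - (h1 + a * ((norm (x - z))^2 - c^2) + N * ((norm (x - z))^2 - c^2)^2)
  <= u x1 - (h1 + a * ((norm (x1 - z))^2 - c^2) + N * ((norm (x1 - z))^2 - c^2)^2)"
  using main by eventually_elim (simp add: ta_def w_def nx1 ux1 a_def)
 with sub[unfolded sub_test_def Let_def, rule_format, of "%t. h1 + a * (t - c^2) + N * (t - c^2)^2"
   "%t. a + 2 * N * (t - c^2)" "%t. 2 * N" x1 z] test_polynomial(1)[of h1 a "c^2" N] test_polynomial(2)[of a N "c^2"] test_polynomial(3)[of N] pos nx1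
 have "1 <= (ss + 4 * a^2 * c^2) powr (1 / (2 * aa) - 1 / 2) * (2 * a + (2 * a + 4 * c^2 * (2 * N)) * (ss / (ss + 4 * a^2 * c^2)))"
  by (auto simp: a_def)
 also have "4 * a^2 * c^2 = 1 / v^2" using pos by (simp add: a_def power_divide power_mult_distrib)
 also have "4 * c^2 * (2 * N) = 4 * M * (1 / v) * (1 / v^2)" using pos by (simp add: N_def power2_eq_square power3_eq_cube)
 also have "2 * a = (1 / v) * (1 / c)" using pos by (simp add: a_def)
 also have "(ss + 1 / v^2) powr (1 / (2 * aa) - 1 / 2) *
   (1 / v * (1 / c) + (1 / v * (1 / c) + 4 * M * (1 / v) * (1 / v^2)) * (ss / (ss + 1 / v^2)))
  <= (ss + 1 / v^2) powr (1 / (2 * aa) - 1 / 2) * ((1 / v) * (1 / c + ss / (c * (ss + 1 / v^2)) + 4 * ss * M))"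
 proof (intro mult_left_mono)
  have D: "ss + 1 / v^2 > 0" using ss pos by (intro add_nonneg_pos) auto
  have "1 / v^2 * (ss / (ss + 1 / v^2)) = ss * ((1 / v^2) / (ss + 1 / v^2))" by simp
  also have "\<dots> <= ss * 1"
  proof (rule mult_left_mono[OF _ ss])
   show "(1 / v^2) / (ss + 1 / v^2) <= 1" unfolding divide_le_eq_1_pos[OF D] using ss by simp
  qed
  finally have fact: "4 * M * (1 / v) * (1 / v^2 * (ss / (ss + 1 / v^2))) <= 4 * M * (1 / v) * ss" using pos by (intro mult_left_mono) auto
  have gen: "f * k + (f * k + m * f * g) * r <= f * (k + r * k + m * y)"
   if "m * f * (g * r) <= m * f * y" for f g k m r y :: real using that by (simp add: algebra_simps)
  have eq: "ss / (c * (ss + 1 / v^2)) = ss / (ss + 1 / v^2) * (1 / c)" "4 * ss * M = 4 * M * ss" by simp_all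
  show "1 / v * (1 / c) + (1 / v * (1 / c) + 4 * M * (1 / v) * (1 / v^2)) * (ss / (ss + 1 / v^2))
   <= (1 / v) * (1 / c + ss / (c * (ss + 1 / v^2)) + 4 * ss * M)" unfolding eq by (rule gen[OF fact])
 qed simp
 finally show "inner_bound aa ss c v M" by (simp add: inner_bound_def mult.assoc)
qed

text \<open>Here each nearby point is tested only in its own direction from z: a point with u x < h1
  + ta x would stick out of the expanding circle. So u >= h1 + ta near the contact point, and
  \<open>super_test\<close> bounds the radius from below.\<close>

lemma contact_above:
 assumes super: "super_test aa ss u" and ss: "ss >= 0"
  and x0: "x0 \<in> B" "u x0 < h1"
  and c: "c > 0"
  and touch: "touch_above S z c v M tt1 h1"
  and int: "z + c *\<^sub>R edir tt1 \<in> interior B"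
 shows "outer_bound aa ss c v"
proof -
 define x1 where "x1 = z + c *\<^sub>R edir tt1"
 have Kne: "K k ~= {}" if "k >= u x0" for k using x0 that by (auto simp: K_def)
 obtain dl where dl: "dl > 0" "S tt1 h1 = z \<bullet> edir tt1 + c"
  "!!tt h. \<bar>tt - tt1\<bar> < dl ==> \<bar>h - h1\<bar> < dl ==>
    S tt h <= z \<bullet> edir tt + c + v * (h - h1) + M * (h - h1)^2" using touch unfolding touch_above_def by metis
 define M' where "M' = \<bar>M\<bar> + 1"
 have M': "M' > 0" "M <= M'" by (auto simp: M'_def)
 have dl': "S tt h <= z \<bullet> edir tt + c + v * (h - h1) + M' * (h - h1)^2"
  if "\<bar>tt - tt1\<bar> < dl" "\<bar>h - h1\<bar> < dl" for tt h
 proof -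
  have "M * (h - h1)^2 <= M' * (h - h1)^2" using M' by (intro mult_right_mono) auto
  then show ?thesis using dl(3)[OF that] by linarith
 qed
 obtain xs where xs: "xs \<in> K h1" "xs \<bullet> edir tt1 = S tt1 h1" using S_attained[OF Kne[of h1]] x0 by auto
 have "xs = x1"
 proof -
  define y where "y = xs - z"
  have y1: "y \<bullet> edir tt1 = c" using xs dl(2) by (simp add: y_def inner_diff_left)
  have le: "y \<bullet> edir tt <= c" if "\<bar>tt - tt1\<bar> < dl" for tt
   using S_upper[OF xs(1), of tt] dl(3)[OF that, of h1] dl(1) by (simp add: y_def inner_diff_left)
  have "DERIV (%tt. y \<bullet> edir tt) tt1 :> y \<bullet> edir (tt1 + pi / 2)"
   unfolding inner_edir by (auto intro!: derivative_eq_intros simp: cos_add sin_add)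
  then have "y \<bullet> edir (tt1 + pi / 2) = 0" by (rule DERIV_local_max[OF _ dl(1)]) (use le y1 in \<open>auto simp: abs_minus_commute\<close>)
  then have "- y $ 1 * sin tt1 + y $ 2 * cos tt1 = 0" "y $ 1 * cos tt1 + y $ 2 * sin tt1 = c" using y1 by (simp_all add: inner_edir cos_add sin_add)
  then have "y $ 1 = c * cos tt1" "y $ 2 = c * sin tt1" using sin_cos_squared_add[of tt1] by algebra+
  then have "y = c *\<^sub>R edir tt1" by (simp add: vec_eq_iff forall_2)
  then show ?thesis by (simp add: y_def x1_def algebra_simps)
 qed
 then have x1K: "x1 \<in> K h1" and x1S: "x1 \<bullet> edir tt1 = S tt1 h1" using xs by auto
 have ux1: "u x1 = h1" using S_support_point[OF x1K x1S] int by (simp add: x1_def)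
 text \<open>Convexity bounds the radial growth of \<open>u\<close> at \<open>x1\<close>, so the set moves with positive speed.\<close>
 have v: "v > 0"
 proof (rule ccontr)
  assume nv: "\<not> v > 0"
  obtain e0 where e0: "e0 > 0" "cball x1 e0 \<subseteq> B" using int unfolding mem_interior_cball x1_def by blast
  define l where "l = max 1 ((u (x1 + e0 *\<^sub>R edir tt1) - h1) / e0)"
  have l: "l >= 1" "u (x1 + e0 *\<^sub>R edir tt1) - h1 <= l * e0"
  proof -
   show "l >= 1" by (simp add: l_def)
   have "(u (x1 + e0 *\<^sub>R edir tt1) - h1) / e0 <= l" by (simp add: l_def)
   then show "u (x1 + e0 *\<^sub>R edir tt1) - h1 <= l * e0" using e0 by (simp add: pos_divide_le_eq)
  qed
  have step: "1 <= M' * l^2 * ep" if ep: "0 < ep" "ep <= e0" "l * ep < dl" for ep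
  proof -
   have "u ((1 - ep / e0) *\<^sub>R x1 + (ep / e0) *\<^sub>R (x1 + e0 *\<^sub>R edir tt1))
    <= (1 - ep / e0) * u x1 + (ep / e0) * u (x1 + e0 *\<^sub>R edir tt1)" using ep e0 by (intro convex_onD[OF cvx]) auto
   also have "(1 - ep / e0) *\<^sub>R x1 + (ep / e0) *\<^sub>R (x1 + e0 *\<^sub>R edir tt1) = x1 + ep *\<^sub>R edir tt1"
    using e0 by (simp add: algebra_simps)
   also have "(1 - ep / e0) * u x1 + (ep / e0) * u (x1 + e0 *\<^sub>R edir tt1)
    = h1 + (ep / e0) * (u (x1 + e0 *\<^sub>R edir tt1) - h1)" by (simp add: ux1 algebra_simps)
   also have "\<dots> <= h1 + (ep / e0) * (l * e0)" using l ep e0 by (intro add_left_mono mult_left_mono) auto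
   finally have ule: "u (x1 + ep *\<^sub>R edir tt1) <= h1 + l * ep" using e0 by (simp add: mult.commute)
   have "x1 + ep *\<^sub>R edir tt1 \<in> cball x1 e0" using ep by (simp add: dist_norm)
   then have "x1 + ep *\<^sub>R edir tt1 \<in> K (h1 + l * ep)" using e0 ule by (auto simp: K_def)
   from S_upper[OF this, of tt1] have "S tt1 h1 + ep <= S tt1 (h1 + l * ep)" using x1S by (simp add: inner_add_left edir_inner_edir)
   also have "\<dots> <= z \<bullet> edir tt1 + c + v * (l * ep) + M' * (l * ep)^2" using dl'[of tt1 "h1 + l * ep"] ep l dl by simp
   also have "v * (l * ep) <= 0" using nv l ep by (intro mult_nonpos_nonneg) auto
   finally have "ep * 1 <= ep * (M' * l^2 * ep)" using dl(2) by (simp add: power2_eq_square algebra_simps)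
   then show ?thesis using ep(1) by (subst (asm) mult_le_cancel_left_pos) auto
  qed
  define ep where "ep = min e0 (min (dl / (2 * l)) (1 / (2 * (M' * l^2))))"
  have A: "M' * l^2 > 0" using M' l by simp
  have "ep > 0" "ep <= e0" using e0 dl(1) l A by (auto simp: ep_def)
  moreover have "l * ep <= l * (dl / (2 * l))" using l by (intro mult_left_mono) (auto simp: ep_def)
  then have "l * ep < dl" using l dl(1) by simp
  ultimately have "1 <= M' * l^2 * ep" by (rule step)
  also have "\<dots> <= M' * l^2 * (1 / (2 * (M' * l^2)))" using A by (intro mult_left_mono) (auto simp: ep_def)
  also have "\<dots> = 1 / 2" using M' l by simp
  finally show False by simp
 qed
 \<comment> \<open>The first part pays for d^2 / (2 * c), the second for M' * t^2.\<close>
 define N where "N = 1 / (2 * c ^ 3 * v) + M' / (2 * v ^ 3 * c^2)"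
 have N0: "N > 0" using c v M' by (simp add: N_def add_pos_pos)
 define w where "w x = (norm (x - z))^2 - c^2" for x :: "real^2"
 define ta where "ta x = w x / (2 * c * v) + (- N) * (w x)^2" for x
 have nx1: "norm (x1 - z) = c" using c by (simp add: x1_def)
 have w1: "w x1 = 0" "ta x1 = 0" by (simp_all add: w_def ta_def nx1)
 define g where "g x = arctan (((x - z) \<bullet> edir (tt1 + pi / 2)) / ((x - z) \<bullet> edir tt1))" for x
 have x1z: "(x1 - z) \<bullet> edir tt1 = c" "(x1 - z) \<bullet> edir (tt1 + pi / 2) = 0" by (simp_all add: x1_def edir_inner_edir)
 have lim: "filterlim w (nhds 0) (nhds x1)" "filterlim ta (nhds 0) (nhds x1)" "filterlim g (nhds 0) (nhds x1)"
  "filterlim (%x. (x - z) \<bullet> edir tt1) (nhds c) (nhds x1)" "filterlim (%x. norm (x - z)) (nhds c) (nhds x1)"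
  "filterlim u (nhds h1) (nhds x1)"
 proof -
  have "isCont w x1" "isCont ta x1" "isCont g x1" "isCont (%x. (x - z) \<bullet> edir tt1) x1" "isCont (%x. norm (x - z)) x1"
   unfolding w_def ta_def g_def using c v x1z by (auto intro!: continuous_intros)
  moreover have "isCont u x1" using cont_u[of UNIV] by (simp add: continuous_on_eq_continuous_at)
  moreover have "g x1 = 0" using x1z by (simp add: g_def)
  ultimately show "filterlim w (nhds 0) (nhds x1)" "filterlim ta (nhds 0) (nhds x1)" "filterlim g (nhds 0) (nhds x1)"
   "filterlim (%x. (x - z) \<bullet> edir tt1) (nhds c) (nhds x1)" "filterlim (%x. norm (x - z)) (nhds c) (nhds x1)"
   "filterlim u (nhds h1) (nhds x1)" using w1 x1z nx1 ux1 by (auto intro!: isCont_tendsto_nhds)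
 qed
 \<comment> \<open>For |t| < v / (2 * M') the function v * t + M' * t^2 is increasing.\<close>
 define ep where "ep = min dl (v / (2 * M'))"
 have ep: "ep > 0" using dl v M' by (simp add: ep_def)
 have e1: "\<forall>\<^sub>F x in nhds x1. \<bar>ta x\<bar> < ep" using lim(2) ep by (auto simp: tendsto_iff dist_real_def)
 have e2: "\<forall>\<^sub>F x in nhds x1. \<bar>w x\<bar> < 2 / 5 / (2 * c * v) / N" using lim(1) c v N0 by (auto simp: tendsto_iff dist_real_def)
 have e3: "\<forall>\<^sub>F x in nhds x1. x \<in> interior B" using eventually_nhds_in_open[OF open_interior int] by (simp add: x1_def)
 have e4: "\<forall>\<^sub>F x in nhds x1. \<bar>g x\<bar> < dl" using lim(3) dl by (auto simp: tendsto_iff dist_real_def)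
 have e5: "\<forall>\<^sub>F x in nhds x1. \<bar>u x - h1\<bar> < ep" using lim(6) ep by (auto simp: tendsto_iff dist_real_def)
 have e6: "\<forall>\<^sub>F x in nhds x1. 0 < (x - z) \<bullet> edir tt1" using order_tendstoD(1)[OF lim(4)] c by simp
 have e7: "\<forall>\<^sub>F x in nhds x1. \<bar>norm (x - z) - c\<bar> < c" using lim(5) c by (auto simp: tendsto_iff dist_real_def)
 have main: "\<forall>\<^sub>F x in nhds x1. u x >= h1 + ta x" using e1 e2 e3 e4 e5 e6 e7
 proof eventually_elim
  case (elim x)
  show ?case
  proof (rule ccontr)
   assume n: "\<not> u x >= h1 + ta x"
   define t where "t = u x - h1"
   have t: "t < ta x" "\<bar>t\<bar> < ep" using n elim by (auto simp: t_def)
   define d where "d = norm (x - z) - c"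
   have wd: "w x = 2 * c * d + d^2" by (simp add: w_def d_def power2_eq_square algebra_simps)
   have "\<bar>w x\<bar> * N < 2 / 5 / (2 * c * v)" using elim(2) N0 by (simp only: pos_less_divide_eq)
   moreover have "\<bar>- N * w x\<bar> = \<bar>w x\<bar> * N" using N0 by (simp add: abs_mult)
   ultimately have "\<bar>- N * w x\<bar> <= 2 / 5 / (2 * c * v)" by linarith
   note est = quadratic_inverse_estimate[OF c v less_imp_le[OF M'(1)] wd ta_def this]
   have "x \<in> K (u x)" using elim(3) interior_subset by (auto simp: K_def)
   \<comment> \<open>The direction of x seen from the centre z; close to tt1 because x is close to
     x1.\<close>
   define tt where "tt = tt1 + g x"
   have pol: "x - z = norm (x - z) *\<^sub>R edir tt" using polar_arctan[OF elim(6)] by (simp add: tt_def g_def)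
   have "(x - z) \<bullet> edir tt = norm (x - z)" by (subst pol) (simp add: edir_inner_edir)
   then have "z \<bullet> edir tt + (c + d) = x \<bullet> edir tt" by (simp add: d_def inner_diff_left)
   also have "\<dots> <= S tt (u x)" using \<open>x \<in> K (u x)\<close> by (rule S_upper)
   also have "\<dots> <= z \<bullet> edir tt + c + v * t + M' * t^2" using dl'[of tt "u x"] elim(4) t(2) by (simp add: tt_def t_def ep_def)
   finally have "d <= v * t + M' * t^2" by simp
   also have "\<dots> < v * ta x + M' * (ta x)^2"
   proof -
    have "\<bar>t\<bar> < v / (2 * M')" "\<bar>ta x\<bar> < v / (2 * M')" using t(2) elim(1) by (simp_all add: ep_def)
    moreover have "v / M' = v / (2 * M') + v / (2 * M')" using M' by (simp add: field_simps)
    ultimately have "\<bar>t + ta x\<bar> < v / M'" by linarith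
    then have "M' * \<bar>t + ta x\<bar> < v" using M' by (simp add: field_simps)
    then have "\<bar>M' * (t + ta x)\<bar> < v" using M' by (simp only: abs_mult abs_of_pos)
    then have "v + M' * (t + ta x) > 0" by linarith
    then have "(ta x - t) * (v + M' * (t + ta x)) > 0" using t(1) by (intro mult_pos_pos) auto
    then show ?thesis by (simp add: power2_eq_square algebra_simps)
   qed
   also have "\<dots> <= d"
   proof -
    have "c^2 * d^2 <= (w x)^2"
    proof -
     have "w x = d * (2 * c + d)" by (simp add: wd power2_eq_square algebra_simps)
     moreover have "c^2 <= (2 * c + d)^2" using elim(7) c by (intro power_mono) (auto simp: d_def)
     ultimately show ?thesis using mult_right_mono[of "c^2" "(2 * c + d)^2" "d^2"] by (simp add: power_mult_distrib mult.commute)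
    qed
    then have "d^2 / (2 * c) <= (w x)^2 / (2 * c ^ 3)" using c by (simp add: field_simps power2_eq_square power3_eq_cube)
    moreover have "v * (- N) * (w x)^2 = - ((w x)^2 / (2 * c ^ 3)) - M' / (2 * c^2 * v^2) * (w x)^2"
    proof -
     have "v * N = 1 / (2 * c ^ 3) + M' / (2 * c^2 * v^2)" using v by (simp add: N_def distrib_left power2_eq_square power3_eq_cube)
     then have "v * (- N) = - (1 / (2 * c ^ 3)) - M' / (2 * c^2 * v^2)" by simp
     then show ?thesis by (simp only: left_diff_distrib) simp
    qed
    ultimately show ?thesis using est by linarith
   qed
   finally show False by simp
  qed
 qed
 define a where "a = 1 / (2 * c * v)"
 have "\<forall>\<^sub>F x in nhds x1. u x - (h1 + a * ((norm (x - z))^2 - c^2) + (- N) * ((norm (x - z))^2 - c^2)^2)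
  >= u x1 - (h1 + a * ((norm (x1 - z))^2 - c^2) + (- N) * ((norm (x1 - z))^2 - c^2)^2)"
  using main by eventually_elim (simp add: ta_def w_def nx1 ux1 a_def)
 with super[unfolded super_test_def Let_def, rule_format, of "%t. h1 + a * (t - c^2) + (- N) * (t - c^2)^2"
   "%t. a + 2 * (- N) * (t - c^2)" "%t. 2 * (- N)" x1 z]
  test_polynomial(1)[of h1 a "c^2" "- N"] test_polynomial(2)[of a "- N" "c^2"] test_polynomial(3)[of "- N"] c v nx1
 have "(ss + 4 * a^2 * c^2) powr (1 / (2 * aa) - 1 / 2) * (2 * a) <= 1" by (auto simp: a_def)
 also have "4 * a^2 * c^2 = 1 / v^2" using c v by (simp add: a_def power_divide power_mult_distrib)
 also have "2 * a = (1 / v) / c" using c v by (simp add: a_def)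
 finally have "(ss + 1 / v^2) powr (1 / (2 * aa) - 1 / 2) * ((1 / v) / c) <= 1" .
 then have "((ss + 1 / v^2) powr (1 / (2 * aa) - 1 / 2) * (1 / v)) / c <= 1" by (simp only: times_divide_eq_right)
 then have "(ss + 1 / v^2) powr (1 / (2 * aa) - 1 / 2) * (1 / v) <= c" unfolding pos_divide_le_eq[OF c] by simp
 then show ?thesis using v by (simp add: outer_bound_def)
qed

end

section \<open>Existence of contact circles\<close>

text \<open>A step of length t along the chord towards h costs an error of order t^2, while
  concavity gives a gain of order t; for t tending to 0 the local bound becomes a global linear
  one.\<close>

lemma concave_touch_above_imp_supergradient:
 fixes f :: "real => real"
 assumes conc: "!!h t. h >= l ==> 0 <= t ==> t <= 1 ==> (1 - t) * f k + t * f h <= f ((1 - t) * k + t * h)"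
  and dl: "dl > 0" "!!h. \<bar>h - k\<bar> < dl ==> f h <= f k + v * (h - k) + M * (h - k)^2"
  and h: "h >= l"
 shows "f h <= f k + v * (h - k)"
proof (rule field_le_epsilon)
 fix e :: real assume e: "e > 0"
 define D where "D = \<bar>h - k\<bar> + 1"
 define t where "t = min 1 (min (dl / (2 * D)) (e / ((\<bar>M\<bar> + 1) * D^2)))"
 have D: "D >= 1" "\<bar>h - k\<bar> < D" by (auto simp: D_def)
 have t: "0 < t" "t <= 1" using dl e D by (auto simp: t_def)
 have tD: "t * D <= dl / 2"
 proof -
  have "t * D <= dl / (2 * D) * D" using D by (intro mult_right_mono) (auto simp: t_def)
  then show ?thesis using D by simp
 qed
 have eq: "(1 - t) * k + t * h - k = t * (h - k)" by (simp add: algebra_simps)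
 then have "\<bar>(1 - t) * k + t * h - k\<bar> = t * \<bar>h - k\<bar>" using t by (simp add: abs_mult)
 also have "\<dots> <= t * D" using t D by (intro mult_left_mono) auto
 finally have near: "\<bar>(1 - t) * k + t * h - k\<bar> < dl" using tD dl(1) by simp
 have "(1 - t) * f k + t * f h <= f k + v * (t * (h - k)) + M * (t * (h - k))^2" using conc[OF h, of t] t dl(2)[OF near] unfolding eq by simp
 then have "t * f h <= t * (f k + v * (h - k) + t * M * (h - k)^2)" by (simp add: power2_eq_square algebra_simps)
 then have 1: "f h <= f k + v * (h - k) + t * (M * (h - k)^2)" using t by (simp add: mult.assoc)
 have "M * (h - k)^2 <= (\<bar>M\<bar> + 1) * D^2" using D by (intro mult_mono) (auto simp: abs_le_square_iff[symmetric])
 then have "t * (M * (h - k)^2) <= t * ((\<bar>M\<bar> + 1) * D^2)" using t by (intro mult_left_mono) auto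
 also have "\<dots> <= e / ((\<bar>M\<bar> + 1) * D^2) * ((\<bar>M\<bar> + 1) * D^2)" by (intro mult_right_mono) (auto simp: t_def)
 also have "\<dots> = e" using D by (simp add: add_nonneg_eq_0_iff)
 finally show "f h <= f k + v * (h - k) + e" using 1 by linarith
qed

text \<open>Here k is a convex combination of h and a point k' at distance ep on the other side of
  k, where the parabola bounds f from below; k > l leaves room for k'.\<close>

lemma concave_touch_below_imp_supergradient:
 fixes f :: "real => real"
 assumes conc: "!!h1 h2 t. h1 >= l ==> h2 >= l ==> 0 <= t ==> t <= 1 ==>
   (1 - t) * f h1 + t * f h2 <= f ((1 - t) * h1 + t * h2)"
  and k: "k > l"
  and dl: "dl > 0" "!!h. \<bar>h - k\<bar> < dl ==> f k + v * (h - k) - M * (h - k)^2 <= f h"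
  and h: "h >= l"
 shows "f h <= f k + v * (h - k)"
proof (cases "h = k")
 case False
 show ?thesis
 proof (rule field_le_epsilon)
  fix e :: real assume e: "e > 0"
  define s where "s = sgn (h - k)"
  have s: "\<bar>h - k\<bar> = s * (h - k)" "s * s = 1" "\<bar>s\<bar> = 1" using False by (auto simp: s_def sgn_if)
  define ep where "ep = min (dl / 2) (min (k - l) (e / ((\<bar>M\<bar> + 1) * \<bar>h - k\<bar>)))"
  have ep: "ep > 0" "ep < dl" "ep <= k - l" using dl k e False by (auto simp: ep_def)
  define k' where "k' = k - s * ep"
  have k': "k' >= l" "\<bar>k' - k\<bar> < dl" "(k' - k)^2 = ep^2" using ep s False by (auto simp: k'_def s_def sgn_if power2_eq_square)
  define t where "t = ep / (ep + \<bar>h - k\<bar>)"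
  have t: "0 <= t" "t <= 1" using ep by (auto simp: t_def)
  have te: "t * (ep + \<bar>h - k\<bar>) = ep" using ep by (simp add: t_def)
  have "(1 - t) * k' + t * h = k - s * ep + s * (t * (ep + s * (h - k)))" using s(2) unfolding k'_def by algebra
  then have mid: "(1 - t) * k' + t * h = k" using te s(1) by simp
  have "(1 - t) * f k' + t * f h <= f k" using conc[OF k'(1) h t] by (simp add: mid)
  moreover have "f k' >= f k - v * s * ep - M * ep^2" using dl(2)[OF k'(2)] k'(3) by (simp add: k'_def)
  then have "(1 - t) * (f k - v * s * ep - M * ep^2) <= (1 - t) * f k'" using t by (intro mult_left_mono) auto
  ultimately have "t * f h <= t * f k + (1 - t) * (v * s * ep + M * ep^2)" by (simp add: algebra_simps)
  also have "(1 - t) * (v * s * ep + M * ep^2) = t * (v * (h - k) + M * ep * \<bar>h - k\<bar>)"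
  proof -
   have "(1 - t) * ep = t * \<bar>h - k\<bar>" using te by (simp add: algebra_simps)
   then have "(1 - t) * (v * s * ep + M * ep^2) = t * \<bar>h - k\<bar> * (v * s + M * ep)" by algebra
   also have "\<dots> = t * (v * (h - k) + M * ep * \<bar>h - k\<bar>)" using s by algebra
   finally show ?thesis .
  qed
  finally have "t * f h <= t * (f k + (v * (h - k) + M * ep * \<bar>h - k\<bar>))" by (simp add: algebra_simps)
  moreover have "t > 0" using ep by (simp add: t_def)
  ultimately have 1: "f h <= f k + v * (h - k) + ep * (M * \<bar>h - k\<bar>)" by (simp add: mult_ac)
  have "ep * (M * \<bar>h - k\<bar>) <= ep * ((\<bar>M\<bar> + 1) * \<bar>h - k\<bar>)" using ep by (intro mult_left_mono mult_right_mono) auto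
  also have "\<dots> <= e / ((\<bar>M\<bar> + 1) * \<bar>h - k\<bar>) * ((\<bar>M\<bar> + 1) * \<bar>h - k\<bar>)"
   by (intro mult_right_mono) (auto simp: ep_def)
  also have "\<dots> = e" using False by (simp add: add_nonneg_eq_0_iff)
  finally show "f h <= f k + v * (h - k) + e" using 1 by linarith
 qed
qed simp

lemma concave_lipschitz_joint_continuous:
 fixes s :: "real => real => real"
 assumes lip: "!!tt ph h. l < h ==> h < m ==> \<bar>s tt h - s ph h\<bar> <= r * \<bar>tt - ph\<bar>"
  and conc: "!!tt. concave_on {l<..<m} (s tt)"
 shows "continuous_on (UNIV \<times> {l<..<m}) (%p. s (fst p) (snd p))"
proof (rule continuous_at_imp_continuous_on, rule ballI)
 fix p :: "real \<times> real" assume p: "p \<in> UNIV \<times> {l<..<m}"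
 define tt0 h0 where "tt0 = fst p" and "h0 = snd p"
 have h0: "l < h0" "h0 < m" using p by (auto simp: h0_def)
 have "continuous_on {l<..<m} (%h. - s tt0 h)" using conc[of tt0] by (intro convex_on_continuous) (auto simp: concave_on_def)
 then have "continuous_on {l<..<m} (s tt0)" using continuous_on_minus by fastforce
 then have "isCont (s tt0) h0" using h0 by (simp add: continuous_on_eq_continuous_at)
 then have c: "(s tt0 \<longlongrightarrow> s tt0 h0) (nhds h0)" by (simp add: isCont_tendsto_nhds)
 have f: "(fst \<longlongrightarrow> tt0) (at p)" and g: "(snd \<longlongrightarrow> h0) (at p)" unfolding tt0_def h0_def by (intro tendsto_intros)+
 have "((%x. \<bar>r\<bar> * \<bar>fst x - tt0\<bar> + \<bar>s tt0 (snd x) - s tt0 h0\<bar>) \<longlongrightarrow>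
   \<bar>r\<bar> * \<bar>tt0 - tt0\<bar> + \<bar>s tt0 h0 - s tt0 h0\<bar>) (at p)" by (intro tendsto_intros f filterlim_compose[OF c] g)
 then have lim: "((%x. \<bar>r\<bar> * \<bar>fst x - tt0\<bar> + \<bar>s tt0 (snd x) - s tt0 h0\<bar>) \<longlongrightarrow> 0) (at p)" by simp
 have ev: "\<forall>\<^sub>F x in at p. l < snd x & snd x < m"
  using order_tendstoD(1)[OF g h0(1)] order_tendstoD(2)[OF g h0(2)] by eventually_elim auto
 have "((%x. s (fst x) (snd x) - s tt0 h0) \<longlongrightarrow> 0) (at p)"
 proof (rule Lim_null_comparison[OF _ lim], rule eventually_mono[OF ev])
  fix x :: "real \<times> real" assume x: "l < snd x & snd x < m"
  have "\<bar>s (fst x) (snd x) - s tt0 (snd x)\<bar> <= r * \<bar>fst x - tt0\<bar>" using lip x by blast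
  also have "\<dots> <= \<bar>r\<bar> * \<bar>fst x - tt0\<bar>" by (intro mult_right_mono) auto
  finally show "norm (s (fst x) (snd x) - s tt0 h0) <= \<bar>r\<bar> * \<bar>fst x - tt0\<bar> + \<bar>s tt0 (snd x) - s tt0 h0\<bar>" by simp
 qed
 then show "isCont (%p. s (fst p) (snd p)) p" unfolding isCont_def tt0_def h0_def by (simp add: LIM_zero_iff)
qed

text \<open>Maximise s - z \<bullet> edir - M * (h - k)^2 over [a, b] times [k, k + d]. The strict
  peak at level k keeps the maximum off the ends of the angular interval, and the penalty keeps it
  off the top level. The bottom level k is allowed: lower levels have smaller s, so the contact
  persists below it.\<close>

lemma exists_touch_above:
 fixes s :: "real => real => real"
 assumes cont: "continuous_on (UNIV \<times> {l<..<m}) (%p. s (fst p) (snd p))" and k: "l < k" "k < m"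
  and mono: "!!tt h1 h2. l < h1 ==> h1 <= h2 ==> h2 < m ==> s tt h1 <= s tt h2"
  and peak: "a < ttm" "ttm < b" "s a k - z \<bullet> edir a < s ttm k - z \<bullet> edir ttm"
   "s b k - z \<bullet> edir b < s ttm k - z \<bullet> edir ttm"
  and R: "!!tt. a <= tt ==> tt <= b ==> s tt k - z \<bullet> edir tt <= R"
  and et: "et > 0"
 shows "\<exists>tt1 k1 c v M. a < tt1 & tt1 < b & k <= k1 & k1 < k + et & k1 < m &
  s ttm k - z \<bullet> edir ttm <= c & c <= R + et & touch_above s z c v M tt1 k1"
proof -
 define G where "G = s ttm k - z \<bullet> edir ttm"
 define g where "g = min et (min (G - (s a k - z \<bullet> edir a)) (G - (s b k - z \<bullet> edir b))) / 2"
 have g: "g > 0" "g < et" "g < G - (s a k - z \<bullet> edir a)" "g < G - (s b k - z \<bullet> edir b)" using peak(3,4) et by (auto simp: g_def G_def)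
 define d0 where "d0 = min et (m - k) / 2"
 have d0: "d0 > 0" "d0 < et" "k + d0 < m" using k et by (auto simp: d0_def min_def field_simps)
 have "uniformly_continuous_on ({a..b} \<times> {k..k + d0}) (%p. s (fst p) (snd p))"
  by (intro compact_uniformly_continuous continuous_on_subset[OF cont] compact_Times) (use k d0 in auto)
 then obtain e where e: "e > 0" "!!p q. p \<in> {a..b} \<times> {k..k + d0} ==> q \<in> {a..b} \<times> {k..k + d0} ==> dist q p < e ==>
   dist (s (fst q) (snd q)) (s (fst p) (snd p)) < g" using g(1) unfolding uniformly_continuous_on_def by metis
 define d where "d = min d0 (e / 2)"
 have d: "d > 0" "d <= d0" "d < e" using d0 e by (auto simp: d_def)
 have osc: "s tt h < s tt k + g" if "a <= tt" "tt <= b" "k <= h" "h <= k + d" for tt h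
  using e(2)[of "(tt, k)" "(tt, h)"] that d by (auto simp: dist_prod_def dist_real_def)
 define M where "M = (\<bar>R\<bar> + g + \<bar>G\<bar> + 1) / d^2"
 have M: "M > 0" "M * d^2 = \<bar>R\<bar> + g + \<bar>G\<bar> + 1" using d g by (auto simp: M_def intro!: divide_pos_pos)
 define Ph where "Ph p = s (fst p) (snd p) - z \<bullet> edir (fst p) - M * (snd p - k)^2" for p
 have "continuous_on ({a..b} \<times> {k..k + d}) Ph" unfolding Ph_def
  by (intro continuous_intros continuous_on_subset[OF cont] continuous_on_compose2[OF continuous_edir])
   (use k d d0 in auto)
 then obtain p where p: "p \<in> {a..b} \<times> {k..k + d}" "!!q. q \<in> {a..b} \<times> {k..k + d} ==> Ph q <= Ph p"
  using continuous_attains_sup[of "{a..b} \<times> {k..k + d}" Ph] peak d by (auto simp: compact_Times)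
 define tt1 k1 where "tt1 = fst p" and "k1 = snd p"
 have p': "a <= tt1" "tt1 <= b" "k <= k1" "k1 <= k + d" using p(1) by (auto simp: tt1_def k1_def)
 have Gle: "G <= Ph p" using p(2)[of "(ttm, k)"] peak d by (simp add: Ph_def G_def)
 define c where "c = s tt1 k1 - z \<bullet> edir tt1"
 have Php: "Ph p = c - M * (k1 - k)^2" by (simp add: Ph_def c_def tt1_def k1_def)
 have Mn: "M * (k1 - k)^2 >= 0" using M by simp
 have cG: "G <= c" using Gle Php Mn by linarith
 have cs: "c < s tt1 k - z \<bullet> edir tt1 + g" using osc[OF p'] by (simp add: c_def)
 have cR: "c < R + g" using cs R[OF p'(1,2)] by simp
 have ne: "tt1 ~= a" "tt1 ~= b" using cs cG g by auto
 have "k1 ~= k + d"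
 proof
  assume "k1 = k + d"
  then have "Ph p = c - (\<bar>R\<bar> + g + \<bar>G\<bar> + 1)" using Php M by simp
  then show False using Gle cR by linarith
 qed
 then have k1: "k1 < k + d" using p' by simp
 define v where "v = 2 * M * (k1 - k)"
 have "touch_above s z c v M tt1 k1" unfolding touch_above_def
 proof (intro conjI exI[of _ "Min {tt1 - a, b - tt1, k + d - k1, k1 - l}"] allI impI)
  show "s tt1 k1 = z \<bullet> edir tt1 + c" by (simp add: c_def)
  show "0 < Min {tt1 - a, b - tt1, k + d - k1, k1 - l}" using ne p' k1 k by auto
  fix tt h assume *: "\<bar>tt - tt1\<bar> < Min {tt1 - a, b - tt1, k + d - k1, k1 - l}" "\<bar>h - k1\<bar> < Min {tt1 - a, b - tt1, k + d - k1, k1 - l}"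
  have tt: "a <= tt" "tt <= b" and h: "h <= k + d" "l < h" using * by auto
  have "s tt h - z \<bullet> edir tt - M * (h - k)^2 <= Ph p"
  proof (cases "k <= h")
   case True
   then show ?thesis using p(2)[of "(tt, h)"] tt h by (simp add: Ph_def)
  next
   case False
   then have "s tt h <= s tt k" using h k by (intro mono) auto
   moreover have "M * (h - k)^2 >= 0" using M by simp
   ultimately show ?thesis using p(2)[of "(tt, k)"] tt d by (simp add: Ph_def)
  qed
  moreover have "v * (h - k1) + M * (h - k1)^2 = M * (h - k)^2 - M * (k1 - k)^2" unfolding v_def by algebra
  ultimately show "s tt h <= z \<bullet> edir tt + c + v * (h - k1) + M * (h - k1)^2" using Php by linarith
 qed
 moreover have "a < tt1" "tt1 < b" "k1 < k + et" "k1 < m" "c <= R + et" using ne p' k1 cR g d d0 by auto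
 ultimately show ?thesis using p'(3) cG unfolding G_def by blast
qed

text \<open>The preceding lemma for - s with levels reversed, which again increases in the
  level.\<close>

lemma exists_touch_below:
 fixes s :: "real => real => real"
 assumes cont: "continuous_on (UNIV \<times> {l<..<m}) (%p. s (fst p) (snd p))" and k: "l < k" "k < m"
  and mono: "!!tt h1 h2. l < h1 ==> h1 <= h2 ==> h2 < m ==> s tt h1 <= s tt h2"
  and peak: "a < ttm" "ttm < b" "s a k - z \<bullet> edir a > s ttm k - z \<bullet> edir ttm"
   "s b k - z \<bullet> edir b > s ttm k - z \<bullet> edir ttm"
  and R: "!!tt. a <= tt ==> tt <= b ==> s tt k - z \<bullet> edir tt >= R"
  and et: "et > 0"
 shows "\<exists>tt1 k1 c v M. a < tt1 & tt1 < b & k - et < k1 & k1 <= k & l < k1 &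
  c <= s ttm k - z \<bullet> edir ttm & R - et <= c & M > 0 & touch_below s z c v M tt1 k1"
proof -
 have "continuous_on (UNIV \<times> {- m<..<- l}) (%p. - s (fst p) (- snd p))"
  by (intro continuous_intros continuous_on_compose2[OF cont, of _ "%p. (fst p, - snd p)", simplified])
   auto
 then have "\<exists>tt1 k1 c v M. a < tt1 & tt1 < b & - k <= k1 & k1 < - k + et & k1 < - l &
  - s ttm (- (- k)) - (- z) \<bullet> edir ttm <= c & c <= - R + et &
  touch_above (%tt h. - s tt (- h)) (- z) c v M tt1 k1"
 proof (rule exists_touch_above)
  show "- s tt (- h1) <= - s tt (- h2)" if "- m < h1" "h1 <= h2" "h2 < - l" for tt h1 h2 using mono[of "- h2" "- h1" tt] that by simp
  show "- s tt (- (- k)) - (- z) \<bullet> edir tt <= - R" if "a <= tt" "tt <= b" for tt using R[OF that] by (simp add: inner_minus_left)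
 qed (use k peak et in \<open>auto simp: inner_minus_left\<close>)
 then obtain tt1 k1 c v M where *: "a < tt1" "tt1 < b" "- k <= k1" "k1 < - k + et" "k1 < - l"
  "- s ttm k + z \<bullet> edir ttm <= c" "c <= - R + et" "touch_above (%tt h. - s tt (- h)) (- z) c v M tt1 k1" by (auto simp: inner_minus_left)
 from *(8) obtain dl where dl: "dl > 0" "- s tt1 (- k1) = - (z \<bullet> edir tt1) + c"
  "!!tt h. \<bar>tt - tt1\<bar> < dl ==> \<bar>h - k1\<bar> < dl ==> - s tt (- h) <= - (z \<bullet> edir tt) + c + v * (h - k1) + M * (h - k1)^2"
  unfolding touch_above_def by (auto simp: inner_minus_left)
 have "touch_below s z (- c) v (\<bar>M\<bar> + 1) tt1 (- k1)" unfolding touch_below_def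
 proof (intro conjI exI[of _ dl] allI impI)
  show "s tt1 (- k1) = z \<bullet> edir tt1 + - c" using dl(2) by linarith
  fix tt h assume t: "\<bar>tt - tt1\<bar> < dl" "\<bar>h - - k1\<bar> < dl"
  then have "\<bar>(- h) - k1\<bar> < dl" by linarith
  from dl(3)[OF t(1) this]
  have 1: "s tt h >= z \<bullet> edir tt - c - v * (- h - k1) - M * (- h - k1)^2" by simp
  define d where "d = h - - k1"
  have d: "- h - k1 = - d" by (simp add: d_def)
  have "M * d^2 <= (\<bar>M\<bar> + 1) * d^2" by (intro mult_right_mono) auto
  then show "z \<bullet> edir tt + - c + v * (h - - k1) - (\<bar>M\<bar> + 1) * (h - - k1)^2 <= s tt h" using 1 unfolding d d_def[symmetric] by simp
 qed (rule dl(1))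
 moreover have "k - et < - k1" "- k1 <= k" "l < - k1" "- c <= s ttm k - z \<bullet> edir ttm" "R - et <= - c" "\<bar>M\<bar> + 1 > 0"
  using *(3-7) by linarith+
 ultimately show ?thesis using *(1,2) by (intro exI[of _ tt1] exI[of _ "- k1"] exI[of _ "- c"] exI[of _ v] exI[of _ "\<bar>M\<bar> + 1"] conjI)
qed

context sublevels
begin

lemma S_concave_on:
 assumes "x0 \<in> B"
 shows "concave_on {u x0..} (S tt)" unfolding concave_on_iff
proof (intro conjI ballI allI impI)
 fix h1 h2 s s' :: real assume *: "h1 \<in> {u x0..}" "h2 \<in> {u x0..}" "0 <= s" "0 <= s'" "s + s' = 1"
 have "K h1 ~= {}" "K h2 ~= {}" using * assms by (auto simp: K_def)
 moreover have s: "s = 1 - s'" using * by simp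
 ultimately show "S tt (s *\<^sub>R h1 + s' *\<^sub>R h2) >= s * S tt h1 + s' * S tt h2" using S_concave[of h1 h2 s' tt] * unfolding s by simp
qed simp

lemma S_continuous:
 assumes x0: "x0 \<in> B" and r: "K m \<subseteq> cball 0 r"
 shows "continuous_on (UNIV \<times> {u x0<..<m}) (%p. S (fst p) (snd p))"
proof (rule concave_lipschitz_joint_continuous)
 show "concave_on {u x0<..<m} (S tt)" for tt using S_concave_on[OF x0, of tt] unfolding concave_on_def by (rule convex_on_subset) auto
 fix tt ph h assume h: "u x0 < h" "h < m"
 show "\<bar>S tt h - S ph h\<bar> <= r * \<bar>tt - ph\<bar>" using K_mono[of h m] r h x0 by (intro S_lipschitz) (auto simp: K_def)
qed

end

section \<open>Speed of the level lines near a long chord\<close>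

lemma sublevels_compact:
 assumes "convex_on UNIV u" "convex B" "compact B"
 shows "sublevels u B"
proof
 show "compact {x \<in> B. u x <= h}" for h
 proof -
  have "continuous_on UNIV u" using convex_on_continuous[OF open_UNIV assms(1)] .
  then have "closed {x. u x <= h}" by (intro closed_Collect_le continuous_on_const)
  then show ?thesis using assms(3) by (simp add: Collect_conj_eq compact_Int_closed)
 qed
qed (use assms in auto)

definition powr_loss :: "real => real" where
 "powr_loss aa = 2 powr \<bar>1 / (2 * aa) - 1 / 2\<bar>"

lemma powr_loss_ge_1: "powr_loss aa >= 1" unfolding powr_loss_def by (rule ge_one_powr_ge_zero) auto

lemma speed_powr:
 fixes v aa :: real
 assumes "v > 0" "aa > 0"
 shows "(1 / v^2) powr (1 / (2 * aa) - 1 / 2) * (1 / v) = v powr (- (1 / aa))"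
proof -
 have 1: "1 / v^2 = v powr (- 2)" "1 / v = v powr (- 1)" using assms by (simp_all add: powr_minus_divide powr_numeral)
 show ?thesis unfolding 1 powr_powr powr_add[symmetric] using assms by (intro arg_cong[of _ _ "(powr) v"]) (simp add: field_simps)
qed

text \<open>When ss is at most the squared gradient 1 / v^2, the condition for ss = 0 holds up to a
  constant and the term with M.\<close>

lemma inner_bound_speed:
 assumes b: "inner_bound aa ss c v M" and aa: "aa > 0" and ss: "0 <= ss" "ss <= 1 / v^2"
  and pos: "c > 0" "v > 0" "M >= 0"
 shows "v <= (powr_loss aa * (2 / c + 4 * ss * M)) powr aa"
proof -
 define P where "P = 1 / v^2"
 have P: "P > 0" "ss <= P" using pos ss by (auto simp: P_def)
 have "ss / (ss + P) * (1 / c) <= 1 * (1 / c)" using P ss pos by (intro mult_right_mono) auto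
 then have "ss / (c * (ss + P)) <= 1 / c" by (simp add: mult.commute)
 then have 1: "1 / c + ss / (c * (ss + P)) + 4 * ss * M <= 2 / c + 4 * ss * M" by simp
 have "1 <= (ss + P) powr (1 / (2 * aa) - 1 / 2) * (1 / v) * (1 / c + ss / (c * (ss + P)) + 4 * ss * M)" using b by (simp add: inner_bound_def P_def)
 also have "\<dots> <= (powr_loss aa * P powr (1 / (2 * aa) - 1 / 2)) * (1 / v) * (2 / c + 4 * ss * M)"
  using powr_sum_bounds(1)[OF ss(1) P(2,1), of "1 / (2 * aa) - 1 / 2"] 1 pos ss P by (intro mult_mono) (auto simp: powr_loss_def)
 also have "\<dots> = v powr (- (1 / aa)) * (powr_loss aa * (2 / c + 4 * ss * M))"
  unfolding speed_powr[OF pos(2) aa, symmetric] P_def by (simp only: mult_ac)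
 finally have "v powr (1 / aa) <= powr_loss aa * (2 / c + 4 * ss * M)" using pos by (simp add: powr_minus_divide field_simps)
 then have "(v powr (1 / aa)) powr aa <= (powr_loss aa * (2 / c + 4 * ss * M)) powr aa" using aa by (intro powr_mono2) auto
 moreover have "(v powr (1 / aa)) powr aa = v" unfolding powr_powr using aa pos(2) by simp
 ultimately show ?thesis by (rule ord_eq_le_trans[OF sym, rotated])
qed

text \<open>Speeds of at least 1 are beyond the claimed bound anyway; for smaller ones the squared
  gradient 1 / v^2 exceeds 1 and dominates ss.\<close>

lemma outer_bound_speed:
 assumes b: "outer_bound aa ss c v" and aa: "aa > 0" and ss: "0 <= ss" "ss <= 1"
  and c: "powr_loss aa * c >= 1"
 shows "v >= (powr_loss aa * c) powr (- aa)"
proof (cases "v >= 1")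
 case True
 have "X powr (- aa) <= 1" if "X >= 1" for X :: real
 proof -
  have "X powr (- aa) <= X powr 0" using that aa by (intro powr_mono) simp_all
  then show ?thesis using that by simp
 qed
 from this[OF c] show ?thesis using True by (rule order_trans)
next
 case False
 have v: "v > 0" using b by (simp add: outer_bound_def)
 define P where "P = 1 / v^2"
 have "v^2 <= 1" using v False by (simp add: power_le_one)
 then have "1 <= P" using v by (simp add: P_def)
 then have P: "P > 0" "ss <= P" using ss by auto
 have "2 powr (- \<bar>1 / (2 * aa) - 1 / 2\<bar>) * P powr (1 / (2 * aa) - 1 / 2) * (1 / v) <=
   (ss + P) powr (1 / (2 * aa) - 1 / 2) * (1 / v)"
  using powr_sum_bounds(2)[OF ss(1) P(2,1), of "1 / (2 * aa) - 1 / 2"] v by (intro mult_right_mono) auto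
 also have "\<dots> <= c" using b by (simp add: outer_bound_def P_def)
 finally have "2 powr (- \<bar>1 / (2 * aa) - 1 / 2\<bar>) * v powr (- (1 / aa)) <= c"
  unfolding speed_powr[OF v aa, symmetric] P_def by (simp only: mult.assoc)
 moreover have "2 powr (- \<bar>1 / (2 * aa) - 1 / 2\<bar>) = 1 / powr_loss aa" unfolding powr_loss_def by (rule powr_minus_divide)
 ultimately have *: "1 / powr_loss aa * v powr (- (1 / aa)) <= c" by (simp only:)
 have "w <= X * c" if "1 / X * w <= c" "X >= 1" for w X :: real using that by (simp add: field_simps)
 from this[OF * powr_loss_ge_1] have "v powr (- (1 / aa)) <= powr_loss aa * c" .
 then have "(powr_loss aa * c) powr (- aa) <= (v powr (- (1 / aa))) powr (- aa)" using aa v by (intro powr_mono2') auto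
 moreover have "(v powr (- (1 / aa))) powr (- aa) = v" unfolding powr_powr using aa v by simp
 ultimately show ?thesis by (rule ord_le_eq_trans)
qed

lemma sin_ge_half: "0 <= x ==> x <= 1 ==> x / 2 <= sin (x::real)"
proof -
 assume x: "0 <= x" "x <= 1"
 have "sin 0 - 0 / 2 <= sin x - x / 2"
 proof (rule DERIV_nonneg_imp_nondecreasing[OF x(1)])
  fix y :: real assume y: "0 <= y" "y <= x"
  have "cos (pi / 3) <= cos y" using y x pi_gt3 by (intro cos_monotone_0_pi_le) auto
  then have "cos y - 1 / 2 >= 0" by (simp add: cos_60)
  moreover have "((%x. sin x - x / 2) has_real_derivative cos y - 1 / 2) (at y)" by (auto intro!: derivative_eq_intros)
  ultimately show "\<exists>d. ((%x. sin x - x / 2) has_real_derivative d) (at y) & 0 <= d" by blast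
 qed
 then show ?thesis by simp
qed

lemma abs_sin_ge_half: "\<bar>x\<bar> <= 1 ==> \<bar>x\<bar> / 2 <= \<bar>sin (x::real)\<bar>"
 using sin_ge_half[of x] sin_ge_half[of "- x"] by (cases "x >= 0") auto

lemma one_minus_cos_le: "1 - cos x <= x^2 / (2::real)"
proof -
 have "(sin (x / 2))^2 <= (x / 2)^2" using abs_sin_x_le_abs_x[of "x / 2"] abs_le_square_iff by blast
 moreover have "cos x = 1 - 2 * (sin (x / 2))^2" using cos_double_sin[of "x / 2"] by simp
 ultimately show ?thesis by (simp add: power_divide)
qed

text \<open>The segment from the given point to the end of the chord on the opposite side meets the
  line of direction f at this height.\<close>

lemma slice_extent:
 fixes u :: "real^2 => real"
 assumes cvx: "convex_on UNIV u" and l: "l > 0" "u (l *\<^sub>R e) <= k" "u (- l *\<^sub>R e) <= k"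
  and x: "u (xi *\<^sub>R e + y *\<^sub>R f) <= k"
 shows "u ((y * (l / (l + \<bar>xi\<bar>))) *\<^sub>R f) <= k"
proof -
 define t where "t = l / (l + \<bar>xi\<bar>)"
 define s where "s = (if xi >= 0 then - l else l)"
 have t: "0 <= t" "t <= 1" using l by (auto simp: t_def)
 have tx: "t * xi + (1 - t) * s = 0" using l by (auto simp: t_def s_def field_simps)
 have "u ((1 - t) *\<^sub>R (s *\<^sub>R e) + t *\<^sub>R (xi *\<^sub>R e + y *\<^sub>R f)) <= (1 - t) * u (s *\<^sub>R e) + t * u (xi *\<^sub>R e + y *\<^sub>R f)"
  by (rule convex_onD[OF cvx t]) auto
 also have "\<dots> <= (1 - t) * k + t * k" using t x l by (intro add_mono mult_left_mono) (auto simp: s_def)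
 also have "(1 - t) *\<^sub>R (s *\<^sub>R e) + t *\<^sub>R (xi *\<^sub>R e + y *\<^sub>R f) = (t * xi + (1 - t) * s) *\<^sub>R e + (y * t) *\<^sub>R f"
  by (simp add: algebra_simps)
 finally show ?thesis unfolding tx by (simp add: t_def algebra_simps)
qed

lemma oblique_coordinates:
 assumes "sin ph ~= 0"
 shows "x = (x $ 1 - x $ 2 / sin ph * cos ph) *\<^sub>R edir 0 + (x $ 2 / sin ph) *\<^sub>R edir ph" using assms by (simp add: vec_eq_iff forall_2)

text \<open>
 Above a long chord the level line contains arcs of circles of radius about \<open>r * len^2 / b\<close>, so it advances slowly.
\<close>

lemma long_chord_speed:
 fixes len b t r ka kb ss ph :: real
 assumes u: "convex_solution aa ss u" and aa: "aa > 0" and k: "ka < kb" "u 0 < ka"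
  and ends: "u (len *\<^sub>R edir 0) <= ka" "u (- len *\<^sub>R edir 0) <= ka"
  and ss: "0 <= ss" "ss <= ((kb - ka) / (16 * b))^2"
  and ph: "sin ph >= 1 / 2"
  and slice: "!!y. u (y *\<^sub>R edir ph) <= kb ==> \<bar>y\<bar> <= b & y <= t"
  and t: "0 <= t" "t <= b" and r: "0 < r" "r <= 1 / 128" and b: "b > 0" "128 * b <= len"
  and y: "kb <= h" "0 <= y" "u (y *\<^sub>R edir ph) <= h"
 shows "min y (4 * b) <= t + 65 * b * (16 * r + 5 * b / len) +
  4 * (powr_loss aa * (2 * b / (r * len^2) + 64 * ss * b / (kb - ka)^2)) powr aa * (h - ka)"
proof -
 define V where "V = (powr_loss aa * (2 * b / (r * len^2) + 64 * ss * b / (kb - ka)^2)) powr aa"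
 define dl km where "dl = (kb - ka) / 2" and "km = (ka + kb) / 2"
 have dl: "dl > 0" "ka = km - dl" "kb = km + dl" using k by (simp_all add: dl_def km_def field_simps)
 have l: "len > 0" "b <= len / 128" using b by auto
 have cvx: "convex_on UNIV u" using u by (simp add: convex_solution_def)
 \<comment> \<open>Half the width of the chord keeps oblique coordinates in the window below
   \<open>len\<close>; the height 4 * b leaves room above the bound b for the slice.\<close>
 define p q :: "real^2" where "p = vector [- len / 2, - 4 * b]" and "q = vector [len / 2, 4 * b]"
 define B where "B = cbox p q"
 have mB: "x \<in> B \<longleftrightarrow> \<bar>x $ 1\<bar> <= len / 2 & \<bar>x $ 2\<bar> <= 4 * b" for x
  by (auto simp: B_def mem_box_cart forall_2 p_def q_def abs_le_iff)
 have iB: "x \<in> interior B \<longleftrightarrow> \<bar>x $ 1\<bar> < len / 2 & \<bar>x $ 2\<bar> < 4 * b" for x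
  by (auto simp: B_def mem_box_cart forall_2 p_def q_def abs_less_iff interior_cbox)
 interpret sublevels u B using cvx by (rule sublevels_compact) (auto simp: B_def)
 have mK: "x \<in> K k' \<longleftrightarrow> x \<in> B & u x <= k'" for x k' by (simp add: K_def)
 have zero: "0 \<in> K k'" if "k' >= ka" for k' using that k l b by (simp add: mK mB)
 have S0: "S tt k' >= 0" if "k' >= ka" for tt k' using S_upper[OF zero[OF that], of tt] by simp
 have half: "u ((len / 2) *\<^sub>R edir 0) <= ka" "u (- (len / 2) *\<^sub>R edir 0) <= ka"
  using convex_onD[OF cvx, of "1/2" 0 "len *\<^sub>R edir 0"] convex_onD[OF cvx, of "1/2" 0 "- len *\<^sub>R edir 0"] k ends by auto
 have Ssin: "S (pi / 2 + ta) k' >= len / 2 * \<bar>sin ta\<bar>" if "k' >= ka" for ta k'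
 proof -
  have "(len / 2) *\<^sub>R edir 0 \<in> K k'" "- (len / 2) *\<^sub>R edir 0 \<in> K k'" using half that l b by (auto simp: mK mB)
  from S_upper[OF this(1), of "pi / 2 + ta"] S_upper[OF this(2), of "pi / 2 + ta"]
  show ?thesis by (auto simp: inner_edir cos_add abs_if)
 qed
 have coord: "\<exists>xi y. x = xi *\<^sub>R edir 0 + y *\<^sub>R edir ph & \<bar>xi\<bar> <= \<bar>x $ 1\<bar> + 2 * \<bar>x $ 2\<bar> &
   y <= t * (1 + \<bar>xi\<bar> / len) & \<bar>x $ 2\<bar> <= 2 * b" if x: "x \<in> K k'" "k' <= kb" for x k'
 proof -
  define y where "y = x $ 2 / sin ph"
  define xi where "xi = x $ 1 - y * cos ph"
  have eq: "x = xi *\<^sub>R edir 0 + y *\<^sub>R edir ph" using oblique_coordinates[of ph x] ph by (simp add: y_def xi_def)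
  have "\<bar>x $ 2\<bar> * 1 <= \<bar>x $ 2\<bar> * (2 * sin ph)" using ph by (intro mult_left_mono) auto
  then have yle: "\<bar>y\<bar> <= 2 * \<bar>x $ 2\<bar>" using ph by (simp add: y_def divide_simps)
  have "\<bar>y * cos ph\<bar> <= \<bar>y\<bar>" by (simp add: abs_mult mult_left_le)
  then have xi: "\<bar>xi\<bar> <= \<bar>x $ 1\<bar> + 2 * \<bar>x $ 2\<bar>" using yle by (simp add: xi_def)
  have xB: "\<bar>x $ 1\<bar> <= len / 2" "\<bar>x $ 2\<bar> <= 4 * b" "u x <= kb" using x by (auto simp: mK mB)
  have xil: "\<bar>xi\<bar> <= len" using xi xB l by linarith
  have "u ((y * (len / (len + \<bar>xi\<bar>))) *\<^sub>R edir ph) <= kb" using ends xB(3) k eq by (intro slice_extent[OF cvx l(1)]) auto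
  from slice[OF this] have "\<bar>y\<bar> * (len / (len + \<bar>xi\<bar>)) <= b" "y * (len / (len + \<bar>xi\<bar>)) <= t"
   using l by (auto simp: abs_mult)
  then have y12: "\<bar>y\<bar> <= b * (1 + \<bar>xi\<bar> / len)" "y <= t * (1 + \<bar>xi\<bar> / len)" using l by (auto simp: field_simps)
  have "b * (1 + \<bar>xi\<bar> / len) <= b * 2" using b xil l by (intro mult_left_mono) auto
  moreover have "\<bar>x $ 2\<bar> <= \<bar>y\<bar>" using ph eq by (simp add: y_def divide_simps mult_left_le)
  ultimately show ?thesis using eq xi y12 by (intro exI[of _ xi] exI[of _ y]) auto
 qed
 \<comment> \<open>\<open>c0\<close> is the depth of the centre below the chord, \<open>ep\<close>
   the range of normals around pi / 2, and \<open>M\<close> the penalty that keeps the contact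
   strictly between the levels ka and kb.\<close>
 define c0 M ep where "c0 = r * len^2 / b" and "M = 4 * b / dl^2" and "ep = 16 * b / len"
 have c0: "c0 > 0" and M: "M > 0" "M * dl^2 = 4 * b" and ep: "0 < ep" "ep <= 1 / 8" and c0ep: "c0 * ep = 16 * r * len"
  using r l b dl by (auto simp: c0_def M_def ep_def power2_eq_square field_simps)
 have rl: "16 * r * len <= len / 8" using r l by (simp add: field_simps)
 have cosl: "c0 * (1 - cos ta) <= len * \<bar>ta\<bar> / 16" if "\<bar>ta\<bar> <= ep" for ta
 proof -
  have "c0 * (1 - cos ta) <= c0 * (ta^2 / 2)" using c0 one_minus_cos_le[of ta] by (intro mult_left_mono) auto
  also have "ta^2 <= ep * \<bar>ta\<bar>" using that mult_right_mono[OF that, of "\<bar>ta\<bar>"] by (simp add: power2_eq_square abs_mult_self_eq)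
  then have "c0 * (ta^2 / 2) <= c0 * (ep * \<bar>ta\<bar> / 2)" using c0 by (intro mult_left_mono) auto
  also have "\<dots> = (16 * r * len) * \<bar>ta\<bar> / 2" unfolding c0ep[symmetric] by simp
  also have "\<dots> <= len / 8 * \<bar>ta\<bar> / 2" using rl by (intro divide_right_mono mult_right_mono) auto
  finally show ?thesis by simp
 qed
 have epl: "len * ep = 16 * b" using l by (simp add: ep_def)
 have cosb: "c0 * (1 - cos ta) <= b" if "\<bar>ta\<bar> <= ep" for ta using cosl[OF that] mult_left_mono[OF that, of len] l epl by simp
 \<comment> \<open>Support function relative to a centre at depth c0, penalised in the level: its
   minimum marks where a disc about this centre touches from inside.\<close>
 define Ph where "Ph p = S (pi / 2 + fst p) (snd p) + c0 * cos (fst p) + M * (snd p - km)^2" for p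
 have Scont: "continuous_on (UNIV \<times> {u 0<..<kb + 1}) (%p. S (fst p) (snd p))"
 proof (rule S_continuous)
  show "0 \<in> B" using l b by (simp add: mB)
  show "K (kb + 1) \<subseteq> cball 0 (len + 4 * b)"
  proof
   fix x assume "x \<in> K (kb + 1)"
   then have "\<bar>x $ 1\<bar> <= len" "\<bar>x $ 2\<bar> <= 4 * b" using l by (auto simp: mK mB)
   then show "x \<in> cball 0 (len + 4 * b)" using norm_le_l1_cart[of x] by (simp add: sum_2)
  qed
 qed
 have "continuous_on ({- ep..ep} \<times> {ka..kb}) (%p. S (pi / 2 + fst p) (snd p))"
  using k by (intro continuous_on_compose2[OF Scont, of _ "%p. (pi / 2 + fst p, snd p)", simplified] continuous_intros) auto
 then have "continuous_on ({- ep..ep} \<times> {ka..kb}) Ph" unfolding Ph_def by (intro continuous_intros)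
 then obtain w where w: "w \<in> {- ep..ep} \<times> {ka..kb}" "!!p. p \<in> {- ep..ep} \<times> {ka..kb} ==> Ph w <= Ph p"
  using continuous_attains_inf[of "{- ep..ep} \<times> {ka..kb}" Ph] ep k by (auto simp: compact_Times)
 define ta1 k1 tt1 where "ta1 = fst w" and "k1 = snd w" and "tt1 = pi / 2 + fst w"
 have w': "\<bar>ta1\<bar> <= ep" "ka <= k1" "k1 <= kb" "tt1 = pi / 2 + ta1" using w(1) by (auto simp: ta1_def k1_def tt1_def)
 have Sb: "S (pi / 2) km <= 2 * b"
 proof (rule S_least)
  show "K km ~= {}" using zero[of km] dl by auto
  show "x \<bullet> edir (pi / 2) <= 2 * b" if "x \<in> K km" for x using coord[OF that] dl by (auto simp: inner_edir)
 qed
 have Phw: "Ph w <= 2 * b + c0" using w(2)[of "(0, km)"] Sb ep dl by (simp add: Ph_def)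
 have Phw_eq: "Ph w = S tt1 k1 + c0 * cos ta1 + M * (k1 - km)^2" by (simp add: Ph_def tt1_def ta1_def k1_def)
 have sq: "M * (k1 - km)^2 >= 0" using M by simp
 have ka1: "k1 ~= ka" "k1 ~= kb"
 proof -
  have "(k1 - km)^2 ~= dl^2"
  proof
   assume "(k1 - km)^2 = dl^2"
   then have "Ph w = S tt1 k1 + c0 * cos ta1 + 4 * b" using Phw_eq M by simp
   moreover have "c0 * cos ta1 >= c0 - b" using cosb[OF w'(1)] by (simp add: algebra_simps)
   ultimately show False using Phw S0[OF w'(2), of tt1] b by linarith
  qed
  then show "k1 ~= ka" "k1 ~= kb" using dl by auto
 qed
 have k1: "ka < k1" "k1 < kb" using ka1 w' by auto
 \<comment> \<open>The chord alone contributes this much; for an angle of size ep it would be 4 * b,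
   too large for a minimum.\<close>
 have Sw: "S tt1 k1 >= len * \<bar>ta1\<bar> / 4"
 proof -
  have "len / 2 * (\<bar>ta1\<bar> / 2) <= len / 2 * \<bar>sin ta1\<bar>" using abs_sin_ge_half[of ta1] w' ep l by (intro mult_left_mono) auto
  then show ?thesis using Ssin[OF w'(2), of ta1] w'(4) by simp
 qed
 have ta1: "\<bar>ta1\<bar> < ep"
 proof (rule ccontr)
  assume "\<not> \<bar>ta1\<bar> < ep"
  then have "len * \<bar>ta1\<bar> = 16 * b" using w'(1) epl by (simp add: not_less)
  then have "S tt1 k1 >= 4 * b" using Sw by simp
  moreover have "c0 * cos ta1 >= c0 - b" using cosb[OF w'(1)] by (simp add: algebra_simps)
  ultimately show False using Phw Phw_eq sq b by linarith
 qed
 define c v z where "c = S tt1 k1 + c0 * cos ta1" and "v = - 2 * M * (k1 - km)" and "z = - c0 *\<^sub>R edir (pi / 2)"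
 have ze: "z \<bullet> edir (pi / 2 + ta) = - c0 * cos ta" for ta by (simp add: z_def edir_inner_edir)
 have cc: "c0 <= c" "c <= c0 + 2 * b"
 proof -
  have "len * \<bar>ta1\<bar> >= 0" using l by simp
  then show "c0 <= c" using Sw cosl[OF w'(1)] by (simp add: c_def algebra_simps)
  show "c <= c0 + 2 * b" using Phw Phw_eq sq by (simp add: c_def)
 qed
 have touch: "touch_below S z c v M tt1 k1" unfolding touch_below_def
 proof (intro conjI exI[of _ "Min {ep - \<bar>ta1\<bar>, k1 - ka, kb - k1}"] allI impI)
  show "S tt1 k1 = z \<bullet> edir tt1 + c" unfolding w'(4) ze by (simp add: c_def w'(4))
  show "0 < Min {ep - \<bar>ta1\<bar>, k1 - ka, kb - k1}" using ta1 k1 by auto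
  fix tt h assume *: "\<bar>tt - tt1\<bar> < Min {ep - \<bar>ta1\<bar>, k1 - ka, kb - k1}" "\<bar>h - k1\<bar> < Min {ep - \<bar>ta1\<bar>, k1 - ka, kb - k1}"
  define ta where "ta = tt - pi / 2"
  have tt: "tt = pi / 2 + ta" by (simp add: ta_def)
  have "(ta, h) \<in> {- ep..ep} \<times> {ka..kb}" using * by (auto simp: tt w'(4))
  from w(2)[OF this] have "c + M * (k1 - km)^2 <= S tt h + c0 * cos ta + M * (h - km)^2" unfolding Phw_eq by (simp add: Ph_def c_def tt)
  moreover have "v * (h - k1) - M * (h - k1)^2 = M * (k1 - km)^2 - M * (h - km)^2" unfolding v_def by algebra
  ultimately show "z \<bullet> edir tt + c + v * (h - k1) - M * (h - k1)^2 <= S tt h" unfolding tt ze by simp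
 qed
 define x1 where "x1 = z + c *\<^sub>R edir tt1"
 have x1: "x1 $ 1 = - c * sin ta1" "x1 $ 2 = c * cos ta1 - c0" by (simp_all add: x1_def z_def w'(4) cos_add sin_add)
 have X1: "\<bar>x1 $ 1\<bar> <= 16 * r * len + b / 4"
 proof -
  have "\<bar>x1 $ 1\<bar> = c * \<bar>sin ta1\<bar>" using cc c0 by (simp add: x1 abs_mult)
  also have "\<dots> <= (c0 + 2 * b) * ep" using cc c0 w'(1) abs_sin_x_le_abs_x[of ta1] b by (intro mult_mono) auto
  also have "\<dots> <= 16 * r * len + b / 4" using c0ep mult_left_mono[OF ep(2), of b] b by (simp add: algebra_simps)
  finally show ?thesis .
 qed
 have cos0: "cos ta1 >= 0" using w'(1) ep pi_gt3 by (intro cos_ge_zero) auto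
 have X2: "x1 $ 2 <= 2 * b" "- b <= x1 $ 2"
 proof -
  have "c * cos ta1 <= c" using cc c0 by (simp add: mult_left_le)
  then show "x1 $ 2 <= 2 * b" using cc by (simp add: x1)
  have "c0 * cos ta1 <= c * cos ta1" using cc cos0 by (intro mult_right_mono) auto
  then show "- b <= x1 $ 2" using cosb[OF w'(1)] by (simp add: x1 algebra_simps)
 qed
 have int: "x1 \<in> interior B" 
 proof -
  have "\<bar>x1 $ 1\<bar> < len / 2" using X1 rl l b by linarith
  then show ?thesis using X2 b unfolding iB by auto
 qed
 have x1e: "x1 \<bullet> edir tt1 = S tt1 k1" using touch unfolding touch_below_def x1_def by (simp add: inner_add_left edir_inner_edir)
 have zi: "0 \<in> interior B" using l b by (simp add: iB)
 have V0: "V >= 0" by (simp add: V_def)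
 have sub: "sub_test aa ss u" using u by (simp add: convex_solution_def)
 have vV: "v <= V"
 proof (cases "v <= 0")
  case False
  then have v: "v > 0" by simp
  have "2 * M * (km - k1) <= 2 * M * dl" using k1 dl M by (intro mult_left_mono) auto
  then have "v <= 2 * M * dl" unfolding v_def by (simp add: algebra_simps)
  also have "\<dots> = 8 * b / dl" using dl by (simp add: M_def power2_eq_square)
  finally have "v^2 <= (8 * b / dl)^2" using v by (intro power_mono) auto
  then have "1 / (8 * b / dl)^2 <= 1 / v^2" using v by (intro frac_le) simp_all
  moreover have "((kb - ka) / (16 * b))^2 = 1 / (8 * b / dl)^2" by (simp add: dl_def power_divide)
  ultimately have ssv: "ss <= 1 / v^2" using ss(2) by (metis order_trans)
  have "c > 0" using cc c0 by linarith
  from contact_below(1)[OF sub ss(1) zi _ this v M(1) touch] int k k1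
  have "inner_bound aa ss c v M" by (simp add: x1_def)
  from inner_bound_speed[OF this aa ss(1) ssv \<open>c > 0\<close> v] M
  have "v <= (powr_loss aa * (2 / c + 4 * ss * M)) powr aa" by simp
  also have "\<dots> <= V" unfolding V_def
  proof (intro powr_mono2 mult_left_mono)
   have "2 / c <= 2 / c0" using cc c0 by (intro divide_left_mono) auto
   also have "2 / c0 = 2 * b / (r * len^2)" by (simp add: c0_def)
   finally show "2 / c + 4 * ss * M <= 2 * b / (r * len^2) + 64 * ss * b / (kb - ka)^2" by (simp add: M_def dl_def power_divide)
  qed (use aa powr_loss_ge_1[of aa] \<open>c > 0\<close> ss M in auto)
  finally show ?thesis .
 qed (use V0 in linarith)
 have cpos: "c > 0" using cc c0 by linarith
 have x1K: "x1 \<in> K k1" using touch_below_member[OF zi _ cpos touch] k k1 by (simp add: x1_def)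
 have hk: "ka <= h" "k1 <= h" using y k k1 by auto
 have ne: "K k' ~= {}" if "k' >= ka" for k' using zero[OF that] by auto
 obtain d where d: "d > 0" "S tt1 k1 = z \<bullet> edir tt1 + c"
  "!!tt h. \<bar>tt - tt1\<bar> < d ==> \<bar>h - k1\<bar> < d ==> z \<bullet> edir tt + c + v * (h - k1) - M * (h - k1)^2 <= S tt h"
  using touch unfolding touch_below_def by metis
 \<comment> \<open>Concavity in the level carries the bound on the speed to all later
   levels.\<close>
 have "S tt1 h <= S tt1 k1 + v * (h - k1)"
 proof (rule concave_touch_below_imp_supergradient[OF _ k1(1) d(1) _ hk(1)])
  show "S tt1 k1 + v * (h - k1) - M * (h - k1)^2 <= S tt1 h" if "\<bar>h - k1\<bar> < d" for h using d(3)[of tt1 h] that d(1,2) by simp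
 qed (use S_concave ne in auto)
 also have "v * (h - k1) <= V * (h - ka)" using vV V0 hk k1 by (intro mult_mono) auto
 finally have Sh: "S tt1 h <= S tt1 k1 + V * (h - ka)" by simp
 define y' where "y' = min y (4 * b)"
 have y': "0 <= y'" "y' <= y" "y' <= 4 * b" using y b by (auto simp: y'_def)
 have "u (y' *\<^sub>R edir ph) <= h"
 proof (cases "y = 0")
  case False
  then have "u ((1 - y' / y) *\<^sub>R 0 + (y' / y) *\<^sub>R (y *\<^sub>R edir ph)) <= (1 - y' / y) * u 0 + (y' / y) * u (y *\<^sub>R edir ph)"
   using y' y by (intro convex_onD[OF cvx]) (auto simp: field_simps)
  also have "\<dots> <= (1 - y' / y) * h + (y' / y) * h" using y' y False k hk by (intro add_mono mult_left_mono) (auto simp: field_simps)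
  finally show ?thesis using False by (simp add: algebra_simps)
 qed (use y y' in auto)
 moreover have "\<bar>y' * cos ph\<bar> <= y'" "\<bar>y' * sin ph\<bar> <= y'" using y' by (auto simp: abs_mult mult_left_le)
 ultimately have "y' *\<^sub>R edir ph \<in> K h" using y' l b by (auto simp: mK mB)
 then have "y' * cos (tt1 - ph) <= S tt1 h" using S_upper[of "y' *\<^sub>R edir ph" h tt1] by (simp add: edir_inner_edir)
 then have 1: "y' * cos (tt1 - ph) <= x1 \<bullet> edir tt1 + V * (h - ka)" using Sh x1e by simp
 \<comment> \<open>The contact point in oblique coordinates: the part along \<open>edir ph\<close>
   is controlled by the slice, the part along the chord is nearly orthogonal to the normal
   tt1.\<close>
 obtain xi y1 where x1c: "x1 = xi *\<^sub>R edir 0 + y1 *\<^sub>R edir ph" "\<bar>xi\<bar> <= \<bar>x1 $ 1\<bar> + 2 * \<bar>x1 $ 2\<bar>"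
  "y1 <= t * (1 + \<bar>xi\<bar> / len)" using coord[OF x1K] k1 by fastforce
 define G where "G = 16 * r * len + 5 * b"
 have xiG: "\<bar>xi\<bar> <= G" 
 proof -
  have "\<bar>x1 $ 2\<bar> <= 2 * b" using X2 b by (auto simp: abs_le_iff)
  then show ?thesis using x1c(2) X1 b unfolding G_def by linarith
 qed
 have "x1 \<bullet> edir tt1 = - xi * sin ta1 + y1 * cos (tt1 - ph)" unfolding x1c(1) w'(4) by (simp add: inner_add_left edir_inner_edir cos_add)
 also have "- xi * sin ta1 <= G * ep"
 proof -
  have "- xi * sin ta1 <= \<bar>xi\<bar> * \<bar>sin ta1\<bar>" using abs_ge_self[of "- xi * sin ta1"] by (simp add: abs_mult)
  also have "\<dots> <= G * ep" using xiG w'(1) abs_sin_x_le_abs_x[of ta1] by (intro mult_mono) auto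
  finally show ?thesis .
 qed
 finally have 2: "(y' - y1) * cos (tt1 - ph) <= G * ep + V * (h - ka)" using 1 by (simp add: algebra_simps)
 have cosphi: "cos (tt1 - ph) >= 1 / 4"
 proof -
  have "cos (tt1 - ph) = sin ph * cos ta1 - cos ph * sin ta1" unfolding w'(4) by (simp add: cos_add cos_diff sin_diff sin_add)
  moreover have "cos ph * sin ta1 <= 1 / 8"
  proof -
   have "\<bar>cos ph\<bar> * \<bar>sin ta1\<bar> <= 1 * (1 / 8)" using w'(1) ep abs_sin_x_le_abs_x[of ta1] by (intro mult_mono) auto
   then show ?thesis using abs_ge_self[of "cos ph * sin ta1"] by (simp add: abs_mult)
  qed
  moreover have "sin ph * cos ta1 >= 1 / 2 * (3 / 4)"
  proof (intro mult_mono)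
   have "ta1^2 <= (1 / 8)^2" using w'(1) ep by (intro abs_le_square_iff[THEN iffD1]) auto
   then show "3 / 4 <= cos ta1" using one_minus_cos_le[of ta1] by (simp add: power2_eq_square)
  qed (use ph in auto)
  ultimately show ?thesis by linarith
 qed
 have G0: "G >= 0" using r l b by (simp add: G_def)
 have Z: "0 <= G * ep + V * (h - ka)" using G0 ep V0 hk by simp
 have "d <= 4 * Z" if "d * k <= Z" "k >= 1 / 4" "Z >= 0" for d k Z :: real
 proof (cases "d <= 0")
  case False
  then have "d * (1 / 4) <= d * k" using that by (intro mult_left_mono) auto
  then show ?thesis using that by linarith
 qed (use that in linarith)
 from this[OF 2 cosphi Z] have "y' - y1 <= 4 * (G * ep + V * (h - ka))" .
 moreover have "y1 <= t + b * (G / len)"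
 proof -
  have "t * (\<bar>xi\<bar> / len) <= b * (G / len)" using t xiG l G0 by (intro mult_mono divide_right_mono) auto
  then show ?thesis using x1c(3) by (simp add: algebra_simps)
 qed
 moreover have "G / len = 16 * r + 5 * b / len" "G * ep = 16 * b * (16 * r + 5 * b / len)" using l by (simp_all add: G_def ep_def field_simps)
 moreover define P W where "P = b * (16 * r + 5 * b / len)" and "W = V * (h - ka)"
 ultimately have "y' - y1 <= 4 * (16 * P + W)" "y1 <= t + P" by (simp_all only: mult.assoc)
 then have "y' <= t + 65 * P + 4 * W" by argo
 then show ?thesis unfolding V_def[symmetric] y'_def by (simp only: P_def W_def mult.assoc)
qed

lemma vector_eta: "vector [x $ 1, x $ 2] = (x :: real^2)" by (simp add: vec_eq_iff forall_2)

lemma rot2_edir: "rot2 om (edir a) = edir (a + om)" by (simp add: rot2_def vec_eq_iff forall_2 cos_add sin_add)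

lemma convex_solution_isometry:
 assumes "convex_solution aa ss u" "aa > 0" "ss >= 0"
 shows "convex_solution aa ss (%x. u (o' + rot2 om x))"
 using convex_solution_similar[OF assms(1) zero_less_one assms(2,3), of o' om 0] by (simp add: similar_def)

lemma convex_solution_reflect:
 assumes "convex_solution aa ss u" "aa > 0" "ss >= 0"
 shows "convex_solution aa ss (%x. u (- x))"
proof -
 have "0 + rot2 pi x = - x" for x by (simp add: rot2_def vec_eq_iff forall_2)
 then show ?thesis using convex_solution_isometry[OF assms, of 0 pi] by simp
qed

text \<open>The chord may be tilted. An isometry moves its midpoint to the origin and the chord to
  the first axis; the slice turns into a line of direction ph, and slope at most 1 in absolute value
  gives sin ph >= 1 / 2. The midpoint lies within t of the origin, which the threshold t - y0
  records.\<close>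

lemma slice_growth_upper:
 fixes a t b r ss :: real
 assumes u: "convex_solution aa ss u" and aa: "aa > 0" and k: "k' < ka" "ka < kb"
  and ends: "u (vector [a, Yp]) <= k'" "u (vector [- a, Ym]) <= k'" "\<bar>Yp\<bar> <= a" "\<bar>Ym\<bar> <= a"
  and ss: "0 <= ss" "ss <= ((kb - ka) / (16 * b))^2"
  and slice: "!!y. u (vector [0, y]) <= kb ==> \<bar>y\<bar> <= t"
  and b: "b > 0" "2 * t <= b" "128 * b <= a" and r: "0 < r" "r <= 1 / 128"
  and h: "kb <= h" "u (vector [0, y]) <= h"
  and E: "65 * b * (16 * r + 5 * b / a) +
   4 * (powr_loss aa * (2 * b / (r * a^2) + 64 * ss * b / (kb - ka)^2)) powr aa * (h - ka) <= E" "E <= b"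
 shows "y <= t + E"
proof -
 define y0 m where "y0 = (Yp + Ym) / 2" and "m = (Yp - Ym) / 2 / a"
 define om len where "om = arctan m" and "len = a * sqrt (1 + m^2)"
 define o' :: "real^2" where "o' = vector [0, y0]"
 have a: "a > 0" using b by linarith
 have "\<bar>(Yp - Ym) / 2\<bar> <= a" using ends by (simp add: abs_le_iff)
 then have "\<bar>m\<bar> <= 1" using a by (simp add: m_def abs_divide)
 then have "1 + m^2 <= 4" using abs_le_square_iff[of m 1] by simp
 then have s: "1 <= sqrt (1 + m^2)" "sqrt (1 + m^2) <= 2" using real_sqrt_le_mono[of "1 + m^2" 4] by simp_all
 have len: "a <= len" using a s by (simp add: len_def)
 have eom: "len *\<^sub>R edir om = vector [a, m * a]"
 proof -
  have "sqrt (1 + m^2) ~= 0" using s(1) by linarith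
  then show ?thesis by (simp add: vec_eq_iff forall_2 len_def om_def cos_arctan sin_arctan)
 qed
 have ma: "m * a = (Yp - Ym) / 2" using a by (simp add: m_def)
 define w where "w x = u (o' + rot2 om x)" for x
 have w: "convex_solution aa ss w" unfolding w_def by (rule convex_solution_isometry[OF u aa ss(1)])
 have wends: "w (len *\<^sub>R edir 0) <= k'" "w (- len *\<^sub>R edir 0) <= k'"
 proof -
  have "o' + len *\<^sub>R edir om = vector [a, Yp]" "o' - len *\<^sub>R edir om = vector [- a, Ym]"
   unfolding eom ma by (simp_all add: o'_def y0_def vec_eq_iff forall_2 field_simps)
  then show "w (len *\<^sub>R edir 0) <= k'" "w (- len *\<^sub>R edir 0) <= k'"
   using ends by (simp_all add: w_def rot2_linear(3) rot2_edir del: scaleR_minus_left) simp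
 qed
 define ph where "ph = pi / 2 - om"
 have wph: "w (y *\<^sub>R edir ph) = u (vector [0, y0 + y])" for y
 proof -
  have "o' + y *\<^sub>R edir (pi / 2) = vector [0, y0 + y]" by (simp add: vec_eq_iff forall_2 o'_def)
  then show ?thesis by (simp add: w_def rot2_linear(3) rot2_edir ph_def)
 qed
 have w0: "w 0 <= k'"
  using convex_onD[OF convex_solution_def[THEN iffD1, OF w, THEN conjunct1], of "1/2" "len *\<^sub>R edir 0" "- len *\<^sub>R edir 0"] wends
  by (simp add: algebra_simps)
 then have y0: "\<bar>y0\<bar> <= t" using slice[of y0] wph[of 0] k by simp
 have sinph: "sin ph >= 1 / 2"
 proof -
  have "sin ph = 1 / sqrt (1 + m^2)" unfolding ph_def sin_diff by (simp add: om_def cos_arctan)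
  moreover have "1 / sqrt (1 + m^2) >= 1 / 2" using s by (intro frac_le) (auto intro!: add_pos_nonneg)
  ultimately show ?thesis by simp
 qed
 define Y where "Y = y - y0"
 show ?thesis
 proof (cases "Y >= 0")
  case False
  have "0 <= 4 * (powr_loss aa * (2 * b / (r * a^2) + 64 * ss * b / (kb - ka)^2)) powr aa * (h - ka)" using k h by (intro mult_nonneg_nonneg) auto
  moreover have "0 <= 65 * b * (16 * r + 5 * b / a)" using b a r by simp
  ultimately have "0 <= E" using E(1) by linarith
  then show ?thesis using False y0 by (simp add: Y_def)
 next
  case True
  have "min Y (4 * b) <= (t - y0) + 65 * b * (16 * r + 5 * b / len) +
   4 * (powr_loss aa * (2 * b / (r * len^2) + 64 * ss * b / (kb - ka)^2)) powr aa * (h - ka)"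
  proof (rule long_chord_speed[OF w aa k(2) _ _ _ ss sinph])
   show "\<bar>y\<bar> <= b & y <= t - y0" if "w (y *\<^sub>R edir ph) <= kb" for y using slice[of "y0 + y"] that y0 b by (auto simp: wph abs_le_iff)
   show "w (Y *\<^sub>R edir ph) <= h" using h by (simp add: wph Y_def)
  qed (use k wends w0 y0 b r h len True in auto)
  also have "\<dots> <= (t - y0) + E"
  proof -
   have "5 * b / len <= 5 * b / a" using a len b by (intro divide_left_mono) auto
   then have 1: "65 * b * (16 * r + 5 * b / len) <= 65 * b * (16 * r + 5 * b / a)" using b by (intro mult_left_mono) auto
   have "2 * b / (r * len^2) <= 2 * b / (r * a^2)" using a len b r by (intro divide_left_mono mult_left_mono power_mono) auto
   then have "(powr_loss aa * (2 * b / (r * len^2) + 64 * ss * b / (kb - ka)^2)) powr aa <=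
    (powr_loss aa * (2 * b / (r * a^2) + 64 * ss * b / (kb - ka)^2)) powr aa"
    using powr_loss_ge_1[of aa] b r ss aa by (intro powr_mono2 mult_left_mono add_right_mono) auto
   then have "4 * (powr_loss aa * (2 * b / (r * len^2) + 64 * ss * b / (kb - ka)^2)) powr aa * (h - ka) <=
    4 * (powr_loss aa * (2 * b / (r * a^2) + 64 * ss * b / (kb - ka)^2)) powr aa * (h - ka)" using k h by (intro mult_right_mono mult_left_mono) auto
   then show ?thesis using 1 E(1) by linarith
  qed
  finally have "min Y (4 * b) <= (t - y0) + E" .
  then show ?thesis using y0 E(2) b by (simp add: Y_def min_def split: if_splits)
 qed
qed

lemma slice_growth:
 fixes a t b r ss :: real
 assumes u: "convex_solution aa ss u" and aa: "aa > 0" and k: "k' < ka" "ka < kb"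
  and ends: "u (vector [a, Yp]) <= k'" "u (vector [- a, Ym]) <= k'" "\<bar>Yp\<bar> <= a" "\<bar>Ym\<bar> <= a"
  and ss: "0 <= ss" "ss <= ((kb - ka) / (16 * b))^2"
  and slice: "!!y. u (vector [0, y]) <= kb ==> \<bar>y\<bar> <= t"
  and b: "b > 0" "2 * t <= b" "128 * b <= a" and r: "0 < r" "r <= 1 / 128"
  and h: "kb <= h" "u (vector [0, y]) <= h"
  and E: "65 * b * (16 * r + 5 * b / a) +
   4 * (powr_loss aa * (2 * b / (r * a^2) + 64 * ss * b / (kb - ka)^2)) powr aa * (h - ka) <= E" "E <= b"
 shows "\<bar>y\<bar> <= t + E"
proof -
 have neg: "- vector [x, y] = (vector [- x, - y] :: real^2)" for x y :: real by (simp add: vec_eq_iff forall_2)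
 have "y <= t + E" by (rule slice_growth_upper[OF u aa k ends ss slice b r h E])
 moreover have "- y <= t + E" by (rule slice_growth_upper[OF convex_solution_reflect[OF u aa ss(1)] aa k, of a "- Ym" "- Yp" b t r h "- y" E])
   (use ends ss slice[of "- _"] b r h E in \<open>auto simp: neg\<close>)
 ultimately show ?thesis by linarith
qed

text \<open>A set that does not reach the abscissa 2 * a is narrow at its right tip, because
  convexity spreads the bound on the slice. A circle of radius at most 20 * t touches it there from
  outside, which bounds the speed from below. By concavity the speed was no smaller at earlier
  levels, so at level k0 the support function in this direction would be negative, although the set
  contains the origin.\<close>

lemma tip_advance:
 fixes a t k k0 ss :: real
 assumes u: "convex_solution aa ss u" and aa: "aa > 0" and ss: "0 <= ss" "ss <= 1" and k: "u 0 <= k0" "k0 < k"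
  and ends: "u (vector [a, Yp]) <= k" "u (vector [- a, Ym]) <= k" "\<bar>Yp\<bar> <= a / 8" "\<bar>Ym\<bar> <= a / 8"
  and slice: "!!y. u (vector [0, y]) <= k ==> \<bar>y\<bar> <= t"
  and t: "t >= 1" "100 * t <= a"
  and big: "3 * a + 20 * t < (powr_loss aa * (20 * t)) powr (- aa) * (k - k0)"
 shows "\<exists>Y. u (vector [2 * a, Y]) <= k"
proof (rule ccontr)
 assume no: "\<not> ?thesis"
 have cvx: "convex_on UNIV u" using u by (simp add: convex_solution_def)
 have a: "a > 0" "t <= a / 100" using t by auto
 have star: "u (s *\<^sub>R x) <= k" if "u x <= k" "0 <= s" "s <= 1" for x s
 proof -
  have "u ((1 - s) *\<^sub>R 0 + s *\<^sub>R x) <= (1 - s) * u 0 + s * u x" using that by (intro convex_onD[OF cvx]) auto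
  also have "\<dots> <= (1 - s) * k + s * k" using that k by (intro add_mono mult_left_mono) auto
  finally show ?thesis by (simp add: algebra_simps)
 qed
 have right: "x $ 1 < 2 * a" if "u x <= k" for x :: "real^2"
 proof (rule ccontr)
  assume "\<not> x $ 1 < 2 * a"
  then have x1: "x $ 1 >= 2 * a" by simp
  then have "u ((2 * a / x $ 1) *\<^sub>R x) <= k" using a that by (intro star) auto
  moreover have "(2 * a / x $ 1) *\<^sub>R x = vector [2 * a, 2 * a / x $ 1 * x $ 2]" using x1 a by (simp add: vec_eq_iff forall_2)
  ultimately show False using no by auto
 qed
 have chord: "\<bar>a * Y + \<bar>X\<bar> * Y'\<bar> <= t * (a + \<bar>X\<bar>)"
  if "u (vector [X, Y]) <= k" "u (vector [X', Y']) <= k" "X' = (if X >= 0 then - a else a)" for X Y X' Y'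
 proof -
  define s where "s = a / (a + \<bar>X\<bar>)"
  have s: "0 <= s" "s <= 1" using a by (auto simp: s_def)
  have "u ((1 - s) *\<^sub>R vector [X', Y'] + s *\<^sub>R vector [X, Y]) <= (1 - s) * u (vector [X', Y']) + s * u (vector [X, Y])"
   using s by (intro convex_onD[OF cvx]) auto
  also have "\<dots> <= (1 - s) * k + s * k" using s that by (intro add_mono mult_left_mono) auto
  also have "(1 - s) *\<^sub>R vector [X', Y'] + s *\<^sub>R vector [X, Y] = (vector [0, (1 - s) * Y' + s * Y] :: real^2)"
   using that(3) a by (auto simp: vec_eq_iff forall_2 s_def field_simps)
  finally have "\<bar>(1 - s) * Y' + s * Y\<bar> <= t" by (intro slice) (simp add: algebra_simps)
  moreover have "(1 - s) * Y' + s * Y = (a * Y + \<bar>X\<bar> * Y') / (a + \<bar>X\<bar>)"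
  proof -
   have "1 - s = \<bar>X\<bar> / (a + \<bar>X\<bar>)" using a by (simp add: s_def field_simps)
   then show ?thesis by (simp add: s_def add_divide_distrib)
  qed
  ultimately show ?thesis using a by (simp add: abs_divide pos_divide_le_eq)
 qed
 \<comment> \<open>Slope of the line through the origin and the left end, the axis of the band
   below.\<close>
 define m where "m = - Ym / a"
 have m8: "\<bar>m\<bar> <= 1 / 8" using ends a by (simp add: m_def abs_divide pos_divide_le_eq)
 have am: "a * m = - Ym" using a by (simp add: m_def)
 have mid: "\<bar>Yp + Ym\<bar> <= 2 * t" using chord[OF ends(1,2)] a by (simp add: distrib_left[symmetric] abs_mult)
 have band: "\<bar>x $ 2 - m * x $ 1\<bar> <= 3 * t + (if x $ 1 < 0 then 3 * t * \<bar>x $ 1\<bar> / a else 0)" if x: "u x <= k" for x :: "real^2"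
 proof (cases "x $ 1 >= 0")
  case True
  have "\<bar>a * x $ 2 + x $ 1 * Ym\<bar> <= t * (a + x $ 1)" using chord[of "x $ 1" "x $ 2" "- a" Ym] x ends True by (simp add: vector_eta)
  also have "\<dots> <= t * (3 * a)" using right[OF x] t by (intro mult_left_mono) auto
  also have "a * x $ 2 + x $ 1 * Ym = a * (x $ 2 - m * x $ 1)"
  proof -
   have "a * (m * x $ 1) = - Ym * x $ 1" unfolding mult.assoc[symmetric] am ..
   then show ?thesis by (simp add: right_diff_distrib mult.commute)
  qed
  finally have "a * \<bar>x $ 2 - m * x $ 1\<bar> <= a * (3 * t)" using a by (simp add: abs_mult mult_ac)
  then show ?thesis using True a by simp
 next
  case False
  define X where "X = \<bar>x $ 1\<bar>"
  have X: "x $ 1 = - X" "X > 0" using False by (auto simp: X_def)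
  have 1: "\<bar>a * x $ 2 + X * Yp\<bar> <= t * (a + X)" using chord[of "x $ 1" "x $ 2" a Yp] x ends False by (simp add: vector_eta X_def)
  have 2: "\<bar>X * (Yp + Ym)\<bar> <= X * (2 * t)" using mid X by (simp add: abs_mult)
  have "a * (x $ 2 - m * x $ 1) = a * x $ 2 + (a * m) * X" by (simp add: X algebra_simps)
  also have "\<dots> = (a * x $ 2 + X * Yp) - X * (Yp + Ym)" unfolding am by (simp add: algebra_simps)
  finally have "\<bar>a * (x $ 2 - m * x $ 1)\<bar> <= t * (a + X) + X * (2 * t)" using 1 2 by linarith
  also have "\<dots> <= a * (3 * t + 3 * t * X / a)" using a t by (simp add: field_simps)
  finally have "a * \<bar>x $ 2 - m * x $ 1\<bar> <= a * (3 * t + 3 * t * X / a)" using a by (simp add: abs_mult)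
  then have "\<bar>x $ 2 - m * x $ 1\<bar> <= 3 * t + 3 * t * X / a" using a by simp
  then show ?thesis using False by (simp add: X_def)
 qed
 define B :: "(real^2) set" where "B = cball 0 (10 * a)"
 interpret sublevels u B using cvx by (rule sublevels_compact) (auto simp: B_def)
 have mK: "x \<in> K h \<longleftrightarrow> norm x <= 10 * a & u x <= h" for x h unfolding K_def by (simp add: B_def)
 have zeroK: "0 \<in> K h" if "h >= k0" for h using that k a by (simp add: mK)
 define Xm where "Xm = S 0 k"
 have neK: "K k ~= {}" using zeroK[of k] k by auto
 have Xm2: "Xm <= 2 * a" unfolding Xm_def by (rule S_least[OF neK]) (use right in \<open>auto simp: mK inner_edir intro: less_imp_le\<close>)
 have Xma: "a <= Xm"
 proof -
  have "norm (vector [a, Yp] :: real^2) <= \<bar>a\<bar> + \<bar>Yp\<bar>" using norm_le_l1_cart[of "vector [a, Yp] :: real^2"] by (simp add: sum_2)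
  then have "vector [a, Yp] \<in> K k" using ends a by (simp add: mK)
  from S_upper[OF this, of 0] show ?thesis by (simp add: Xm_def inner_edir)
 qed
 \<comment> \<open>On the axis, 16 * t before the tip. Relative to this centre the support function
   is 16 * t at angle 0, at most 11 * t at the angles pi / 3 and - pi / 3, and at most 19 * t
   between them, so there is an outer contact in between.\<close>
 define z :: "real^2" where "z = vector [Xm - 16 * t, m * Xm]"
 have ze: "z \<bullet> edir ta = Xm * (cos ta + m * sin ta) - 16 * t * cos ta" for ta by (simp add: z_def inner_edir algebra_simps)
 have Sup: "S ta k - z \<bullet> edir ta <= 3 * t * \<bar>sin ta\<bar> + 16 * t * cos ta" if "- pi / 3 <= ta" "ta <= pi / 3" for ta
 proof -
  have c: "cos ta >= 1 / 2" using cos_monotone_0_pi_le[of "\<bar>ta\<bar>" "pi / 3"] that by (simp add: cos_60 abs_le_iff)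
  have "\<bar>m\<bar> * \<bar>sin ta\<bar> <= 1 / 8 * 1" using m8 by (intro mult_mono) auto
  then have ms: "\<bar>m * sin ta\<bar> <= 1 / 8" by (simp add: abs_mult)
  have "x \<bullet> edir ta <= Xm * (cos ta + m * sin ta) + 3 * t * \<bar>sin ta\<bar>" if x: "x \<in> K k" for x :: "real^2"
  proof -
   have xX: "x $ 1 <= Xm" using S_upper[OF x, of 0] by (simp add: Xm_def inner_edir)
   define d where "d = x $ 2 - m * x $ 1"
   have "x \<bullet> edir ta = x $ 1 * (cos ta + m * sin ta) + d * sin ta" by (simp add: inner_edir d_def algebra_simps)
   also have "d * sin ta <= \<bar>d\<bar> * \<bar>sin ta\<bar>" using abs_ge_self[of "d * sin ta"] by (simp add: abs_mult)
   also have "\<bar>d\<bar> * \<bar>sin ta\<bar> <= (3 * t + (if x $ 1 < 0 then 3 * t * \<bar>x $ 1\<bar> / a else 0)) * \<bar>sin ta\<bar>"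
    using band[of x] x by (intro mult_right_mono) (auto simp: mK d_def)
   finally have 1: "x \<bullet> edir ta <= x $ 1 * (cos ta + m * sin ta) + 3 * t * \<bar>sin ta\<bar> + (if x $ 1 < 0 then 3 * t * \<bar>x $ 1\<bar> / a else 0) * \<bar>sin ta\<bar>"
    by (simp add: algebra_simps)
   show ?thesis
   proof (cases "x $ 1 < 0")
    case False
    have "x $ 1 * (cos ta + m * sin ta) <= Xm * (cos ta + m * sin ta)" using xX c ms by (intro mult_right_mono) auto
    then show ?thesis using 1 False by simp
   next
    case True
    have "3 * t / a <= 3 / 100" using a by (simp add: field_simps)
    then have "3 * t / a * (\<bar>x $ 1\<bar> * \<bar>sin ta\<bar>) <= 3 / 100 * (\<bar>x $ 1\<bar> * 1)"
     by (intro mult_mono) (auto intro: mult_left_mono)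
    then have "(if x $ 1 < 0 then 3 * t * \<bar>x $ 1\<bar> / a else 0) * \<bar>sin ta\<bar> <= - 3 / 100 * x $ 1" using True by simp
    moreover have "x $ 1 * (cos ta + m * sin ta) <= x $ 1 * (3 / 8)" using True c ms by (intro mult_left_mono_neg) auto
    moreover have "0 <= Xm * (cos ta + m * sin ta)" using Xma a c ms by (intro mult_nonneg_nonneg) auto
    ultimately show ?thesis using 1 True by linarith
   qed
  qed
  then have "S ta k <= Xm * (cos ta + m * sin ta) + 3 * t * \<bar>sin ta\<bar>" by (rule S_least[OF neK])
  then show ?thesis by (simp add: ze)
 qed
 have cont: "continuous_on (UNIV \<times> {u 0<..<k + 1}) (%p. S (fst p) (snd p))"
 proof (rule S_continuous)
  show "0 \<in> B" using a by (simp add: B_def)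
  show "K (k + 1) \<subseteq> cball 0 (10 * a)" by (auto simp: mK)
 qed
 have "\<exists>tt1 k1 c v M. - pi / 3 < tt1 & tt1 < pi / 3 & k <= k1 & k1 < k + t & k1 < k + 1 &
  S 0 k - z \<bullet> edir 0 <= c & c <= 19 * t + t & touch_above S z c v M tt1 k1"
 proof (rule exists_touch_above[OF cont])
  have s0: "S 0 k - z \<bullet> edir 0 = 16 * t" by (simp add: ze Xm_def)
  have "\<bar>sin (pi / 3)\<bar> <= 1" by (rule abs_sin_le_one)
  then have "3 * t * \<bar>sin (pi / 3)\<bar> <= 3 * t * 1" using t by (intro mult_left_mono) auto
  then have 11: "3 * t * \<bar>sin (pi / 3)\<bar> + 16 * t * cos (pi / 3) <= 11 * t" by (simp add: cos_60)
  show "S (- pi / 3) k - z \<bullet> edir (- pi / 3) < S 0 k - z \<bullet> edir 0" "S (pi / 3) k - z \<bullet> edir (pi / 3) < S 0 k - z \<bullet> edir 0"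
   using Sup[of "pi / 3"] Sup[of "- pi / 3"] 11 t unfolding s0 by simp_all
  show "S ta k - z \<bullet> edir ta <= 19 * t" if "- pi / 3 <= ta" "ta <= pi / 3" for ta
  proof -
   have "3 * t * \<bar>sin ta\<bar> <= 3 * t * 1" "16 * t * cos ta <= 16 * t * 1" using t by (intro mult_left_mono; simp)+
   then show ?thesis using Sup[OF that] by linarith
  qed
  show "S tt h1 <= S tt h2" if "u 0 < h1" "h1 <= h2" for tt h1 h2 using that a by (intro S_mono) (auto simp: set_eq_iff mK intro!: exI[of _ 0])
 qed (use k t in auto)
 then obtain tt1 k1 c v M where c: "- pi / 3 < tt1" "tt1 < pi / 3" "k <= k1"
  "S 0 k - z \<bullet> edir 0 <= c" "c <= 20 * t" "touch_above S z c v M tt1 k1" by auto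
 have c16: "c >= 16 * t" using c(4) by (simp add: ze Xm_def)
 have mX: "\<bar>m\<bar> * Xm <= 1 / 8 * (2 * a)" using m8 Xm2 Xma a by (intro mult_mono) auto
 have zn: "norm z <= 3 * a"
 proof -
  have "norm z <= \<bar>Xm - 16 * t\<bar> + \<bar>m * Xm\<bar>" using norm_le_l1_cart[of z] by (simp add: sum_2 z_def)
  also have "\<bar>Xm - 16 * t\<bar> <= 2 * a" using Xm2 Xma a t by simp
  finally show ?thesis using mX a Xma by (simp add: abs_mult)
 qed
 have int: "z + c *\<^sub>R edir tt1 \<in> interior B"
 proof -
  have "norm (z + c *\<^sub>R edir tt1) <= norm z + \<bar>c\<bar>" using norm_triangle_ineq[of z "c *\<^sub>R edir tt1"] by simp
  then show ?thesis using zn c c16 t a by (simp add: B_def interior_cball)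
 qed
 have super: "super_test aa ss u" using u by (simp add: convex_solution_def)
 have zB: "0 \<in> B" using a by (simp add: B_def)
 have ob: "outer_bound aa ss c v" by (rule contact_above[OF super ss(1) zB _ _ c(6) int]) (use k c c16 t in auto)
 have one: "powr_loss aa * c >= 1" "powr_loss aa * c <= powr_loss aa * (20 * t)"
  using powr_loss_ge_1[of aa] c16 c(5) t mult_mono[of 1 "powr_loss aa" 1 c] by auto
 define W where "W = (powr_loss aa * (20 * t)) powr (- aa)"
 have "W <= (powr_loss aa * c) powr (- aa)" unfolding W_def using one aa by (intro powr_mono2') auto
 then have vW: "W <= v" using outer_bound_speed[OF ob aa ss one(1)] by (rule order_trans)
 obtain dl where dl: "dl > 0" "S tt1 k1 = z \<bullet> edir tt1 + c"
  "!!tt h. \<bar>tt - tt1\<bar> < dl ==> \<bar>h - k1\<bar> < dl ==> S tt h <= z \<bullet> edir tt + c + v * (h - k1) + M * (h - k1)^2"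
  using c(6) unfolding touch_above_def by metis
 have "S tt1 k0 <= S tt1 k1 + v * (k0 - k1)"
 proof (rule concave_touch_above_imp_supergradient[of k0 _ _ dl _ M])
  show "S tt1 h <= S tt1 k1 + v * (h - k1) + M * (h - k1)^2" if "\<bar>h - k1\<bar> < dl" for h using dl(3)[of tt1 h] that dl(1,2) by simp
  show "(1 - s) * S tt1 k1 + s * S tt1 h <= S tt1 ((1 - s) * k1 + s * h)" if "k0 <= h" "0 <= s" "s <= 1" for h s
   using zeroK[of k1] zeroK[of h] that k c by (intro S_concave) auto
 qed (use dl in auto)
 moreover have "W * (k - k0) <= v * (k1 - k0)"
 proof -
  have "0 <= W" by (simp add: W_def)
  then show ?thesis using vW c k by (intro mult_mono) auto
 qed
 moreover have "0 <= S tt1 k0" using S_upper[OF zeroK, of k0 tt1] by simp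
 moreover have "S tt1 k1 <= 3 * a + 20 * t"
 proof -
  have "z \<bullet> edir tt1 <= 3 * a" using inner_edir_le[of z tt1] zn by linarith
  then show ?thesis using dl(2) c(5) by simp
 qed
 ultimately show False using big unfolding W_def[symmetric] by (simp add: right_diff_distrib)
qed

section \<open>Exclusion of long chords\<close>

lemma powr_scale_square:
 fixes a Z aa :: real
 assumes "a > 0" "Z > 0"
 shows "a * (Z / a^2) powr aa = Z powr aa * a powr (1 - 2 * aa)"
proof -
 have "a^2 = a powr 2" using assms by (simp add: powr_numeral)
 then have "(Z / a^2) powr aa = Z powr aa / a powr (2 * aa)"
 proof -
  have "a\<^sup>2 powr aa = a powr (2 * aa)" by (simp only: \<open>a\<^sup>2 = a powr 2\<close> powr_powr)
  then show ?thesis using assms by (simp add: powr_divide)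
 qed
 moreover have "a powr (1 - 2 * aa) = a / a powr (2 * aa)" using assms by (simp add: powr_diff)
 ultimately show ?thesis by simp
qed

lemma eventually_powr_small:
 fixes aa c e :: real
 assumes "aa > 1 / 2" "e > 0"
 shows "\<forall>\<^sub>F a in at_top. c * a powr (1 - 2 * aa) <= e"
proof -
 have "((%a. c * a powr (1 - 2 * aa)) \<longlongrightarrow> c * 0) at_top" using assms by (intro tendsto_intros tendsto_neg_powr filterlim_ident) auto
 from order_tendstoD(2)[OF this, of e] show ?thesis using assms(2) by (auto elim: eventually_mono)
qed

lemma geometric_partial_sum_le:
 fixes x :: real
 assumes "0 <= x" "x < 1"
 shows "(\<Sum>i<n. x ^ i) <= 1 / (1 - x)"
proof -
 have "(\<Sum>i<n. x ^ i) = (1 - x ^ n) / (1 - x)" using assms by (simp add: sum_gp_strict)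
 also have "\<dots> <= 1 / (1 - x)" using assms by (intro divide_right_mono) auto
 finally show ?thesis .
qed

lemma inverse_power_powr: "Q > 0 ==> (inverse (Q ^ j)) powr aa = ((Q::real) powr (- aa)) ^ j"
 by (induction j) (simp_all add: powr_mult inverse_powr powr_minus)

text \<open>
 While the level doubles, the chord doubles too (\<open>tip_advance\<close>) and the slice through the origin grows by an amount
 that is summable because \<open>aa > 1 / 2\<close>. So the slice stays bounded at all levels, which is absurd.
\<close>

lemma no_long_chord:
 fixes aa C :: real
 assumes aa: "aa > 1 / 2" and C: "C >= 1"
 shows "\<exists>a0. \<forall>a\<ge>a0. \<exists>s1>0. \<forall>ss w. 0 <= ss --> ss <= s1 --> convex_solution aa ss w --> w 0 <= 3 / 4 -->
  w (vector [a, 0]) <= 3 / 4 --> w (vector [- a, 0]) <= 3 / 4 --> \<not> (\<forall>y. w (vector [0, y]) <= 1 --> \<bar>y\<bar> <= C)"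
proof -
 define K where "K = powr_loss aa"
 have K: "K >= 1" using powr_loss_ge_1 by (simp add: K_def)
 \<comment> \<open>The speed that \<open>tip_advance\<close> guarantees for slices of at most 3 *
   C.\<close>
 define w0 where "w0 = (K * (20 * (3 * C))) powr (- aa)"
 have KC: "1 <= K * (20 * (3 * C))" using K C mult_mono[of 1 K 1 "20 * (3 * C)"] by simp
 have neg: "0 < G powr (- aa) & G powr (- aa) <= 1" if "G >= 1" for G :: real using that powr_mono[of "- aa" 0 G] aa by simp
 from neg[OF KC] have w0: "0 < w0" "w0 <= 1" by (simp_all only: w0_def)
 have "2 powr (1 / aa) < 2 powr (2::real)" using aa by (intro powr_less_mono) (auto simp: field_simps)
 then have tp: "2 powr (1 / aa) < (4::real)" by (simp add: powr_numeral)
 \<comment> \<open>The radius parameter must decrease geometrically for its error to be summable,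
   but slowly enough for the advance, of order (2 * (4 * q) powr (- aa)) ^ j, to be summable too. A
   ratio q < 1 of this kind exists because 2 powr (1 / aa) < 4.\<close>
 define q where "q = (1 + 2 powr (1 / aa) / 4) / 2"
 have q: "0 < q" "q < 1" "2 powr (1 / aa) < 4 * q" using tp by (auto simp: q_def field_simps add_pos_pos)
 define p where "p = 2 * (4 * q) powr (- aa)"
 have p: "0 < p" "p < 1"
 proof -
  show "0 < p" using q by (simp add: p_def)
  have "(2 powr (1 / aa)) powr aa < (4 * q) powr aa" using q aa by (intro powr_less_mono2) auto
  then have "2 < (4 * q) powr aa" using aa by (simp add: powr_powr)
  then show "p < 1" by (simp add: p_def powr_minus_divide divide_less_eq)
 qed
 \<comment> \<open>6240 = 65 * 6 * 16 is the coefficient of C * r in the growth of the slice; with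
   18720 = 3 * 6240 these errors add up to at most C / 3.\<close>
 define r0 where "r0 = (1 - q) / 18720"
 have r0: "0 < r0" "r0 <= 1 / 18720" using q by (auto simp: r0_def)
 have "\<forall>\<^sub>F a in at_top. a >= 100000 * C" by (rule eventually_ge_at_top)
 moreover have "\<forall>\<^sub>F a in at_top. 64 / w0 * (160000 * K * C) powr aa * a powr (1 - 2 * aa) <= C / 2"
  using aa C by (intro eventually_powr_small) auto
 moreover have "\<forall>\<^sub>F a in at_top. 128 / w0 * (18 * K * C / r0) powr aa / (1 - p) * a powr (1 - 2 * aa) <= C / 3"
  using aa C by (intro eventually_powr_small) auto
 ultimately have "\<forall>\<^sub>F a in at_top. a >= 100000 * C &
   64 / w0 * (160000 * K * C) powr aa * a powr (1 - 2 * aa) <= C / 2 &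
   128 / w0 * (18 * K * C / r0) powr aa / (1 - p) * a powr (1 - 2 * aa) <= C / 3" by eventually_elim auto
 then obtain a0 where a0: "!!a. a >= a0 ==> a >= 100000 * C &
   64 / w0 * (160000 * K * C) powr aa * a powr (1 - 2 * aa) <= C / 2 &
   128 / w0 * (18 * K * C / r0) powr aa / (1 - p) * a powr (1 - 2 * aa) <= C / 3" unfolding eventually_at_top_linorder by blast
 show ?thesis
 proof (rule exI[of _ a0], intro allI impI)
  fix a assume "a0 <= a"
  from a0[OF this] have a: "a >= 100000 * C"
   and A1: "64 / w0 * (160000 * K * C) powr aa * a powr (1 - 2 * aa) <= C / 2"
   and A2: "128 / w0 * (18 * K * C / r0) powr aa / (1 - p) * a powr (1 - 2 * aa) <= C / 3" by auto
  have apos: "a > 0" "a >= 100000" using a C by linarith+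
  define s1 where "s1 = min 1 (min ((1 / (256 * C))^2) (9 / a^2))"
  have s1: "s1 > 0" using C apos by (simp add: s1_def)
  show "\<exists>s1>0. \<forall>ss w. 0 <= ss --> ss <= s1 --> convex_solution aa ss w --> w 0 <= 3 / 4 -->
   w (vector [a, 0]) <= 3 / 4 --> w (vector [- a, 0]) <= 3 / 4 --> \<not> (\<forall>y. w (vector [0, y]) <= 1 --> \<bar>y\<bar> <= C)"
  proof (rule exI[of _ s1], intro conjI allI impI notI s1)
   fix ss w assume ss: "0 <= ss" "ss <= s1" and w: "convex_solution aa ss w" and wz: "w 0 <= 3 / 4"
    and ends: "w (vector [a, 0]) <= 3 / 4" "w (vector [- a, 0]) <= 3 / 4"
    and slice1: "\<forall>y. w (vector [0, y]) <= 1 --> \<bar>y\<bar> <= C"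
   have ss1: "ss <= 1" "ss <= (1 / (256 * C))^2" "ss <= 9 / a^2" using ss by (auto simp: s1_def)
   have cvx: "convex_on UNIV w" using w by (simp add: convex_solution_def)
   have aa0: "aa > 0" using aa by simp
   \<comment> \<open>With this ratio of level to length the requirement of
     \<open>tip_advance\<close> is, up to constants, 3 * l < 8 * l at every stage.\<close>
   define La where "La = 16 * a / w0"
   have La: "16 * a <= La" "w0 * La = 16 * a" using w0 apos by (auto simp: La_def field_simps)
   have base: "\<bar>y\<bar> <= 2 * C" if y: "w (vector [0, y]) <= La" for y
   proof -
    have "\<bar>y\<bar> <= C + C"
    proof (rule slice_growth[OF w aa0, of "3 / 4" "7 / 8" 1 a 0 0 "2 * C" C "1 / 20000" La y C])
     show "ss <= ((1 - 7 / 8) / (16 * (2 * C)))^2" using ss1(2) by simp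
     have "2 * (2 * C) / (1 / 20000 * a^2) + 64 * ss * (2 * C) / (1 - 7 / 8)^2 <= 160000 * C / a^2"
     proof -
      have "8192 * C * ss <= 8192 * C * (9 / a^2)" using ss1(3) C by (intro mult_left_mono) auto
      also have "\<dots> <= 80000 * (C / a^2)" using C by (auto intro!: divide_right_mono)
      finally have "8192 * C * ss <= 80000 * (C / a^2)" .
      moreover have "2 * (2 * C) / (1 / 20000 * a^2) = 80000 * (C / a^2)" by simp
      moreover have "64 * ss * (2 * C) / (1 - 7 / 8)^2 = 8192 * C * ss" by (simp add: power2_eq_square)
      ultimately show ?thesis by simp
     qed
     then have "(K * (2 * (2 * C) / (1 / 20000 * a^2) + 64 * ss * (2 * C) / (1 - 7 / 8)^2)) powr aa <= (K * (160000 * C / a^2)) powr aa"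
      using K C ss aa by (intro powr_mono2 mult_left_mono) auto
     then have "4 * (K * (2 * (2 * C) / (1 / 20000 * a^2) + 64 * ss * (2 * C) / (1 - 7 / 8)^2)) powr aa * (La - 7 / 8)
      <= 4 * (K * (160000 * C / a^2)) powr aa * La" using La apos by (intro mult_mono mult_left_mono) auto
     also have "\<dots> = 64 / w0 * (a * (160000 * K * C / a^2) powr aa)" by (simp add: La_def mult_ac)
     also have "\<dots> <= C / 2" using A1 K C apos by (subst powr_scale_square) (auto simp: mult.assoc)
     finally have 1: "4 * (powr_loss aa * (2 * (2 * C) / (1 / 20000 * a^2) + 64 * ss * (2 * C) / (1 - 7 / 8)^2)) powr aa * (La - 7 / 8) <= C / 2"
      unfolding K_def .
     have "65 * (2 * C) * (16 * (1 / 20000) + 5 * (2 * C) / a) <= 65 * (2 * C) * (16 * (1 / 20000) + 1 / 10000)"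
      using a C apos by (intro mult_left_mono add_left_mono) (auto simp: pos_divide_le_eq)
     also have "\<dots> = 117 / 1000 * C" by simp
     finally show "65 * (2 * C) * (16 * (1 / 20000) + 5 * (2 * C) / a) +
      4 * (powr_loss aa * (2 * (2 * C) / (1 / 20000 * a^2) + 64 * ss * (2 * C) / (1 - 7 / 8)^2)) powr aa * (La - 7 / 8) <= C" using 1 C by linarith
    qed (use ends slice1 C a apos La y ss in auto)
    then show ?thesis by simp
   qed
   define l h where "l j = a * 2 ^ j" and "h j = La * 2 ^ j" for j :: nat
   \<comment> \<open>Growth of the slice in stage j: the errors from the radius parameter and from
     the length of the chord, and the advance of the level line. Each sums to at most C / 3.\<close>
   define e where "e j = 6240 * C * r0 * q ^ j + 11700 * C^2 / a * (1 / 2) ^ j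
    + 128 / w0 * (18 * K * C / r0) powr aa * a powr (1 - 2 * aa) * p ^ j" for j :: nat
   define t where "t j = 2 * C + (\<Sum>i<j. e i)" for j
   have e0: "0 <= e j" for j unfolding e_def using C r0 q apos w0 K p by (intro add_nonneg_nonneg mult_nonneg_nonneg) auto
   have esum: "(\<Sum>i<j. e i) <= C" for j
   proof -
    have "(\<Sum>i<j. e i) = 6240 * C * r0 * (\<Sum>i<j. q ^ i) + 11700 * C^2 / a * (\<Sum>i<j. (1 / 2) ^ i)
     + 128 / w0 * (18 * K * C / r0) powr aa * a powr (1 - 2 * aa) * (\<Sum>i<j. p ^ i)" unfolding e_def by (simp add: sum.distrib sum_distrib_left)
    also have "\<dots> <= 6240 * C * r0 * (1 / (1 - q)) + 11700 * C^2 / a * (1 / (1 - 1 / 2))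
     + 128 / w0 * (18 * K * C / r0) powr aa * a powr (1 - 2 * aa) * (1 / (1 - p))"
     using q p C r0 apos w0 K by (intro add_mono mult_left_mono geometric_partial_sum_le) auto
    also have "\<dots> <= C / 3 + C / 3 + C / 3"
    proof (intro add_mono)
     have "r0 * (1 / (1 - q)) = 1 / 18720" using q by (simp add: r0_def)
     then show "6240 * C * r0 * (1 / (1 - q)) <= C / 3" by (simp only: mult.assoc)
     have "C * (70200 * C) <= C * a" using a C by (intro mult_left_mono) auto
     then show "11700 * C^2 / a * (1 / (1 - 1 / 2)) <= C / 3" using apos by (simp add: pos_divide_le_eq power2_eq_square)
     show "128 / w0 * (18 * K * C / r0) powr aa * a powr (1 - 2 * aa) * (1 / (1 - p)) <= C / 3" using A2 by (simp add: mult_ac)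
    qed
    finally show ?thesis by simp
   qed
   have t: "2 * C <= t j" "t j <= 3 * C" for j using esum[of j] sum_nonneg[of "{..<j}" e] e0 by (auto simp: t_def)
   have lj: "a <= l j" for j using apos by (simp add: l_def)
   have hj: "La <= h j" "w0 * h j = 16 * l j" "16 * l j <= h j" for j
   proof -
    have "La * 1 <= La * 2 ^ j" using La apos by (intro mult_left_mono) auto
    then show "La <= h j" by (simp add: h_def)
    show "w0 * h j = 16 * l j" unfolding h_def l_def using La(2) by (simp add: mult.assoc[symmetric])
    show "16 * l j <= h j" using mult_right_mono[OF La(1), of "2 ^ j"] by (simp add: h_def l_def)
   qed
   \<comment> \<open>At level h j / 4 the set reaches the abscissae l j and - l j, and up to level h
     j the slice obeys t j <= 3 * C. The tips double up to level h j / 2, which is a quarter of h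
     (Suc j).\<close>
   have main: "(\<exists>Yp Ym. w (vector [l j, Yp]) <= h j / 4 & w (vector [- l j, Ym]) <= h j / 4) &
    (\<forall>y. w (vector [0, y]) <= h j --> \<bar>y\<bar> <= t j)" for j
   proof (induction j)
    case 0
    have "3 / 4 <= h 0 / 4" using La apos by (simp add: h_def)
    then show ?case using ends base by (auto simp: l_def h_def t_def intro!: exI[of _ 0])
   next
    case (Suc j)
    then obtain Yp Ym where Y: "w (vector [l j, Yp]) <= h j / 4" "w (vector [- l j, Ym]) <= h j / 4"
     and sl: "!!y. w (vector [0, y]) <= h j ==> \<bar>y\<bar> <= t j" by auto
    have h34: "3 / 4 <= h j / 4" "1 < h j / 2" using hj(1)[of j] La apos by auto
    have lens: "\<bar>Y\<bar> <= l j / 8" if Y: "w (vector [X, Y]) <= h j / 4" "\<bar>X\<bar> = l j" for X Y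
    proof -
     have v: "X *\<^sub>R edir 0 + Y *\<^sub>R edir (pi / 2) = (vector [X, Y] :: real^2)" "a *\<^sub>R edir 0 = (vector [a, 0] :: real^2)"
      "- a *\<^sub>R edir 0 = (vector [- a, 0] :: real^2)" "z *\<^sub>R edir (pi / 2) = (vector [0, z] :: real^2)" for z
      by (simp_all add: vec_eq_iff forall_2)
     have "w ((Y * (a / (a + \<bar>X\<bar>))) *\<^sub>R edir (pi / 2)) <= h j / 4"
     proof (rule slice_extent[OF cvx apos(1)])
      show "w (a *\<^sub>R edir 0) <= h j / 4" "w (- a *\<^sub>R edir 0) <= h j / 4" unfolding v(2,3) using ends h34 by auto
      show "w (X *\<^sub>R edir 0 + Y *\<^sub>R edir (pi / 2)) <= h j / 4" unfolding v(1) by (rule Y)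
     qed
     then have "\<bar>Y * (a / (a + \<bar>X\<bar>))\<bar> <= 3 * C" using sl[of "Y * (a / (a + \<bar>X\<bar>))"] t[of j] h34 unfolding v(4) by linarith
     then have "\<bar>Y\<bar> * a <= 3 * C * (a + l j)" using apos Y(2) lj[of j] by (simp add: abs_mult abs_divide pos_divide_le_eq)
     also have "\<dots> <= 3 * C * (2 * l j)" using lj[of j] C by (intro mult_left_mono) auto
     also have "\<dots> <= l j / 8 * a" using mult_right_mono[OF a, of "l j"] lj[of j] apos by simp
     finally show ?thesis using apos by simp
    qed
    have Yb: "\<bar>Yp\<bar> <= l j / 8" "\<bar>Ym\<bar> <= l j / 8" using lens Y lj[of j] apos by auto
    have hS: "h (Suc j) = 2 * h j" "l (Suc j) = 2 * l j" by (simp_all add: h_def l_def)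
    have sl': "\<bar>y\<bar> <= t (Suc j)" if y: "w (vector [0, y]) <= h (Suc j)" for y
    proof -
     define r where "r = r0 * q ^ j"
     have r: "0 < r" "r <= 1 / 128"
     proof -
      have "r0 * q ^ j <= r0 * 1" using q r0 by (intro mult_left_mono power_le_one) auto
      then have "r <= r0" by (simp add: r_def)
      then show "r <= 1 / 128" using r0 by linarith
      show "0 < r" using q r0 by (simp add: r_def)
     qed
     have "\<bar>y\<bar> <= t j + e j"
     proof (rule slice_growth[OF w aa0, of "h j / 4" "h j / 2" "h j" "l j" Yp Ym "6 * C" "t j" r "h (Suc j)" y "e j"])
      have "1 <= h j / 2 / (16 * (6 * C))" using hj(1)[of j] La a C by (simp add: field_simps)
      then have "1 <= ((h j - h j / 2) / (16 * (6 * C)))^2" by (simp add: one_le_power)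
      then show "ss <= ((h j - h j / 2) / (16 * (6 * C)))^2" using ss1(1) by linarith
      have lp: "l j > 0" using lj[of j] apos by linarith
      have hp: "h j > 0" using h34 by simp
      have "64 * ss * (6 * C) / (h j - h j / 2)^2 <= 6 * C / (r * (l j)^2)"
      proof -
       have "64 * ss * (6 * C) / (h j - h j / 2)^2 = 256 * (6 * C) * ss / (h j)^2" by (simp add: power_divide)
       also have "\<dots> <= 256 * (6 * C) * 1 / (16 * l j)^2" using hj(3)[of j] lp ss1(1) ss C by (intro frac_le mult_left_mono power_mono) auto
       also have "\<dots> = 6 * C / (1 * (l j)^2)" by (simp add: power_mult_distrib)
       also have "\<dots> <= 6 * C / (r * (l j)^2)" using r lp C by (intro frac_le mult_right_mono) auto
       finally show ?thesis .
      qed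
      from add_left_mono[OF this, of "2 * (6 * C) / (r * (l j)^2)"]
      have "2 * (6 * C) / (r * (l j)^2) + 64 * ss * (6 * C) / (h j - h j / 2)^2 <= 18 * C / (r * (l j)^2)"
       unfolding add_divide_distrib[symmetric] by simp
      then have "(K * (2 * (6 * C) / (r * (l j)^2) + 64 * ss * (6 * C) / (h j - h j / 2)^2)) powr aa <= (K * (18 * C / (r * (l j)^2))) powr aa"
       using K C ss aa r by (intro powr_mono2 mult_left_mono) auto
      then have "4 * (K * (2 * (6 * C) / (r * (l j)^2) + 64 * ss * (6 * C) / (h j - h j / 2)^2)) powr aa * (h (Suc j) - h j / 2)
       <= 4 * (K * (18 * C / (r * (l j)^2))) powr aa * (2 * h j)" using hp unfolding hS by (intro mult_mono mult_left_mono) auto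
      also have "\<dots> = 128 / w0 * (18 * K * C / r0) powr aa * a powr (1 - 2 * aa) * p ^ j"
      proof -
       have "(l j)^2 = a^2 * 4 ^ j" 
       proof -
        have "(2 ^ j)^2 = (4::real) ^ j" by (simp add: power2_eq_square flip: power_mult_distrib)
        then show ?thesis by (simp add: l_def power_mult_distrib)
       qed
       then have "K * (18 * C / (r * (l j)^2)) = (18 * K * C / r0 / a^2) * inverse ((4 * q) ^ j)"
        by (simp add: r_def power_mult_distrib divide_inverse mult_ac)
       then have "(K * (18 * C / (r * (l j)^2))) powr aa = (18 * K * C / r0 / a^2) powr aa * (inverse ((4 * q) ^ j)) powr aa"
        using K C r0 q by (simp only: powr_mult)
       moreover have "(inverse ((4 * q) ^ j)) powr aa = ((4 * q) powr (- aa)) ^ j" using q by (intro inverse_power_powr) simp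
       moreover have "4 * (X * Z ^ j) * (2 * h j) = 128 / w0 * (a * X) * (2 * Z) ^ j" for X Z by (simp add: h_def La_def power_mult_distrib)
       ultimately have "4 * (K * (18 * C / (r * (l j)^2))) powr aa * (2 * h j) =
        128 / w0 * (a * (18 * K * C / r0 / a^2) powr aa) * p ^ j" by (simp only: p_def)
       then show ?thesis using K C r0 apos by (subst (asm) powr_scale_square) (auto simp: mult_ac)
      qed
      finally have 1: "4 * (powr_loss aa * (2 * (6 * C) / (r * (l j)^2) + 64 * ss * (6 * C) / (h j - h j / 2)^2)) powr aa * (h (Suc j) - h j / 2)
       <= 128 / w0 * (18 * K * C / r0) powr aa * a powr (1 - 2 * aa) * p ^ j" unfolding K_def .
      have "65 * (6 * C) * (16 * r + 5 * (6 * C) / l j) = 6240 * C * r0 * q ^ j + 11700 * C^2 / a * (1 / 2) ^ j"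
      proof -
       have "5 * (6 * C) / l j = 30 * C / a * (1 / 2) ^ j" by (simp add: l_def power_one_over)
       moreover have "65 * (6 * C) * (16 * (r0 * z) + 30 * C / a * y) = 6240 * C * r0 * z + 11700 * C^2 / a * y" for y z
        using apos by (simp add: field_simps power2_eq_square)
       ultimately show ?thesis by (simp only: r_def)
      qed
      then show "65 * (6 * C) * (16 * r + 5 * (6 * C) / l j) +
       4 * (powr_loss aa * (2 * (6 * C) / (r * (l j)^2) + 64 * ss * (6 * C) / (h j - h j / 2)^2)) powr aa * (h (Suc j) - h j / 2) <= e j"
       using 1 by (simp add: e_def)
      have "e j <= (\<Sum>i<Suc j. e i)" using e0 sum_nonneg[of "{..<j}" e] by simp
      then show "e j <= 6 * C" using esum[of "Suc j"] C by linarith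
     qed (use Y Yb sl t[of j] h34 hS r ss y C a lj[of j] apos in auto)
     then show ?thesis by (simp add: t_def)
    qed
    have neg: "- vector [x, y] = (vector [- x, - y] :: real^2)" for x y :: real by (simp add: vec_eq_iff forall_2)
    have big: "3 * l j + 20 * (3 * C) < (powr_loss aa * (20 * (3 * C))) powr (- aa) * (h j / 2 - 1)"
    proof -
     have "w0 * (h j / 2 - 1) = 8 * l j - w0" using hj(2)[of j] by (simp add: right_diff_distrib)
     then show ?thesis using w0 lj[of j] a C unfolding w0_def[symmetric] K_def[symmetric] by linarith
    qed
    have slh: "\<bar>y\<bar> <= 3 * C" if "w (vector [0, y]) <= h j / 2" for y using sl[of y] that h34 t[of j] by linarith
    have "\<exists>Y. w (vector [2 * l j, Y]) <= h j / 2" by (rule tip_advance[OF w aa0 ss(1) ss1(1), of 1 "h j / 2" "l j" Yp Ym "3 * C"])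
      (use wz Y Yb slh big h34 lj[of j] a C in auto)
    moreover have "\<exists>Y. w (- vector [2 * l j, Y]) <= h j / 2"
     by (rule tip_advance[OF convex_solution_reflect[OF w aa0 ss(1)] aa0 ss(1) ss1(1), of 1 "h j / 2" "l j" "- Ym" "- Yp" "3 * C"])
      (use wz Y Yb slh[of "- _"] big h34 lj[of j] a C in \<open>auto simp: neg\<close>)
    ultimately show ?case using sl' by (auto simp: hS neg)
   qed
   \<comment> \<open>The point (0, 4 * C) belongs to some level, while no slice exceeds 3 *
     C.\<close>
   obtain j where j: "w (vector [0, 4 * C]) < 2 ^ j" using real_arch_pow[of 2 "w (vector [0, 4 * C])"] by auto
   have "2 ^ j <= h j" using La apos by (simp add: h_def)
   then have "\<bar>4 * C\<bar> <= t j" using main[of j] j by auto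
   then show False using t[of j] C by linarith
  qed
 qed
qed

section \<open>Growth of the sublevel sets\<close>

lemma convex_linear_lower_bound:
 fixes u :: "real^2 => real"
 assumes cvx: "convex_on UNIV u"
 obtains M where "M >= 0" "!!x. u 0 - M * norm x <= u x"
proof -
 have "continuous_on (sphere 0 1) u" using convex_on_continuous[OF open_UNIV cvx] continuous_on_subset by blast
 then have "bounded (u ` sphere 0 1)" by (intro compact_imp_bounded compact_continuous_image) auto
 then obtain M where M: "M > 0" "!!x. norm x = 1 ==> \<bar>u x\<bar> <= M" unfolding bounded_pos by auto
 show thesis
 proof (rule that[of "M + \<bar>u 0\<bar>"])
  fix x :: "real^2"
  define r where "r = norm x"
  show "u 0 - (M + \<bar>u 0\<bar>) * norm x <= u x"
  proof (cases "r = 0")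
   case False
   then have r: "r > 0" by (simp add: r_def)
   define e where "e = - (1 / r) *\<^sub>R x"
   have "norm e = 1" using r by (simp add: e_def r_def)
   define s where "s = r / (1 + r)"
   have s: "0 <= s" "s <= 1" "1 - s = 1 / (1 + r)" using r by (auto simp: s_def field_simps)
   have "(1 - s) *\<^sub>R x + s *\<^sub>R e = 0" unfolding s(3) using r by (simp add: s_def e_def)
   then have "u 0 <= (1 - s) * u x + s * u e" using convex_onD[OF cvx s(1,2), of x e] by simp
   also have "\<dots> = (u x + r * u e) / (1 + r)" unfolding s(3) by (simp add: s_def add_divide_distrib)
   finally have "u 0 * (1 + r) <= u x + r * u e" using r by (simp add: pos_le_divide_eq)
   moreover have "r * (u e - u 0) <= r * (M + \<bar>u 0\<bar>)" using M(2)[OF \<open>norm e = 1\<close>] r by (intro mult_left_mono) auto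
   ultimately show ?thesis by (simp add: r_def algebra_simps)
  qed (simp add: r_def)
 qed (use M in auto)
qed

text \<open>A longer slice would put a triangle with base from (- a, 0) to (a, 0) and height C into
  the sublevel set, and with it a disc of radius C / 4 centred at height C / 2. There w lies between
  - 1 and 1, so \<open>ball_bound\<close> contradicts the size of C.\<close>

lemma slice_bounded_by_ball:
 fixes a C :: real
 assumes w: "convex_solution aa ss w" and aa: "aa > 0" and ss: "0 <= ss" "ss <= 1"
  and ends: "w (vector [a, 0]) <= 1" "w (vector [- a, 0]) <= 1"
  and C: "C >= 4" "C <= a" "3 * \<bar>ball_const aa\<bar> < (C / 4) powr (1 + aa)"
  and low: "!!x. norm x <= a ==> w x >= - 1"
  and y: "w (vector [0, y]) <= 1"
 shows "\<bar>y\<bar> <= C"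
proof (rule ccontr)
 assume "\<not> \<bar>y\<bar> <= C"
 then have yC: "C < \<bar>y\<bar>" by simp
 have cvx: "convex_on UNIV w" using w by (simp add: convex_solution_def)
 have comb: "w ((1 - s) *\<^sub>R p + s *\<^sub>R q) <= 1" if "w p <= 1" "w q <= 1" "0 <= s" "s <= 1" for p q s
 proof -
  have "w ((1 - s) *\<^sub>R p + s *\<^sub>R q) <= (1 - s) * w p + s * w q" using that by (intro convex_onD[OF cvx]) auto
  also have "\<dots> <= (1 - s) * 1 + s * 1" using that by (intro add_mono mult_left_mono) auto
  finally show ?thesis by simp
 qed
 have axis: "w (vector [X, 0]) <= 1" if "\<bar>X\<bar> <= a" for X
 proof -
  have "(1 - (X + a) / (2 * a)) *\<^sub>R vector [- a, 0] + ((X + a) / (2 * a)) *\<^sub>R vector [a, 0] = (vector [X, 0] :: real^2)"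
   using C by (simp add: vec_eq_iff forall_2 field_simps)
  then show ?thesis using comb[OF ends(2,1), of "(X + a) / (2 * a)"] that C by (simp add: field_simps abs_le_iff)
 qed
 define s where "s = sgn y"
 have s: "s * s = 1" "\<bar>s\<bar> = 1" "y = s * \<bar>y\<bar>" using yC C by (auto simp: s_def sgn_if)
 have top: "w (vector [0, s * C]) <= 1"
 proof -
  have "(1 - C / \<bar>y\<bar>) *\<^sub>R vector [0, 0] + (C / \<bar>y\<bar>) *\<^sub>R vector [0, y] = (vector [0, s * C] :: real^2)"
   using yC C s(3) by (simp add: vec_eq_iff forall_2 field_simps)
  then show ?thesis using comb[OF axis[of 0] y, of "C / \<bar>y\<bar>"] yC C by (simp add: field_simps)
 qed
 define z :: "real^2" where "z = vector [0, s * (C / 2)]"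
 have "w p <= 1" if "p \<in> cball z (C / 4)" for p
 proof -
  have "\<bar>p $ 1\<bar> <= C / 4" "\<bar>p $ 2 - s * (C / 2)\<bar> <= C / 4"
   using that component_le_norm_cart[of "p - z" 1] component_le_norm_cart[of "p - z" 2] by (auto simp: z_def dist_norm norm_minus_commute)
  define l where "l = s * p $ 2 / C"
  have "s * (p $ 2 - s * (C / 2)) = s * p $ 2 - C / 2" using s(1) by algebra
  then have "\<bar>s * p $ 2 - C / 2\<bar> <= C / 4" using \<open>\<bar>p $ 2 - s * (C / 2)\<bar> <= C / 4\<close> s(2) by (metis abs_mult mult_1)
  then have "C / 4 <= s * p $ 2" "s * p $ 2 <= 3 * C / 4" by (simp_all only: abs_le_iff) linarith+
  then have l: "1 / 4 <= l" "l <= 3 / 4" using C by (auto simp: l_def pos_le_divide_eq pos_divide_le_eq)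
  have lC: "l * (s * C) = s * (s * p $ 2)" using C by (simp add: l_def)
  define X where "X = p $ 1 / (1 - l)"
  have "\<bar>X\<bar> = \<bar>p $ 1\<bar> / (1 - l)" using l by (simp add: X_def abs_divide)
  also have "\<dots> <= (C / 4) / (1 / 4)" using l \<open>\<bar>p $ 1\<bar> <= C / 4\<close> C by (intro frac_le) auto
  finally have "\<bar>X\<bar> <= a" using C by simp
  have "s * (s * p $ 2) = p $ 2" using s(1) by (simp add: mult.assoc[symmetric])
  with lC have lC: "l * (s * C) = p $ 2" by (rule trans)
  have "(1 - l) *\<^sub>R vector [X, 0] + l *\<^sub>R vector [0, s * C] = p" using l by (simp add: vec_eq_iff forall_2 X_def lC)
  then show ?thesis using comb[OF axis[OF \<open>\<bar>X\<bar> <= a\<close>] top, of l] l by simp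
 qed
 then have "(C / 4) powr (1 + aa) <= ball_const aa * (1 - w z)" using C by (intro ball_bound[OF w aa ss]) auto
 also have "\<dots> <= \<bar>ball_const aa\<bar> * 3"
 proof -
  have "norm z <= C / 2" using norm_le_l1_cart[of z] s(2) C by (simp add: sum_2 z_def abs_mult)
  then have "w z >= - 1" using C by (intro low) auto
  moreover have "w z <= 1" using \<open>!!p. p \<in> cball z (C / 4) ==> w p <= 1\<close>[of z] C by simp
  ultimately have "\<bar>1 - w z\<bar> <= 3" by simp
  then have "\<bar>ball_const aa\<bar> * \<bar>1 - w z\<bar> <= \<bar>ball_const aa\<bar> * 3" by (intro mult_left_mono) auto
  then show ?thesis using abs_ge_self[of "ball_const aa * (1 - w z)"] by (simp add: abs_mult)
 qed
 finally show False using C(3) by simp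
qed

text \<open>A point of level 1 beyond distance 8 * a makes u at most 3 / 4 on the part of its ray
  between 3 * a and 5 * a. Centred at 4 * a this is a chord for \<open>no_long_chord\<close>, so a
  slice longer than C exists, against \<open>slice_bounded_by_ball\<close>. The lower bound of slope
  et keeps u above - 1 on the relevant disc.\<close>

lemma sublevel_bound_normalized:
 fixes aa :: real
 assumes aa: "aa > 1 / 2"
 obtains D ss1 et where "D > 0" "ss1 > 0" "et > 0"
  "!!ss u x. 0 <= ss ==> ss <= ss1 ==> convex_solution aa ss u ==> \<bar>u 0\<bar> <= et ==>
   (!!x. u x >= u 0 - et * norm x) ==> u x <= 1 ==> norm x <= D"
proof -
 define G where "G = (3 * \<bar>ball_const aa\<bar> + 1) powr (1 / (1 + aa))"
 define C where "C = 4 * max 1 G"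
 have C4: "C >= 4" by (simp add: C_def)
 have "G powr (1 + aa) <= (C / 4) powr (1 + aa)" using aa by (intro powr_mono2) (auto simp: C_def G_def)
 moreover have "G powr (1 + aa) = 3 * \<bar>ball_const aa\<bar> + 1" using aa by (simp add: G_def powr_powr)
 ultimately have Cb: "3 * \<bar>ball_const aa\<bar> < (C / 4) powr (1 + aa)" by simp
 obtain a0 where a0: "!!a. a >= a0 ==> \<exists>s1>0. \<forall>ss w. 0 <= ss --> ss <= s1 --> convex_solution aa ss w --> w 0 <= 3 / 4 -->
  w (vector [a, 0]) <= 3 / 4 --> w (vector [- a, 0]) <= 3 / 4 --> \<not> (\<forall>y. w (vector [0, y]) <= 1 --> \<bar>y\<bar> <= C)"
  using no_long_chord[OF aa, of C] C4 by auto
 define a where "a = max a0 C"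
 have a: "a >= a0" "a >= C" "a > 0" using C4 by (auto simp: a_def)
 obtain s1 where s1: "s1 > 0" and no: "!!ss w. 0 <= ss ==> ss <= s1 ==> convex_solution aa ss w ==> w 0 <= 3 / 4 ==>
  w (vector [a, 0]) <= 3 / 4 ==> w (vector [- a, 0]) <= 3 / 4 ==> \<exists>y. w (vector [0, y]) <= 1 & \<not> \<bar>y\<bar> <= C"
  using a0[OF a(1)] by metis
 define et where "et = min (1 / 8) (1 / (10 * a))"
 have et: "et > 0" "et <= 1 / 8" "et * (5 * a) <= 1 / 2"
 proof -
  have "et * (5 * a) <= 1 / (10 * a) * (5 * a)" using a by (intro mult_right_mono) (auto simp: et_def)
  then show "et * (5 * a) <= 1 / 2" using a by simp
 qed (use a in \<open>auto simp: et_def\<close>)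
 show thesis
 proof (rule that[of "8 * a" "min s1 1" et])
  fix ss u and x :: "real^2"
  assume ss: "0 <= ss" "ss <= min s1 1" and u: "convex_solution aa ss u" and u0: "\<bar>u 0\<bar> <= et"
   and low: "!!x. u x >= u 0 - et * norm x" and x: "u x <= 1"
  show "norm x <= 8 * a"
  proof (rule ccontr)
   assume "\<not> norm x <= 8 * a"
   then have xa: "8 * a < norm x" by simp
   have cvx: "convex_on UNIV u" using u by (simp add: convex_solution_def)
   have aa0: "aa > 0" using aa by simp
   obtain om where om: "x = norm x *\<^sub>R edir om" using polar_decomposition by blast
   have ray: "u ((s * (8 * a)) *\<^sub>R edir om) <= 1 / 8 + s" if s: "0 <= s" "s <= 1" for s
   proof -
    define ta where "ta = s * (8 * a) / norm x"
    have ta: "0 <= ta" "ta <= s" using s xa a mult_left_mono[of "8 * a" "norm x" s] by (auto simp: ta_def divide_simps)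
    have "(s * (8 * a)) *\<^sub>R edir om = (1 - ta) *\<^sub>R 0 + ta *\<^sub>R x"
    proof -
     have "x ~= 0" using xa a by auto
     then have "ta *\<^sub>R (norm x *\<^sub>R edir om) = (s * (8 * a)) *\<^sub>R edir om" by (simp add: ta_def)
     then show ?thesis using om by simp
    qed
    then have "u ((s * (8 * a)) *\<^sub>R edir om) <= (1 - ta) * u 0 + ta * u x" using convex_onD[OF cvx, of ta 0 x] ta s by simp
    also have "\<dots> <= (1 - ta) * (1 / 8) + ta * 1" using u0 et x ta s by (intro add_mono mult_left_mono) auto
    also have "\<dots> <= 1 / 8 + s" using ta by argo
    finally show ?thesis .
   qed
   define o' where "o' = (4 * a) *\<^sub>R edir om"
   define w where "w y = u (o' + rot2 om y)" for y
   have w: "convex_solution aa ss w" unfolding w_def by (rule convex_solution_isometry[OF u aa0 ss(1)])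
   have wX: "w (vector [X, 0]) = u ((4 * a + X) *\<^sub>R edir om)" for X
   proof -
    have "vector [X, 0] = X *\<^sub>R edir 0" by (simp add: vec_eq_iff forall_2)
    then show ?thesis by (simp add: w_def rot2_linear(3) rot2_edir o'_def scaleR_add_left)
   qed
   have v0: "(0 :: real^2) = vector [0, 0]" by (simp add: vec_eq_iff forall_2)
   have ends: "w 0 <= 3 / 4" "w (vector [a, 0]) <= 3 / 4" "w (vector [- a, 0]) <= 3 / 4"
    using ray[of "1 / 2"] ray[of "5 / 8"] ray[of "3 / 8"] unfolding v0 wX by simp_all
   have wlow: "w y >= - 1" if "norm y <= a" for y
   proof -
    have "norm (o' + rot2 om y) <= 5 * a" using norm_triangle_ineq[of o' "rot2 om y"] that a by (simp add: o'_def)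
    then have "et * norm (o' + rot2 om y) <= et * (5 * a)" using et by (intro mult_left_mono) auto
    then show ?thesis using low[of "o' + rot2 om y"] u0 et unfolding w_def by linarith
   qed
   obtain y where y: "w (vector [0, y]) <= 1" "\<not> \<bar>y\<bar> <= C" using no[OF ss(1) _ w ends] ss by auto
   have "\<bar>y\<bar> <= C" by (rule slice_bounded_by_ball[OF w aa0 ss(1)]) (use ends ss a C4 Cb wlow y in auto)
   then show False using y by simp
  qed
 qed (use a s1 et in auto)
qed

lemma blow_down_solution:
 assumes u: "convex_solution aa ss u" and aa: "aa > 0" and ss: "ss >= 0" and h: "h > 0"
 shows "convex_solution aa (ss * h powr - (2 * (aa / (1 + aa)))) (blow_down aa u h)"
proof -
 define mu where "mu = h powr (1 / (1 + aa))"
 have mu: "mu > 0" "mu powr (1 + aa) = h" using h aa by (auto simp: mu_def powr_powr)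
 have "similar 0 mu 0 y = mu *\<^sub>R y" for y by (simp add: similar_def rot2_def vec_eq_iff forall_2)
 moreover have "(mu powr aa)^2 = h powr (2 * (aa / (1 + aa)))" by (simp add: mu_def powr_powr power2_eq_square powr_add[symmetric] mult.commute)
 ultimately show ?thesis using convex_solution_similar[OF u mu(1) aa ss, of 0 0 0] mu(2)
  by (simp add: blow_down_def[abs_def] mu_def[symmetric] powr_minus_divide)
qed

text \<open>Rescaling level h to level 1 multiplies u 0, the slope of a linear minorant and ss by
  negative powers of h, so the normalised bound applies to all large h.\<close>

lemma sublevel_growth:
 fixes aa :: real
 assumes u: "convex_solution aa ss u" and aa: "aa > 1 / 2" and ss: "0 <= ss" "ss <= 1"
 obtains D h0 where "D > 0" "h0 > 0" "!!h x. h >= h0 ==> u x <= h ==> norm x <= D * h powr (1 / (1 + aa))"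
proof -
 obtain D ss1 et where D: "D > 0" "ss1 > 0" "et > 0" and
  nb: "!!ss u x. 0 <= ss ==> ss <= ss1 ==> convex_solution aa ss u ==> \<bar>u 0\<bar> <= et ==>
   (!!x. u x >= u 0 - et * norm x) ==> u x <= 1 ==> norm x <= D" using sublevel_bound_normalized[OF aa] by blast
 have cvx: "convex_on UNIV u" using u by (simp add: convex_solution_def)
 obtain M where M: "M >= 0" "!!x. u 0 - M * norm x <= u x" using convex_linear_lower_bound[OF cvx] by blast
 define bb where "bb = 1 / (1 + aa)"
 have bb: "0 < bb" "bb < 1" "bb * (1 + aa) = 1" using aa by (auto simp: bb_def)
 have "((%h. h powr - (2 * (bb * aa))) \<longlongrightarrow> 0) at_top" using bb aa by (intro tendsto_neg_powr filterlim_ident) auto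
 then have e1: "\<forall>\<^sub>F h in at_top. h powr - (2 * (bb * aa)) < ss1" using D by (auto simp: order_tendsto_iff)
 have "((%h. \<bar>u 0\<bar> * h powr - 1) \<longlongrightarrow> \<bar>u 0\<bar> * 0) at_top" by (intro tendsto_intros tendsto_neg_powr filterlim_ident) auto
 then have e2: "\<forall>\<^sub>F h in at_top. \<bar>u 0\<bar> * h powr - 1 < et" using D by (auto simp: order_tendsto_iff)
 have "((%h. M * h powr (bb - 1)) \<longlongrightarrow> M * 0) at_top" using bb by (intro tendsto_intros tendsto_neg_powr filterlim_ident) auto
 then have e3: "\<forall>\<^sub>F h in at_top. M * h powr (bb - 1) < et" using D by (auto simp: order_tendsto_iff)
 have "\<forall>\<^sub>F h in at_top. h > 0 & h powr - (2 * (bb * aa)) < ss1 & \<bar>u 0\<bar> * h powr - 1 < et & M * h powr (bb - 1) < et"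
  using e1 e2 e3 eventually_gt_at_top[of 0] by eventually_elim auto
 then obtain h0 where h0: "!!h. h >= h0 ==> h > 0 & h powr - (2 * (bb * aa)) < ss1 & \<bar>u 0\<bar> * h powr - 1 < et & M * h powr (bb - 1) < et"
  unfolding eventually_at_top_linorder by blast
 show thesis
 proof (rule that[OF D(1), of h0])
  show "h0 > 0" using h0[of h0] by simp
  fix h x assume h: "h >= h0" and x: "u x <= h"
  have hp: "h > 0" and small: "h powr - (2 * (bb * aa)) < ss1" "\<bar>u 0\<bar> * h powr - 1 < et" "M * h powr (bb - 1) < et" using h0[OF h] by auto
  define mu where "mu = h powr bb"
  have mu: "mu > 0" "mu powr (1 + aa) = h" using hp bb by (auto simp: mu_def powr_powr)
  define w where "w y = u (mu *\<^sub>R y) / h" for y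
  have "w = blow_down aa u h" by (simp add: fun_eq_iff w_def blow_down_def mu_def bb_def)
  then have w: "convex_solution aa (ss * h powr - (2 * (bb * aa))) w" using blow_down_solution[OF u _ ss(1) hp] aa by (simp add: bb_def)
  have sg: "ss * h powr - (2 * (bb * aa)) <= ss1" using mult_right_mono[OF ss(2), of "h powr - (2 * (bb * aa))"] small(1) by simp
  have "norm ((1 / mu) *\<^sub>R x) <= D"
  proof (rule nb[OF _ sg w])
   show "\<bar>w 0\<bar> <= et" using small(2) hp by (simp add: w_def powr_minus_divide abs_divide)
   show "w ((1 / mu) *\<^sub>R x) <= 1" using x hp mu by (simp add: w_def)
   show "w 0 - et * norm y <= w y" for y
   proof -
    have "M * mu / h = M * h powr (bb - 1)" using hp by (simp add: mu_def powr_diff)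
    then have "M * mu / h * norm y <= et * norm y" using small(3) by (intro mult_right_mono) auto
    moreover have "(u 0 - M * (mu * norm y)) / h <= w y" unfolding w_def using M(2)[of "mu *\<^sub>R y"] hp mu by (intro divide_right_mono) auto
    then have "w 0 - M * mu / h * norm y <= w y" by (simp add: w_def diff_divide_distrib mult.assoc)
    ultimately show ?thesis by linarith
   qed
  qed (use ss in auto)
  then show "norm x <= D * h powr (1 / (1 + aa))" using mu by (simp add: mu_def bb_def field_simps)
 qed
qed

section \<open>The class of expanding fronts\<close>

text \<open>Properties of support functions of sublevel sets that survive limits;
  \<open>outer\<close> and \<open>inner\<close> stand for the evolution equation. \<open>et\<close>
  is the level above which they are known, since a solution is controlled only at large levels; it
  tends to 0 under the blow-down.\<close>

locale front =
 fixes aa D ss et :: real and s :: "real => real => real"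
 assumes aa: "aa > 0" and et: "et >= 0"
  and periodic: "h > et ==> s (tt + 2 * pi) h = s tt h"
  and tc: "h > et ==> trig_convex (%tt. s tt h)"
  and lip: "h > et ==> \<bar>s tt h - s ph h\<bar> <= D * h powr (1 / (1 + aa)) * \<bar>tt - ph\<bar>"
  and conc: "concave_on {et<..} (s tt)"
  and mono: "et < h ==> h <= k ==> s tt h <= s tt k"
  and nonneg: "h > et ==> 0 <= s tt h"
  and upper: "h > et ==> s tt h <= D * h powr (1 / (1 + aa))"
  and outer: "h > et ==> c > 0 ==> touch_above s z c v M tt h ==> outer_bound aa ss c v"
  and inner: "h > et ==> c > 0 ==> v > 0 ==> M > 0 ==> touch_below s z c v M tt h ==> inner_bound aa ss c v M"

text \<open>\<open>D\<close> and \<open>h0\<close> do not depend on l, which makes the blow-downs a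
  precompact family; the level h0 / l and the parameter of the equation tend to 0.\<close>

lemma support_front:
 assumes u: "convex_solution aa ss u" and aa: "aa > 1 / 2" and ss: "0 <= ss" "ss <= 1"
 obtains D h0 where "D > 0" "h0 > 0"
  "!!l. l > 0 ==> sublevels (blow_down aa u l) UNIV"
  "!!l. l > 0 ==> front aa D (ss * l powr - (2 * (aa / (1 + aa)))) (h0 / l) (sublevels.S (blow_down aa u l) UNIV)"
  "!!l h. l > 0 ==> h > h0 / l ==> blow_down aa u l 0 < h"
proof -
 obtain D h1 where D: "D > 0" "h1 > 0" "!!h x. h >= h1 ==> u x <= h ==> norm x <= D * h powr (1 / (1 + aa))"
  using sublevel_growth[OF u aa ss] by blast
 define h0 where "h0 = max h1 (\<bar>u 0\<bar> + 1)"
 have h0: "h0 > 0" "h1 <= h0" "u 0 < h0" by (auto simp: h0_def)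
 have zero: "blow_down aa u l 0 < h" if "l > 0" "h > h0 / l" for l h
 proof -
  have "h0 < h * l" using that by (simp add: pos_divide_less_eq)
  then show ?thesis using h0 that by (simp add: blow_down_def pos_divide_less_eq)
 qed
 have bound: "norm x <= D * h powr (1 / (1 + aa))" if "l > 0" "h >= h0 / l" "blow_down aa u l x <= h" for l h x
 proof -
  have "u (l powr (1 / (1 + aa)) *\<^sub>R x) <= l * h" "h0 <= l * h" using that by (simp_all add: blow_down_def pos_divide_le_eq mult.commute)
  then have "norm (l powr (1 / (1 + aa)) *\<^sub>R x) <= D * (l * h) powr (1 / (1 + aa))" using h0 by (intro D(3)) auto
  also have "\<dots> = l powr (1 / (1 + aa)) * (D * h powr (1 / (1 + aa)))" by (simp add: powr_mult)
  finally show ?thesis using that by simp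
 qed
 have sl: "sublevels (blow_down aa u l) UNIV" if l: "l > 0" for l
 proof
  show cvx: "convex_on UNIV (blow_down aa u l)" using blow_down_solution[OF u _ ss(1) l] aa by (simp add: convex_solution_def)
  fix h
  have "norm x <= D * (max h (h0 / l)) powr (1 / (1 + aa))" if "blow_down aa u l x <= h" for x using that l by (intro bound[OF l]) auto
  then have "bounded {x. blow_down aa u l x <= h}" by (auto simp: bounded_iff)
  moreover have "closed {x. blow_down aa u l x <= h}" using convex_on_continuous[OF open_UNIV cvx] by (intro closed_Collect_le continuous_on_const)
  ultimately show "compact {x \<in> UNIV. blow_down aa u l x <= h}" by (simp add: compact_eq_bounded_closed)
 qed simp
 have fr: "front aa D (ss * l powr - (2 * (aa / (1 + aa)))) (h0 / l) (sublevels.S (blow_down aa u l) UNIV)" if l: "l > 0" for l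
 proof -
  interpret sublevels "blow_down aa u l" UNIV by (rule sl[OF l])
  define ss' where "ss' = ss * l powr - (2 * (aa / (1 + aa)))"
  have w: "convex_solution aa ss' (blow_down aa u l)" unfolding ss'_def using aa by (intro blow_down_solution[OF u _ ss(1) l]) simp
  have ss': "ss' >= 0" using ss by (simp add: ss'_def)
  have zK: "0 \<in> K h" if "h > h0 / l" for h using zero[OF l that] by (simp add: K_def)
  then have ne: "K h ~= {}" if "h > h0 / l" for h using that by blast
  have Kb: "K h \<subseteq> cball 0 (D * h powr (1 / (1 + aa)))" if "h > h0 / l" for h using bound[OF l, of h] that by (auto simp: K_def)
  show ?thesis unfolding ss'_def[symmetric]
  proof
   show "concave_on {h0 / l<..} (S tt)" for tt using S_concave_on[of 0 tt] unfolding concave_on_def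
    by (rule convex_on_subset) (use zero[OF l] in \<open>auto intro: less_imp_le\<close>)
   show "0 <= S tt h" if "h > h0 / l" for tt h using S_upper[OF zK[OF that], of tt] by simp
   show "S tt h <= D * h powr (1 / (1 + aa))" if h: "h > h0 / l" for tt h
   proof (rule S_least[OF ne[OF h]])
    fix x assume "x \<in> K h"
    then have "norm x <= D * h powr (1 / (1 + aa))" using Kb[OF h] by auto
    then show "x \<bullet> edir tt <= D * h powr (1 / (1 + aa))" using inner_edir_le[of x tt] by linarith
   qed
   show "outer_bound aa ss' c v" if "h > h0 / l" "c > 0" "touch_above S z c v M tt h" for h c v M z tt
    using w by (intro contact_above[OF _ ss' _ zero[OF l that(1)] that(2,3)]) (simp_all add: convex_solution_def)
   show "inner_bound aa ss' c v M" if "h > h0 / l" "c > 0" "v > 0" "M > 0" "touch_below S z c v M tt h" for h c v M z tt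
    using w by (intro contact_below(1)[OF _ ss' _ zero[OF l that(1)] that(2-5)]) (simp_all add: convex_solution_def)
  qed (use S_periodic S_trig_convex S_lipschitz[OF Kb ne] S_mono ne h0 l aa in auto)
 qed
 show thesis by (rule that[OF D(1) h0(1) sl fr zero])
qed

context front
begin

lemma D_nonneg: "D >= 0"
proof -
 have "0 <= D * (et + 1) powr (1 / (1 + aa))" using nonneg[of "et + 1" 0] upper[of "et + 1" 0] by simp
 then show ?thesis using et by (simp add: zero_le_mult_iff)
qed

lemma chord_decreasing:
 assumes "et < h1" "h1 < h2" "h2 <= h3"
 shows "(s tt h3 - s tt h2) * (h2 - h1) <= (s tt h2 - s tt h1) * (h3 - h2)"
proof -
 define t where "t = (h2 - h1) / (h3 - h1)"
 have t: "0 <= t" "t <= 1" "1 - t = (h3 - h2) / (h3 - h1)" using assms by (auto simp: t_def field_simps)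
 have "t * (h3 - h1) = h2 - h1" using assms by (simp add: t_def)
 then have "(1 - t) * h1 + t * h3 = h2" by (simp add: algebra_simps)
 moreover have "(1 - t) * s tt h1 + t * s tt h3 <= s tt ((1 - t) *\<^sub>R h1 + t *\<^sub>R h3)"
  using conc[of tt] t(1,2) assms unfolding concave_on_iff by auto
 ultimately have "(1 - t) * s tt h1 + t * s tt h3 <= s tt h2" by simp
 then have "((h3 - h2) * s tt h1 + (h2 - h1) * s tt h3) / (h3 - h1) <= s tt h2" unfolding t(3) by (simp add: t_def add_divide_distrib)
 then have "(h3 - h2) * s tt h1 + (h2 - h1) * s tt h3 <= s tt h2 * (h3 - h1)" using assms by (simp add: pos_divide_le_eq)
 then show ?thesis by (simp add: algebra_simps)
qed

text \<open>As s is nonnegative down to et, concavity bounds the slope beyond h1 by that of the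
  chord from (et, 0). The level et itself is only approached.\<close>

lemma chord_le:
 assumes "et < h1" "h1 <= h2"
 shows "(s tt h2 - s tt h1) * (h1 - et) <= s tt h1 * (h2 - h1)"
proof (rule field_le_epsilon)
 fix e :: real assume e: "e > 0"
 define A where "A = s tt h2 - s tt h1"
 have A: "A >= 0" using mono[OF assms] by (simp add: A_def)
 define h where "h = et + min ((h1 - et) / 2) (e / (A + 1))"
 have "0 < min ((h1 - et) / 2) (e / (A + 1))" "min ((h1 - et) / 2) (e / (A + 1)) < h1 - et" using assms e A by (auto simp: min_less_iff_disj)
 then have h: "et < h" "h < h1" "h - et <= e / (A + 1)" by (auto simp: h_def)
 have "A * (h - et) <= A * (e / (A + 1))" using h A by (intro mult_left_mono) auto
 also have "\<dots> <= e" using A e by (simp add: pos_divide_le_eq algebra_simps)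
 finally have 1: "A * (h - et) <= e" .
 have "A * (h1 - h) <= (s tt h1 - s tt h) * (h2 - h1)" unfolding A_def by (rule chord_decreasing[OF h(1,2) assms(2)])
 also have "\<dots> <= s tt h1 * (h2 - h1)" using nonneg[OF h(1), of tt] assms by (intro mult_right_mono) auto
 finally show "(s tt h2 - s tt h1) * (h1 - et) <= s tt h1 * (h2 - h1) + e" using 1 unfolding A_def by (simp add: algebra_simps)
qed

lemma jointly_continuous: "continuous_on (UNIV \<times> {et<..}) (%p. s (fst p) (snd p))"
proof (rule continuous_at_imp_continuous_on, rule ballI)
 fix p :: "real \<times> real" assume p: "p \<in> UNIV \<times> {et<..}"
 define m where "m = snd p + 1"
 have "continuous_on (UNIV \<times> {et<..<m}) (%p. s (fst p) (snd p))"
 proof (rule concave_lipschitz_joint_continuous)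
  show "concave_on {et<..<m} (s tt)" for tt using conc[of tt] unfolding concave_on_def by (rule convex_on_subset) auto
  fix tt ph h assume h: "et < h" "h < m"
  show "\<bar>s tt h - s ph h\<bar> <= (D * m powr (1 / (1 + aa))) * \<bar>tt - ph\<bar>"
  proof (rule order_trans[OF lip[OF h(1)]], intro mult_right_mono mult_left_mono)
   show "h powr (1 / (1 + aa)) <= m powr (1 / (1 + aa))" using h et aa by (intro powr_mono2) auto
  qed (use D_nonneg in auto)
 qed
 then show "isCont (%p. s (fst p) (snd p)) p" by (rule continuous_on_interior) (use p in \<open>auto simp: interior_Times m_def mem_Times_iff\<close>)
qed

end

text \<open>Moving the centre back by kp along edir tt1 and adding kp to the radius keeps the
  contact point and makes it strict, by kp * (1 - cos) in the angle and by kp * (h - h1)^2 in the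
  level. A function uniformly close to s then has a contact nearby, with radius and speed close to
  the given ones.\<close>

lemma touch_above_perturbed:
 fixes sn :: "nat => real => real => real"
 assumes touch: "touch_above s z c v M tt1 h1"
  and cs: "isCont (%p. s (fst p) (snd p)) (tt1, h1)"
  and lim: "uniform_limit ({tt1 - r0..tt1 + r0} \<times> {h1 - r0..h1 + r0}) (%n p. sn n (fst p) (snd p)) (%p. s (fst p) (snd p)) sequentially"
  and csn: "\<forall>\<^sub>F n in sequentially. continuous_on ({tt1 - r0..tt1 + r0} \<times> {h1 - r0..h1 + r0}) (%p. sn n (fst p) (snd p))"
  and pos: "r0 > 0" "kp > 0" "ep > 0"
 shows "\<forall>\<^sub>F n in sequentially. \<exists>tt' h' c' v'. \<bar>h' - h1\<bar> < ep & \<bar>c' - (c + kp)\<bar> < ep & \<bar>v' - v\<bar> < ep &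
  touch_above (sn n) (z - kp *\<^sub>R edir tt1) c' v' (M + kp) tt' h'"
proof -
 obtain dl where dl: "dl > 0" "s tt1 h1 = z \<bullet> edir tt1 + c"
  "!!tt h. \<bar>tt - tt1\<bar> < dl ==> \<bar>h - h1\<bar> < dl ==> s tt h <= z \<bullet> edir tt + c + v * (h - h1) + M * (h - h1)^2"
  using touch unfolding touch_above_def by metis
 define w where "w = z - kp *\<^sub>R edir tt1"
 define A where "A = 2 * \<bar>M + kp\<bar> + norm w + 1"
 have A: "A >= 1" by (simp add: A_def)
 obtain d where d: "d > 0" "!!p. dist p (tt1, h1) < d ==> dist (s (fst p) (snd p)) (s tt1 h1) < ep / 4"
  using cs pos(3) unfolding continuous_at_eps_delta by (metis fst_conv snd_conv zero_less_divide_iff zero_less_numeral)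
 define r where "r = min (min r0 1) (min (dl / 2) (min (d / 4) (ep / (4 * A))))"
 have r': "r <= r0" "r <= 1" "r <= dl / 2" "r <= d / 4" by (auto simp: r_def)
 have r: "r > 0" "r <= r0" "r <= 1" "r < dl" "2 * r < d" "A * r <= ep / 4"
 proof -
  have "A * r <= A * (ep / (4 * A))" using A by (intro mult_left_mono) (auto simp: r_def)
  then show "A * r <= ep / 4" using A by simp
  show "r > 0" using pos dl(1) d(1) A by (simp add: r_def)
 qed (use r' dl(1) d(1) in auto)
 define m where "m = kp * min (1 - cos r) (r^2)"
 have "cos r < cos 0" using r pi_gt3 by (intro cos_monotone_0_pi) auto
 then have m: "m > 0" using r pos by (simp add: m_def)
 define Q where "Q = {tt1 - r..tt1 + r} \<times> {h1 - r..h1 + r}"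
 have Q: "Q \<subseteq> {tt1 - r0..tt1 + r0} \<times> {h1 - r0..h1 + r0}" "compact Q" "(tt1, h1) \<in> Q" using r by (auto simp: Q_def compact_Times)
 have e: "min (m / 3) (ep / 4) > 0" using m pos by simp
 have ev: "\<forall>\<^sub>F n in sequentially. \<forall>p\<in>Q. \<bar>sn n (fst p) (snd p) - s (fst p) (snd p)\<bar> < min (m / 3) (ep / 4)"
  using uniform_limitD[OF lim e] by eventually_elim (use Q(1) in \<open>auto simp: dist_real_def\<close>)
 define ps where "ps tt h = w \<bullet> edir tt + (c + kp) + v * (h - h1) + (M + kp) * (h - h1)^2" for tt h
 have pss: "s tt h + kp * (1 - cos (tt - tt1)) + kp * (h - h1)^2 <= ps tt h" if "\<bar>tt - tt1\<bar> <= r" "\<bar>h - h1\<bar> <= r" for tt h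
  using dl(3)[of tt h] that r unfolding ps_def w_def by (simp add: inner_diff_left edir_inner_edir algebra_simps)
 have ps1: "ps tt1 h1 = s tt1 h1" using dl(2) by (simp add: ps_def w_def inner_diff_left edir_inner_edir)
 from ev csn show ?thesis
 proof eventually_elim
  case (elim n)
  have "continuous_on Q (%p. sn n (fst p) (snd p) - ps (fst p) (snd p))"
   unfolding ps_def by (intro continuous_intros continuous_on_subset[OF elim(2) Q(1)] continuous_on_compose2[OF continuous_edir]) auto
  then have "\<exists>p\<in>Q. \<forall>q\<in>Q. sn n (fst q) (snd q) - ps (fst q) (snd q) <= sn n (fst p) (snd p) - ps (fst p) (snd p)"
   by (intro continuous_attains_sup Q(2)) (use Q(3) in auto)
  then obtain p where p: "p \<in> Q" "!!q. q \<in> Q ==> sn n (fst q) (snd q) - ps (fst q) (snd q) <= sn n (fst p) (snd p) - ps (fst p) (snd p)"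
   by blast
  define tt' h' where "tt' = fst p" and "h' = snd p"
  have pQ: "\<bar>tt' - tt1\<bar> <= r" "\<bar>h' - h1\<bar> <= r" using p(1) by (auto simp: Q_def tt'_def h'_def abs_le_iff)
  have near: "\<bar>sn n tt' h' - s tt' h'\<bar> < m / 3" "\<bar>sn n tt' h' - s tt' h'\<bar> < ep / 4" "\<bar>sn n tt1 h1 - s tt1 h1\<bar> < m / 3"
   using elim(1) p(1) Q(3) by (auto simp: tt'_def h'_def)
  have "kp * (1 - cos (tt' - tt1)) + kp * (h' - h1)^2 < m"
  proof -
   have "sn n tt1 h1 - ps tt1 h1 <= sn n tt' h' - ps tt' h'" using p(2)[OF Q(3)] by (simp add: tt'_def h'_def)
   then show ?thesis using ps1 near(1,3) pss[OF pQ] m by linarith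
  qed
  moreover have "0 <= kp * (1 - cos (tt' - tt1))" "0 <= kp * (h' - h1)^2" using pos by auto
  moreover have "m <= kp * (1 - cos r)" "m <= kp * r^2" unfolding m_def using pos by (auto intro: mult_left_mono)
  ultimately have "kp * (1 - cos (tt' - tt1)) < kp * (1 - cos r)" "kp * (h' - h1)^2 < kp * r^2" by linarith+
  then have lt: "cos r < cos \<bar>tt' - tt1\<bar>" "\<bar>h' - h1\<bar>\<^sup>2 < r^2" using pos by auto
  have "X ~= r" if "cos r < cos X" for X using that by auto
  note 1 = this[OF lt(1)]
  have "X ~= r" if "X^2 < r^2" for X using that by auto
  note 2 = this[OF lt(2)]
  note 1 2
  then have int: "\<bar>tt' - tt1\<bar> < r" "\<bar>h' - h1\<bar> < r" using pQ by auto
  define c' v' where "c' = sn n tt' h' - w \<bullet> edir tt'" and "v' = v + 2 * (M + kp) * (h' - h1)"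
  have "touch_above (sn n) w c' v' (M + kp) tt' h'" unfolding touch_above_def
  proof (intro conjI exI[of _ "min (r - \<bar>tt' - tt1\<bar>) (r - \<bar>h' - h1\<bar>)"] allI impI)
   show "sn n tt' h' = w \<bullet> edir tt' + c'" by (simp add: c'_def)
   show "0 < min (r - \<bar>tt' - tt1\<bar>) (r - \<bar>h' - h1\<bar>)" using int by simp
   fix tt h assume *: "\<bar>tt - tt'\<bar> < min (r - \<bar>tt' - tt1\<bar>) (r - \<bar>h' - h1\<bar>)" "\<bar>h - h'\<bar> < min (r - \<bar>tt' - tt1\<bar>) (r - \<bar>h' - h1\<bar>)"
   then have "\<bar>tt - tt1\<bar> <= r" "\<bar>h - h1\<bar> <= r" by linarith+
   then have "(tt, h) \<in> Q" by (auto simp: Q_def abs_le_iff)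
   from p(2)[OF this] have "sn n tt h - ps tt h <= sn n tt' h' - ps tt' h'" by (simp add: tt'_def h'_def)
   moreover have "v' * (h - h') + (M + kp) * (h - h')^2 =
    v * (h - h1) + (M + kp) * (h - h1)^2 - (v * (h' - h1) + (M + kp) * (h' - h1)^2)" unfolding v'_def by algebra
   ultimately show "sn n tt h <= w \<bullet> edir tt + c' + v' * (h - h') + (M + kp) * (h - h')^2" unfolding c'_def ps_def by linarith
  qed
  moreover have "\<bar>h' - h1\<bar> < ep"
  proof -
   have "1 * r <= A * r" using A r by (intro mult_right_mono) auto
   then show ?thesis using int(2) r pos by linarith
  qed
  moreover have "\<bar>v' - v\<bar> < ep"
  proof -
   have "\<bar>v' - v\<bar> = 2 * \<bar>M + kp\<bar> * \<bar>h' - h1\<bar>" 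
   proof -
    have "v' - v = 2 * ((M + kp) * (h' - h1))" by (simp add: v'_def)
    then show ?thesis by (simp only: abs_mult)
   qed
   also have "\<dots> <= A * r" using int(2) A by (intro mult_mono) (auto simp: A_def)
   finally show ?thesis using r(6) pos by linarith
  qed
  moreover have "\<bar>c' - (c + kp)\<bar> < ep"
  proof -
   have "dist (tt', h') (tt1, h1) <= \<bar>tt' - tt1\<bar> + \<bar>h' - h1\<bar>"
    unfolding dist_Pair_Pair using sqrt_sum_squares_le_sum_abs[of "dist tt' tt1" "dist h' h1"] by (simp add: dist_real_def)
   then have "dist (s tt' h') (s tt1 h1) < ep / 4" using d(2)[of "(tt', h')"] int r(5) by simp
   then have "\<bar>s tt' h' - s tt1 h1\<bar> < ep / 4" by (simp add: dist_real_def)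
   moreover have "\<bar>w \<bullet> edir tt' - w \<bullet> edir tt1\<bar> <= ep / 4"
   proof -
    have "\<bar>w \<bullet> (edir tt' - edir tt1)\<bar> <= norm w * norm (edir tt' - edir tt1)" by (rule Cauchy_Schwarz_ineq2)
    also have "\<dots> <= A * r" using edir_lipschitz[of tt' tt1] int(1) A by (intro mult_mono) (auto simp: A_def)
    finally show ?thesis using r(6) by (simp add: inner_diff_right)
   qed
   moreover have "s tt1 h1 - w \<bullet> edir tt1 = c + kp" using ps1 by (simp add: ps_def)
   ultimately show ?thesis using near(2) unfolding c'_def by linarith
  qed
  ultimately show ?case unfolding w_def by blast
 qed
qed

section \<open>Locally uniform limits of fronts\<close>

definition strip :: "nat => (real \<times> real) set" where
 "strip N = {- real N..real N} \<times> {1 / (real N + 1)..real N + 1}"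

lemma compact_strip: "compact (strip N)" by (simp add: strip_def compact_Times)

lemma strip_exhausts: "h > 0 ==> \<exists>N0. \<forall>N\<ge>N0. (tt, h) \<in> strip N"
proof -
 assume h: "h > 0"
 obtain N0 :: nat where N0: "\<bar>tt\<bar> + h + 1 / h <= real N0" using real_arch_simple by blast
 have "(tt, h) \<in> strip N" if "N >= N0" for N
 proof -
  have "\<bar>tt\<bar> + h + 1 / h <= real N" using N0 that by (rule order_trans[OF _ of_nat_mono])
  moreover have "0 <= \<bar>tt\<bar>" "0 < 1 / h" using h by auto
  ultimately have N: "\<bar>tt\<bar> <= real N" "h <= real N" "1 / h <= real N + 1" using h by linarith+
  have "1 <= h * (real N + 1)" using mult_left_mono[OF N(3), of h] h by simp
  then have "1 / (real N + 1) <= h" by (simp add: pos_divide_le_eq)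
  moreover have "h <= real N + 1" "- real N <= tt" "tt <= real N" using N(1,2) by linarith+
  ultimately show ?thesis by (simp only: strip_def mem_Times_iff fst_conv snd_conv atLeastAtMost_iff simp_thms)
 qed
 then show ?thesis by blast
qed

text \<open>Locally uniform convergence on all angles and positive levels, which the strips
  exhaust.\<close>

definition front_limit :: "(nat => real => real => real) => (real => real => real) => bool" where
 "front_limit sn s \<longleftrightarrow> (\<forall>N. uniform_limit (strip N) (%n p. sn n (fst p) (snd p)) (%p. s (fst p) (snd p)) sequentially)"

lemma front_limit_pointwise: "front_limit sn s ==> h > 0 ==> (%n. sn n tt h) \<longlonglongrightarrow> s tt h"
proof -
 assume l: "front_limit sn s" and h: "h > 0"
 obtain N where "(tt, h) \<in> strip N" using strip_exhausts[OF h, of tt] by blast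
 from tendsto_uniform_limitI[OF l[unfolded front_limit_def, rule_format] this] show ?thesis by simp
qed

lemma touch_above_subsequence:
 assumes lim: "front_limit sn s" and Q: "\<forall>\<^sub>F n in sequentially. Q n"
  and csn: "!!N. \<forall>\<^sub>F n in sequentially. continuous_on (strip N) (%p. sn n (fst p) (snd p))"
  and touch: "touch_above s z c v M tt1 h1" and pos: "h1 > 0" "kp > 0"
 obtains X tt' h' c' v' where "filterlim X at_top sequentially" "!!m. Q (X m)" "h' \<longlonglongrightarrow> h1" "c' \<longlonglongrightarrow> c + kp" "v' \<longlonglongrightarrow> v"
  "!!m::nat. touch_above (sn (X m)) (z - kp *\<^sub>R edir tt1) (c' m) (v' m) (M + kp) (tt' m) (h' m)"
proof -
 define r0 where "r0 = h1 / 2"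
 obtain N1 N2 where N: "!!N. N >= N1 ==> (\<bar>tt1\<bar> + r0 + 1, h1 / 4) \<in> strip N" "!!N. N >= N2 ==> (0, 2 * h1) \<in> strip N"
  using strip_exhausts[of "h1 / 4"] strip_exhausts[of "2 * h1"] pos by (metis mult_pos_pos zero_less_divide_iff zero_less_numeral)
 define N where "N = max N1 N2"
 have N12: "(\<bar>tt1\<bar> + r0 + 1, h1 / 4) \<in> strip N" "(0, 2 * h1) \<in> strip N" using N by (auto simp: N_def)
 have sub: "{tt1 - r0..tt1 + r0} \<times> {h1 - r0..h1 + r0} \<subseteq> strip N" and int: "(tt1, h1) \<in> interior (strip N)"
  using N12 pos by (auto simp: strip_def r0_def interior_Times)
 have ul: "uniform_limit (strip N) (%n p. sn n (fst p) (snd p)) (%p. s (fst p) (snd p)) sequentially" using lim by (simp add: front_limit_def)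
 have "continuous_on (strip N) (%p. s (fst p) (snd p))" by (rule uniform_limit_theorem[OF csn ul]) simp
 then have cs: "isCont (%p. s (fst p) (snd p)) (tt1, h1)" using int by (rule continuous_on_interior)
 have csn': "\<forall>\<^sub>F n in sequentially. continuous_on ({tt1 - r0..tt1 + r0} \<times> {h1 - r0..h1 + r0}) (%p. sn n (fst p) (snd p))"
  using csn[of N] by eventually_elim (rule continuous_on_subset[OF _ sub])
 have ex: "\<exists>n tt' h' c' v'. n >= m & Q n & \<bar>h' - h1\<bar> < inverse (real (Suc m)) & \<bar>c' - (c + kp)\<bar> < inverse (real (Suc m)) &
   \<bar>v' - v\<bar> < inverse (real (Suc m)) & touch_above (sn n) (z - kp *\<^sub>R edir tt1) c' v' (M + kp) tt' h'" for m
 proof -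
  have "\<forall>\<^sub>F n in sequentially. \<exists>tt' h' c' v'. \<bar>h' - h1\<bar> < inverse (real (Suc m)) & \<bar>c' - (c + kp)\<bar> < inverse (real (Suc m)) &
   \<bar>v' - v\<bar> < inverse (real (Suc m)) & touch_above (sn n) (z - kp *\<^sub>R edir tt1) c' v' (M + kp) tt' h'"
   by (rule touch_above_perturbed[OF touch cs uniform_limit_on_subset[OF ul sub]])
    (use csn' pos in \<open>auto simp: r0_def\<close>)
  then have "\<forall>\<^sub>F n in sequentially. n >= m & Q n & (\<exists>tt' h' c' v'. \<bar>h' - h1\<bar> < inverse (real (Suc m)) & \<bar>c' - (c + kp)\<bar> < inverse (real (Suc m)) &
   \<bar>v' - v\<bar> < inverse (real (Suc m)) & touch_above (sn n) (z - kp *\<^sub>R edir tt1) c' v' (M + kp) tt' h')"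
   using eventually_ge_at_top[of m] Q by eventually_elim blast
  then show ?thesis using eventually_happens'[OF sequentially_bot] by blast
 qed
 then obtain X tt' h' c' v' where X: "!!m. X m >= m" "!!m. Q (X m)"
  "!!m. \<bar>h' m - h1\<bar> < inverse (real (Suc m))" "!!m. \<bar>c' m - (c + kp)\<bar> < inverse (real (Suc m))"
  "!!m. \<bar>v' m - v\<bar> < inverse (real (Suc m))" "!!m. touch_above (sn (X m)) (z - kp *\<^sub>R edir tt1) (c' m) (v' m) (M + kp) (tt' m) (h' m)"
  by metis
 have conv: "a \<longlonglongrightarrow> b" if "!!m. \<bar>a m - b\<bar> < inverse (real (Suc m))" for a :: "nat => real" and b
  by (rule LIM_zero_cancel, rule Lim_null_comparison[OF _ LIMSEQ_inverse_real_of_nat])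
   (use that in \<open>auto intro!: always_eventually less_imp_le\<close>)
 have fl: "filterlim X at_top sequentially"  by (rule filterlim_at_top_mono[OF filterlim_ident]) (simp add: X(1))
 show thesis by (rule that[OF fl X(2) conv[OF X(3)] conv[OF X(4)] conv[OF X(5)] X(6)])
qed

lemma outer_bound_mono: "outer_bound aa ss c v ==> c <= c' ==> outer_bound aa ss c' v" unfolding outer_bound_def by auto

text \<open>Positivity of the speed could be lost in the limit; \<open>outer_bound_speed\<close>
  prevents this as long as the radii stay bounded.\<close>

lemma outer_bound_limit:
 fixes ss c v :: "nat => real"
 assumes b: "!!m. outer_bound aa (ss m) (c m) (v m)" and aa: "aa > 0" and ss: "!!m. 0 <= ss m" "ss \<longlonglongrightarrow> 0"
  and c: "c \<longlonglongrightarrow> c0" and v: "v \<longlonglongrightarrow> v0"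
 shows "outer_bound aa 0 c0 v0"
proof -
 define C where "C = \<bar>c0\<bar> + 1"
 define V where "V = (powr_loss aa * C) powr (- aa)"
 have KC: "powr_loss aa * C >= 1" using powr_loss_ge_1[of aa] mult_mono[of 1 "powr_loss aa" 1 C] by (simp add: C_def)
 have "\<forall>\<^sub>F m in sequentially. c m < C" using order_tendstoD(2)[OF c, of C] by (simp add: C_def)
 moreover have "\<forall>\<^sub>F m in sequentially. ss m < 1" using order_tendstoD(2)[OF ss(2), of 1] by simp
 ultimately have "\<forall>\<^sub>F m in sequentially. V <= v m"
 proof eventually_elim
  case (elim m)
  then show ?case unfolding V_def by (intro outer_bound_speed[OF outer_bound_mono[OF b] aa ss(1) _ KC]) auto
 qed
 then have "V <= v0" by (rule tendsto_lowerbound[OF v]) simp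
 moreover have "V > 0" using KC unfolding V_def by (metis not_one_le_zero powr_gt_zero)
 ultimately have v0: "v0 > 0" by linarith
 have "(%m. (ss m + 1 / (v m)^2) powr (1 / (2 * aa) - 1 / 2) * (1 / v m)) \<longlonglongrightarrow> (0 + 1 / v0^2) powr (1 / (2 * aa) - 1 / 2) * (1 / v0)"
  using v0 by (intro tendsto_intros ss(2) v) auto
 then have "(0 + 1 / v0^2) powr (1 / (2 * aa) - 1 / 2) * (1 / v0) <= c0"
  by (rule LIMSEQ_le[OF _ c]) (use b in \<open>auto simp: outer_bound_def\<close>)
 then show ?thesis using v0 by (simp add: outer_bound_def)
qed

lemma inner_bound_limit:
 fixes ss c v :: "nat => real"
 assumes b: "\<forall>\<^sub>F m in sequentially. inner_bound aa (ss m) (c m) (v m) M" and ss: "ss \<longlonglongrightarrow> 0"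
  and c: "c \<longlonglongrightarrow> c0" "c0 > 0" and v: "v \<longlonglongrightarrow> v0" "v0 > 0"
 shows "inner_bound aa 0 c0 v0 M'"
proof -
 have "(%m. (ss m + 1 / (v m)^2) powr (1 / (2 * aa) - 1 / 2) * (1 / v m) * (1 / c m + ss m / (c m * (ss m + 1 / (v m)^2)) + 4 * ss m * M))
  \<longlonglongrightarrow> (0 + 1 / v0^2) powr (1 / (2 * aa) - 1 / 2) * (1 / v0) * (1 / c0 + 0 / (c0 * (0 + 1 / v0^2)) + 4 * 0 * M)"
  using c(2) v(2) by (intro tendsto_intros ss c(1) v(1)) auto
 then have "1 <= (0 + 1 / v0^2) powr (1 / (2 * aa) - 1 / 2) * (1 / v0) * (1 / c0 + 0 / (c0 * (0 + 1 / v0^2)) + 4 * 0 * M)"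
  by (rule tendsto_lowerbound) (use b in \<open>auto simp: inner_bound_def elim!: eventually_mono\<close>)
 then show ?thesis by (simp add: inner_bound_def)
qed

lemma touch_below_uminus: "touch_below s z c v M tt h \<longleftrightarrow> touch_above (%tt h. - s tt h) (- z) (- c) (- v) M tt h"
proof -
 have "- a <= - b + - c + - v * x + M * y \<longleftrightarrow> b + c + v * x - M * y <= a" for a b c v x M y :: real by auto
 then show ?thesis unfolding touch_below_def touch_above_def by (auto simp: eq_neg_iff_add_eq_0 algebra_simps)
qed

text \<open>A contact with the limit is passed to the approximating fronts at the price of the
  radius c + kp or c - kp; n tends to infinity for fixed kp, then kp tends to 0. The other
  properties pass to pointwise limits.\<close>

lemma front_limit_front:
 assumes fr: "!!n. front aa D (ss n) (et n) (sn n)" and ss: "!!n. 0 <= ss n" "ss \<longlonglongrightarrow> 0" and et: "et \<longlonglongrightarrow> 0"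
  and lim: "front_limit sn s"
 shows "front aa D 0 0 s"
proof -
 have pw: "(%n. sn n tt h) \<longlonglongrightarrow> s tt h" if "h > 0" for tt h using front_limit_pointwise[OF lim that] .
 have ev: "\<forall>\<^sub>F n in sequentially. et n < h" if "h > 0" for h using order_tendstoD(2)[OF et that] .
 have aa: "aa > 0" using front.aa[OF fr] .
 have csn: "\<forall>\<^sub>F n in sequentially. continuous_on (strip N) (%p. sn n (fst p) (snd p))" for N
 proof -
  have "\<forall>\<^sub>F n in sequentially. et n < 1 / (real N + 1)" by (intro ev) simp
  then show ?thesis
  proof eventually_elim
   case (elim n)
   then have "strip N \<subseteq> UNIV \<times> {et n<..}" by (auto simp: strip_def)
   then show ?case by (rule continuous_on_subset[OF front.jointly_continuous[OF fr]])
  qed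
 qed
 have eta_ev: "\<forall>\<^sub>F m in sequentially. et (X m) < h' m" if "filterlim X at_top sequentially" "h' \<longlonglongrightarrow> h" "h > 0" for X :: "nat => nat" and h' h
 proof -
  have "\<forall>\<^sub>F m in sequentially. et (X m) < h / 2" using order_tendstoD(2)[OF filterlim_compose[OF et that(1)], of "h / 2"] that by simp
  moreover have "\<forall>\<^sub>F m in sequentially. h / 2 < h' m" using order_tendstoD(1)[OF that(2), of "h / 2"] that by simp
  ultimately show ?thesis by eventually_elim simp
 qed
 have shift: "a \<longlonglongrightarrow> l ==> (%m. a (m + k)) \<longlonglongrightarrow> l" for a :: "nat => real" and l k by (rule LIMSEQ_ignore_initial_segment)
 have Kinv: "(%k. inverse (real (Suc k))) \<longlonglongrightarrow> 0" by (rule LIMSEQ_inverse_real_of_nat)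
 show ?thesis
 proof
  show "s (tt + 2 * pi) h = s tt h" if "0 < h" for h tt
  proof (rule LIMSEQ_unique[OF pw[OF that]])
   have "\<forall>\<^sub>F n in sequentially. sn n tt h = sn n (tt + 2 * pi) h" using ev[OF that] by eventually_elim (simp add: front.periodic[OF fr])
   then show "(%n. sn n (tt + 2 * pi) h) \<longlonglongrightarrow> s tt h" using pw[OF that] by (rule Lim_transform_eventually[rotated])
  qed
  show "trig_convex (%tt. s tt h)" if h: "0 < h" for h unfolding trig_convex_def
  proof (intro allI impI)
   fix a t b :: real assume ab: "a < t" "t < b" "b - a < pi"
   show "s t h * sin (b - a) <= s a h * sin (b - t) + s b h * sin (t - a)"
   proof (rule tendsto_le)
    show "(%n. sn n a h * sin (b - t) + sn n b h * sin (t - a)) \<longlonglongrightarrow> s a h * sin (b - t) + s b h * sin (t - a)"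
     "(%n. sn n t h * sin (b - a)) \<longlonglongrightarrow> s t h * sin (b - a)" by (intro tendsto_intros pw h)+
    show "\<forall>\<^sub>F n in sequentially. sn n t h * sin (b - a) <= sn n a h * sin (b - t) + sn n b h * sin (t - a)"
     using ev[OF h] by eventually_elim (use trig_convexD[OF front.tc[OF fr] ab] in auto)
   qed simp
  qed
  show "\<bar>s tt h - s ph h\<bar> <= D * h powr (1 / (1 + aa)) * \<bar>tt - ph\<bar>" if h: "0 < h" for h tt ph
  proof (rule tendsto_upperbound)
   show "(%n. \<bar>sn n tt h - sn n ph h\<bar>) \<longlonglongrightarrow> \<bar>s tt h - s ph h\<bar>" by (intro tendsto_intros pw h)
   show "\<forall>\<^sub>F n in sequentially. \<bar>sn n tt h - sn n ph h\<bar> <= D * h powr (1 / (1 + aa)) * \<bar>tt - ph\<bar>"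
    using ev[OF h] by eventually_elim (rule front.lip[OF fr])
  qed simp
  show "concave_on {0<..} (s tt)" for tt unfolding concave_on_iff
  proof (intro conjI ballI allI impI)
   fix h k t t' :: real assume *: "h \<in> {0<..}" "k \<in> {0<..}" "0 <= t" "0 <= t'" "t + t' = 1"
   have m: "t * h + t' * k > 0"
   proof (cases "t = 0")
    case False
    then have "t * h > 0" "t' * k >= 0" using * by auto
    then show ?thesis by linarith
   qed (use * in auto)
   show "t * s tt h + t' * s tt k <= s tt (t *\<^sub>R h + t' *\<^sub>R k)"
   proof (rule tendsto_le)
    show "(%n. sn n tt (t *\<^sub>R h + t' *\<^sub>R k)) \<longlonglongrightarrow> s tt (t *\<^sub>R h + t' *\<^sub>R k)"
     "(%n. t * sn n tt h + t' * sn n tt k) \<longlonglongrightarrow> t * s tt h + t' * s tt k" using m * by (intro tendsto_intros pw; simp)+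
    have "\<forall>\<^sub>F n in sequentially. et n < h" "\<forall>\<^sub>F n in sequentially. et n < k" using * by (auto intro: ev)
    then show "\<forall>\<^sub>F n in sequentially. t * sn n tt h + t' * sn n tt k <= sn n tt (t *\<^sub>R h + t' *\<^sub>R k)"
     by eventually_elim (use front.conc[OF fr, unfolded concave_on_iff] * in auto)
   qed simp
  qed simp
  show "s tt h <= s tt k" if h: "0 < h" "h <= k" for h k tt
  proof (rule tendsto_le[OF _ pw pw])
   show "\<forall>\<^sub>F n in sequentially. sn n tt h <= sn n tt k" using ev[OF h(1)] by eventually_elim (rule front.mono[OF fr _ h(2)])
  qed (use h in auto)
  show "0 <= s tt h" if h: "0 < h" for h tt
   by (rule tendsto_lowerbound[OF pw[OF h]]) (use ev[OF h] front.nonneg[OF fr] in \<open>auto elim!: eventually_mono\<close>)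
  show "s tt h <= D * h powr (1 / (1 + aa))" if h: "0 < h" for h tt
   by (rule tendsto_upperbound[OF pw[OF h]]) (use ev[OF h] front.upper[OF fr] in \<open>auto elim!: eventually_mono\<close>)
  show "outer_bound aa 0 c v" if h: "0 < h" and c: "0 < c" and t: "touch_above s z c v M tt h" for h c v M z tt
  proof -
   have "outer_bound aa 0 (c + kp) v" if kp: "kp > 0" for kp
   proof (rule touch_above_subsequence[OF lim _ csn t h kp, of "%_. True"])
    fix X tt' h' c' v' assume X: "filterlim X at_top sequentially" "h' \<longlonglongrightarrow> h" "c' \<longlonglongrightarrow> c + kp" "v' \<longlonglongrightarrow> v"
     "!!m::nat. touch_above (sn (X m)) (z - kp *\<^sub>R edir tt) (c' m) (v' m) (M + kp) (tt' m) (h' m)"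
    have "\<forall>\<^sub>F m in sequentially. et (X m) < h' m & 0 < c' m"
     using eta_ev[OF X(1,2) h] order_tendstoD(1)[OF X(3), of 0] c kp by (simp add: eventually_conj)
    then obtain k where k: "!!m. m >= k ==> et (X m) < h' m & 0 < c' m" unfolding eventually_sequentially by blast
    show "outer_bound aa 0 (c + kp) v"
    proof (rule outer_bound_limit[OF _ aa _ _ shift[OF X(3), of k] shift[OF X(4), of k]])
     show "outer_bound aa (ss (X (m + k))) (c' (m + k)) (v' (m + k))" for m using k[of "m + k"] by (intro front.outer[OF fr _ _ X(5)]) auto
     show "(%m. ss (X (m + k))) \<longlonglongrightarrow> 0" by (rule shift[OF filterlim_compose[OF ss(2) X(1)]])
    qed (rule ss(1))
   qed simp
   then have all: "outer_bound aa 0 (c + inverse (real (Suc k))) v" for k by simp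
   have "(%k. c + inverse (real (Suc k))) \<longlonglongrightarrow> c + 0" by (intro tendsto_intros Kinv)
   then have cl: "(%k. c + inverse (real (Suc k))) \<longlonglongrightarrow> c" by simp
   show ?thesis by (rule outer_bound_limit[OF all aa _ _ cl]) auto
  qed
  show "inner_bound aa 0 c v M" if h: "0 < h" and c: "0 < c" and v: "0 < v" and M: "M > 0" and t: "touch_below s z c v M tt h" for h c v M z tt
  proof -
   have limm: "front_limit (%n tt h. - sn n tt h) (%tt h. - s tt h)" using lim unfolding front_limit_def by (auto intro: uniform_limit_uminus)
   have csm: "\<forall>\<^sub>F n in sequentially. continuous_on (strip N) (%p. - sn n (fst p) (snd p))" for N
    using csn[of N] by eventually_elim (rule continuous_on_minus)
   have "inner_bound aa 0 (c - kp) v M" if kp: "kp > 0" "kp < c" for kp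
   proof (rule touch_above_subsequence[OF limm _ csm t[unfolded touch_below_uminus] h kp(1), of "%_. True"])
    fix X tt' h' c' v' assume X: "filterlim X at_top sequentially" "h' \<longlonglongrightarrow> h" "c' \<longlonglongrightarrow> - c + kp" "v' \<longlonglongrightarrow> - v"
     "!!m::nat. touch_above (%tt h. - sn (X m) tt h) (- z - kp *\<^sub>R edir tt) (c' m) (v' m) (M + kp) (tt' m) (h' m)"
    have cl: "(%m. - c' m) \<longlonglongrightarrow> c - kp" using tendsto_minus[OF X(3)] by simp
    have vl: "(%m. - v' m) \<longlonglongrightarrow> v" using tendsto_minus[OF X(4)] by simp
    have tb: "touch_below (sn (X m)) (z + kp *\<^sub>R edir tt) (- c' m) (- v' m) (M + kp) (tt' m) (h' m)" for m
     unfolding touch_below_uminus using X(5)[of m] by simp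
    have "\<forall>\<^sub>F m in sequentially. 0 < - c' m" "\<forall>\<^sub>F m in sequentially. 0 < - v' m"
     using order_tendstoD(1)[OF cl, of 0] order_tendstoD(1)[OF vl, of 0] kp v by simp_all
    with eta_ev[OF X(1,2) h] have "\<forall>\<^sub>F m in sequentially. inner_bound aa (ss (X m)) (- c' m) (- v' m) (M + kp)"
     by eventually_elim (rule front.inner[OF fr _ _ _ _ tb], use M kp in auto)
    then show "inner_bound aa 0 (c - kp) v M" by (rule inner_bound_limit[OF _ filterlim_compose[OF ss(2) X(1)] cl _ vl v]) (use kp in auto)
   qed simp
   then have all: "inner_bound aa 0 (c - inverse (real (Suc k))) v M" if "inverse (real (Suc k)) < c" for k using that by simp
   have "(%k. c - inverse (real (Suc k))) \<longlonglongrightarrow> c - 0" by (intro tendsto_intros Kinv)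
   then have cl: "(%k. c - inverse (real (Suc k))) \<longlonglongrightarrow> c" by simp
   have "\<forall>\<^sub>F k in sequentially. inner_bound aa 0 (c - inverse (real (Suc k))) v M"
    using order_tendstoD(2)[OF Kinv c] by eventually_elim (rule all)
   then show ?thesis by (rule inner_bound_limit[OF _ tendsto_const cl c tendsto_const v])
  qed
 qed (use aa in auto)
qed

text \<open>Equicontinuity: in the angle by the bound on the radius of the sets, in the level by
  \<open>chord_le\<close>, whose denominator h1 - et stays away from 0 on a strip.\<close>

lemma (in front) strip_lipschitz:
 assumes etN: "et <= 1 / (2 * (real N + 1))" and p: "p \<in> strip N" "p' \<in> strip N"
 shows "\<bar>s (fst p) (snd p) - s (fst p') (snd p')\<bar> <=
  D * (real N + 1) powr (1 / (1 + aa)) * (1 + 2 * (real N + 1)) * dist p p'"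
  and "\<bar>s (fst p) (snd p)\<bar> <= D * (real N + 1) powr (1 / (1 + aa))"
proof -
 define B where "B = D * (real N + 1) powr (1 / (1 + aa))"
 have B: "B >= 0" using D_nonneg by (simp add: B_def)
 have lo: "et + 1 / (2 * (real N + 1)) <= h" "h <= real N + 1" "et < h" if "1 / (real N + 1) <= h" "h <= real N + 1" for h
 proof -
  define y where "y = 1 / (2 * (real N + 1))"
  have y: "y > 0" "y + y = 1 / (real N + 1)" by (simp_all add: y_def field_simps)
  have "et + y <= h" using etN that y(2) unfolding y_def[symmetric] by linarith
  then show "et + 1 / (2 * (real N + 1)) <= h" "et < h" using y(1) unfolding y_def[symmetric] by linarith+
 qed (rule that)
 have up: "s tt h <= B" "0 <= s tt h" if "1 / (real N + 1) <= h" "h <= real N + 1" for tt h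
 proof -
  have "h powr (1 / (1 + aa)) <= (real N + 1) powr (1 / (1 + aa))" using lo[OF that] et aa by (intro powr_mono2) auto
  then have "D * h powr (1 / (1 + aa)) <= B" unfolding B_def using D_nonneg by (intro mult_left_mono)
  then show "s tt h <= B" using upper[OF lo(3)[OF that], of tt] by linarith
  show "0 <= s tt h" using nonneg[OF lo(3)[OF that]] .
 qed
 have inS: "1 / (real N + 1) <= snd p" "snd p <= real N + 1" "1 / (real N + 1) <= snd p'" "snd p' <= real N + 1"
  using p by (auto simp: strip_def mem_Times_iff)
 show "\<bar>s (fst p) (snd p)\<bar> <= D * (real N + 1) powr (1 / (1 + aa))" using up[OF inS(1,2), of "fst p"] by (simp add: B_def)
 have hl: "\<bar>s tt h - s tt h'\<bar> <= B * (2 * (real N + 1)) * \<bar>h - h'\<bar>" if h: "1 / (real N + 1) <= h" "h <= h'" "h' <= real N + 1" for tt h h'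
 proof -
  have h1: "h <= real N + 1" using h by simp
  define x where "x = s tt h' - s tt h"
  have x: "x >= 0" using mono[OF lo(3)[OF h(1) h1] h(2), of tt] by (simp add: x_def)
  have "x * (1 / (2 * (real N + 1))) <= x * (h - et)" using lo(1)[OF h(1) h1] x by (intro mult_left_mono) auto
  also have "\<dots> <= s tt h * (h' - h)" unfolding x_def by (rule chord_le[OF lo(3)[OF h(1) h1] h(2)])
  also have "\<dots> <= B * (h' - h)" using up[OF h(1) h1] h by (intro mult_right_mono) auto
  finally have "x <= B * (h' - h) * (2 * (real N + 1))" by (simp add: pos_divide_le_eq)
  then show ?thesis using x h by (simp add: x_def mult_ac)
 qed
 have 1: "\<bar>s (fst p) (snd p) - s (fst p') (snd p)\<bar> <= B * dist p p'"
 proof -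
  have "(snd p) powr (1 / (1 + aa)) <= (real N + 1) powr (1 / (1 + aa))" using lo[OF inS(1,2)] et aa by (intro powr_mono2) auto
  then have "D * (snd p) powr (1 / (1 + aa)) * \<bar>fst p - fst p'\<bar> <= B * dist p p'"
   unfolding B_def using D_nonneg dist_fst_le[of p p'] by (intro mult_mono mult_left_mono) (auto simp: dist_real_def)
  then show ?thesis using lip[OF lo(3)[OF inS(1,2)], of "fst p" "fst p'"] by linarith
 qed
 have 2: "\<bar>s (fst p') (snd p) - s (fst p') (snd p')\<bar> <= B * (2 * (real N + 1)) * dist p p'"
 proof -
  have "\<bar>s (fst p') (snd p) - s (fst p') (snd p')\<bar> <= B * (2 * (real N + 1)) * \<bar>snd p - snd p'\<bar>"
   using hl[of "snd p" "snd p'" "fst p'"] hl[of "snd p'" "snd p" "fst p'"] inS by (cases "snd p <= snd p'") (simp_all add: abs_minus_commute)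
  also have "\<dots> <= B * (2 * (real N + 1)) * dist p p'" using B dist_snd_le[of p p'] by (intro mult_left_mono) (auto simp: dist_real_def)
  finally show ?thesis .
 qed
 show "\<bar>s (fst p) (snd p) - s (fst p') (snd p')\<bar> <= D * (real N + 1) powr (1 / (1 + aa)) * (1 + 2 * (real N + 1)) * dist p p'"
  unfolding B_def[symmetric] using 1 2 by (simp add: algebra_simps)
qed

lemma front_compactness:
 assumes fr: "!!n. front aa D (ss n) (et n) (sn n)" and ss: "!!n. 0 <= ss n" "ss \<longlonglongrightarrow> 0" and et: "et \<longlonglongrightarrow> 0"
 obtains r s where "strict_mono (r :: nat => nat)" "front_limit (%n. sn (r n)) s" "front aa D 0 0 s"
proof -
 define P where "P N f \<longleftrightarrow> (\<exists>g. uniform_limit (strip N) (%n p. sn (f n) (fst p) (snd p)) g sequentially)" for N and f :: "nat => nat"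
 interpret subseqs P
 proof
  fix N and f :: "nat => nat" assume f: "strict_mono f"
  have "\<forall>\<^sub>F n in sequentially. et n < 1 / (2 * (real N + 1))" using order_tendstoD(2)[OF et, of "1 / (2 * (real N + 1))"] by simp
  \<comment> \<open>The bounds on strip N hold once et is small, hence the shift of indices by
    n0.\<close>
  then obtain n0 where n0: "!!n. n >= n0 ==> et n < 1 / (2 * (real N + 1))" unfolding eventually_sequentially by blast
  define B C where "B = D * (real N + 1) powr (1 / (1 + aa))" and "C = B * (1 + 2 * (real N + 1))"
  have BC: "B >= 0" "C >= 0" using front.D_nonneg[OF fr] by (auto simp: B_def C_def)
  define F where "F n p = sn (f (n + n0)) (fst p) (snd p)" for n p
  have small: "et (f (n + n0)) <= 1 / (2 * (real N + 1))" for n using n0[of "f (n + n0)"] seq_suble[OF f, of "n + n0"] by simp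
  have 1: "norm (F n p) <= B" if "p \<in> strip N" for n p using front.strip_lipschitz(2)[OF fr small that that] by (simp add: F_def B_def)
  have 2: "norm (F n p - F n p') <= C * dist p p'" if "p \<in> strip N" "p' \<in> strip N" for n p p'
   using front.strip_lipschitz(1)[OF fr small that] by (simp add: F_def B_def C_def)
  obtain g k where gk: "strict_mono (k :: nat => nat)" "!!e. 0 < e ==> \<exists>M. \<forall>n p. n >= M & p \<in> strip N --> norm (F (k n) p - g p) < e"
  proof (rule Arzela_Ascoli[OF compact_strip[of N], of F B])
   fix p e assume p: "p \<in> strip N" and e: "0 < (e::real)"
   have "C * (e / (C + 1)) < e" using BC e by (simp add: pos_divide_less_eq algebra_simps)
   then have "norm (F n p - F n p') < e" if "p' \<in> strip N" "norm (p - p') < e / (C + 1)" for n p'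
    using 2[OF p that(1), of n] mult_left_mono[of "dist p p'" "e / (C + 1)" C] that BC by (simp add: dist_norm)
   then show "\<exists>d>0. \<forall>n p'. p' \<in> strip N & norm (p - p') < d --> norm (F n p - F n p') < e"
    using BC e by (intro exI[of _ "e / (C + 1)"]) auto
  qed (use 1 in auto)
  have "uniform_limit (strip N) (%n p. sn (f (k n + n0)) (fst p) (snd p)) g sequentially"
   unfolding uniform_limit_sequentially_iff using gk(2) by (fastforce simp: F_def dist_norm)
  moreover have "strict_mono (%n. k n + n0)" using gk(1) by (simp add: strict_mono_def)
  ultimately show "\<exists>r'. strict_mono r' & P N (f \<circ> r')" by (intro exI[of _ "%n. k n + n0"]) (auto simp: P_def comp_def)
 qed
 define s where "s tt h = lim (%n. sn (diagseq n) tt h)" for tt h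
 have ul: "uniform_limit (strip N) (%n p. sn (diagseq n) (fst p) (snd p)) (%p. s (fst p) (snd p)) sequentially" for N
 proof -
  have "P N (diagseq \<circ> ((+) (Suc N)))"
  proof (rule diagseq_holds)
   fix r f n assume r: "strict_mono (r :: nat => nat)" and "P n f"
   then obtain g where "uniform_limit (strip n) (%m p. sn (f m) (fst p) (snd p)) g sequentially" unfolding P_def by blast
   from filterlim_compose[OF this filterlim_subseq[OF r]] show "P n (f \<circ> r)" unfolding P_def by auto
  qed
  then obtain g where "uniform_limit (strip N) (%n p. sn (diagseq (n + Suc N)) (fst p) (snd p)) g sequentially"
   unfolding P_def by (auto simp: add.commute)
  then have g: "uniform_limit (strip N) (%n p. sn (diagseq n) (fst p) (snd p)) g sequentially" unfolding uniform_limit_sequentially_iff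
  proof (intro allI impI)
   fix e :: real assume e: "e > 0"
    and *: "\<forall>e>0. \<exists>M. \<forall>n\<ge>M. \<forall>p\<in>strip N. dist (sn (diagseq (n + Suc N)) (fst p) (snd p)) (g p) < e"
   then obtain M where M: "!!n p. n >= M ==> p \<in> strip N ==> dist (sn (diagseq (n + Suc N)) (fst p) (snd p)) (g p) < e" by blast
   have "dist (sn (diagseq n) (fst p) (snd p)) (g p) < e" if "n >= M + Suc N" "p \<in> strip N" for n p using M[of "n - Suc N" p] that by simp
   then show "\<exists>M. \<forall>n\<ge>M. \<forall>p\<in>strip N. dist (sn (diagseq n) (fst p) (snd p)) (g p) < e" by blast
  qed
  have "g p = s (fst p) (snd p)" if "p \<in> strip N" for p using limI[OF tendsto_uniform_limitI[OF g that]] by (simp add: s_def)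
  then show ?thesis using g by (simp cong: uniform_limit_cong')
 qed
 then have fl: "front_limit (%n. sn (diagseq n)) s" by (simp add: front_limit_def)
 have "front aa D 0 0 s" using ss et subseq_diagseq by (intro front_limit_front[of aa D "%n. ss (diagseq n)" "%n. et (diagseq n)", OF fr _ _ _ fl])
   (auto intro: filterlim_compose[OF _ filterlim_subseq])
 then show thesis using that[OF subseq_diagseq fl] by blast
qed

section \<open>Regularity of limit fronts\<close>

text \<open>The smallest multiple l of cos (tt - mid) that lifts the interpolant \<open>z0\<close>
  of the end values above w touches w at an interior angle; the factor 1 + e then leaves a positive
  gap below kp. With w = s - kp this gives a centre from which the support function has an interior
  peak with a value between 0 and kp.\<close>

lemma trig_barrier:
 fixes w :: "real => real"
 assumes ab: "a < t" "t < b" "b - a < pi" and cont: "continuous_on {a..b} w" and kp: "kp > 0"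
  and gt: "w t * sin (b - a) > w a * sin (b - t) + w b * sin (t - a)"
 obtains z ttm m where "a < ttm" "ttm < b" "m > 0" "w a - z \<bullet> edir a < w ttm - z \<bullet> edir ttm"
  "w b - z \<bullet> edir b < w ttm - z \<bullet> edir ttm" "- kp < w ttm - z \<bullet> edir ttm"
  "!!tt. a <= tt ==> tt <= b ==> w tt - z \<bullet> edir tt <= - m"
proof -
 have sab: "sin (b - a) > 0" using ab by (intro sin_gt_zero) auto
 \<comment> \<open>The two directions are orthogonal to edir b and to edir a, so each term fits one
   end value.\<close>
 define z0 where "z0 = (w a / sin (b - a)) *\<^sub>R edir (b - pi / 2) + (w b / sin (b - a)) *\<^sub>R edir (a + pi / 2)"
 have "cos (a - (b - pi / 2)) = sin (b - a)" "cos (b - (a + pi / 2)) = sin (b - a)" "cos (b - (b - pi / 2)) = 0" "cos (a - (a + pi / 2)) = 0"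
 proof -
  have e: "a - (b - pi / 2) = pi / 2 - (b - a)" "b - (a + pi / 2) = - (pi / 2 - (b - a))" by simp_all
  show "cos (a - (b - pi / 2)) = sin (b - a)" "cos (b - (a + pi / 2)) = sin (b - a)" unfolding e cos_minus sin_cos_eq by simp_all
 qed simp_all
 then have z0: "z0 \<bullet> edir a = w a" "z0 \<bullet> edir b = w b" using sab by (simp_all add: z0_def inner_add_left edir_inner_edir)
 define mid where "mid = (a + b) / 2"
 define C where "C = cos ((b - a) / 2)"
 have Cpos: "C > 0" unfolding C_def using ab by (intro cos_gt_zero) auto
 have cosC: "C <= cos (tt - mid)" if "a <= tt" "tt <= b" for tt
 proof -
  have "\<bar>tt - mid\<bar> <= (b - a) / 2" using that by (auto simp: mid_def abs_le_iff field_simps)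
  then have "cos ((b - a) / 2) <= cos \<bar>tt - mid\<bar>" using ab by (intro cos_monotone_0_pi_le) auto
  then show ?thesis by (simp add: C_def)
 qed
 have cab: "cos (a - mid) = C" "cos (b - mid) = C"
 proof -
  have "a - mid = - ((b - a) / 2)" "b - mid = (b - a) / 2" by (simp_all add: mid_def field_simps)
  then show "cos (a - mid) = C" "cos (b - mid) = C" unfolding C_def by (simp_all only: cos_minus)
 qed
 define f where "f tt = (w tt - z0 \<bullet> edir tt) / cos (tt - mid)" for tt
 have "cos (tt - mid) ~= 0" if "tt \<in> {a..b}" for tt using cosC[of tt] that Cpos by auto
 then have "continuous_on {a..b} f" unfolding f_def by (intro continuous_intros cont continuous_on_compose2[OF continuous_edir]) auto
 then have "\<exists>x\<in>{a..b}. \<forall>y\<in>{a..b}. f y <= f x" using ab by (intro continuous_attains_sup) auto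
 then obtain ttm where ttm: "ttm \<in> {a..b}" "!!tt. tt \<in> {a..b} ==> f tt <= f ttm" by blast
 define l where "l = f ttm"
 have "w t * sin (b - a) > (z0 \<bullet> edir t) * sin (b - a)" unfolding edir_three_point[of z0 t b a] z0 using gt .
 then have "w t - z0 \<bullet> edir t > 0" using sab by (simp add: mult_less_cancel_right)
 then have "f t > 0" using cosC[of t] ab Cpos by (simp add: f_def)
 then have l: "l > 0" using ttm(2)[of t] ab by (simp add: l_def)
 have "f a = 0" "f b = 0" by (simp_all add: f_def z0)
 then have ttab: "a < ttm" "ttm < b" using l ttm(1) by (auto simp: l_def less_le)
 have wle: "w tt - z0 \<bullet> edir tt <= l * cos (tt - mid)" if "a <= tt" "tt <= b" for tt
 proof -
  have "f tt <= l" unfolding l_def using that by (intro ttm(2)) simp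
  then show ?thesis using cosC[OF that] Cpos unfolding f_def by (simp add: pos_divide_le_eq)
 qed
 have wm: "w ttm - z0 \<bullet> edir ttm = l * cos (ttm - mid)" using cosC[of ttm] ttm(1) Cpos by (simp add: l_def f_def)
 define e where "e = min (C / 2) (kp / (2 * l))"
 have e: "e > 0" "e < C" "l * e < kp"
 proof -
  have "l * e <= l * (kp / (2 * l))" using l by (intro mult_left_mono) (auto simp: e_def)
  then show "l * e < kp" using l kp by simp
 qed (use Cpos kp l in \<open>auto simp: e_def min_less_iff_disj\<close>)
 define z where "z = z0 + (l * (1 + e)) *\<^sub>R edir mid"
 have ze: "w tt - z \<bullet> edir tt = (w tt - z0 \<bullet> edir tt) - l * cos (tt - mid) - l * e * cos (tt - mid)" for tt
  by (simp add: z_def inner_add_left edir_inner_edir algebra_simps)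
 have wz: "w ttm - z \<bullet> edir ttm = - (l * e * cos (ttm - mid))" by (simp add: ze wm)
 have lec: "l * e * cos (ttm - mid) <= l * e" using l e by (simp add: mult_left_le)
 have "0 < l * e * C" using l e Cpos by simp
 then have "l * e < l * C + l * e * C" using mult_strict_left_mono[OF e(2) l] by linarith
 then have bd: "- (l * C) - l * e * C < w ttm - z \<bullet> edir ttm" unfolding wz using lec by linarith
 show thesis
 proof (rule that[OF ttab, of "l * e * C"])
  show "l * e * C > 0" using l e Cpos by simp
  show "w a - z \<bullet> edir a < w ttm - z \<bullet> edir ttm" "w b - z \<bullet> edir b < w ttm - z \<bullet> edir ttm"
   using bd by (simp_all add: ze z0 cab)
  show "- kp < w ttm - z \<bullet> edir ttm" unfolding wz using lec e by linarith
  show "w tt - z \<bullet> edir tt <= - (l * e * C)" if "a <= tt" "tt <= b" for tt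
  proof -
   have "l * e * C <= l * e * cos (tt - mid)" using cosC[OF that] l e by (intro mult_left_mono) auto
   then show ?thesis using wle[OF that] unfolding ze by linarith
  qed
 qed
qed

locale ancient_front = front aa D 0 0 s for aa D s
begin

lemma speed_gt:
 assumes "h > 0" "c > 0" "touch_above s z c v M tt h" and V: "V > 0" "c < V powr (- (1 / aa))"
 shows "v > V"
proof (rule ccontr)
 assume n: "\<not> v > V"
 have o: "v > 0" "(1 / v^2) powr (1 / (2 * aa) - 1 / 2) * (1 / v) <= c" using outer[OF assms(1-3)] by (simp_all add: outer_bound_def)
 then have "v powr (- (1 / aa)) <= c" using speed_powr[OF o(1) aa] by simp
 moreover have "V powr (- (1 / aa)) <= v powr (- (1 / aa))" using n o aa by (intro powr_mono2') auto
 ultimately show False using V by simp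
qed

lemma speed_lt:
 assumes "h > 0" "M > 0" "touch_below s z c v M tt h" and V: "V > 0" "c > V powr (- (1 / aa))"
 shows "v < V"
proof (rule ccontr)
 assume n: "\<not> v < V"
 then have v: "v > 0" using V by simp
 have c: "c > 0" using V powr_ge_zero[of V "- (1 / aa)"] by linarith
 have "1 <= (1 / v^2) powr (1 / (2 * aa) - 1 / 2) * (1 / v) * (1 / c)" using inner[OF assms(1) c v assms(2,3)] by (simp add: inner_bound_def)
 then have "1 <= v powr (- (1 / aa)) * (1 / c)" unfolding speed_powr[OF v aa] .
 then have "c <= v powr (- (1 / aa))" using c by (simp add: pos_le_divide_eq)
 moreover have "v powr (- (1 / aa)) <= V powr (- (1 / aa))" using n V aa by (intro powr_mono2') auto
 ultimately show False using V by simp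
qed

lemma cont_level: "h > 0 ==> isCont (%tt. s tt h) tt" using trig_convex_isCont[OF tc] .

lemma cont_strip: "continuous_on (UNIV \<times> {0<..<m}) (%p. s (fst p) (snd p))" by (rule continuous_on_subset[OF jointly_continuous]) auto

lemma concave_ineq: "0 < h ==> 0 < k ==> 0 <= t ==> t <= 1 ==> (1 - t) * s tt h + t * s tt k <= s tt ((1 - t) * h + t * k)"
 using conc[of tt] unfolding concave_on_iff by auto

text \<open>The weak form of s'' + s >= V powr (- 1 / aa): slow points are flat. Otherwise the
  barrier yields an outer contact circle of smaller radius, whose speed exceeds V by
  \<open>speed_gt\<close>; this speed is a supergradient in h and contradicts the slopes below the
  contact.\<close>

lemma trig_convex_of_speed_le:
 assumes ab: "a < t" "t < b" "b - a < pi" and k: "0 < k1" "k1 < k" "k < k2" and V: "V > 0"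
  and chord: "!!tt h h'. a <= tt ==> tt <= b ==> k1 <= h ==> h <= h' ==> h' <= k2 ==> s tt h' - s tt h <= V * (h' - h)"
 shows "(s t k - V powr (- (1 / aa))) * sin (b - a) <=
  (s a k - V powr (- (1 / aa))) * sin (b - t) + (s b k - V powr (- (1 / aa))) * sin (t - a)"
proof (rule ccontr)
 define kp where "kp = V powr (- (1 / aa))"
 have kp: "kp > 0" using V by (simp add: kp_def)
 assume "\<not> ?thesis"
 then have gt: "(s t k - kp) * sin (b - a) > (s a k - kp) * sin (b - t) + (s b k - kp) * sin (t - a)" by (simp add: kp_def)
 have "continuous_on {a..b} (%tt. s tt k - kp)" using k by (intro continuous_intros continuous_at_imp_continuous_on ballI cont_level) auto
 then obtain z ttm m where z: "a < ttm" "ttm < b" "m > 0"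
  "s a k - kp - z \<bullet> edir a < s ttm k - kp - z \<bullet> edir ttm" "s b k - kp - z \<bullet> edir b < s ttm k - kp - z \<bullet> edir ttm"
  "- kp < s ttm k - kp - z \<bullet> edir ttm" "!!tt. a <= tt ==> tt <= b ==> s tt k - kp - z \<bullet> edir tt <= - m" by (rule trig_barrier[OF ab _ kp gt]) (rule that)
 have "\<exists>tt1 h1 c v M. a < tt1 & tt1 < b & k <= h1 & h1 < k + min (m / 2) (k2 - k) & h1 < k2 + 1 &
  s ttm k - z \<bullet> edir ttm <= c & c <= (kp - m) + min (m / 2) (k2 - k) & touch_above s z c v M tt1 h1"
 proof (rule exists_touch_above[OF cont_strip])
  show "s tt k - z \<bullet> edir tt <= kp - m" if "a <= tt" "tt <= b" for tt using z(7)[OF that] by simp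
 qed (use k z mono in auto)
 then obtain tt1 h1 c v M where c: "a < tt1" "tt1 < b" "k <= h1" "h1 < k + min (m / 2) (k2 - k)" "s ttm k - z \<bullet> edir ttm <= c"
  "c <= (kp - m) + min (m / 2) (k2 - k)" "touch_above s z c v M tt1 h1" by blast
 have "min (m / 2) (k2 - k) <= m / 2" "min (m / 2) (k2 - k) <= k2 - k" by (rule min.cobounded1 min.cobounded2)+
 then have c': "h1 < k2" "c < kp" using c(4,6) z(3) by linarith+
 have v: "v > V" using c c' z(6) k V by (intro speed_gt[OF _ _ c(7)]) (auto simp: kp_def)
 obtain dl where dl: "dl > 0" "s tt1 h1 = z \<bullet> edir tt1 + c"
  "!!tt h. \<bar>tt - tt1\<bar> < dl ==> \<bar>h - h1\<bar> < dl ==> s tt h <= z \<bullet> edir tt + c + v * (h - h1) + M * (h - h1)^2"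
  using c(7) unfolding touch_above_def by metis
 have "s tt1 k1 <= s tt1 h1 + v * (k1 - h1)"
 proof (rule concave_touch_above_imp_supergradient[of k1 _ _ dl _ M])
  show "s tt1 h <= s tt1 h1 + v * (h - h1) + M * (h - h1)^2" if "\<bar>h - h1\<bar> < dl" for h using dl(3)[of tt1 h] that dl(1,2) by simp
  show "(1 - t) * s tt1 h1 + t * s tt1 h <= s tt1 ((1 - t) * h1 + t * h)" if "k1 <= h" "0 <= t" "t <= 1" for h t
   using that k c by (intro concave_ineq) auto
 qed (use dl in auto)
 moreover have "V * (h1 - k1) < v * (h1 - k1)" using v k c c' by (intro mult_strict_right_mono) auto
 moreover have "s tt1 h1 - s tt1 k1 <= V * (h1 - k1)" using k c c' by (intro chord) auto
 ultimately show False by (simp add: algebra_simps)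
qed

text \<open>The mirror image: the barrier for kp - s gives an inner contact circle of radius above
  kp, slower than V, against the slopes above the contact level.\<close>

lemma trig_concave_of_speed_ge:
 assumes ab: "a < t" "t < b" "b - a < pi" and k: "0 < k1" "k1 < k" "k < k2" and V: "V > 0"
  and chord: "!!tt h h'. a <= tt ==> tt <= b ==> k1 <= h ==> h <= h' ==> h' <= k2 ==> V * (h' - h) <= s tt h' - s tt h"
 shows "(s a k - V powr (- (1 / aa))) * sin (b - t) + (s b k - V powr (- (1 / aa))) * sin (t - a) <=
  (s t k - V powr (- (1 / aa))) * sin (b - a)"
proof (rule ccontr)
 define kp where "kp = V powr (- (1 / aa))"
 have kp: "kp > 0" using V by (simp add: kp_def)
 assume "\<not> ?thesis"
 then have gt: "(kp - s t k) * sin (b - a) > (kp - s a k) * sin (b - t) + (kp - s b k) * sin (t - a)" by (simp add: kp_def algebra_simps)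
 have "continuous_on {a..b} (%tt. kp - s tt k)" using k by (intro continuous_intros continuous_at_imp_continuous_on ballI cont_level) auto
 then obtain z' ttm m where z': "a < ttm" "ttm < b" "m > 0"
  "kp - s a k - z' \<bullet> edir a < kp - s ttm k - z' \<bullet> edir ttm" "kp - s b k - z' \<bullet> edir b < kp - s ttm k - z' \<bullet> edir ttm"
  "- kp < kp - s ttm k - z' \<bullet> edir ttm" "!!tt. a <= tt ==> tt <= b ==> kp - s tt k - z' \<bullet> edir tt <= - m" by (rule trig_barrier[OF ab _ kp gt]) (rule that)
 define z where "z = - z'"
 have zz: "z' \<bullet> edir tt = - (z \<bullet> edir tt)" for tt by (simp add: z_def)
 note z = z'[unfolded zz]
 have "\<exists>tt1 h1 c v M. a < tt1 & tt1 < b & k - min (m / 2) (k - k1) < h1 & h1 <= k & 0 < h1 &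
  c <= s ttm k - z \<bullet> edir ttm & (kp + m) - min (m / 2) (k - k1) <= c & M > 0 & touch_below s z c v M tt1 h1"
 proof (rule exists_touch_below[OF cont_strip[of "k2"]])
  show "s tt k - z \<bullet> edir tt >= kp + m" if "a <= tt" "tt <= b" for tt using z(7)[OF that] by simp
 qed (use k z mono in auto)
 then obtain tt1 h1 c v M where c: "a < tt1" "tt1 < b" "k - min (m / 2) (k - k1) < h1" "h1 <= k"
  "(kp + m) - min (m / 2) (k - k1) <= c" "M > 0" "touch_below s z c v M tt1 h1" by blast
 have "min (m / 2) (k - k1) <= m / 2" "min (m / 2) (k - k1) <= k - k1" by (rule min.cobounded1 min.cobounded2)+
 then have c': "k1 < h1" "kp < c" using c(3,5) z(3) by linarith+
 have v: "v < V" using c c' k V by (intro speed_lt[OF _ c(6,7)]) (auto simp: kp_def)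
 obtain dl where dl: "dl > 0" "s tt1 h1 = z \<bullet> edir tt1 + c"
  "!!tt h. \<bar>tt - tt1\<bar> < dl ==> \<bar>h - h1\<bar> < dl ==> z \<bullet> edir tt + c + v * (h - h1) - M * (h - h1)^2 <= s tt h"
  using c(7) unfolding touch_below_def by metis
 have "s tt1 k2 <= s tt1 h1 + v * (k2 - h1)"
 proof (rule concave_touch_below_imp_supergradient[of k1 _ _ dl _ M])
  show "s tt1 h1 + v * (h - h1) - M * (h - h1)^2 <= s tt1 h" if "\<bar>h - h1\<bar> < dl" for h using dl(3)[of tt1 h] that dl(1,2) by simp
  show "(1 - t) * s tt1 h + t * s tt1 h' <= s tt1 ((1 - t) * h + t * h')" if "k1 <= h" "k1 <= h'" "0 <= t" "t <= 1" for h h' t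
   using that k by (intro concave_ineq) auto
 qed (use dl k c c' in auto)
 moreover have "v * (k2 - h1) < V * (k2 - h1)" using v k c c' by (intro mult_strict_right_mono) auto
 moreover have "V * (k2 - h1) <= s tt1 k2 - s tt1 h1" using k c c' by (intro chord) auto
 ultimately show False by linarith
qed

definition sdiff :: "real => real => real => real" where
 "sdiff r tt h = s (tt + r) h + s (tt - r) h - 2 * cos r * s tt h"

lemma sdiff_bound_iff:
 assumes "0 < r" "r < pi / 2"
 shows "(s tt h - kp) * sin (tt + r - (tt - r)) <= (s (tt - r) h - kp) * sin (tt + r - tt) + (s (tt + r) h - kp) * sin (tt - (tt - r))
   \<longleftrightarrow> 2 * kp * (1 - cos r) <= sdiff r tt h" (is "?L")
  and "(s (tt - r) h - kp) * sin (tt + r - tt) + (s (tt + r) h - kp) * sin (tt - (tt - r)) <= (s tt h - kp) * sin (tt + r - (tt - r))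
   \<longleftrightarrow> sdiff r tt h <= 2 * kp * (1 - cos r)" (is "?R")
proof -
 have sr: "sin r > 0" using assms by (intro sin_gt_zero) auto
 have e: "tt + r - (tt - r) = 2 * r" "tt + r - tt = r" "tt - (tt - r) = r" by simp_all
 have "(s (tt - r) h - kp) * sin r + (s (tt + r) h - kp) * sin r - (s tt h - kp) * sin (2 * r) = sin r * (sdiff r tt h - 2 * kp * (1 - cos r))"
  unfolding sin_double sdiff_def by algebra
 moreover have "0 <= sin r * X \<longleftrightarrow> 0 <= X" "sin r * X <= 0 \<longleftrightarrow> X <= 0" for X using sr by (simp_all add: zero_le_mult_iff mult_le_0_iff)
 ultimately show ?L ?R unfolding e by (metis diff_ge_0_iff_ge, metis diff_le_0_iff_le)
qed

lemma cont_height: "h > 0 ==> isCont (s tt) h"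
proof -
 assume h: "h > 0"
 have "continuous_on {0<..} (%h. - s tt h)" using conc[of tt] by (intro convex_on_continuous) (auto simp: concave_on_def)
 then have "isCont (%h. - s tt h) h" using h by (simp add: continuous_on_eq_continuous_at)
 from continuous_minus[OF this] show ?thesis by simp
qed

text \<open>\<open>trig_convex_of_speed_le\<close> requires levels on both sides of k, while the
  speed is bounded only from h upwards; so it is used for k > h, and k tends to h.\<close>

lemma sdiff_ge:
 assumes h: "h > 0" "d > 0" and r: "0 < r" "r < pi / 2" and V: "V > 0"
  and chord: "!!ph k k'. \<bar>ph - tt\<bar> <= r ==> h <= k ==> k <= k' ==> k' <= h + d ==> s ph k' - s ph k <= V * (k' - k)"
 shows "2 * V powr (- (1 / aa)) * (1 - cos r) <= sdiff r tt h"
proof (rule tendsto_lowerbound)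
 show "((%k. sdiff r tt k) \<longlongrightarrow> sdiff r tt h) (at_right h)"
  unfolding sdiff_def using h by (intro tendsto_intros filterlim_mono[OF isContD[OF cont_height] order_refl at_le]) auto
 have "\<forall>\<^sub>F k in at_right h. k < h + d" using h by (intro order_tendstoD(2)[OF tendsto_ident_at]) simp
 then show "\<forall>\<^sub>F k in at_right h. 2 * V powr (- (1 / aa)) * (1 - cos r) <= sdiff r tt k" using eventually_at_right_less[of h]
 proof eventually_elim
  case (elim k)
  have "(s tt k - V powr (- (1 / aa))) * sin (tt + r - (tt - r)) <=
   (s (tt - r) k - V powr (- (1 / aa))) * sin (tt + r - tt) + (s (tt + r) k - V powr (- (1 / aa))) * sin (tt - (tt - r))"
   by (rule trig_convex_of_speed_le[of _ _ _ h _ "h + d"]) (use r h V elim chord in \<open>auto simp: abs_le_iff\<close>)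
  then show ?case unfolding sdiff_bound_iff(1)[OF r] .
 qed
qed simp

lemma sdiff_le:
 assumes h: "0 < d" "d < h" and r: "0 < r" "r < pi / 2" and V: "V > 0"
  and chord: "!!ph k k'. \<bar>ph - tt\<bar> <= r ==> h - d <= k ==> k <= k' ==> k' <= h ==> V * (k' - k) <= s ph k' - s ph k"
 shows "sdiff r tt h <= 2 * V powr (- (1 / aa)) * (1 - cos r)"
proof (rule tendsto_upperbound)
 show "((%k. sdiff r tt k) \<longlongrightarrow> sdiff r tt h) (at_left h)"
  unfolding sdiff_def using h by (intro tendsto_intros filterlim_mono[OF isContD[OF cont_height] order_refl at_le]) auto
 have "\<forall>\<^sub>F k in at_left h. h - d < k" using h by (intro order_tendstoD(1)[OF tendsto_ident_at]) simp
 moreover have "\<forall>\<^sub>F k in at_left h. k < h" by (simp add: eventually_at_filter)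
 ultimately show "\<forall>\<^sub>F k in at_left h. sdiff r tt k <= 2 * V powr (- (1 / aa)) * (1 - cos r)"
 proof eventually_elim
  case (elim k)
  have "(s (tt - r) k - V powr (- (1 / aa))) * sin (tt + r - tt) + (s (tt + r) k - V powr (- (1 / aa))) * sin (tt - (tt - r)) <=
   (s tt k - V powr (- (1 / aa))) * sin (tt + r - (tt - r))"
   by (rule trig_concave_of_speed_ge[of _ _ _ "h - d" _ h]) (use r h V elim chord in \<open>auto simp: abs_le_iff\<close>)
  then show ?case unfolding sdiff_bound_iff(2)[OF r] .
 qed
qed simp

end

context ancient_front
begin

section \<open>The speed of a limit front\<close>

lemma slope_mono:
 assumes "0 < a" "a < b" "b <= c" "c <= d"
 shows "(s tt d - s tt c) * (b - a) <= (s tt b - s tt a) * (d - c)"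
proof (cases "b = c")
 case True
 then show ?thesis using chord_decreasing[of a b d tt] assms by simp
next
 case False
 have bc: "c - b > 0" using False assms by simp
 have "(s tt d - s tt c) * (c - b) <= (s tt c - s tt b) * (d - c)" using chord_decreasing[of b c d tt] assms False by simp
 then have "(s tt d - s tt c) * (c - b) * (b - a) <= (s tt c - s tt b) * (d - c) * (b - a)" using assms by (intro mult_right_mono) auto
 moreover have "(s tt c - s tt b) * (b - a) <= (s tt b - s tt a) * (c - b)" using chord_decreasing[of a b c tt] assms by simp
 then have "(s tt c - s tt b) * (b - a) * (d - c) <= (s tt b - s tt a) * (c - b) * (d - c)" using assms by (intro mult_right_mono) auto
 ultimately have "(c - b) * ((s tt d - s tt c) * (b - a)) <= (c - b) * ((s tt b - s tt a) * (d - c))" by (simp add: mult_ac)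
 then show ?thesis using bc by (simp only: mult_le_cancel_left_pos)
qed

lemma near_cont:
 fixes f :: "real => real"
 assumes "isCont f x" "e > 0"
 obtains rh where "rh > 0" "!!y. \<bar>y - x\<bar> <= rh ==> \<bar>f y - f x\<bar> < e"
proof -
 obtain d where "d > 0" "!!y. dist y x < d ==> dist (f y) (f x) < e" using assms unfolding continuous_at_eps_delta by blast
 then show thesis by (intro that[of "d / 2"]) (auto simp: dist_real_def)
qed

text \<open>Formally the left side of the equation for s2 - s1 is a difference of radii of
  curvature, nonnegative since the front slows down and slower points are flatter. The mean slope
  \<open>S\<close> separates the speeds: above h2 they are at most S, below h1 at least S, up to om
  at nearby angles, and the radii for S + om and S - om differ by at most ep. Where the increment is
  0 it has a minimum.\<close>

lemma increment_trig_convex: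
 assumes h: "0 < h1" "h1 < h2"
 shows "trig_convex (%tt. s tt h2 - s tt h1)"
proof (rule trig_convexI)
 define De where "De tt = s tt h2 - s tt h1" for tt
 have cont: "isCont De tt" for tt unfolding De_def using h by (intro continuous_intros cont_level) auto
 have De0: "De tt >= 0" for tt using mono[of h1 h2 tt] h by (simp add: De_def)
 show "isCont (%tt. s tt h2 - s tt h1) tt" for tt using cont[of tt] by (simp add: De_def[abs_def])
 fix tt
 have "trig_sub De tt" unfolding trig_sub_def
 proof (intro allI impI)
  fix ep :: real assume ep: "ep > 0"
  show "\<forall>\<^sub>F r in at_right 0. - ep * r^2 <= De (tt + r) + De (tt - r) - 2 * cos r * De tt"
  proof (cases "De tt = 0")
   case True
   have "- ep * r^2 <= De (tt + r) + De (tt - r)" for r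
   proof -
    have "0 <= ep * r^2" using ep by simp
    then show ?thesis using De0[of "tt + r"] De0[of "tt - r"] by linarith
   qed
   then show ?thesis using True by simp
  next
   case False
   define m S where "m = h2 - h1" and "S = De tt / m"
   have m: "m > 0" using h by (simp add: m_def)
   have S: "S > 0" using False De0[of tt] m by (simp add: S_def less_le)
   have "isCont (%V. V powr (- (1 / aa))) S" using S by (intro continuous_intros) auto
   then obtain om0 where om0: "om0 > 0" "!!V. \<bar>V - S\<bar> <= om0 ==> \<bar>V powr (- (1 / aa)) - S powr (- (1 / aa))\<bar> < ep / 2"
    using near_cont[OF _ half_gt_zero[OF ep]] by blast
   define om where "om = min om0 (S / 2)"
   have om: "om > 0" "om <= om0" "om < S" using om0(1) S by (auto simp: om_def min_less_iff_disj)
   have gap: "(S - om) powr (- (1 / aa)) - (S + om) powr (- (1 / aa)) <= ep"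
    using om0(2)[of "S - om"] om0(2)[of "S + om"] om unfolding abs_less_iff by simp
   have mom: "m * om > 0" using m om by simp
   obtain rh where rh: "rh > 0" "!!ph. \<bar>ph - tt\<bar> <= rh ==> \<bar>De ph - De tt\<bar> < m * om" using near_cont[OF cont mom] by blast
   have DeS: "De tt = m * S" using m by (simp add: S_def)
   have near: "(S - om) * m <= De ph" "De ph <= (S + om) * m" if "\<bar>ph - tt\<bar> <= rh" for ph
    using rh(2)[OF that] unfolding DeS abs_less_iff by (simp_all add: algebra_simps)
   have "\<forall>\<^sub>F r in at_right 0. r < min rh (pi / 2)" using rh(1) pi_gt_zero by (intro order_tendstoD(2)[OF tendsto_ident_at]) auto
   then show ?thesis using eventually_at_right_less[of 0]
   proof eventually_elim
    case (elim r)
    then have r: "0 < r" "r < pi / 2" "r <= rh" by auto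
    have up: "2 * (S + om) powr (- (1 / aa)) * (1 - cos r) <= sdiff r tt h2"
    proof (rule sdiff_ge[of h2 1])
     fix ph k k' assume k: "\<bar>ph - tt\<bar> <= r" "h2 <= k" "k <= k'"
     have "(s ph k' - s ph k) * m <= De ph * (k' - k)" using slope_mono[of h1 h2 k k' ph] h k by (simp add: m_def De_def)
     also have "\<dots> <= (S + om) * m * (k' - k)" using near(2)[of ph] k r by (intro mult_right_mono) auto
     finally show "s ph k' - s ph k <= (S + om) * (k' - k)" using m by (simp add: mult_ac)
    qed (use h r S om in auto)
    have low: "sdiff r tt h1 <= 2 * (S - om) powr (- (1 / aa)) * (1 - cos r)"
    proof (rule sdiff_le[of "h1 / 2"])
     fix ph k k' assume k: "\<bar>ph - tt\<bar> <= r" "h1 - h1 / 2 <= k" "k <= k'" "k' <= h1"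
     show "(S - om) * (k' - k) <= s ph k' - s ph k"
     proof (cases "k = k'")
      case False
      have "(S - om) * m * (k' - k) <= De ph * (k' - k)" using near(1)[of ph] k r by (intro mult_right_mono) auto
      also have "\<dots> <= (s ph k' - s ph k) * m" using slope_mono[of k k' h1 h2 ph] h k False by (simp add: m_def De_def)
      finally show ?thesis using m by (simp add: mult_ac)
     qed simp
    qed (use h r S om in auto)
    define G where "G = (S - om) powr (- (1 / aa)) - (S + om) powr (- (1 / aa))"
    have "De (tt + r) + De (tt - r) - 2 * cos r * De tt = sdiff r tt h2 - sdiff r tt h1" by (simp add: De_def sdiff_def algebra_simps)
    also have "\<dots> >= - (2 * G * (1 - cos r))" using up low unfolding G_def by (simp add: algebra_simps)
    finally have 1: "- (2 * G * (1 - cos r)) <= De (tt + r) + De (tt - r) - 2 * cos r * De tt" .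
    have "G * (1 - cos r) <= ep * (1 - cos r)" using gap by (intro mult_right_mono) (auto simp: G_def)
    also have "\<dots> <= ep * (r^2 / 2)" using ep one_minus_cos_le[of r] by (intro mult_left_mono) auto
    finally have "2 * G * (1 - cos r) <= ep * r^2" by simp
    then show ?case using 1 by linarith
   qed
  qed
 qed
 then show "trig_sub (%tt. s tt h2 - s tt h1) tt" by (simp add: De_def[abs_def])
qed

lemma trig_convex_limit:
 assumes "!!n::nat. trig_convex (f n)" "!!tt. (%n. f n tt) \<longlonglongrightarrow> g tt"
 shows "trig_convex g" unfolding trig_convex_def
proof (intro allI impI)
 fix a t b :: real assume ab: "a < t" "t < b" "b - a < pi"
 show "g t * sin (b - a) <= g a * sin (b - t) + g b * sin (t - a)"
  by (rule LIMSEQ_le[of "%n. f n t * sin (b - a)" _ "%n. f n a * sin (b - t) + f n b * sin (t - a)"])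
   (auto intro!: tendsto_intros assms(2) trig_convexD[OF assms(1) ab])
qed

lemma trig_convex_scale: "trig_convex f ==> c >= 0 ==> trig_convex (%tt. f tt * c)" unfolding trig_convex_def
proof (intro allI impI)
 fix a t b :: real assume f: "\<forall>a t b. a < t --> t < b --> b - a < pi --> f t * sin (b - a) <= f a * sin (b - t) + f b * sin (t - a)"
  and c: "c >= 0" and ab: "a < t" "t < b" "b - a < pi"
 have "(f t * sin (b - a)) * c <= (f a * sin (b - t) + f b * sin (t - a)) * c" using f ab c by (intro mult_right_mono) auto
 then show "f t * c * sin (b - a) <= f a * c * sin (b - t) + f b * c * sin (t - a)" by (simp add: algebra_simps)
qed

text \<open>A fixed sequence of increments below h. The difference quotients of a concave function
  are monotone along it, and limits of sequences preserve trigonometric convexity.\<close>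

definition step :: "real => nat => real" where "step h n = h / real (n + 2)"

definition slopeR :: "real => real => nat => real" where
 "slopeR tt h n = (s tt (h + step h n) - s tt h) * (1 / step h n)"

definition slopeL :: "real => real => nat => real" where
 "slopeL tt h n = (s tt h - s tt (h - step h n)) * (1 / step h n)"

lemma step: "h > 0 ==> 0 < step h n" "h > 0 ==> step h n < h"
proof -
 assume h: "h > 0"
 show "0 < step h n" using h by (simp add: step_def)
 have "h * 1 < h * real (n + 2)" using h by (intro mult_strict_left_mono) auto
 then show "step h n < h" by (simp add: step_def pos_divide_less_eq)
qed

lemma step_mono: "h > 0 ==> n <= m ==> step h m <= step h n" unfolding step_def by (intro divide_left_mono) auto

lemma step_tendsto: "step h \<longlonglongrightarrow> 0"
 unfolding step_def[abs_def] by (intro real_tendsto_divide_at_top[OF tendsto_const] filterlim_compose[OF filterlim_real_sequentially] filterlim_add_const_nat_at_top)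

lemma slope_order:
 assumes "0 < a" "a < b" "b <= c" "c < d"
 shows "(s tt d - s tt c) / (d - c) <= (s tt b - s tt a) / (b - a)" using slope_mono[of a b c d tt] assms by (simp add: divide_simps mult_ac)

lemma slope_right_mono:
 assumes "0 < h" "h < k" "k <= k'"
 shows "(s tt k' - s tt h) / (k' - h) <= (s tt k - s tt h) / (k - h)"
proof -
 have "(s tt k' - s tt k) * (k - h) <= (s tt k - s tt h) * (k' - k)" using chord_decreasing[of h k k' tt] assms by simp
 then have "(s tt k' - s tt h) * (k - h) <= (s tt k - s tt h) * (k' - h)" by (simp add: algebra_simps)
 then show ?thesis using assms by (simp add: divide_simps mult_ac)
qed

lemma slope_left_mono:
 assumes "0 < k'" "k' <= k" "k < h"
 shows "(s tt h - s tt k) / (h - k) <= (s tt h - s tt k') / (h - k')"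
proof (cases "k' = k")
 case False
 have "(s tt h - s tt k) * (k - k') <= (s tt k - s tt k') * (h - k)" using chord_decreasing[of k' k h tt] assms False by simp
 then have "(s tt h - s tt k) * (h - k') <= (s tt h - s tt k') * (h - k)" by (simp add: algebra_simps)
 then show ?thesis using assms by (simp add: divide_simps mult_ac)
qed simp

lemma slopeR_eq: "h > 0 ==> slopeR tt h n = (s tt (h + step h n) - s tt h) / ((h + step h n) - h)"
 and slopeL_eq: "h > 0 ==> slopeL tt h n = (s tt h - s tt (h - step h n)) / (h - (h - step h n))" by (simp_all add: slopeR_def slopeL_def)

definition speed :: "real => real => real" where "speed tt h = lim (slopeR tt h)"
definition speedL :: "real => real => real" where "speedL tt h = lim (slopeL tt h)"

lemma speeds:
 assumes h: "h > 0"
 shows "slopeR tt h \<longlonglongrightarrow> speed tt h" "slopeL tt h \<longlonglongrightarrow> speedL tt h" "speed tt h <= speedL tt h"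
  and "h < k ==> (s tt k - s tt h) / (k - h) <= speed tt h"
  and "0 < k ==> k < h ==> speedL tt h <= (s tt h - s tt k) / (h - k)"
proof -
 have RL: "slopeR tt h n <= slopeL tt h m" for n m
  unfolding slopeR_eq[OF h] slopeL_eq[OF h] using step[OF h, of n] step[OF h, of m] by (intro slope_order) auto
 have R: "slopeR tt h n <= slopeR tt h m" if "n <= m" for n m
  unfolding slopeR_eq[OF h] using step[OF h, of n] step[OF h, of m] step_mono[OF h that] h by (intro slope_right_mono) auto
 have L: "slopeL tt h m <= slopeL tt h n" if "n <= m" for n m
  unfolding slopeL_eq[OF h] using step[OF h, of n] step[OF h, of m] step_mono[OF h that] h by (intro slope_left_mono) auto
 show r: "slopeR tt h \<longlonglongrightarrow> speed tt h" unfolding speed_def convergent_LIMSEQ_iff[symmetric]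
 proof (rule Bseq_monoseq_convergent)
  have "\<bar>slopeR tt h n\<bar> <= \<bar>slopeR tt h 0\<bar> + \<bar>slopeL tt h 0\<bar>" for n using R[of 0 n] RL[of n 0] by linarith
  then show "Bseq (slopeR tt h)" by (intro BseqI') auto
  show "monoseq (slopeR tt h)" using R by (auto simp: monoseq_def)
 qed
 show l: "slopeL tt h \<longlonglongrightarrow> speedL tt h" unfolding speedL_def convergent_LIMSEQ_iff[symmetric]
 proof (rule Bseq_monoseq_convergent)
  have "\<bar>slopeL tt h n\<bar> <= \<bar>slopeR tt h 0\<bar> + \<bar>slopeL tt h 0\<bar>" for n using L[of 0 n] RL[of 0 n] by linarith
  then show "Bseq (slopeL tt h)" by (intro BseqI') auto
  show "monoseq (slopeL tt h)" using L by (auto simp: monoseq_def)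
 qed
 show "speed tt h <= speedL tt h" by (rule LIMSEQ_le[OF r l]) (use RL in auto)
 show "(s tt k - s tt h) / (k - h) <= speed tt h" if k: "h < k"
 proof (rule tendsto_lowerbound[OF r])
  have "\<forall>\<^sub>F n in sequentially. step h n < k - h" using order_tendstoD(2)[OF step_tendsto[of h]] k by simp
  then show "\<forall>\<^sub>F n in sequentially. (s tt k - s tt h) / (k - h) <= slopeR tt h n"
   by eventually_elim (unfold slopeR_eq[OF h], rule slope_right_mono, use h step[OF h] in auto)
 qed simp
 show "speedL tt h <= (s tt h - s tt k) / (h - k)" if k: "0 < k" "k < h"
 proof (rule tendsto_upperbound[OF l])
  have "\<forall>\<^sub>F n in sequentially. step h n < h - k" using order_tendstoD(2)[OF step_tendsto[of h]] k by simp
  then show "\<forall>\<^sub>F n in sequentially. slopeL tt h n <= (s tt h - s tt k) / (h - k)"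
   by eventually_elim (unfold slopeL_eq[OF h], rule slope_left_mono, use k step[OF h] in auto)
 qed simp
qed

lemma speed_nonneg: "h > 0 ==> speed tt h >= 0"
proof -
 assume h: "h > 0"
 have "0 <= (s tt (h + 1) - s tt h) / ((h + 1) - h)" using mono[OF h, of "h + 1" tt] by simp
 then show ?thesis using speeds(4)[OF h, of "h + 1" tt] by simp
qed

text \<open>Through \<open>trig_convex_isCont\<close> this makes the speed continuous in the angle,
  so that a bound at one angle holds nearby.\<close>

lemma speed_trig_convex: "h > 0 ==> trig_convex (%tt. speed tt h)"
proof (rule trig_convex_limit)
 assume h: "h > 0"
 show "trig_convex (%tt. slopeR tt h n)" for n unfolding slopeR_def using step[OF h, of n] h by (intro trig_convex_scale increment_trig_convex) auto
 show "(%n. slopeR tt h n) \<longlonglongrightarrow> speed tt h" for tt using speeds(1)[OF h] .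
qed

lemma speedL_trig_convex: "h > 0 ==> trig_convex (%tt. speedL tt h)"
proof (rule trig_convex_limit)
 assume h: "h > 0"
 show "trig_convex (%tt. slopeL tt h n)" for n unfolding slopeL_def using step[OF h, of n] h by (intro trig_convex_scale increment_trig_convex) auto
 show "(%n. slopeL tt h n) \<longlonglongrightarrow> speedL tt h" for tt using speeds(2)[OF h] .
qed

lemma cont_speed: "h > 0 ==> isCont (%tt. speed tt h) tt" using trig_convex_isCont[OF speed_trig_convex] .

lemma eventually_small: "rh > 0 ==> \<forall>\<^sub>F r in at_right 0. 0 < r & r < pi / 2 & r <= (rh::real)"
proof -
 assume "rh > 0"
 then have "\<forall>\<^sub>F r in at_right 0. r < min rh (pi / 2)" using pi_gt_zero by (intro order_tendstoD(2)[OF tendsto_ident_at]) auto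
 then show ?thesis using eventually_at_right_less[of 0] by eventually_elim auto
qed

lemma eventually_sdiff_ge:
 assumes h: "h > 0" and V: "speed tt h < V"
 shows "\<forall>\<^sub>F r in at_right 0. 2 * V powr (- (1 / aa)) * (1 - cos r) <= sdiff r tt h"
proof -
 have V0: "V > 0" using V speed_nonneg[OF h, of tt] by linarith
 obtain rh where rh: "rh > 0" "!!ph. \<bar>ph - tt\<bar> <= rh ==> \<bar>speed ph h - speed tt h\<bar> < V - speed tt h"
  using near_cont[OF cont_speed[OF h]] V by (metis diff_gt_0_iff_gt)
 from eventually_small[OF rh(1)] show ?thesis
 proof eventually_elim
  case (elim r)
  show ?case
  proof (rule sdiff_ge[OF h zero_less_one _ _ V0])
   fix ph k k' assume k: "\<bar>ph - tt\<bar> <= r" "h <= k" "k <= k'"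
   have sp: "speed ph h <= V" using rh(2)[of ph] k elim by linarith
   show "s ph k' - s ph k <= V * (k' - k)"
   proof (cases "k = k'")
    case False
    have "(s ph k' - s ph k) / (k' - k) <= speed ph h"
    proof (cases "h = k")
     case True then show ?thesis using speeds(4)[OF h, of k' ph] k False by simp
    next
     case False
     have "(s ph k' - s ph k) / (k' - k) <= (s ph k - s ph h) / (k - h)" using slope_order[of h k k k' ph] h k False \<open>k ~= k'\<close> by simp
     then show ?thesis using speeds(4)[OF h, of k ph] k False by simp
    qed
    then show ?thesis using sp k False by (simp add: pos_divide_le_eq mult_right_mono order_trans)
   qed simp
  qed (use elim in auto)
 qed
qed

lemma eventually_sdiff_leL:
 assumes h: "h > 0" and V: "0 < V" "V < speedL tt h"
 shows "\<forall>\<^sub>F r in at_right 0. sdiff r tt h <= 2 * V powr (- (1 / aa)) * (1 - cos r)"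
proof -
 obtain rh where rh: "rh > 0" "!!ph. \<bar>ph - tt\<bar> <= rh ==> \<bar>speedL ph h - speedL tt h\<bar> < speedL tt h - V"
  using near_cont[OF trig_convex_isCont[OF speedL_trig_convex[OF h]]] V by (metis diff_gt_0_iff_gt)
 from eventually_small[OF rh(1)] show ?thesis
 proof eventually_elim
  case (elim r)
  show ?case
  proof (rule sdiff_le[of "h / 2" h _ V])
   fix ph k k' assume k: "\<bar>ph - tt\<bar> <= r" "h - h / 2 <= k" "k <= k'" "k' <= h"
   have sp: "V <= speedL ph h" using rh(2)[of ph] k elim by linarith
   show "V * (k' - k) <= s ph k' - s ph k"
   proof (cases "k = k'")
    case False
    have "speedL ph h <= (s ph k' - s ph k) / (k' - k)"
    proof (cases "h = k'")
     case True then show ?thesis using speeds(5)[OF h, of k ph] k False h by simp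
    next
     case False
     have "(s ph h - s ph k') / (h - k') <= (s ph k' - s ph k) / (k' - k)" using slope_order[of k k' k' h ph] h k False \<open>k ~= k'\<close> by simp
     then show ?thesis using speeds(5)[OF h, of k' ph] k False h by simp
    qed
    then have "V <= (s ph k' - s ph k) / (k' - k)" using sp by linarith
    then show ?thesis using k False by (simp add: pos_le_divide_eq)
   qed simp
  qed (use elim h V in auto)
 qed
qed

text \<open>Both one-sided speeds control the same second difference at level h: the right one
  bounds the radius of curvature from below, the left one from above. As the radius decreases with
  the speed, a larger left speed would make the two bounds incompatible.\<close>

lemma speedL_eq: "h > 0 ==> speedL tt h = speed tt h"
proof (rule ccontr)
 assume h: "h > 0" and ne: "speedL tt h ~= speed tt h"
 define om where "om = (speedL tt h - speed tt h) / 3"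
 have om: "om > 0" using speeds(3)[OF h, of tt] ne by (simp add: om_def)
 define V1 V2 where "V1 = speed tt h + om" and "V2 = speedL tt h - om"
 have V: "speed tt h < V1" "V1 < V2" "V2 < speedL tt h" using om by (auto simp: V1_def V2_def om_def field_simps)
 have V1: "V1 > 0" using om speed_nonneg[OF h, of tt] by (simp add: V1_def)
 have V2: "V2 > 0" using V V1 by simp
 have "\<forall>\<^sub>F r in at_right 0. 2 * V1 powr (- (1 / aa)) * (1 - cos r) <= 2 * V2 powr (- (1 / aa)) * (1 - cos r) & 0 < r & r < pi / 2"
  using eventually_sdiff_ge[OF h V(1)] eventually_sdiff_leL[OF h V2 V(3)] eventually_small[OF zero_less_one] by eventually_elim linarith
 then obtain r where r: "2 * V1 powr (- (1 / aa)) * (1 - cos r) <= 2 * V2 powr (- (1 / aa)) * (1 - cos r)" "0 < r" "r < pi / 2"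
  using eventually_happens'[OF trivial_limit_at_right_real] by blast
 have "cos r < cos 0" using r by (intro cos_monotone_0_pi) auto
 then have "V1 powr (- (1 / aa)) <= V2 powr (- (1 / aa))" using r(1) by (simp add: mult_le_cancel_right)
 moreover have "V2 powr (- (1 / aa)) < V1 powr (- (1 / aa))" using V V1 aa by (intro powr_less_mono2_neg) auto
 ultimately show False by simp
qed

lemma speed_le_slope: "0 < k ==> k < h ==> speed tt h <= (s tt h - s tt k) / (h - k)" using speeds(5)[of h k tt] speedL_eq[of h tt] by simp

lemma eventually_sdiff_le: "0 < h ==> 0 < V ==> V < speed tt h ==>
  \<forall>\<^sub>F r in at_right 0. sdiff r tt h <= 2 * V powr (- (1 / aa)) * (1 - cos r)"
 using eventually_sdiff_leL[of h V tt] speedL_eq[of h tt] by simp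

end

section \<open>The reflection argument\<close>

lemma neg_powr_gap:
 fixes x y V q :: real
 assumes "0 < x" "x <= y" "y <= V" "q > 0"
 shows "q * V powr (- q - 1) * (y - x) <= x powr (- q) - y powr (- q)"
proof -
 define g where "g t = t powr (- q) + q * V powr (- q - 1) * t" for t
 have "g y <= g x"
 proof (rule DERIV_nonpos_imp_nonincreasing[OF assms(2)])
  fix t assume t: "x <= t" "t <= y"
  have "DERIV g t :> - q * t powr (- q - 1) + q * V powr (- q - 1)" unfolding g_def using t assms by (auto intro!: derivative_eq_intros)
  moreover have "V powr (- q - 1) <= t powr (- q - 1)" using t assms by (intro powr_mono2') auto
  then have "- q * t powr (- q - 1) + q * V powr (- q - 1) <= 0" using assms by simp
  ultimately show "\<exists>d. DERIV g t :> d & d <= 0" by blast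
 qed
 then show ?thesis by (simp add: g_def algebra_simps)
qed

context ancient_front
begin

lemma increment_le: "0 < h ==> h <= k ==> s tt k - s tt h <= speed tt h * (k - h)"
 using speeds(4)[of h k tt] by (cases "h = k") (simp_all add: pos_divide_le_eq)

lemma increment_ge: "0 < h ==> h <= k ==> speed tt k * (k - h) <= s tt k - s tt h"
 using speed_le_slope[of h k tt] by (cases "h = k") (simp_all add: pos_le_divide_eq)

lemma speed_antimono: "0 < h ==> h <= k ==> speed tt k <= speed tt h"
proof (cases "h = k")
 assume "0 < h" "h <= k" and False: "h ~= k"
 then have "speed tt k * (k - h) <= speed tt h * (k - h)" using increment_le[of h k tt] increment_ge[of h k tt] by linarith
 then show ?thesis using False \<open>h <= k\<close> by (simp add: mult_le_cancel_right)
qed simp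

lemma speed_upper: "h > 0 ==> speed tt h * h <= s tt h"
proof -
 assume h: "h > 0"
 have "speed tt h <= s tt h / h"
 proof (rule LIMSEQ_le_const2[OF speeds(1)[OF h]], intro exI allI impI)
  fix n
  have "(s tt (h + step h n) - s tt h) * h <= s tt h * step h n" using chord_le[of h "h + step h n" tt] h step[OF h, of n] by simp
  then show "slopeR tt h n <= s tt h / h" unfolding slopeR_def using h step[OF h, of n] by (simp add: divide_simps mult_ac)
 qed
 then show ?thesis using h by (simp add: pos_le_divide_eq)
qed

lemma cont_speed_height:
 assumes h: "h > 0"
 shows "isCont (speed tt) h" unfolding isCont_def
proof (rule order_tendstoI)
 fix a assume a: "a < speed tt h"
 have "\<forall>\<^sub>F n in sequentially. a < slopeR tt h n" using order_tendstoD(1)[OF speeds(1)[OF h] a] .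
 then obtain n where n: "a < slopeR tt h n" using eventually_happens'[OF sequentially_bot] by blast
 define k where "k = h + step h n"
 have k: "k > h" "a < (s tt k - s tt h) / (k - h)" using n step[OF h, of n] by (auto simp: k_def slopeR_def)
 have "((%x. (s tt k - s tt x) / (k - x)) \<longlongrightarrow> (s tt k - s tt h) / (k - h)) (at h)"
  using k by (intro tendsto_intros isContD[OF cont_height[OF h]]) auto
 from order_tendstoD(1)[OF this k(2)] order_tendstoD(2)[OF tendsto_ident_at k(1)] order_tendstoD(1)[OF tendsto_ident_at h]
 show "\<forall>\<^sub>F x in at h. a < speed tt x"
 proof eventually_elim
  case (elim x)
  then show ?case using speeds(4)[of x k tt] by simp
 qed
next
 fix a assume a: "speed tt h < a"
 have "\<forall>\<^sub>F n in sequentially. slopeL tt h n < a" using order_tendstoD(2)[OF speeds(2)[OF h, unfolded speedL_eq[OF h]] a] .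
 then obtain n where n: "slopeL tt h n < a" using eventually_happens'[OF sequentially_bot] by blast
 define k where "k = h - step h n"
 have k: "k < h" "k > 0" "(s tt h - s tt k) / (h - k) < a" using n step[OF h, of n] by (auto simp: k_def slopeL_def)
 have "((%x. (s tt x - s tt k) / (x - k)) \<longlongrightarrow> (s tt h - s tt k) / (h - k)) (at h)"
  using k by (intro tendsto_intros isContD[OF cont_height[OF h]]) auto
 from order_tendstoD(2)[OF this k(3)] order_tendstoD(1)[OF tendsto_ident_at k(1)]
 show "\<forall>\<^sub>F x in at h. speed tt x < a"
 proof eventually_elim
  case (elim x)
  then show ?case using speed_le_slope[of k x tt] k by simp
 qed
qed

text \<open>Maximum principle for the difference of a front and its reflection, weighted by \<open>exp (k * (1 - h))\<close>, towards lower levels.\<close>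

lemma reflection_step:
 fixes ps m hs :: real
 assumes hs: "0 < hs" "hs < 1" and D: "D > 0"
  and init: "!!tt. 0 <= tt ==> tt <= pi ==> m * sin tt <= s (ps - tt) 1 - s (ps + tt) 1"
  and tt: "0 <= tt" "tt <= pi" and ep: "ep > 0"
 shows "\<exists>k. - ep * exp k <= s (ps - tt) hs - s (ps + tt) hs - m * sin tt & k = 4 * (D * hs powr (1 / (1 + aa)) / hs) powr (1 / aa + 1) * aa * (1 - hs)"
proof -
 define q where "q = 1 / aa"
 have q: "q > 0" using aa by (simp add: q_def)
 define V where "V = D * hs powr (1 / (1 + aa)) / hs"
 have V: "V > 0" using D hs by (simp add: V_def)
 have spV: "speed ph h <= V" if "hs <= h" for ph h
 proof -
  have "speed ph hs * hs <= D * hs powr (1 / (1 + aa))" using speed_upper[OF hs(1), of ph] upper[OF hs(1), of ph] by linarith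
  then have "speed ph hs <= V" using hs by (simp add: V_def pos_le_divide_eq)
  then show ?thesis using speed_antimono[OF hs(1) that, of ph] by linarith
 qed
 \<comment> \<open>\<open>V\<close> bounds the speeds from level hs upwards, and q * V powr (- q -
   1) is the least slope, in absolute value, of v powr (- q) up to V. With this k the decay of the
   weight forces a gap of speeds that the second differences cannot sustain.\<close>
 define k where "k = 4 * V powr (q + 1) / q"
 have k: "k > 0" using V q by (simp add: k_def)
 define f where "f tt h = s (ps - tt) h - s (ps + tt) h - m * sin tt" for tt h
 define F where "F p = f (fst p) (snd p) + ep * exp (k * (1 - snd p))" for p
 define R where "R = {0..pi} \<times> {hs..1}"
 have contF: "continuous_on R F"
 proof -
  have "continuous_on R (%p. s (ps - fst p) (snd p))" "continuous_on R (%p. s (ps + fst p) (snd p))"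
   using hs by (auto intro!: continuous_intros continuous_on_compose2[OF jointly_continuous, of _ "%p. (ps - fst p, snd p)", simplified]
    continuous_on_compose2[OF jointly_continuous, of _ "%p. (ps + fst p, snd p)", simplified] simp: R_def)
  then show ?thesis unfolding F_def f_def by (intro continuous_intros)
 qed
 have Fpos: "F p > 0" if p: "p \<in> R" for p
 proof (rule ccontr)
  assume "\<not> F p > 0"
  define Z where "Z = {p \<in> R. F p <= 0}"
  have "compact R" by (simp add: R_def compact_Times)
  have "closed (R \<inter> F -` {..0})" by (rule continuous_closed_preimage[OF contF compact_imp_closed[OF \<open>compact R\<close>] closed_atMost])
  then have "compact ((R \<inter> F -` {..0}) \<inter> R)" using \<open>compact R\<close> by (rule closed_Int_compact)
  moreover have "(R \<inter> F -` {..0}) \<inter> R = Z" by (auto simp: Z_def)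
  ultimately have "compact Z" by simp
  moreover have "p \<in> Z" using p \<open>\<not> F p > 0\<close> by (simp add: Z_def)
  then have "Z ~= {}" by blast
  ultimately have "\<exists>x\<in>Z. \<forall>y\<in>Z. snd y <= snd x" by (intro continuous_attains_sup) (auto intro: continuous_intros)
  \<comment> \<open>The highest level at which F fails to be positive, that is, the first failure on
    the way down from level 1.\<close>
  then obtain p0 where p0: "p0 \<in> Z" "!!y. y \<in> Z ==> snd y <= snd p0" by blast
  define tt0 h0 where "tt0 = fst p0" and "h0 = snd p0"
  have p0R: "0 <= tt0" "tt0 <= pi" "hs <= h0" "h0 <= 1" and F0: "F (tt0, h0) <= 0"
   using p0(1) by (auto simp: Z_def R_def tt0_def h0_def mem_Times_iff)
  have h0pos: "h0 > 0" using p0R hs by simp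
  define E where "E = ep * exp (k * (1 - h0))"
  have E: "E > 0" using ep by (simp add: E_def)
  have "F (tt, 1) > 0" if "0 <= tt" "tt <= pi" for tt using init[OF that] ep by (simp add: F_def f_def)
  then have h01: "h0 < 1" using F0 p0R by (cases "h0 = 1") (auto simp: not_le[symmetric])
  have later: "F (tt, h) > 0" if "0 <= tt" "tt <= pi" "h0 < h" "h <= 1" for tt h
   using p0(2)[of "(tt, h)"] that p0R by (force simp: Z_def R_def h0_def)
  have contFh: "((%h. F (tt, h)) \<longlongrightarrow> F (tt, h0)) (at_right h0)" for tt unfolding F_def f_def fst_conv snd_conv using h0pos
   by (intro tendsto_intros filterlim_mono[OF isContD[OF cont_height] order_refl at_le]) auto
  have evh: "\<forall>\<^sub>F h in at_right h0. h0 < h & h < 1"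
   using order_tendstoD(2)[OF tendsto_ident_at h01] eventually_at_right_less[of h0] by eventually_elim auto
  have Fge: "F (tt, h0) >= 0" if "0 <= tt" "tt <= pi" for tt
  proof (rule tendsto_lowerbound[OF contFh])
   show "\<forall>\<^sub>F h in at_right h0. 0 <= F (tt, h)" using evh by eventually_elim (use later[OF that] in \<open>auto intro: less_imp_le\<close>)
  qed simp
  have F0eq: "F (tt0, h0) = 0" using F0 Fge[OF p0R(1,2)] by simp
  then have f0: "f tt0 h0 = - E" by (simp add: F_def E_def)
  have "f 0 h0 = 0" "f pi h0 = 0" using periodic[OF h0pos, of "ps - pi"] by (simp_all add: f_def algebra_simps)
  then have tt0: "0 < tt0" "tt0 < pi" using f0 E p0R by (auto simp: less_le)
  define v1 v2 where "v1 = speed (ps - tt0) h0" and "v2 = speed (ps + tt0) h0"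
  \<comment> \<open>F vanishes at h0 and is positive just above, so f increases there at least as
    fast as the weight decays.\<close>
  have "k * E <= v1 - v2"
  proof (rule tendsto_le[of "at_right h0"])
   show "((%h. v1 - speed (ps + tt0) h) \<longlongrightarrow> v1 - v2) (at_right h0)" unfolding v2_def
    by (intro tendsto_intros filterlim_mono[OF isContD[OF cont_speed_height[OF h0pos]] order_refl at_le]) auto
   have "((%h. k * (ep * exp (k * (1 - h)))) \<longlongrightarrow> k * (ep * exp (k * (1 - h0)))) (at_right h0)" by (intro tendsto_intros)
   then show "((%h. k * (ep * exp (k * (1 - h)))) \<longlongrightarrow> k * E) (at_right h0)" by (simp add: E_def)
   show "\<forall>\<^sub>F h in at_right h0. k * (ep * exp (k * (1 - h))) <= v1 - speed (ps + tt0) h" using evh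
   proof eventually_elim
    case (elim h)
    define d where "d = h - h0"
    have d: "d > 0" using elim by (simp add: d_def)
    have "0 < F (tt0, h)" using later[OF p0R(1,2)] elim by simp
    then have "- (ep * exp (k * (1 - h))) < f tt0 h" by (simp add: F_def)
    then have 1: "ep * (exp (k * (1 - h0)) - exp (k * (1 - h))) <= f tt0 h - f tt0 h0" unfolding f0 E_def by (simp add: algebra_simps)
    have "exp (k * (1 - h0)) = exp (k * (1 - h)) * exp (k * d)" by (simp add: d_def exp_add[symmetric] algebra_simps)
    moreover have "exp (k * (1 - h)) * (1 + k * d) <= exp (k * (1 - h)) * exp (k * d)" by (intro mult_left_mono exp_ge_add_one_self) auto
    ultimately have "k * exp (k * (1 - h)) * d <= exp (k * (1 - h0)) - exp (k * (1 - h))" by (simp add: algebra_simps)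
    then have 2: "ep * (k * exp (k * (1 - h)) * d) <= ep * (exp (k * (1 - h0)) - exp (k * (1 - h)))" using ep by (intro mult_left_mono) auto
    have "f tt0 h - f tt0 h0 <= (v1 - speed (ps + tt0) h) * d"
     using increment_le[OF h0pos, of h "ps - tt0"] increment_ge[OF h0pos, of h "ps + tt0"] elim by (simp add: f_def v1_def d_def left_diff_distrib)
    then have "(k * (ep * exp (k * (1 - h)))) * d <= (v1 - speed (ps + tt0) h) * d" using 1 2 by (simp add: mult_ac)
    then show ?case using d by (simp only: mult_le_cancel_right_pos)
   qed
  qed simp
  then have v12: "v2 + k * E <= v1" by simp
  have v20: "v2 >= 0" unfolding v2_def by (rule speed_nonneg[OF h0pos])
  define om where "om = (v1 - v2) / 4"
  have kE: "k * E > 0" using k E by simp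
  have om: "om > 0" "4 * om >= k * E" using v12 kE by (auto simp: om_def)
  have V12: "0 < v1 - om" "v1 - om < v1" "v2 < v2 + om" "0 < v2 + om" "(v1 - om) - (v2 + om) = 2 * om" "v1 - om <= V"
   using om v20 kE v12 spV[of h0 "ps - tt0"] p0R by (auto simp: om_def v1_def field_simps)
  have "\<forall>\<^sub>F r in at_right 0. sdiff r (ps - tt0) h0 <= 2 * (v1 - om) powr (- q) * (1 - cos r)"
   unfolding q_def using V12 by (intro eventually_sdiff_le[OF h0pos]) (simp_all add: v1_def)
  moreover have "\<forall>\<^sub>F r in at_right 0. 2 * (v2 + om) powr (- q) * (1 - cos r) <= sdiff r (ps + tt0) h0"
   unfolding q_def using V12 by (intro eventually_sdiff_ge[OF h0pos]) (simp_all add: v2_def)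
  moreover have "\<forall>\<^sub>F r in at_right 0. 0 < r & r < pi / 2 & r <= min tt0 (pi - tt0)" using tt0 by (intro eventually_small) simp
  ultimately have "\<forall>\<^sub>F r in at_right 0. sdiff r (ps - tt0) h0 - sdiff r (ps + tt0) h0 <= 2 * ((v1 - om) powr (- q) - (v2 + om) powr (- q)) * (1 - cos r) &
    0 < r & r < pi / 2 & r <= min tt0 (pi - tt0)" by eventually_elim (simp add: algebra_simps)
  then obtain r where r: "sdiff r (ps - tt0) h0 - sdiff r (ps + tt0) h0 <= 2 * ((v1 - om) powr (- q) - (v2 + om) powr (- q)) * (1 - cos r)"
   "0 < r" "r < pi / 2" "r <= tt0" "r <= pi - tt0" using eventually_happens'[OF trivial_limit_at_right_real] by fastforce
  \<comment> \<open>f has a minimum over the angles at tt0, so its second difference is at least - 2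
    * E * (1 - cos r); the larger speed v1 means a smaller radius of curvature and pushes it below
    this.\<close>
  have "f (tt0 + r) h0 >= - E" "f (tt0 - r) h0 >= - E" using Fge[of "tt0 + r"] Fge[of "tt0 - r"] r tt0 by (simp_all add: F_def E_def)
  moreover have "f (tt0 + r) h0 + f (tt0 - r) h0 - 2 * cos r * f tt0 h0 = sdiff r (ps - tt0) h0 - sdiff r (ps + tt0) h0"
   by (simp add: f_def sdiff_def sin_add sin_diff algebra_simps)
  ultimately have "- (2 * E) * (1 - cos r) <= 2 * ((v1 - om) powr (- q) - (v2 + om) powr (- q)) * (1 - cos r)"
   using r(1) unfolding f0 by (simp add: algebra_simps)
  moreover have "cos r < cos 0" using r by (intro cos_monotone_0_pi) auto
  then have "1 - cos r > 0" by simp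
  ultimately have "- (2 * E) <= 2 * ((v1 - om) powr (- q) - (v2 + om) powr (- q))" by (simp only: mult_le_cancel_right_pos)
  then have "(v2 + om) powr (- q) - (v1 - om) powr (- q) <= E" by simp
  moreover have "q * V powr (- q - 1) * ((v1 - om) - (v2 + om)) <= (v2 + om) powr (- q) - (v1 - om) powr (- q)"
   using V12 om q by (intro neg_powr_gap) auto
  moreover have "2 * E <= q * V powr (- q - 1) * ((v1 - om) - (v2 + om))"
  proof -
   have "V powr (- q - 1) * V powr (q + 1) = 1" using V by (simp add: powr_add[symmetric])
   then have "q * V powr (- q - 1) * (k * E / 2) = 2 * E" using q by (simp add: k_def field_simps)
   moreover have "q * V powr (- q - 1) * (k * E / 2) <= q * V powr (- q - 1) * (2 * om)" using om q by (intro mult_left_mono) auto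
   ultimately show ?thesis unfolding V12(5) by linarith
  qed
  ultimately show False using E by linarith
 qed
 have "(tt, hs) \<in> R" using tt hs by (simp add: R_def)
 from Fpos[OF this] have "- ep * exp (k * (1 - hs)) <= s (ps - tt) hs - s (ps + tt) hs - m * sin tt" by (simp add: F_def f_def)
 moreover have "k * (1 - hs) = 4 * (D * hs powr (1 / (1 + aa)) / hs) powr (1 / aa + 1) * aa * (1 - hs)" by (simp add: k_def V_def q_def)
 ultimately show ?thesis by metis
qed

lemma reflection_preserved:
 fixes ps m :: real
 assumes hs: "0 < hs" "hs < 1" and D: "D > 0"
  and init: "!!tt. 0 <= tt ==> tt <= pi ==> m * sin tt <= s (ps - tt) 1 - s (ps + tt) 1"
  and tt: "0 <= tt" "tt <= pi"
 shows "m * sin tt <= s (ps - tt) hs - s (ps + tt) hs"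
proof (rule field_le_epsilon)
 fix e :: real assume e: "e > 0"
 define k where "k = 4 * (D * hs powr (1 / (1 + aa)) / hs) powr (1 / aa + 1) * aa * (1 - hs)"
 have "e / exp k > 0" using e by simp
 from reflection_step[OF hs D init tt this] have "- (e / exp k) * exp k <= s (ps - tt) hs - s (ps + tt) hs - m * sin tt" unfolding k_def by blast
 then show "m * sin tt <= s (ps - tt) hs - s (ps + tt) hs + e" by simp
qed

text \<open>From level 1 upwards speeds are at most D, so w = s - kp is trigonometrically convex. If
  it were negative at ph, the three-point inequality would give the reflected comparison at level 1
  with m = - 2 * w ph > 0. It persists at all lower levels and at the angle pi / 2 bounds s from
  below by m, while s tends to 0 with h.\<close>

lemma support_lower_unit:
 assumes D: "D > 0"
 shows "s ph 1 >= D powr (- (1 / aa))"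
proof (rule ccontr)
 assume neg: "\<not> ?thesis"
 define kp where "kp = D powr (- (1 / aa))"
 define w where "w tt = s tt 1 - kp" for tt
 have wph: "w ph < 0" using neg by (simp add: w_def kp_def)
 have wc: "isCont w tt" for tt unfolding w_def by (intro continuous_intros cont_level) simp
 have "trig_convex w"
 proof (rule trig_convexI[OF wc])
  fix tt
  show "trig_sub w tt" unfolding trig_sub_def
  proof (intro allI impI)
   fix ep :: real assume ep: "ep > 0"
   from eventually_small[OF zero_less_one] show "\<forall>\<^sub>F r in at_right 0. - ep * r^2 <= w (tt + r) + w (tt - r) - 2 * cos r * w tt"
   proof eventually_elim
    case (elim r)
    have "2 * kp * (1 - cos r) <= sdiff r tt 1" unfolding kp_def
    proof (rule sdiff_ge[OF zero_less_one zero_less_one _ _ D])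
     fix ph k k' :: real assume k: "1 <= k" "k <= k'"
     have "speed ph k <= D" using speed_antimono[of 1 k ph] speed_upper[of 1 ph] upper[of 1 ph] k by simp
     then have "speed ph k * (k' - k) <= D * (k' - k)" using k by (intro mult_right_mono) auto
     then show "s ph k' - s ph k <= D * (k' - k)" using increment_le[of k k' ph] k by simp
    qed (use elim in auto)
    then have "0 <= w (tt + r) + w (tt - r) - 2 * cos r * w tt" by (simp add: w_def sdiff_def algebra_simps)
    moreover have "0 <= ep * r^2" using ep by simp
    ultimately show ?case by linarith
   qed
  qed
 qed
 note wD = trig_convexD[OF this]
 define ps m where "ps = ph - pi / 2" and "m = - 2 * w ph"
 have m: "m > 0" using wph by (simp add: m_def)
 have per: "w (tt + 2 * pi) = w tt" for tt using periodic[of 1 tt] by (simp add: w_def)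
 \<comment> \<open>At pi / 2 the division by cos tt is impossible; that angle is recovered by
   continuity.\<close>
 have main: "m * sin tt <= w (ps - tt) - w (ps + tt)" if t: "0 <= tt" "tt <= pi" "tt ~= pi / 2" for tt
 proof -
  consider "tt = 0" | "tt = pi" | "0 < tt" "tt < pi / 2" | "pi / 2 < tt" "tt < pi" using t by linarith
  then show ?thesis
  proof cases
   case 2
   then show ?thesis using per[of "ps - pi"] by (simp add: algebra_simps)
  next
   case 3
   have c: "cos tt > 0" using 3 by (intro cos_gt_zero) auto
   have ineq: "w (ps + tt) * sin (ph - (ps - tt)) <= w (ps - tt) * sin (ph - (ps + tt)) + w ph * sin ((ps + tt) - (ps - tt))"
    using 3 by (intro wD) (auto simp: ps_def)
   have e: "ph - (ps - tt) = tt + pi / 2" "ph - (ps + tt) = pi / 2 - tt" "(ps + tt) - (ps - tt) = 2 * tt" by (simp_all add: ps_def)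
   have "w (ps + tt) * cos tt <= w (ps - tt) * cos tt + w ph * (2 * sin tt * cos tt)"
    using ineq unfolding e by (simp add: sin_add sin_diff sin_double)
   then have "cos tt * (m * sin tt) <= cos tt * (w (ps - tt) - w (ps + tt))" by (simp add: m_def algebra_simps)
   then show ?thesis using c by (simp only: mult_le_cancel_left_pos)
  next
   case 4
   have "cos (pi - tt) > 0" using 4 by (intro cos_gt_zero) auto
   then have c: "- cos tt > 0" by simp
   have ineq: "w (ps + tt) * sin ((ps - tt + 2 * pi) - ph) <= w ph * sin ((ps - tt + 2 * pi) - (ps + tt)) + w (ps - tt + 2 * pi) * sin ((ps + tt) - ph)"
    using 4 by (intro wD) (auto simp: ps_def)
   have e: "(ps - tt + 2 * pi) - ph = (pi - tt) + pi / 2" "(ps - tt + 2 * pi) - (ps + tt) = 2 * (pi - tt)" "(ps + tt) - ph = tt - pi / 2"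
    by (simp_all add: ps_def)
   have "w (ps + tt) * (- cos tt) <= w ph * (2 * sin tt * (- cos tt)) + w (ps - tt) * (- cos tt)"
   proof -
    have "sin ((pi - tt) + pi / 2) = - cos tt" unfolding sin_add[of "pi - tt"] by simp
    moreover have "sin (tt - pi / 2) = - cos tt" by (simp add: sin_diff)
    moreover have "sin (2 * (pi - tt)) = 2 * sin tt * (- cos tt)" unfolding sin_double by simp
    ultimately show ?thesis using ineq unfolding e per by simp
   qed
   then have "(- cos tt) * (m * sin tt) <= (- cos tt) * (w (ps - tt) - w (ps + tt))" by (simp add: m_def algebra_simps)
   then show ?thesis using c by (simp only: mult_le_cancel_left_pos)
  qed simp
 qed
 have init: "m * sin tt <= s (ps - tt) 1 - s (ps + tt) 1" if t: "0 <= tt" "tt <= pi" for tt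
 proof (cases "tt = pi / 2")
  case False
  then show ?thesis using main[OF t] by (simp add: w_def)
 next
  case True
  have lim: "((%t. w (ps - t) - w (ps + t)) \<longlongrightarrow> w (ps - tt) - w (ps + tt)) (at_left tt)" "((%t. m * sin t) \<longlongrightarrow> m * sin tt) (at_left tt)"
   by (intro tendsto_intros isCont_tendsto_compose[OF wc])+
  have "\<forall>\<^sub>F t in at_left tt. 0 < t" using True pi_gt_zero by (intro order_tendstoD(1)[OF tendsto_ident_at]) linarith
  moreover have "\<forall>\<^sub>F t in at_left tt. t < tt" by (simp add: eventually_at_filter)
  ultimately have "\<forall>\<^sub>F t in at_left tt. m * sin t <= w (ps - t) - w (ps + t)" by eventually_elim (rule main, use t True in auto)
  from tendsto_le[OF _ lim this] show ?thesis by (simp add: w_def)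
 qed
 have below: "m <= D * h powr (1 / (1 + aa))" if h: "0 < h" "h < 1" for h
 proof -
  have "m * sin (pi / 2) <= s (ps - pi / 2) h - s (ps + pi / 2) h" by (rule reflection_preserved[OF h D init]) auto
  then show ?thesis using upper[OF h(1), of "ps - pi / 2"] nonneg[OF h(1), of "ps + pi / 2"] by simp
 qed
 define h where "h = min (1 / 2) ((m / (2 * D)) powr (1 + aa))"
 have h: "0 < h" "h < 1" using m D by (auto simp: h_def)
 have "h powr (1 / (1 + aa)) <= ((m / (2 * D)) powr (1 + aa)) powr (1 / (1 + aa))" using h aa by (intro powr_mono2) (auto simp: h_def)
 also have "\<dots> = m / (2 * D)" using m D aa by (simp add: powr_powr)
 finally have "D * h powr (1 / (1 + aa)) <= D * (m / (2 * D))" using D by (intro mult_left_mono) auto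
 then show False using below[OF h] m D by simp
qed

end

context ancient_front
begin

section \<open>Scaling, positive speed and the curvature equation\<close>

lemma scaled:
 assumes l: "l > 0"
 shows "ancient_front aa D (%tt h. s tt (l * h) / l powr (1 / (1 + aa)))"
proof -
 define b where "b = 1 / (1 + aa)"
 define m where "m = l powr b"
 have m: "m > 0" using l by (simp add: m_def)
 have lh: "l * h > 0" if "h > 0" for h using l that by simp
 have pw: "(l * h) powr b / m = h powr b" for h using l by (simp add: m_def powr_mult)
 have touchA: "touch_above s (m *\<^sub>R z) (m * c) (m * v / l) (m * M / l^2) tt (l * h)"
  if "touch_above (%tt h. s tt (l * h) / m) z c v M tt h" for z c v M tt h
 proof -
  obtain dl where dl: "dl > 0" "s tt (l * h) / m = z \<bullet> edir tt + c"
   "!!ph k. \<bar>ph - tt\<bar> < dl ==> \<bar>k - h\<bar> < dl ==> s ph (l * k) / m <= z \<bullet> edir ph + c + v * (k - h) + M * (k - h)^2"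
   using \<open>touch_above (%tt h. s tt (l * h) / m) z c v M tt h\<close> unfolding touch_above_def by metis
  show ?thesis unfolding touch_above_def
  proof (intro conjI exI[of _ "min dl (l * dl)"] allI impI)
   show "s tt (l * h) = (m *\<^sub>R z) \<bullet> edir tt + m * c" using dl(2) m by (simp add: field_simps)
   fix ph k assume *: "\<bar>ph - tt\<bar> < min dl (l * dl)" "\<bar>k - l * h\<bar> < min dl (l * dl)"
   have kh: "k / l - h = (k - l * h) / l" using l by (simp add: field_simps)
   have "\<bar>k / l - h\<bar> < dl" using * l unfolding kh by (simp add: abs_divide pos_divide_less_eq mult.commute)
   from dl(3)[OF _ this, of ph] * have "s ph k <= m * (z \<bullet> edir ph + c + v * (k / l - h) + M * (k / l - h)^2)"
    using l m by (simp add: pos_divide_le_eq mult.commute)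
   then show "s ph k <= (m *\<^sub>R z) \<bullet> edir ph + m * c + m * v / l * (k - l * h) + m * M / l^2 * (k - l * h)^2"
    unfolding kh by (simp add: distrib_left power_divide)
  qed (use dl(1) l in auto)
 qed
 have touchB: "touch_below s (m *\<^sub>R z) (m * c) (m * v / l) (m * M / l^2) tt (l * h)"
  if "touch_below (%tt h. s tt (l * h) / m) z c v M tt h" for z c v M tt h
 proof -
  obtain dl where dl: "dl > 0" "s tt (l * h) / m = z \<bullet> edir tt + c"
   "!!ph k. \<bar>ph - tt\<bar> < dl ==> \<bar>k - h\<bar> < dl ==> z \<bullet> edir ph + c + v * (k - h) - M * (k - h)^2 <= s ph (l * k) / m"
   using \<open>touch_below (%tt h. s tt (l * h) / m) z c v M tt h\<close> unfolding touch_below_def by metis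
  show ?thesis unfolding touch_below_def
  proof (intro conjI exI[of _ "min dl (l * dl)"] allI impI)
   show "s tt (l * h) = (m *\<^sub>R z) \<bullet> edir tt + m * c" using dl(2) m by (simp add: field_simps)
   fix ph k assume *: "\<bar>ph - tt\<bar> < min dl (l * dl)" "\<bar>k - l * h\<bar> < min dl (l * dl)"
   have kh: "k / l - h = (k - l * h) / l" using l by (simp add: field_simps)
   have "\<bar>k / l - h\<bar> < dl" using * l unfolding kh by (simp add: abs_divide pos_divide_less_eq mult.commute)
   from dl(3)[OF _ this, of ph] * have "m * (z \<bullet> edir ph + c + v * (k / l - h) - M * (k / l - h)^2) <= s ph k"
    using l m by (simp add: pos_le_divide_eq mult.commute)
   then show "(m *\<^sub>R z) \<bullet> edir ph + m * c + m * v / l * (k - l * h) - m * M / l^2 * (k - l * h)^2 <= s ph k"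
    unfolding kh by (simp add: distrib_left right_diff_distrib[of m] power_divide)
  qed (use dl(1) l in auto)
 qed
 have vscale: "(m * v / l) powr (- (1 / aa)) = m * v powr (- (1 / aa))" if "v > 0" for v
 proof -
  have "m * v / l = l powr (b - 1) * v" using l by (simp add: m_def powr_diff)
  then have "(m * v / l) powr (- (1 / aa)) = l powr ((b - 1) * (- (1 / aa))) * v powr (- (1 / aa))" by (simp add: powr_mult powr_powr)
  also have "(b - 1) * (- (1 / aa)) = b" using aa by (simp add: b_def field_simps)
  finally show ?thesis by (simp add: m_def)
 qed
 show ?thesis unfolding b_def[symmetric] m_def[symmetric] ancient_front_def
 proof
  show "s (tt + 2 * pi) (l * h) / m = s tt (l * h) / m" if "0 < h" for h tt using periodic[OF lh[OF that]] by simp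
  show "trig_convex (%tt. s tt (l * h) / m)" if "0 < h" for h using trig_convex_scale[OF tc[OF lh[OF that]], of "1 / m"] m by simp
  show "\<bar>s tt (l * h) / m - s ph (l * h) / m\<bar> <= D * h powr (1 / (1 + aa)) * \<bar>tt - ph\<bar>" if "0 < h" for h tt ph
  proof -
   have "\<bar>s tt (l * h) - s ph (l * h)\<bar> / m <= D * (l * h) powr b * \<bar>tt - ph\<bar> / m"
    using lip[OF lh[OF that], of tt ph] m by (intro divide_right_mono) (auto simp: b_def)
   also have "\<dots> = D * ((l * h) powr b / m) * \<bar>tt - ph\<bar>" by simp
   finally show ?thesis using m unfolding pw by (simp add: b_def diff_divide_distrib[symmetric] abs_divide)
  qed
  show "concave_on {0<..} (%h. s tt (l * h) / m)" for tt unfolding concave_on_iff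
  proof (intro conjI ballI allI impI)
   fix h k t t' :: real assume *: "h \<in> {0<..}" "k \<in> {0<..}" "0 <= t" "0 <= t'" "t + t' = 1"
   then have t: "t = 1 - t'" by simp
   have "((1 - t') * s tt (l * h) + t' * s tt (l * k)) / m <= s tt ((1 - t') * (l * h) + t' * (l * k)) / m"
    using * l m by (intro divide_right_mono concave_ineq) auto
   moreover have "(1 - t') * (l * h) + t' * (l * k) = l * ((1 - t') * h + t' * k)" by (simp add: algebra_simps)
   ultimately show "t * (s tt (l * h) / m) + t' * (s tt (l * k) / m) <= s tt (l * (t *\<^sub>R h + t' *\<^sub>R k)) / m"
    unfolding t by (simp add: add_divide_distrib)
  qed simp
  show "s tt (l * h) / m <= s tt (l * k) / m" if "0 < h" "h <= k" for h k tt
   using mono[OF lh[OF that(1)], of "l * k" tt] that l m by (simp add: divide_right_mono)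
  show "0 <= s tt (l * h) / m" if "0 < h" for h tt using nonneg[OF lh[OF that]] m by simp
  show "s tt (l * h) / m <= D * h powr (1 / (1 + aa))" if "0 < h" for h tt
  proof -
   have "s tt (l * h) / m <= D * (l * h) powr b / m" using upper[OF lh[OF that]] m by (intro divide_right_mono) (auto simp: b_def)
   also have "\<dots> = D * ((l * h) powr b / m)" by simp
   finally show ?thesis unfolding pw by (simp add: b_def)
  qed
  show "outer_bound aa 0 c v" if h: "0 < h" and c: "0 < c" and t: "touch_above (%tt h. s tt (l * h) / m) z c v M tt h" for h c v M z tt
  proof -
   have "m * c > 0" using m c by simp
   from outer[OF lh[OF h] this touchA[OF t]] have o: "m * v / l > 0"
    "(1 / (m * v / l)^2) powr (1 / (2 * aa) - 1 / 2) * (1 / (m * v / l)) <= m * c" unfolding outer_bound_def by simp_all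
   have v: "v > 0" using o(1) m l by (simp add: zero_less_divide_iff zero_less_mult_iff)
   have "m * v powr (- (1 / aa)) <= m * c" using o(2) unfolding speed_powr[OF o(1) aa] vscale[OF v] .
   then have "v powr (- (1 / aa)) <= c" using m by simp
   then show ?thesis unfolding outer_bound_def using v speed_powr[OF v aa] by simp
  qed
  show "inner_bound aa 0 c v M" if h: "0 < h" and c: "0 < c" and v: "0 < v" and M: "0 < M" and t: "touch_below (%tt h. s tt (l * h) / m) z c v M tt h" for h c v M z tt
  proof -
   have p: "m * c > 0" "m * v / l > 0" "m * M / l^2 > 0" using m c v M l by simp_all
   from inner[OF lh[OF h] p touchB[OF t]]
   have "1 <= (1 / (m * v / l)^2) powr (1 / (2 * aa) - 1 / 2) * (1 / (m * v / l)) * (1 / (m * c))" unfolding inner_bound_def by simp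
   then have "1 <= m * v powr (- (1 / aa)) * (1 / (m * c))" unfolding speed_powr[OF p(2) aa] vscale[OF v] .
   then have "1 <= v powr (- (1 / aa)) * (1 / c)" using m by simp
   then show ?thesis unfolding inner_bound_def using speed_powr[OF v aa] by simp
  qed
 qed (use aa in auto)
qed

lemma support_lower:
 assumes "D > 0" "h > 0"
 shows "D powr (- (1 / aa)) * h powr (1 / (1 + aa)) <= s tt h"
 using ancient_front.support_lower_unit[OF scaled[OF assms(2)] assms(1), of tt] assms(2) by (simp add: pos_le_divide_eq)

text \<open>The radius of curvature that the speed law prescribes; \<open>curvature\<close>
  identifies it with s'' + s.\<close>

definition rad :: "real => real => real" where "rad tt h = speed tt h powr (- (1 / aa))"

text \<open>The two-sided growth of s forces a gain of 1 between h and k, and by concavity the speed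
  at h accounts for it. As k depends only on h, D and aa, the bound is uniform over the
  class.\<close>

lemma speed_lower:
 assumes D: "D > 0" and h: "h > 0" and k: "h < k" "D * h powr (1 / (1 + aa)) + 1 <= D powr (- (1 / aa)) * k powr (1 / (1 + aa))"
 shows "1 / (k - h) <= speed tt h"
proof -
 have "1 <= s tt k - s tt h" using support_lower[OF D, of k tt] upper[OF h, of tt] k h by linarith
 also have "\<dots> <= speed tt h * (k - h)" using k h by (intro increment_le) auto
 finally show ?thesis using k by (simp add: pos_divide_le_eq)
qed

lemma speed_lower_height:
 assumes D: "D > 0"
 obtains k where "h < k" "D * h powr (1 / (1 + aa)) + 1 <= D powr (- (1 / aa)) * k powr (1 / (1 + aa))"
proof -
 define A where "A = (D * h powr (1 / (1 + aa)) + 1) / D powr (- (1 / aa))"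
 define k where "k = max (h + 1) (A powr (1 + aa))"
 have A: "A > 0" using D by (auto simp: A_def intro!: divide_pos_pos add_nonneg_pos)
 have "A = (A powr (1 + aa)) powr (1 / (1 + aa))" using A aa by (simp add: powr_powr)
 also have "\<dots> <= k powr (1 / (1 + aa))" using aa by (intro powr_mono2) (auto simp: k_def)
 finally have "D powr (- (1 / aa)) * A <= D powr (- (1 / aa)) * k powr (1 / (1 + aa))" by (intro mult_left_mono) auto
 moreover have "D powr (- (1 / aa)) * A = D * h powr (1 / (1 + aa)) + 1" using D by (simp add: A_def)
 ultimately show thesis by (intro that[of k]) (auto simp: k_def)
qed

lemma speed_pos: "D > 0 ==> h > 0 ==> speed tt h > 0"
proof -
 assume D: "D > 0" and h: "h > 0"
 obtain k where k: "h < k" "D * h powr (1 / (1 + aa)) + 1 <= D powr (- (1 / aa)) * k powr (1 / (1 + aa))" using speed_lower_height[OF D] by blast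
 have "0 < 1 / (k - h)" using k by simp
 then show ?thesis using speed_lower[OF D h k, of tt] by linarith
qed

text \<open>Speeds V slightly above and slightly below the actual one enclose the second difference;
  continuity of V powr (- 1 / aa) closes the gap.\<close>

lemma sdiff_limit:
 assumes D: "D > 0" and h: "h > 0"
 shows "((%r. sdiff r tt h / r^2) \<longlongrightarrow> rad tt h) (at_right 0)"
proof -
 define v where "v = speed tt h"
 have v: "v > 0" unfolding v_def by (rule speed_pos[OF D h])
 have g: "((%r. (2 * V powr (- (1 / aa)) * (1 - cos r)) / r^2) \<longlongrightarrow> V powr (- (1 / aa))) (at_right (0::real))" for V :: real
  by real_asymp
 have "isCont (%V. V powr (- (1 / aa))) v" using v by (intro continuous_intros) auto
 then have cp: "((%V. V powr (- (1 / aa))) \<longlongrightarrow> rad tt h) (at v within X)" for X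
  unfolding rad_def v_def[symmetric] by (rule filterlim_mono[OF isContD order_refl at_le]) auto
 have pos: "\<forall>\<^sub>F r in at_right 0. (0::real) < r" by (rule eventually_at_right_less)
 show ?thesis
 proof (rule order_tendstoI)
  fix a assume a: "a < rad tt h"
  from order_tendstoD(1)[OF cp a] eventually_at_right_less[of v] have "\<forall>\<^sub>F V in at_right v. a < V powr (- (1 / aa)) & v < V"
   by eventually_elim auto
  then obtain V where V: "a < V powr (- (1 / aa))" "v < V" using eventually_happens'[OF trivial_limit_at_right_real] by blast
  from eventually_sdiff_ge[OF h V(2)[unfolded v_def]] order_tendstoD(1)[OF g V(1)] pos
  show "\<forall>\<^sub>F r in at_right 0. a < sdiff r tt h / r^2" by eventually_elim (rule less_le_trans, assumption, simp add: divide_right_mono)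
 next
  fix a assume a: "rad tt h < a"
  have "\<forall>\<^sub>F V in at_left v. V < v" by (simp add: eventually_at_filter)
  with order_tendstoD(2)[OF cp a] order_tendstoD(1)[OF tendsto_ident_at v] have "\<forall>\<^sub>F V in at_left v. V powr (- (1 / aa)) < a & V < v & 0 < V"
   by eventually_elim auto
  then obtain V where V: "V powr (- (1 / aa)) < a" "V < v" "0 < V" using eventually_happens'[OF trivial_limit_at_left_real] by blast
  from eventually_sdiff_le[OF h V(3) V(2)[unfolded v_def]] order_tendstoD(2)[OF g V(1)] pos
  show "\<forall>\<^sub>F r in at_right 0. sdiff r tt h / r^2 < a"
   by eventually_elim (rule le_less_trans[rotated], assumption, simp add: divide_right_mono)
 qed
qed

lemma cont_rad: "D > 0 ==> h > 0 ==> isCont (%tt. rad tt h) tt"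
 unfolding rad_def using speed_pos[of h tt] by (intro continuous_intros cont_speed) auto

lemma curvature:
 assumes D: "D > 0" and h: "h > 0"
 obtains s' where "!!tt. DERIV (%tt. s tt h) tt :> s' tt" "!!tt. DERIV s' tt :> rad tt h - s tt h"
 using trig_second_difference_imp_deriv[OF cont_level[OF h] cont_rad[OF D h] sdiff_limit[OF D h, unfolded sdiff_def]] by blast

end

section \<open>Rigidity of limit fronts\<close>

text \<open>The level at which the expanding circle ((1 + aa) * h) powr (1 / (1 + aa)) has radius 1
  and speed 1.\<close>

definition unit_level :: "real => real" where "unit_level aa = 1 / (1 + aa)"

context ancient_front
begin

lemma speed_periodic: "h > 0 ==> speed (tt + 2 * pi) h = speed tt h"
proof -
 assume h: "h > 0"
 have "slopeR (tt + 2 * pi) h n = slopeR tt h n" for n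
  using periodic[of h tt] periodic[of "h + step h n" tt] h step[OF h, of n] by (simp add: slopeR_def)
 then have "slopeR (tt + 2 * pi) h = slopeR tt h" by (rule ext)
 then show ?thesis by (simp add: speed_def)
qed

lemma height_deriv: "h > 0 ==> DERIV (s tt) h :> speed tt h" unfolding has_field_derivative_iff
proof (rule LIM_zero_cancel)
 assume h: "h > 0"
 have lim: "((%x. \<bar>speed tt x - speed tt h\<bar>) \<longlongrightarrow> 0) (at h)"
  using isContD[OF cont_speed_height[OF h, of tt]] by (simp add: tendsto_rabs_zero_iff LIM_zero_iff)
 have "\<forall>\<^sub>F x in at h. 0 < x" using h by (intro order_tendstoD(1)[OF tendsto_ident_at])
 moreover have "\<forall>\<^sub>F x in at h. x ~= h" by (simp add: eventually_at_filter)
 ultimately have "\<forall>\<^sub>F x in at h. norm ((s tt x - s tt h) / (x - h) - speed tt h) <= \<bar>speed tt x - speed tt h\<bar>"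
 proof eventually_elim
  case (elim x)
  show ?case
  proof (cases "x > h")
   case True
   then have "speed tt x <= (s tt x - s tt h) / (x - h)" "(s tt x - s tt h) / (x - h) <= speed tt h"
    using speed_le_slope[of h x tt] speeds(4)[of h x tt] h by auto
   then show ?thesis by simp
  next
   case False
   then have "speed tt h <= (s tt h - s tt x) / (h - x)" "(s tt h - s tt x) / (h - x) <= speed tt x"
    using speed_le_slope[of x h tt] speeds(4)[of x h tt] elim by auto
   moreover have "(s tt x - s tt h) / (x - h) = (s tt h - s tt x) / (h - x)" by (metis minus_diff_eq minus_divide_divide)
   ultimately show ?thesis by simp
  qed
 qed
 then show "((%x. (s tt x - s tt h) / (x - h) - speed tt h) \<longlongrightarrow> 0) (at h)" by (rule Lim_null_comparison[OF _ lim])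
qed

abbreviation lev where "lev \<equiv> unit_level aa"

text \<open>The first variation of \<open>energy\<close> in \<open>s\<close> is \<open>s'' + s - s powr (- 1 / aa)\<close>, as \<open>rad\<close> is \<open>s'' + s\<close>.\<close>

definition energy :: real where
 "energy = integral {0..2 * pi} (%tt. s tt lev * rad tt lev / 2 - powr_primitive (1 / aa) (s tt lev))"

end

section \<open>The compact class of limit fronts and its energy\<close>

lemma powr_primitive_lipschitz:
 assumes "0 < m" "m <= x" "m <= y" "q > 0"
 shows "\<bar>powr_primitive q x - powr_primitive q y\<bar> <= m powr (- q) * \<bar>x - y\<bar>"
proof -
 have "norm (powr_primitive q x - powr_primitive q y) <= m powr (- q) * norm (x - y)"
 proof (rule field_differentiable_bound[of "{m..}"])
  show "(powr_primitive q has_field_derivative t powr (- q)) (at t within {m..})" if "t \<in> {m..}" for t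
   using powr_primitive_deriv[of t q] that assms by (auto intro: has_field_derivative_at_within)
  show "norm (t powr (- q)) <= m powr (- q)" if "t \<in> {m..}" for t using that assms by (auto intro!: powr_mono2')
 qed (use assms in auto)
 then show ?thesis by simp
qed

context
 fixes aa D :: real
 assumes D: "D > 0" and aa12: "aa > 1 / 2"
begin

abbreviation G where "G \<equiv> ancient_front aa D"
abbreviation lv where "lv \<equiv> unit_level aa"
abbreviation sp where "sp \<equiv> ancient_front.speed"
abbreviation rd where "rd \<equiv> ancient_front.rad aa"
abbreviation en where "en \<equiv> ancient_front.energy aa"

text \<open>Derivatives of concave functions converge along with the functions wherever the limit is
  differentiable: a fixed chord on either side of h bounds the speeds of all but finitely many
  members.\<close>

lemma speed_tendsto:
 assumes fr: "!!n. G (sn n)" "G s" and lim: "!!tt h. h > 0 ==> (%n. sn n tt h) \<longlonglongrightarrow> s tt h" and h: "h > 0"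
 shows "(%n. sp (sn n) tt h) \<longlonglongrightarrow> sp s tt h"
proof (rule order_tendstoI)
 interpret ancient_front aa D s by (rule fr)
 fix a assume "a < speed tt h"
 from order_tendstoD(1)[OF speeds(1)[OF h] this] obtain n where n: "a < slopeR tt h n" using eventually_happens'[OF sequentially_bot] by blast
 define k where "k = h + step h n"
 have k: "k > h" "a < (s tt k - s tt h) / (k - h)" using n step[OF h, of n] by (auto simp: k_def slopeR_def)
 have "(%m. (sn m tt k - sn m tt h) / (k - h)) \<longlonglongrightarrow> (s tt k - s tt h) / (k - h)" using k h by (intro tendsto_intros lim) auto
 from order_tendstoD(1)[OF this k(2)] show "\<forall>\<^sub>F m in sequentially. a < sp (sn m) tt h"
  by eventually_elim (use ancient_front.speeds(4)[OF fr(1) h k(1)] in \<open>blast intro: less_le_trans\<close>)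
next
 interpret ancient_front aa D s by (rule fr)
 fix a assume "speed tt h < a"
 then have "speedL tt h < a" using speedL_eq[OF h] by simp
 from order_tendstoD(2)[OF speeds(2)[OF h] this] obtain n where n: "slopeL tt h n < a" using eventually_happens'[OF sequentially_bot] by blast
 define k where "k = h - step h n"
 have k: "k < h" "k > 0" "(s tt h - s tt k) / (h - k) < a" using n step[OF h, of n] by (auto simp: k_def slopeL_def)
 have "(%m. (sn m tt h - sn m tt k) / (h - k)) \<longlonglongrightarrow> (s tt h - s tt k) / (h - k)" using k h by (intro tendsto_intros lim) auto
 from order_tendstoD(2)[OF this k(3)] show "\<forall>\<^sub>F m in sequentially. sp (sn m) tt h < a"
  by eventually_elim (use ancient_front.speed_le_slope[OF fr(1) k(2,1)] in \<open>blast intro: le_less_trans\<close>)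
qed

lemma lv_pos: "0 < lv" "lv < 1" using aa12 unfolding unit_level_def by auto

lemma class_bounds:
 obtains m B P where "m > 0" "P > 0" "!!s tt. G s ==> m <= s tt lv" "!!s tt. G s ==> s tt lv <= B"
  "!!s tt. G s ==> 0 <= rd s tt lv & rd s tt lv <= P"
proof (cases "\<exists>s. G s")
 case True
 then obtain s0 where s0: "G s0" by blast
 \<comment> \<open>k involves only D and aa, so the resulting bound on the speed serves every member
   of the class.\<close>
 obtain k where k: "lv < k" "D * lv powr (1 / (1 + aa)) + 1 <= D powr (- (1 / aa)) * k powr (1 / (1 + aa))"
  using ancient_front.speed_lower_height[OF s0 D] by blast
 show thesis
 proof (rule that)
  show "D powr (- (1 / aa)) * lv powr (1 / (1 + aa)) > 0" "(1 / (k - lv)) powr (- (1 / aa)) > 0" using D lv_pos k by auto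
  fix s tt assume s: "G s"
  show "D powr (- (1 / aa)) * lv powr (1 / (1 + aa)) <= s tt lv" by (rule ancient_front.support_lower[OF s D lv_pos(1)])
  show "s tt lv <= D * lv powr (1 / (1 + aa))" using s lv_pos unfolding ancient_front_def by (intro front.upper) auto
  have "1 / (k - lv) <= sp s tt lv" by (rule ancient_front.speed_lower[OF s D lv_pos(1) k])
  then show "0 <= rd s tt lv & rd s tt lv <= (1 / (k - lv)) powr (- (1 / aa))"
   unfolding ancient_front.rad_def[OF s] using k aa12 by (auto intro!: powr_mono2')
 qed
qed (use that[of 1 1 1] in auto)

lemma cont_fields:
 assumes "G s"
 shows "continuous_on X (%tt. s tt lv)" "continuous_on X (%tt. rd s tt lv)" "continuous_on X (%tt. sp s tt lv)"
  "continuous_on X (%tt. powr_primitive q (s tt lv))"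
proof -
 interpret ancient_front aa D s by (rule assms)
 show c: "continuous_on X (%tt. s tt lv)" "continuous_on X (%tt. rd s tt lv)" "continuous_on X (%tt. sp s tt lv)"
  using lv_pos by (auto intro!: continuous_at_imp_continuous_on cont_level cont_rad[OF D] cont_speed)
 obtain m where m: "m > 0" "!!tt. m <= s tt lv" using class_bounds assms by metis
 have "continuous_on {0<..} (powr_primitive q)" using powr_primitive_deriv[of _ q] by (intro continuous_at_imp_continuous_on ballI DERIV_isCont) auto
 then show "continuous_on X (%tt. powr_primitive q (s tt lv))"
  by (rule continuous_on_compose2[OF _ c(1)]) (use m in \<open>auto intro: less_le_trans\<close>)
qed

lemma integrable_fields: "continuous_on {0..2 * pi} f ==> f integrable_on {0..2 * pi}" for f :: "real => real"
 by (rule integrable_continuous_interval)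

lemma rad_tendsto:
 assumes fr: "!!n. G (sn n)" "G s" and lim: "!!tt h. h > 0 ==> (%n. sn n tt h) \<longlonglongrightarrow> s tt h"
 shows "(%n. rd (sn n) tt lv) \<longlonglongrightarrow> rd s tt lv" unfolding ancient_front.rad_def[OF fr(1)] ancient_front.rad_def[OF fr(2)]
 using ancient_front.speed_pos[OF fr(2) D lv_pos(1), of tt] by (intro tendsto_powr[OF speed_tendsto[OF fr lim lv_pos(1)] tendsto_const]) auto

lemma energy_tendsto:
 assumes fr: "!!n. G (sn n)" "G s" and lim: "!!tt h. h > 0 ==> (%n. sn n tt h) \<longlonglongrightarrow> s tt h"
 shows "(%n. en (sn n)) \<longlonglongrightarrow> en s"
proof -
 obtain m B P where b: "m > 0" "P > 0" "!!s tt. G s ==> m <= s tt lv" "!!s tt. G s ==> s tt lv <= B"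
  "!!s tt. G s ==> 0 <= rd s tt lv & rd s tt lv <= P" by (rule class_bounds) (rule that)
 define F where "F = powr_primitive (1 / aa)"
 have cF: "isCont F t" if "t > 0" for t unfolding F_def using powr_primitive_deriv[OF that] by (rule DERIV_isCont)
 have "(%n. integral {0..2 * pi} (%tt. sn n tt lv * rd (sn n) tt lv / 2 - F (sn n tt lv))) \<longlonglongrightarrow>
  integral {0..2 * pi} (%tt. s tt lv * rd s tt lv / 2 - F (s tt lv))"
 proof (rule dominated_convergence(2)[where h = "%_. B * P / 2 + (\<bar>F m\<bar> + m powr (- (1 / aa)) * B)"])
  show "(%tt. sn n tt lv * rd (sn n) tt lv / 2 - F (sn n tt lv)) integrable_on {0..2 * pi}" for n
   unfolding F_def by (intro integrable_fields continuous_intros cont_fields fr) auto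
  show "(%n. sn n tt lv * rd (sn n) tt lv / 2 - F (sn n tt lv)) \<longlonglongrightarrow> s tt lv * rd s tt lv / 2 - F (s tt lv)" for tt
   using b(1) b(3)[OF fr(2), of tt]
   by (intro tendsto_diff tendsto_divide tendsto_mult tendsto_const rad_tendsto[OF fr lim] lim[OF lv_pos(1)] isCont_tendsto_compose[OF cF]) auto
  show "norm (sn n tt lv * rd (sn n) tt lv / 2 - F (sn n tt lv)) <= B * P / 2 + (\<bar>F m\<bar> + m powr (- (1 / aa)) * B)" for n tt
  proof -
   define x where "x = sn n tt lv"
   have x: "m <= x" "x <= B" using b(3,4)[OF fr(1)] by (auto simp: x_def)
   have "\<bar>F x - F m\<bar> <= m powr (- (1 / aa)) * \<bar>x - m\<bar>" unfolding F_def using b(1) x aa12 by (intro powr_primitive_lipschitz) auto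
   also have "\<dots> <= m powr (- (1 / aa)) * B" using x b(1) by (intro mult_left_mono) auto
   finally have 1: "\<bar>F x\<bar> <= \<bar>F m\<bar> + m powr (- (1 / aa)) * B" by linarith
   have "x * rd (sn n) tt lv <= B * P" "0 <= x * rd (sn n) tt lv" using x b(1) b(5)[OF fr(1), of n tt] by (auto intro!: mult_mono)
   then show ?thesis using 1 unfolding x_def[symmetric] by simp
  qed
 qed (auto intro: integrable_fields)
 then show ?thesis unfolding ancient_front.energy_def[OF fr(1)] ancient_front.energy_def[OF fr(2)] F_def .
qed

text \<open>The operator s'' + s is symmetric on the circle: the difference of the integrands is the
  derivative of a periodic Wronskian.\<close>

lemma energy_symmetric:
 assumes s: "G s" and t: "G t"
 shows "integral {0..2 * pi} (%tt. s tt lv * rd t tt lv) = integral {0..2 * pi} (%tt. t tt lv * rd s tt lv)"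
proof -
 obtain s' where s': "!!tt. DERIV (%tt. s tt lv) tt :> s' tt" "!!tt. DERIV s' tt :> rd s tt lv - s tt lv" using ancient_front.curvature[OF s D lv_pos(1)] by blast
 obtain t' where t': "!!tt. DERIV (%tt. t tt lv) tt :> t' tt" "!!tt. DERIV t' tt :> rd t tt lv - t tt lv" using ancient_front.curvature[OF t D lv_pos(1)] by blast
 have per: "f (0 + 2 * pi) = f 0 & f' (2 * pi) = f' 0" if "!!x. f (x + 2 * pi) = f x" "!!x. DERIV f x :> f' x" for f f' :: "real => real"
 proof -
  have "DERIV (%x. f (x + 2 * pi)) 0 :> f' (0 + 2 * pi)" using that(2)[of "0 + 2 * pi"] by (simp only: DERIV_shift)
  then have "DERIV f 0 :> f' (2 * pi)" using that(1) by simp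
  from DERIV_unique[OF this that(2)] show ?thesis using that(1)[of 0] by simp
 qed
 have p: "s (0 + 2 * pi) lv = s 0 lv & s' (2 * pi) = s' 0" "t (0 + 2 * pi) lv = t 0 lv & t' (2 * pi) = t' 0"
  using per[of "%tt. s tt lv", OF front.periodic[OF s[unfolded ancient_front_def] lv_pos(1)] s'(1)]
   per[of "%tt. t tt lv", OF front.periodic[OF t[unfolded ancient_front_def] lv_pos(1)] t'(1)] by auto
 define W where "W tt = s tt lv * t' tt - t tt lv * s' tt" for tt
 have "((%tt. s tt lv * rd t tt lv - t tt lv * rd s tt lv) has_integral (W (2 * pi) - W 0)) {0..2 * pi}"
 proof (rule fundamental_theorem_of_calculus)
  fix tt assume "tt \<in> {0..2 * pi}"
  have "DERIV W tt :> s tt lv * rd t tt lv - t tt lv * rd s tt lv" unfolding W_def by (auto intro!: derivative_eq_intros s' t' simp: algebra_simps)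
  then show "(W has_vector_derivative s tt lv * rd t tt lv - t tt lv * rd s tt lv) (at tt within {0..2 * pi})"
   by (simp add: has_real_derivative_iff_has_vector_derivative has_vector_derivative_at_within)
 qed simp
 moreover have "W (2 * pi) = W 0" using p by (simp add: W_def)
 ultimately have "integral {0..2 * pi} (%tt. s tt lv * rd t tt lv - t tt lv * rd s tt lv) = 0" by (simp add: integral_unique)
 moreover have "integral {0..2 * pi} (%tt. s tt lv * rd t tt lv - t tt lv * rd s tt lv) =
  integral {0..2 * pi} (%tt. s tt lv * rd t tt lv) - integral {0..2 * pi} (%tt. t tt lv * rd s tt lv)"
  by (intro Henstock_Kurzweil_Integration.integral_diff integrable_fields continuous_intros cont_fields s t)
 ultimately show ?thesis by simp
qed

definition blow :: "(real => real => real) => real => real => real => real" where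
 "blow s l tt h = s tt (l * h) / l powr (1 / (1 + aa))"

lemma blow: "G s ==> l > 0 ==> G (blow s l)" unfolding blow_def[abs_def] by (rule ancient_front.scaled)

lemma blow_deriv:
 assumes s: "G s" and l: "l > 0"
 shows "DERIV (%l. blow s l tt lv) l :> (sp s tt (l * lv) * lv - s tt (l * lv) * lv / l) / l powr lv"
proof -
 have lh: "l * lv > 0" using l lv_pos by simp
 have lve: "1 / (1 + aa) = lv" using unit_level_def by simp
 have "DERIV (%l. s tt (l * lv)) l :> sp s tt (l * lv) * lv"
  by (rule DERIV_chain2[where f = "s tt" and g = "%l. l * lv", OF ancient_front.height_deriv[OF s lh]]) (auto intro!: derivative_eq_intros)
 moreover have "DERIV (%l. l powr (- lv)) l :> - lv * l powr (- lv - 1)" using l by (auto intro!: derivative_eq_intros)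
 ultimately have "DERIV (%l. s tt (l * lv) * l powr (- lv)) l :>
   sp s tt (l * lv) * lv * l powr (- lv) + (- lv * l powr (- lv - 1)) * s tt (l * lv)" by (rule DERIV_mult)
 moreover have "l powr (- lv - 1) = l powr (- lv) / l" using l by (simp add: powr_diff)
 ultimately show ?thesis unfolding blow_def lve by (simp add: powr_minus_divide diff_divide_distrib mult_ac)
qed

text \<open>Uniform in the angle, as the domination of difference quotients in the scale
  requires.\<close>

lemma blow_lipschitz:
 assumes s: "G s" and l: "1 / 2 <= l" "l <= 2"
 shows "\<bar>blow s l tt lv - s tt lv\<bar> <= 8 * (D * (2 * lv) powr lv) * \<bar>l - 1\<bar>"
proof -
 interpret ancient_front aa D s by (rule s)
 define A where "A = D * (2 * lv) powr lv"
 have A: "A >= 0" using D by (simp add: A_def)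
 have "norm (blow s l tt lv - blow s 1 tt lv) <= 8 * A * norm (l - 1)"
 proof (rule field_differentiable_bound[of "{1/2..2}"])
  fix x :: real assume x: "x \<in> {1/2..2}"
  then have xp: "x > 0" and xl: "x * lv > 0" using lv_pos by auto
  show "((%l. blow s l tt lv) has_field_derivative (sp s tt (x * lv) * lv - s tt (x * lv) * lv / x) / x powr lv) (at x within {1/2..2})"
   by (rule has_field_derivative_at_within[OF blow_deriv[OF s xp]])
  have "(x * lv) powr (1 / (1 + aa)) <= (2 * lv) powr lv" unfolding unit_level_def[symmetric] using x lv_pos by (intro powr_mono2) auto
  then have "D * (x * lv) powr (1 / (1 + aa)) <= A" unfolding A_def using D by (intro mult_left_mono) auto
  then have sA: "0 <= s tt (x * lv)" "s tt (x * lv) <= A" using upper[OF xl, of tt] nonneg[OF xl, of tt] by linarith+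
  have sx: "s tt (x * lv) / x <= 2 * A" using frac_le[OF order_trans[OF sA] sA(2), of "1 / 2" x] x by simp
  have "sp s tt (x * lv) * (x * lv) <= s tt (x * lv)" by (rule speed_upper[OF xl])
  then have "sp s tt (x * lv) * lv <= s tt (x * lv) / x" using xp by (simp add: pos_le_divide_eq mult_ac)
  then have 1: "0 <= sp s tt (x * lv) * lv" "sp s tt (x * lv) * lv <= 2 * A" using sx speed_nonneg[OF xl, of tt] lv_pos by auto
  have "s tt (x * lv) / x * lv <= 2 * A * 1" using sx sA xp lv_pos by (intro mult_mono) auto
  then have 2: "0 <= s tt (x * lv) * lv / x" "s tt (x * lv) * lv / x <= 2 * A" using sA xp lv_pos by auto
  have "(1 / 2) powr 1 <= (1 / 2) powr lv" using lv_pos by (intro powr_mono') auto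
  also have "\<dots> <= x powr lv" using x lv_pos by (intro powr_mono2) auto
  finally have 3: "1 / 2 <= x powr lv" by simp
  have "\<bar>sp s tt (x * lv) * lv - s tt (x * lv) * lv / x\<bar> <= 4 * A" using 1 2 A by (simp add: abs_le_iff)
  then have "\<bar>(sp s tt (x * lv) * lv - s tt (x * lv) * lv / x) / x powr lv\<bar> <= (4 * A) / (1 / 2)"
   unfolding abs_divide using 3 A by (intro frac_le) auto
  then show "norm ((sp s tt (x * lv) * lv - s tt (x * lv) * lv / x) / x powr lv) <= 8 * A" by simp
 qed (use l in auto)
 then show ?thesis by (simp add: A_def blow_def)
qed

text \<open>By symmetry the quadratic part changes by the integral of (t - s) * (rad t + rad s) / 2.
  Thus only s is differentiated in the scale, whereas convergence of the radii of curvature is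
  enough.\<close>

lemma energy_variation:
 assumes s: "G s" and l: "!!n. l n \<in> {1/2..2} - {1}" "l \<longlonglongrightarrow> 1"
 shows "(%n. (en (blow s (l n)) - en s) / (l n - 1)) \<longlonglongrightarrow>
  integral {0..2 * pi} (%tt. lv * (sp s tt lv - s tt lv) * (rd s tt lv - s tt lv powr (- (1 / aa))))"
proof -
 obtain m B P where b: "m > 0" "P > 0" "!!s tt. G s ==> m <= s tt lv" "!!s tt. G s ==> s tt lv <= B"
  "!!s tt. G s ==> 0 <= rd s tt lv & rd s tt lv <= P" by (rule class_bounds) (rule that)
 define F where "F = powr_primitive (1 / aa)"
 define t where "t n = blow s (l n)" for n
 have lpos: "l n > 0" "l n ~= 1" for n using l(1)[of n] by auto
 have t: "G (t n)" for n unfolding t_def by (rule blow[OF s lpos(1)])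
 have tlim: "(%n. t n tt h) \<longlonglongrightarrow> s tt h" if "h > 0" for tt h
 proof -
  have "isCont (s tt) (1 * h)" using ancient_front.cont_height[OF s that] by simp
  then have "(%n. s tt (l n * h) / l n powr (1 / (1 + aa))) \<longlonglongrightarrow> s tt (1 * h) / 1 powr (1 / (1 + aa))"
   by (intro tendsto_intros isCont_tendsto_compose[of _ "s tt"] l(2)) auto
  then show ?thesis by (simp add: t_def blow_def)
 qed
 define C where "C = 8 * (D * (2 * lv) powr lv)"
 have lip: "\<bar>t n tt lv - s tt lv\<bar> <= C * \<bar>l n - 1\<bar>" for n tt using blow_lipschitz[OF s] l(1)[of n] by (simp add: t_def C_def)
 define Q where "Q n tt = (t n tt lv - s tt lv) / (l n - 1)" for n tt
 define R where "R n tt = (F (t n tt lv) - F (s tt lv)) / (l n - 1)" for n tt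
 have Qb: "\<bar>Q n tt\<bar> <= C" for n tt using lip[of n tt] lpos(2)[of n] by (simp add: Q_def abs_divide pos_divide_le_eq)
 have Rb: "\<bar>R n tt\<bar> <= m powr (- (1 / aa)) * C" for n tt
 proof -
  have "\<bar>F (t n tt lv) - F (s tt lv)\<bar> <= m powr (- (1 / aa)) * \<bar>t n tt lv - s tt lv\<bar>"
   unfolding F_def using b(1) b(3)[OF t] b(3)[OF s] aa12 by (intro powr_primitive_lipschitz) auto
  also have "\<dots> <= m powr (- (1 / aa)) * (C * \<bar>l n - 1\<bar>)" by (intro mult_left_mono lip) simp
  finally show ?thesis using lpos(2)[of n] by (simp add: R_def abs_divide pos_divide_le_eq mult.assoc)
 qed
 have lat: "filterlim l (at 1) sequentially" using l(2) lpos(2) by (simp add: filterlim_at)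
 have s1: "blow s 1 tt lv = s tt lv" for tt by (simp add: blow_def)
 have d1: "DERIV (%l. blow s l tt lv) 1 :> lv * (sp s tt lv - s tt lv)" for tt
  using blow_deriv[OF s zero_less_one, of tt] by (simp add: algebra_simps)
 have Ql: "(%n. Q n tt) \<longlonglongrightarrow> lv * (sp s tt lv - s tt lv)" for tt
  using filterlim_compose[OF d1[unfolded has_field_derivative_iff] lat] by (simp add: Q_def t_def s1)
 have Rl: "(%n. R n tt) \<longlonglongrightarrow> s tt lv powr (- (1 / aa)) * (lv * (sp s tt lv - s tt lv))" for tt
 proof -
  have "DERIV F (blow s 1 tt lv) :> s tt lv powr (- (1 / aa))" unfolding F_def s1 using b(1) b(3)[OF s, of tt] by (intro powr_primitive_deriv) simp
  from DERIV_chain2[OF this d1] have "DERIV (%l. F (blow s l tt lv)) 1 :> s tt lv powr (- (1 / aa)) * (lv * (sp s tt lv - s tt lv))" .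
  from filterlim_compose[OF this[unfolded has_field_derivative_iff] lat] show ?thesis by (simp add: R_def t_def s1)
 qed
 have I: "f integrable_on {0..2 * pi}" if "continuous_on {0..2 * pi} f" for f :: "real => real" using that by (rule integrable_fields)
 note ci = continuous_intros cont_fields[OF s] cont_fields[OF t]
 have lin: "integral X (%tt. p tt + (q tt - r tt) / 2) = integral X p + (integral X q - integral X r) / 2"
  if "p integrable_on X" "q integrable_on X" "r integrable_on X" for p q r :: "real => real" and X
  using that by (simp add: Henstock_Kurzweil_Integration.integral_add Henstock_Kurzweil_Integration.integral_diff integrable_diff)
 have al: "((x * p / 2 - f) - (y * q / 2 - g) + (x * q - y * p) / 2) / d = (x - y) / d * (p + q) / 2 - (f - g) / d" for x p f y q g d :: real
 proof -
  have "(x * p / 2 - f) - (y * q / 2 - g) + (x * q - y * p) / 2 = (x - y) * ((p + q) / 2) - (f - g)" by (simp add: field_simps)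
  then show ?thesis by (simp only: diff_divide_distrib[of "_ / 2"] times_divide_eq_left times_divide_eq_right divide_divide_eq_left mult.commute)
 qed
 have eq: "(en (t n) - en s) / (l n - 1) = integral {0..2 * pi} (%tt. Q n tt * (rd (t n) tt lv + rd s tt lv) / 2 - R n tt)" for n
 proof -
  have "en (t n) - en s = integral {0..2 * pi} (%tt. (t n tt lv * rd (t n) tt lv / 2 - F (t n tt lv)) - (s tt lv * rd s tt lv / 2 - F (s tt lv)))"
   unfolding ancient_front.energy_def[OF s] ancient_front.energy_def[OF t] F_def
   by (rule Henstock_Kurzweil_Integration.integral_diff[symmetric]) (intro I ci; simp)+
  \<comment> \<open>A zero term, by symmetry, that turns the difference of products into the product
    of difference and sum.\<close>
  also have "\<dots> = integral {0..2 * pi} (%tt. (t n tt lv * rd (t n) tt lv / 2 - F (t n tt lv)) - (s tt lv * rd s tt lv / 2 - F (s tt lv)))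
   + (integral {0..2 * pi} (%tt. t n tt lv * rd s tt lv) - integral {0..2 * pi} (%tt. s tt lv * rd (t n) tt lv)) / 2"
   using energy_symmetric[OF s t] by simp
  also have "\<dots> = integral {0..2 * pi} (%tt. ((t n tt lv * rd (t n) tt lv / 2 - F (t n tt lv)) - (s tt lv * rd s tt lv / 2 - F (s tt lv)))
   + (t n tt lv * rd s tt lv - s tt lv * rd (t n) tt lv) / 2)" unfolding F_def by (rule lin[symmetric]) (intro I ci; simp)+
  finally have "en (t n) - en s = integral {0..2 * pi} (%tt. ((t n tt lv * rd (t n) tt lv / 2 - F (t n tt lv)) - (s tt lv * rd s tt lv / 2 - F (s tt lv)))
   + (t n tt lv * rd s tt lv - s tt lv * rd (t n) tt lv) / 2)" .
  then have "(en (t n) - en s) / (l n - 1) = integral {0..2 * pi} (%tt. (((t n tt lv * rd (t n) tt lv / 2 - F (t n tt lv)) - (s tt lv * rd s tt lv / 2 - F (s tt lv)))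
   + (t n tt lv * rd s tt lv - s tt lv * rd (t n) tt lv) / 2) / (l n - 1))" by simp
  also have "\<dots> = integral {0..2 * pi} (%tt. Q n tt * (rd (t n) tt lv + rd s tt lv) / 2 - R n tt)" unfolding Q_def R_def al ..
  finally show ?thesis .
 qed
 have "(%n. integral {0..2 * pi} (%tt. Q n tt * (rd (t n) tt lv + rd s tt lv) / 2 - R n tt)) \<longlonglongrightarrow>
  integral {0..2 * pi} (%tt. lv * (sp s tt lv - s tt lv) * (rd s tt lv - s tt lv powr (- (1 / aa))))"
 proof (rule dominated_convergence(2)[where h = "%_. C * (P + P) / 2 + m powr (- (1 / aa)) * C"])
  show "(%tt. Q n tt * (rd (t n) tt lv + rd s tt lv) / 2 - R n tt) integrable_on {0..2 * pi}" for n
   unfolding Q_def R_def F_def using lpos(2)[of n] by (intro I ci) auto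
  show "norm (Q n tt * (rd (t n) tt lv + rd s tt lv) / 2 - R n tt) <= C * (P + P) / 2 + m powr (- (1 / aa)) * C" for n tt
  proof -
   have "\<bar>Q n tt * (rd (t n) tt lv + rd s tt lv)\<bar> <= C * (P + P)"
    unfolding abs_mult using Qb[of n tt] b(5)[OF t[of n], of tt] b(5)[OF s, of tt] by (intro mult_mono) auto
   then show ?thesis using Rb[of n tt] by simp
  qed
  show "(%n. Q n tt * (rd (t n) tt lv + rd s tt lv) / 2 - R n tt) \<longlonglongrightarrow> lv * (sp s tt lv - s tt lv) * (rd s tt lv - s tt lv powr (- (1 / aa)))" for tt
  proof -
   have "(%n. Q n tt * (rd (t n) tt lv + rd s tt lv) / 2 - R n tt) \<longlonglongrightarrow>
    lv * (sp s tt lv - s tt lv) * (rd s tt lv + rd s tt lv) / 2 - s tt lv powr (- (1 / aa)) * (lv * (sp s tt lv - s tt lv))"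
    by (intro tendsto_intros Ql Rl rad_tendsto[OF t s tlim]) auto
   moreover have "lv * (sp s tt lv - s tt lv) * (rd s tt lv + rd s tt lv) / 2 - s tt lv powr (- (1 / aa)) * (lv * (sp s tt lv - s tt lv)) = lv * (sp s tt lv - s tt lv) * (rd s tt lv - s tt lv powr (- (1 / aa)))"
    by (simp add: field_simps)
   ultimately show ?thesis by (simp only:)
  qed
 qed (auto intro: I)
 then show ?thesis unfolding t_def[symmetric] eq .
qed

text \<open>The factor \<open>e\<close> treats maxima and minima together. Scales 1 + 1 / (n + 2)
  and 1 - 1 / (n + 2) give the derivative \<open>X\<close> opposite signs, so X = 0. Its integrand
  has one sign because x powr (- 1 / aa) decreases; hence speed and support function agree, and
  \<open>shrinker_unique\<close> applies with exponent 1 / aa < 2.\<close>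

lemma critical_unit:
 assumes s: "G s" and e: "e ~= (0::real)" and max: "!!t. G t ==> e * en t <= e * en s"
 shows "s tt lv = 1"
proof -
 interpret ancient_front aa D s by (rule s)
 define X where "X = integral {0..2 * pi} (%tt. lv * (sp s tt lv - s tt lv) * (rd s tt lv - s tt lv powr (- (1 / aa))))"
 have spos: "s tt lv > 0" for tt using support_lower[OF D lv_pos(1), of tt] D lv_pos by (auto intro: less_le_trans[rotated])
 have i: "(%n. inverse (real (Suc (Suc n)))) \<longlonglongrightarrow> 0" using LIMSEQ_Suc[OF LIMSEQ_inverse_real_of_nat] .
 have il: "0 < inverse (real (Suc (Suc n)))" "inverse (real (Suc (Suc n))) <= 1 / 2" for n by (auto simp: field_simps)
 have X: "(%n. e * ((en (blow s (1 + c * inverse (real (Suc (Suc n))))) - en s) / (c * inverse (real (Suc (Suc n)))))) \<longlonglongrightarrow> e * X"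
  if c: "c = 1 \<or> c = - 1" for c :: real
 proof -
  have "(%n. 1 + c * inverse (real (Suc (Suc n)))) \<longlonglongrightarrow> 1 + c * 0" by (intro tendsto_intros i)
  then have lim: "(%n. 1 + c * inverse (real (Suc (Suc n)))) \<longlonglongrightarrow> 1" by simp
  have mem: "1 + c * inverse (real (Suc (Suc n))) \<in> {1/2..2} - {1}" for n
  proof -
   define y where "y = inverse (real (Suc (Suc n)))"
   show ?thesis unfolding y_def[symmetric] using il[of n, folded y_def] c by auto
  qed
  from tendsto_mult[OF tendsto_const[of e] energy_variation[OF s mem lim]] show ?thesis by (simp add: X_def)
 qed
 have le: "e * (en (blow s (1 + c * inverse (real (Suc (Suc n))))) - en s) <= 0" if "c = 1 \<or> c = - 1" for c :: real and n
 proof -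
  define y where "y = inverse (real (Suc (Suc n)))"
  have "0 < 1 + c * y" using il[of n, folded y_def] that by auto
  from max[OF blow[OF s this]] show ?thesis by (simp add: right_diff_distrib y_def)
 qed
 have "e * X <= 0" by (rule LIMSEQ_le_const2[OF X[of 1]]) (use le[of 1] il in \<open>auto simp: mult_le_0_iff divide_le_0_iff\<close>)
 moreover have "e * X >= 0"
 proof (rule LIMSEQ_le_const[OF X[of "- 1"]], simp, intro exI allI impI)
  fix n :: nat
  have "0 <= e * (en (blow s (1 + (- 1) * inverse (real (Suc (Suc n))))) - en s) / ((- 1) * inverse (real (Suc (Suc n))))"
   using le[of "- 1" n] il(1)[of n] by (intro divide_nonpos_neg) auto
  then show "0 <= e * ((en (blow s (1 + (- 1) * inverse (real (Suc (Suc n))))) - en s) / ((- 1) * inverse (real (Suc (Suc n)))))" by simp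
 qed
 ultimately have X0: "X = 0" using e by (metis antisym mult_eq_0_iff)
 define g where "g tt = - (lv * (sp s tt lv - s tt lv) * (rd s tt lv - s tt lv powr (- (1 / aa))))" for tt
 have vpos: "sp s tt lv > 0" for tt by (rule speed_pos[OF D lv_pos(1)])
 have pm: "x powr (- (1 / aa)) < y powr (- (1 / aa))" if "0 < y" "y < x" for x y using that aa by (intro powr_less_mono2_neg) auto
 have gpos: "g tt > 0" if "sp s tt lv ~= s tt lv" for tt
 proof (cases "sp s tt lv < s tt lv")
  case True
  then show ?thesis using pm[OF vpos True] lv_pos unfolding g_def rad_def by (simp add: mult_less_0_iff mult_pos_neg mult_neg_pos)
 next
  case False
  then have "s tt lv < sp s tt lv" using that by simp
  from this pm[OF spos this] show ?thesis using lv_pos unfolding g_def rad_def by (simp add: mult_pos_neg)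
 qed
 have g0: "g tt = 0" if "sp s tt lv = s tt lv" for tt using that by (simp add: g_def)
 have "integral {0..2 * pi} g = 0" unfolding g_def using X0 by (simp add: X_def)
 moreover have "continuous_on {0..2 * pi} g" unfolding g_def
  using spos by (intro continuous_intros cont_fields[OF s]) (auto simp: less_imp_neq[symmetric])
 ultimately have "\<forall>tt\<in>{0..2 * pi}. g tt = 0" using integral_eq_0_iff[of 0 "2 * pi" g] gpos g0 pi_gt_zero by (metis less_imp_le mult_pos_pos order_refl zero_less_numeral)
 then have base: "sp s tt lv = s tt lv" if "tt \<in> {0..2 * pi}" for tt using gpos[of tt] that by fastforce
 interpret P1: periodic_fun_simple "%tt. sp s tt lv - s tt lv" "2 * pi"
  using speed_periodic[OF lv_pos(1)] periodic[OF lv_pos(1)] by unfold_locales simp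
 have all: "sp s tt lv = s tt lv" for tt
 proof -
  define n where "n = \<lfloor>tt / (2 * pi)\<rfloor>"
  have "of_int n <= tt / (2 * pi)" "tt / (2 * pi) < of_int n + 1" unfolding n_def by linarith+
  then have "tt - of_int n * (2 * pi) \<in> {0..2 * pi}" by (auto simp: field_simps)
  then show ?thesis using base P1.minus_of_int[of tt n] by fastforce
 qed
 obtain s' where s': "!!tt. DERIV (%tt. s tt lv) tt :> s' tt" "!!tt. DERIV s' tt :> rad tt lv - s tt lv" using curvature[OF D lv_pos(1)] by blast
 have d2: "DERIV s' tt :> s tt lv powr (- (1 / aa)) - s tt lv" for tt using s'(2)[of tt] unfolding rad_def all .
 show ?thesis by (rule shrinker_unique[OF _ _ spos periodic[OF lv_pos(1)] s'(1) d2]) (use aa12 in \<open>auto simp: field_simps\<close>)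
qed

text \<open>Direct method: \<open>front_compactness\<close> yields a limit of a maximising sequence,
  and the energy is continuous along it. The same argument first shows that the supremum is
  finite.\<close>

lemma extremal_exists:
 assumes s0: "G s0"
 obtains s where "G s" "!!t. G t ==> (e::real) * en t <= e * en s"
proof -
 have bdd: "bdd_above ((%s. e * en s) ` Collect G)"
 proof (rule ccontr)
  assume n: "\<not> ?thesis"
  have "\<exists>s. G s & real n < e * en s" for n using n unfolding bdd_above_def by (auto simp: not_le)
  then obtain sn where sn: "!!n. G (sn n)" "!!n. real n < e * en (sn n)" by metis
  obtain r s where r: "strict_mono (r :: nat => nat)" "front_limit (%n. sn (r n)) s" "front aa D 0 0 s"
   by (rule front_compactness[of aa D "%_. 0" "%_. 0" sn]) (use sn(1) in \<open>auto simp: ancient_front_def\<close>)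
  have "(%n. e * en (sn (r n))) \<longlonglongrightarrow> e * en s"
   using r by (intro tendsto_intros energy_tendsto sn(1) front_limit_pointwise) (auto simp: ancient_front_def)
  from convergent_imp_Bseq[OF convergentI[OF this]] obtain B where B: "\<forall>n. norm (e * en (sn (r n))) <= B" unfolding Bseq_def by blast
  obtain n :: nat where "B <= real n" using real_arch_simple by blast
  then show False using B[rule_format, of n] sn(2)[of "r n"] seq_suble[OF r(1), of n] by (simp add: abs_le_iff)
 qed
 define M where "M = Sup ((%s. e * en s) ` Collect G)"
 have "\<exists>s. G s & M - inverse (real (Suc n)) < e * en s" for n
  using less_cSup_iff[OF _ bdd, of "M - inverse (real (Suc n))"] s0 unfolding M_def[symmetric] by auto
 then obtain sn where sn: "!!n. G (sn n)" "!!n. M - inverse (real (Suc n)) < e * en (sn n)" by metis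
 obtain r s where r: "strict_mono (r :: nat => nat)" "front_limit (%n. sn (r n)) s" "front aa D 0 0 s"
  by (rule front_compactness[of aa D "%_. 0" "%_. 0" sn]) (use sn(1) in \<open>auto simp: ancient_front_def\<close>)
 have s: "G s" using r by (simp add: ancient_front_def)
 have lim: "(%n. e * en (sn (r n))) \<longlonglongrightarrow> e * en s" using r by (intro tendsto_intros energy_tendsto sn(1) s front_limit_pointwise) auto
 have "(%n. M - inverse (real (Suc n))) \<longlonglongrightarrow> M - 0" by (intro tendsto_intros LIMSEQ_inverse_real_of_nat)
 then have "(%n. M - inverse (real (Suc (r n)))) \<longlonglongrightarrow> M" using filterlim_compose[OF _ filterlim_subseq[OF r(1)]] by fastforce
 then have "M <= e * en s" by (rule LIMSEQ_le[OF _ lim]) (use sn(2) in \<open>auto intro: less_imp_le\<close>)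
 moreover have "e * en t <= M" if "G t" for t unfolding M_def by (rule cSup_upper[OF _ bdd]) (use that in auto)
 ultimately show thesis by (intro that[OF s]) (blast intro: order_trans)
qed

lemma energy_unit:
 assumes s: "G s" and 1: "!!tt. s tt lv = 1"
 shows "en s = integral {0..2 * pi} (%tt. 1 / 2 - powr_primitive (1 / aa) 1)"
proof -
 obtain s' where s': "!!tt. DERIV (%tt. s tt lv) tt :> s' tt" "!!tt. DERIV s' tt :> rd s tt lv - s tt lv" using ancient_front.curvature[OF s D lv_pos(1)] by blast
 have "s' tt = 0" for tt using s'(1)[of tt] unfolding 1 by (rule DERIV_unique) simp
 then have "s' = (%_. 0)" by auto
 then have "rd s tt lv = 1" for tt using DERIV_unique[OF s'(2)[of tt], of 0] 1 by simp
 then show ?thesis unfolding ancient_front.energy_def[OF s] 1 by simp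
qed

lemma ancient_front_unique:
 assumes s: "G s" and h: "h > 0"
 shows "s tt h = ((1 + aa) * h) powr (1 / (1 + aa))"
proof -
 obtain s1 where s1: "G s1" "!!t. G t ==> 1 * en t <= 1 * en s1" using extremal_exists[OF s, of 1] by blast
 obtain s2 where s2: "G s2" "!!t. G t ==> (- 1) * en t <= (- 1) * en s2" using extremal_exists[OF s, of "- 1"] by blast
 have "en s1 = en s2" using energy_unit[OF s1(1) critical_unit[OF s1(1) _ s1(2)]] energy_unit[OF s2(1) critical_unit[OF s2(1) _ s2(2)]] by simp
 then have unit: "t ph lv = 1" if "G t" for t ph using critical_unit[OF that, of 1] s1(2) s2(2)[OF that] by force
 define l where "l = h / lv"
 have l: "l > 0" "l * lv = h" using h lv_pos by (auto simp: l_def)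
 have "s tt h / l powr (1 / (1 + aa)) = 1" using unit[OF blow[OF s l(1)], of tt] unfolding blow_def l(2) .
 then have "s tt h = l powr (1 / (1 + aa))" using l by (simp add: field_simps)
 moreover have "l = (1 + aa) * h" by (simp add: l_def unit_level_def mult.commute)
 ultimately show ?thesis by simp
qed

end

section \<open>Convergence of the blow-downs\<close>

text \<open>The points move with n and their angles need not converge; uniform convergence to
  support functions that do not depend on the angle takes care of this. Comparison of norm (x n)
  with the limit radius V h then tells on which side of level h the value lies.\<close>

lemma blow_down_subsequence:
 fixes x :: "nat => real^2"
 assumes u: "convex_solution aa ss u" and aa: "aa > 1 / 2" and ss: "0 <= ss" "ss <= 1"
  and l: "!!n. l n > 0" "filterlim l at_top sequentially" and x: "x \<longlonglongrightarrow> x0"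
 obtains r where "strict_mono (r :: nat => nat)"
  "(%n. blow_down aa u (l (r n)) (x (r n))) \<longlonglongrightarrow> norm x0 powr (1 + aa) / (1 + aa)"
proof -
 obtain D h0 where D: "D > 0" "h0 > 0"
  and sub: "!!l. l > 0 ==> sublevels (blow_down aa u l) UNIV"
  and fr: "!!l. l > 0 ==> front aa D (ss * l powr - (2 * (aa / (1 + aa)))) (h0 / l) (sublevels.S (blow_down aa u l) UNIV)"
  and zero: "!!l h. l > 0 ==> h > h0 / l ==> blow_down aa u l 0 < h" by (rule support_front[OF u aa ss]) (rule that)
 define T where "T n = sublevels.S (blow_down aa u (l n)) UNIV" for n
 have h0l: "(%n. h0 / l n) \<longlonglongrightarrow> 0" by (rule real_tendsto_divide_at_top[OF tendsto_const l(2)])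
 have "(%n. l n powr - (2 * (aa / (1 + aa)))) \<longlonglongrightarrow> 0" using aa by (intro tendsto_neg_powr l(2)) auto
 then have "(%n. ss * l n powr - (2 * (aa / (1 + aa)))) \<longlonglongrightarrow> ss * 0" by (intro tendsto_intros)
 then have "(%n. ss * l n powr - (2 * (aa / (1 + aa)))) \<longlonglongrightarrow> 0" by simp
 then obtain r s where r: "strict_mono (r :: nat => nat)" "front_limit (%n. T (r n)) s" "front aa D 0 0 s" using ss fr[OF l(1)] h0l
  by (elim front_compactness[of aa D "%n. ss * l n powr - (2 * (aa / (1 + aa)))" "%n. h0 / l n" T, rotated 2]) (auto simp: T_def)
 define V where "V h = ((1 + aa) * h) powr (1 / (1 + aa))" for h
 have s: "s tt h = V h" if "h > 0" for tt h unfolding V_def using r(3) D aa that by (intro ancient_front_unique) (auto simp: ancient_front_def)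
 have lim: "(%n. T (r n) (t n) h) \<longlonglongrightarrow> V h" if h: "h > 0" and t: "!!n. 0 <= t n & t n <= 2 * pi" for h and t :: "nat => real"
 proof (rule tendstoI)
  fix e :: real assume e: "e > 0"
  obtain N where N: "(2 * pi, h) \<in> strip N" using strip_exhausts[OF h] by blast
  have tN: "(t n, h) \<in> strip N" for n using N t[of n] by (auto simp: strip_def)
  have "\<forall>\<^sub>F n in sequentially. \<forall>p\<in>strip N. dist (T (r n) (fst p) (snd p)) (s (fst p) (snd p)) < e"
   by (rule uniform_limitD[OF r(2)[unfolded front_limit_def, rule_format] e])
  then show "\<forall>\<^sub>F n in sequentially. dist (T (r n) (t n) h) (V h) < e" by eventually_elim (use tN s[OF h] in fastforce)
 qed
 have xr: "(%n. norm (x (r n))) \<longlonglongrightarrow> norm x0" using LIMSEQ_subseq_LIMSEQ[OF x r(1)] by (intro tendsto_norm) (simp add: o_def)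
 have lr: "filterlim (%n. l (r n)) at_top sequentially" by (rule filterlim_compose[OF l(2) filterlim_subseq[OF r(1)]])
 have rep: "\<exists>t. 0 <= t & t <= 2 * pi & edir t = edir ph" for ph by (rule edir_representative[of 0 ph]) (auto intro: less_imp_le)
 define w where "w n = blow_down aa u (l (r n))" for n
 define f where "f = norm x0 powr (1 + aa) / (1 + aa)"
 have Vf: "V h < norm x0" if "0 < h" "h < f" for h
 proof -
  have "(1 + aa) * h < norm x0 powr (1 + aa)" using that aa by (simp add: f_def field_simps)
  then have "V h < (norm x0 powr (1 + aa)) powr (1 / (1 + aa))" unfolding V_def using that aa by (intro powr_less_mono2) auto
  then show ?thesis using aa by (simp add: powr_powr)
 qed
 have fV: "norm x0 < V h" if "f < h" for h
 proof -
  have "norm x0 powr (1 + aa) < (1 + aa) * h" using that aa by (simp add: f_def field_simps)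
  then have "(norm x0 powr (1 + aa)) powr (1 / (1 + aa)) < V h" unfolding V_def using aa by (intro powr_less_mono2) auto
  then show ?thesis using aa by (simp add: powr_powr)
 qed
 have below: "\<forall>\<^sub>F n in sequentially. h < w n (x (r n))" if h: "0 < h" "h < f" for h
 proof -
  have "\<exists>t. 0 <= t & t <= 2 * pi & x (r n) = norm (x (r n)) *\<^sub>R edir t" for n
  proof -
   obtain ph where "x (r n) = norm (x (r n)) *\<^sub>R edir ph" using polar_decomposition by blast
   then show ?thesis using rep[of ph] by metis
  qed
  then obtain t where t: "!!n. 0 <= t n & t n <= 2 * pi" "!!n. x (r n) = norm (x (r n)) *\<^sub>R edir (t n)" by metis
  obtain y where y: "V h < y" "y < norm x0" using Vf[OF h] dense by blast
  from order_tendstoD(2)[OF lim[of h t, OF h(1) t(1)] y(1)] order_tendstoD(1)[OF xr y(2)] show ?thesis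
  proof eventually_elim
   case (elim n)
   interpret sublevels "w n" UNIV unfolding w_def by (rule sub[OF l(1)])
   show ?case
   proof (rule ccontr)
    assume "\<not> ?thesis"
    then have "x (r n) \<in> K h" by (simp add: K_def)
    from S_upper[OF this, of "t n"] have "x (r n) \<bullet> edir (t n) <= S (t n) h" .
    moreover have "x (r n) \<bullet> edir (t n) = norm (x (r n))" by (subst t(2)) (simp add: edir_inner_edir)
    ultimately show False using elim by (simp add: T_def w_def)
   qed
  qed
 qed
 have above: "\<forall>\<^sub>F n in sequentially. w n (x (r n)) <= h" if h: "f < h" for h
 proof -
  have h0: "h > 0" using h aa by (intro le_less_trans[OF _ h]) (simp add: f_def)
  \<comment> \<open>A direction in [0, 2 * pi] that separates x (r n) from the set, if there is one;
    for large n even this direction fails to separate, and x (r n) belongs to the set.\<close>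
  define t where "t n = (SOME t. 0 <= t & t <= 2 * pi & ((\<exists>ph. T (r n) ph h < x (r n) \<bullet> edir ph) --> T (r n) t h < x (r n) \<bullet> edir t))" for n
  have "\<exists>t. 0 <= t & t <= 2 * pi & ((\<exists>ph. T (r n) ph h < x (r n) \<bullet> edir ph) --> T (r n) t h < x (r n) \<bullet> edir t)" for n
  proof (cases "\<exists>ph. T (r n) ph h < x (r n) \<bullet> edir ph")
   case True
   then obtain ph where p: "T (r n) ph h < x (r n) \<bullet> edir ph" by blast
   obtain t where t: "0 <= t" "t <= 2 * pi" "edir t = edir ph" using rep by blast
   have "T (r n) t h = T (r n) ph h" unfolding T_def sublevels.S_def[OF sub[OF l(1)]] t(3) ..
   then show ?thesis using p t by metis
  qed (use pi_ge_zero in \<open>auto intro: exI[of _ 0]\<close>)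
  from someI_ex[OF this] have t: "0 <= t n & t n <= 2 * pi"
   "(\<exists>ph. T (r n) ph h < x (r n) \<bullet> edir ph) ==> T (r n) (t n) h < x (r n) \<bullet> edir (t n)" for n unfolding t_def by blast+
  obtain y where y: "norm x0 < y" "y < V h" using fV[OF h] dense by blast
  have "\<forall>\<^sub>F n in sequentially. h0 / l (r n) < h" using order_tendstoD(2)[OF real_tendsto_divide_at_top[OF tendsto_const lr] h0] .
  with order_tendstoD(1)[OF lim[of h t, OF h0 t(1)] y(2)] order_tendstoD(2)[OF xr y(1)] show ?thesis
  proof eventually_elim
   case (elim n)
   interpret sublevels "w n" UNIV unfolding w_def by (rule sub[OF l(1)])
   have "x (r n) \<in> K h"
   proof (rule S_membership)
    show "K h ~= {}" using zero[OF l(1) elim(3)] K_def w_def by (auto intro: less_imp_le)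
    have "\<not> S (t n) h < x (r n) \<bullet> edir (t n)" using elim(1,2) inner_edir_le[of "x (r n)" "t n"] by (simp add: T_def w_def)
    then show "x (r n) \<bullet> edir ph <= S ph h" for ph using t(2)[of n] unfolding T_def w_def by (meson not_le)
   qed
   then show ?case by (simp add: K_def)
  qed
 qed
 \<comment> \<open>Fronts carry positive levels only. The lower bound 0, which is needed for x0 = 0,
   comes from a linear minorant of u whose slope tends to 0 under the blow-down.\<close>
 have nonneg: "\<forall>\<^sub>F n in sequentially. a < w n (x (r n))" if a: "a < 0" for a
 proof -
  obtain M where M: "M >= 0" "!!x. u 0 - M * norm x <= u x" using convex_linear_lower_bound u unfolding convex_solution_def by metis
  define b where "b = 1 / (1 + aa)"
  have "(%n. u 0 / l (r n)) \<longlonglongrightarrow> 0" by (rule real_tendsto_divide_at_top[OF tendsto_const lr])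
  moreover have "(%n. l (r n) powr - (1 - b)) \<longlonglongrightarrow> 0" using aa by (intro tendsto_neg_powr lr) (simp add: b_def)
  ultimately have "(%n. u 0 / l (r n) - M * (l (r n) powr - (1 - b) * norm (x (r n)))) \<longlonglongrightarrow> 0 - M * (0 * norm x0)"
   by (intro tendsto_intros xr)
  from order_tendstoD(1)[OF this, of a] a
  have "\<forall>\<^sub>F n in sequentially. a < u 0 / l (r n) - M * (l (r n) powr - (1 - b) * norm (x (r n)))" by simp
  then show ?thesis
  proof eventually_elim
   case (elim n)
   have L: "l (r n) > 0" by (rule l)
   have "l (r n) powr - (1 - b) = l (r n) powr b / l (r n)" using powr_diff[of "l (r n)" b 1] L by simp
   then have "u 0 / l (r n) - M * (l (r n) powr - (1 - b) * norm (x (r n))) = (u 0 - M * norm (l (r n) powr b *\<^sub>R x (r n))) / l (r n)"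
    by (simp add: diff_divide_distrib)
   also have "\<dots> <= w n (x (r n))"
    unfolding w_def blow_down_def b_def using M(2)[of "l (r n) powr (1 / (1 + aa)) *\<^sub>R x (r n)"] L by (intro divide_right_mono) auto
   finally show ?case using elim by simp
  qed
 qed
 have "(%n. w n (x (r n))) \<longlonglongrightarrow> f"
 proof (rule order_tendstoI)
  fix a assume a: "a < f"
  show "\<forall>\<^sub>F n in sequentially. a < w n (x (r n))"
  proof (cases "a < 0")
   case False
   then obtain h where h: "a < h" "h < f" using a dense by blast
   from below[of h] h False show ?thesis by (auto elim!: eventually_mono)
  qed (rule nonneg)
 next
  fix a assume "f < a"
  then obtain h where h: "f < h" "h < a" using dense by blast
  from above[OF h(1)] h(2) show "\<forall>\<^sub>F n in sequentially. w n (x (r n)) < a" by (auto elim!: eventually_mono)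
 qed
 then show thesis using that[OF r(1)] by (simp add: w_def f_def)
qed

theorem theorem1:
 fixes \<alpha> \<sigma> :: real and u :: "real^2 \<Rightarrow> real"
 assumes "\<alpha> > 1 / 2"
  and "0 \<le> \<sigma>" and "\<sigma> \<le> 1"
  and "convex_on UNIV u"
  and "entire_solution \<alpha> \<sigma> u"
 shows "\<forall>K. compact K \<longrightarrow>
  uniform_limit K (blow_down \<alpha> u) (\<lambda>x. norm x powr (1 + \<alpha>) / (1 + \<alpha>)) at_top"
proof (intro allI impI)
 fix K :: "(real^2) set" assume K: "compact K"
 let ?f = "\<lambda>x :: real^2. norm x powr (1 + \<alpha>) / (1 + \<alpha>)"
 have u: "convex_solution \<alpha> \<sigma> u"
  using assms classical_imp_convex_solution[of \<alpha> \<sigma> u] viscosity_imp_convex_solution[of \<alpha> u]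
  by (cases "\<sigma> = 0") (auto simp: entire_solution_def)
 show "uniform_limit K (blow_down \<alpha> u) ?f at_top"
 proof (rule ccontr)
  assume "\<not> ?thesis"
  \<comment> \<open>Failure of uniform convergence provides levels and points of K with error at
    least e; on a subsequence the points converge, and the preceding lemma makes the error tend to
    0.\<close>
  then obtain e where e: "e > 0" "\<not> (\<forall>\<^sub>F h in at_top. \<forall>x\<in>K. dist (blow_down \<alpha> u h x) (?f x) < e)"
   unfolding uniform_limit_iff by blast
  have "\<exists>l x. real (Suc n) \<le> l \<and> x \<in> K \<and> e \<le> dist (blow_down \<alpha> u l x) (?f x)" for n
   using e(2) unfolding eventually_at_top_linorder by (meson not_less)
  then obtain l x where lx: "\<And>n. real (Suc n) \<le> l n" "\<And>n. x n \<in> K" "\<And>n. e \<le> dist (blow_down \<alpha> u (l n) (x n)) (?f (x n))" by metis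
  obtain x0 q where q: "x0 \<in> K" "strict_mono (q :: nat \<Rightarrow> nat)" "(x \<circ> q) \<longlonglongrightarrow> x0"
   using K lx(2) unfolding compact_def by metis
  have pos: "l n > 0" for n using lx(1)[of n] by linarith
  have "filterlim l at_top sequentially"
   by (rule filterlim_at_top_mono[OF filterlim_real_sequentially]) (use lx(1) in \<open>auto intro!: always_eventually order_trans[OF _ lx(1)]\<close>)
  then have lq: "filterlim (l \<circ> q) at_top sequentially" unfolding o_def by (rule filterlim_compose[OF _ filterlim_subseq[OF q(2)]])
  obtain r where r: "strict_mono (r :: nat \<Rightarrow> nat)" "(\<lambda>n. blow_down \<alpha> u ((l \<circ> q) (r n)) ((x \<circ> q) (r n))) \<longlonglongrightarrow> ?f x0"
   by (rule blow_down_subsequence[OF u assms(1-3) _ lq q(3)]) (use pos in auto)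
  have "(\<lambda>n. norm ((x \<circ> q) (r n)) powr (1 + \<alpha>) / (1 + \<alpha>)) \<longlonglongrightarrow> ?f x0"
   using LIMSEQ_subseq_LIMSEQ[OF q(3) r(1)] assms(1) unfolding o_def by (intro tendsto_intros tendsto_powr') auto
  from tendsto_dist[OF r(2) this] have "(\<lambda>n. dist (blow_down \<alpha> u ((l \<circ> q) (r n)) ((x \<circ> q) (r n))) (?f ((x \<circ> q) (r n)))) \<longlonglongrightarrow> 0" by simp
  from order_tendstoD(2)[OF this e(1)] obtain n where "dist (blow_down \<alpha> u ((l \<circ> q) (r n)) ((x \<circ> q) (r n))) (?f ((x \<circ> q) (r n))) < e"
   using eventually_happens'[OF sequentially_bot] by blast
  then show False using lx(3)[of "q (r n)"] by simp
 qed
qed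

end
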